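(* Let $a(x,\xi)\in L^\infty S^m_\varrho$ on $\mathbf{R}^n\times\mathbf{R}^n$ with $m<-\frac{n+1}{2}\varrho+n(\varrho-1)$ and $\varrho\in[0,1]$. Let the phase function $\varphi(x,\xi)$ satisfy $|\mathrm{det}_{n-1}\,\partial^2_{\xi\xi}\varphi(x,\xi)|\ge c>0$ for some constant $c$. Furthermore, suppose that $\varphi(x,\xi)-\langle x,\xi\rangle\in L^\infty\Phi^1$. Then the associated Fourier integral operator $T_{a,\varphi}$ is bounded on $L^p_w$ for $1<p<\infty$ and $w\in A_p$.
   Context: Notation: $\langle\xi\rangle=(1+|\xi|^2)^{1/2}$; $\widehat u(\xi)=\int e^{-i\langle x,\xi\rangle}u(x)\,dx$. Operator: $T_{a,\varphi}u(x)=(2\pi)^{-n}\int_{\mathbf{R}^n}e^{i\varphi(x,\xi)}a(x,\xi)\widehat u(\xi)\,d\xi$. Class $L^\infty S^m_\varrho$: functions $a(x,\xi)$, smooth in $\xi$ and bounded measurable in $x$, such that for every multi-index $\alpha$, $\sup_{\xi}\langle\xi\rangle^{-m+\varrho|\alpha|}\|\partial_\xi^\alpha a(\cdot,\xi)\|_{L^\infty(\mathbf{R}^n)}<\infty$. Class $L^\infty\Phi^1$: real-valued functions $\theta(x,\xi)$, positively homogeneous of degree $1$ and smooth on $\mathbf{R}^n\setminus0$ in $\xi$, bounded measurable in $x$, with $\sup_{\xi\ne0}|\xi|^{-1+|\alpha|}\|\partial_\xi^\alpha\theta(\cdot,\xi)\|_{L^\infty(\mathbf{R}^n)}<\infty$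 for all $|\alpha|\ge1$. $\mathrm{det}_{n-1}$: for an $n\times n$ matrix $M$, $\mathrm{det}_{n-1}M$ denotes the determinant of the matrix $PMP$, where $P$ is the projection to the orthogonal complement of $\ker M$. Weights: for $1<p<\infty$, $w\in A_p$ means $w$ is positive, locally integrable and $\sup_B w_B\big((w^{-1/(p-1)})_B\big)^{p-1}<\infty$ over balls $B\subset\mathbf{R}^n$ ($f_B$ the average over $B$). $\|u\|_{L^p_w}=(\int|u|^pw\,dx)^{1/p}$. *)

theory Defs
  imports "HOL-Analysis.Analysis"
begin

text \<open>Points of Euclidean space are vectors of type \<open>real ^ 'n\<close>, with \<open>n = CARD('n)\<close>. All
  measurability and integration is with respect to Lebesgue measure.\<close>

subsection \<open>Iterated partial derivatives and smoothness\<close>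

definition partial :: "'n \<Rightarrow> (real ^ 'n \<Rightarrow> 'b::real_normed_vector) \<Rightarrow> real ^ 'n \<Rightarrow> 'b"
  where "partial i f x = frechet_derivative f (at x) (axis i 1)"

text \<open>A multi-index \<open>\<alpha>\<close> is represented by a list \<open>\<alpha>\<close> of coordinate directions, in which the
  direction \<open>i\<close> occurs \<open>\<alpha>\<^sub>i\<close> times, so that \<open>|\<alpha>| = length \<alpha>\<close>. For smooth functions the order
  of the list is immaterial.\<close>

primrec partials :: "'n list \<Rightarrow> (real ^ 'n \<Rightarrow> 'b::real_normed_vector) \<Rightarrow> real ^ 'n \<Rightarrow> 'b"
  where
    "partials [] f = f"
  | "partials (i # \<alpha>) f = partial i (partials \<alpha> f)"

text \<open>For open \<open>U\<close> this is \<open>C\<^sup>\<infinity>\<close>: differentiability of all iterated partial derivatives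
  also gives their continuity.\<close>

definition smooth_on :: "(real ^ 'n) set \<Rightarrow> (real ^ 'n \<Rightarrow> 'b::real_normed_vector) \<Rightarrow> bool"
  where "smooth_on U f \<longleftrightarrow> (\<forall>\<alpha>. \<forall>x\<in>U. partials \<alpha> f differentiable (at x))"

definition hessian :: "(real ^ 'n \<Rightarrow> real) \<Rightarrow> real ^ 'n \<Rightarrow> real ^ 'n ^ 'n"
  where "hessian f x = (\<chi> i j. partials [i, j] f x)"

definition jbracket :: "real ^ 'n \<Rightarrow> real"
  where "jbracket \<xi> = sqrt (1 + (norm \<xi>)\<^sup>2)"


subsection \<open>Symbols and phases\<close>

text \<open>The bound \<open>sup\<^sub>\<xi> c(\<xi>) \<parallel>g(\<cdot>,\<xi>)\<parallel>\<^sub>L\<^sub>\<infinity> < \<infinity>\<close> is written out as one constant bounding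
  \<open>c(\<xi>) |g(x,\<xi>)|\<close> for every \<open>\<xi>\<close> and almost every \<open>x\<close>.\<close>

definition Linf_symbol ::
    "real \<Rightarrow> real \<Rightarrow> (real ^ 'n \<Rightarrow> real ^ 'n \<Rightarrow> complex) set"
  where "Linf_symbol m \<rho> = {a.
     (\<forall>x. smooth_on UNIV (a x)) \<and>
     (\<forall>\<xi>. (\<lambda>x. a x \<xi>) \<in> borel_measurable lebesgue) \<and>
     (\<forall>\<alpha>. \<exists>C. \<forall>\<xi>. AE x in lebesgue.
        jbracket \<xi> powr (- m + \<rho> * real (length \<alpha>)) * norm (partials \<alpha> (a x) \<xi>) \<le> C)}"

definition Linf_Phi1 :: "(real ^ 'n \<Rightarrow> real ^ 'n \<Rightarrow> real) set"
  where "Linf_Phi1 = {\<theta>.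
     (\<forall>x. smooth_on (- {0}) (\<theta> x)) \<and>
     (\<forall>x \<xi> t. \<xi> \<noteq> 0 \<longrightarrow> t > 0 \<longrightarrow> \<theta> x (t *\<^sub>R \<xi>) = t * \<theta> x \<xi>) \<and>
     (\<forall>\<xi>. \<xi> \<noteq> 0 \<longrightarrow> (\<lambda>x. \<theta> x \<xi>) \<in> borel_measurable lebesgue \<and>
        (\<exists>C. AE x in lebesgue. \<bar>\<theta> x \<xi>\<bar> \<le> C)) \<and>
     (\<forall>\<alpha>. length \<alpha> \<ge> 1 \<longrightarrow> (\<exists>C. \<forall>\<xi>. \<xi> \<noteq> 0 \<longrightarrow> (AE x in lebesgue.
        norm \<xi> powr (- 1 + real (length \<alpha>)) * \<bar>partials \<alpha> (\<theta> x) \<xi>\<bar> \<le> C)))}"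

text \<open>With \<open>V\<close> the orthogonal complement of \<open>ker M\<close> and \<open>P\<close> the orthogonal projection onto
  \<open>V\<close> (as a matrix), \<open>det\<^sub>n\<^sub>-\<^sub>1 M\<close> is the determinant of \<open>P M P\<close> as an endomorphism of \<open>V\<close>.
  It is computed by extending this endomorphism by the identity on \<open>ker M\<close>; the \<open>n \<times> n\<close>
  determinant of \<open>P M P\<close> itself would vanish. The index \<open>n - 1\<close> is the size of the determinant:
  if \<open>dim V \<noteq> n - 1\<close>, there is no such determinant and the value is \<open>0\<close>. For \<open>n = 1\<close> and
  \<open>M = 0\<close> it is the empty determinant \<open>1\<close>.\<close>

definition det_corank1 :: "real ^ 'n ^ 'n \<Rightarrow> real"
  where "det_corank1 M =
    (let V = orthogonal_comp {v. M *v v = 0}; P = matrix (closest_point V)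
     in if dim V = CARD('n) - 1 then det (P ** M ** P + (mat 1 - P)) else 0)"


subsection \<open>Fourier integral operators\<close>

definition schwartz :: "(real ^ 'n \<Rightarrow> complex) set"
  where "schwartz = {u. smooth_on UNIV u \<and>
     (\<forall>\<alpha> (N::nat). \<exists>C. \<forall>x. (1 + norm x) ^ N * norm (partials \<alpha> u x) \<le> C)}"

definition fourier :: "(real ^ 'n \<Rightarrow> complex) \<Rightarrow> real ^ 'n \<Rightarrow> complex"
  where "fourier u \<xi> = (LINT x|lebesgue. exp (- \<i> * of_real (x \<bullet> \<xi>)) * u x)"

definition FIO :: "(real ^ 'n \<Rightarrow> real ^ 'n \<Rightarrow> complex) \<Rightarrow> (real ^ 'n \<Rightarrow> real ^ 'n \<Rightarrow> real)
    \<Rightarrow> (real ^ 'n \<Rightarrow> complex) \<Rightarrow> real ^ 'n \<Rightarrow> complex"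
  where "FIO a \<phi> u x =
    inverse (of_real ((2 * pi) ^ CARD('n))) *
    (LINT \<xi>|lebesgue. exp (\<i> * of_real (\<phi> x \<xi>)) * a x \<xi> * fourier u \<xi>)"


subsection \<open>Weighted Lebesgue spaces\<close>

definition ball_avg :: "(real ^ 'n \<Rightarrow> real) \<Rightarrow> real ^ 'n \<Rightarrow> real \<Rightarrow> real"
  where "ball_avg f z r = (LINT y:ball z r|lebesgue. f y) / measure lebesgue (ball z r)"

text \<open>Integrability of the dual weight on balls is part of the finiteness of the supremum; it has
  to be required explicitly because the integral of a non-integrable function is \<open>0\<close>.\<close>

definition A_weight :: "real \<Rightarrow> (real ^ 'n \<Rightarrow> real) set"
  where "A_weight p = {w.
     w \<in> borel_measurable lebesgue \<and>
     (AE x in lebesgue. 0 < w x) \<and>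
     (\<forall>K. compact K \<longrightarrow> set_integrable lebesgue K w) \<and>
     (\<forall>z r. 0 < r \<longrightarrow> set_integrable lebesgue (ball z r) (\<lambda>x. w x powr (- 1 / (p - 1)))) \<and>
     (\<exists>C. \<forall>z r. 0 < r \<longrightarrow>
        ball_avg w z r * ball_avg (\<lambda>x. w x powr (- 1 / (p - 1))) z r powr (p - 1) \<le> C)}"

definition Lpw :: "real \<Rightarrow> (real ^ 'n \<Rightarrow> real) \<Rightarrow> (real ^ 'n \<Rightarrow> complex) set"
  where "Lpw p w = {u. u \<in> borel_measurable lebesgue \<and>
     integrable lebesgue (\<lambda>x. norm (u x) powr p * w x)}"

definition Lpw_norm :: "real \<Rightarrow> (real ^ 'n \<Rightarrow> real) \<Rightarrow> (real ^ 'n \<Rightarrow> complex) \<Rightarrow> real"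
  where "Lpw_norm p w u = (LINT x|lebesgue. norm (u x) powr p * w x) powr (1 / p)"

text \<open>An operator \<open>T\<close> given on the Schwartz space is bounded on \<open>L\<^sup>p\<^sub>w\<close> if it is the
  restriction of a bounded linear operator \<open>S\<close> of \<open>L\<^sup>p\<^sub>w\<close>; in particular
  \<open>\<parallel>T u\<parallel> \<le> C \<parallel>u\<parallel>\<close> for all Schwartz functions \<open>u\<close>. The operator \<open>S\<close> acts on functions
  rather than on classes, hence its linearity is required almost everywhere; by the norm bound
  it then respects equality almost everywhere.\<close>

definition bounded_on_Lpw :: "real \<Rightarrow> (real ^ 'n \<Rightarrow> real) \<Rightarrow>
    ((real ^ 'n \<Rightarrow> complex) \<Rightarrow> real ^ 'n \<Rightarrow> complex) \<Rightarrow> bool"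
  where "bounded_on_Lpw p w T \<longleftrightarrow>
    schwartz \<subseteq> Lpw p w \<and>
    (\<exists>S C.
      (\<forall>u\<in>Lpw p w. S u \<in> Lpw p w \<and> Lpw_norm p w (S u) \<le> C * Lpw_norm p w u) \<and>
      (\<forall>u\<in>Lpw p w. \<forall>v\<in>Lpw p w. AE x in lebesgue. S (\<lambda>y. u y + v y) x = S u x + S v x) \<and>
      (\<forall>c. \<forall>u\<in>Lpw p w. AE x in lebesgue. S (\<lambda>y. c * u y) x = c * S u x) \<and>
      (\<forall>u\<in>schwartz. AE x in lebesgue. S u x = T u x))"

end

theory Submission
  imports Defs
begin

text \<open>On Schwartz functions the operator is integration against a kernel \<open>k(x, x - y)\<close>. Decompose the
  symbol \<open>e\<^sup>i\<^sup>\<theta> a\<close> dyadically in \<open>\<xi>\<close>, where \<open>\<theta> = \<phi> - \<langle>x,\<xi>\<rangle>\<close>. The piece at frequency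
  \<open>\<lambda> = 2\<^sup>j \<ge> 1\<close> has a kernel of size \<open>O(\<lambda>\<^bsup>m+n\<^esup> |z|\<^bsup>-N\<^esup>)\<close> for every \<open>N\<close>, by integration by parts, and of size
  \<open>O(\<lambda>\<^bsup>m+n-\<rho>(n-1)/2\<^esup>)\<close>, by van der Corput differencing: because the Hessian of \<open>\<theta>\<close> is nondegenerate
  transversally to the radial direction, two copies of the integrand shifted by different multiples
  of \<open>\<lambda>\<^bsup>1-\<rho>\<^esup>\<close> in a transversal hyperplane are almost orthogonal, and there is room for
  \<open>\<lambda>\<^bsup>\<rho>(n-1)\<^esup>\<close> such shifts. The assumption on \<open>m\<close> makes the second exponent negative, so that
  interpolation gives \<open>O(2\<^bsup>-\<epsilon>j\<^esup> (1 + |z|)\<^bsup>-n-1/2\<^esup>)\<close>. At low frequencies the kernel of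
  \<open>(e\<^sup>i\<^sup>\<theta> - 1) a\<close> has the same decay, since \<open>\<theta>\<close> is homogeneous of degree \<open>1\<close>. Hence
  \<open>|k(x, z)| \<le> C (1 + |z|)\<^bsup>-n-1/2\<^esup>\<close>, and the operator is dominated by \<open>\<Sum>\<^sub>k 2\<^bsup>-k/2\<^esup> A\<^sub>k\<close> with \<open>A\<^sub>k\<close> the
  average over balls of radius \<open>2\<^sup>k\<close>. The \<open>A\<^sub>p\<close> condition and a covering argument bound \<open>A\<^sub>k\<close> on
  \<open>L\<^sup>p\<^sub>w\<close> uniformly in \<open>k\<close>; no maximal function is needed.\<close>

subsection \<open>Symbol estimates\<close>

text \<open>The hypothesis on \<open>m\<close> says exactly that
  \<open>m + n - \<rho> (n - 1) / 2 < 0\<close>, and this exponent is what the differencing yields.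
  Each derivative of the amplitude brings a factor \<lambda>^(-\<rho>), while the Hessian of
  \<theta> has size 1/\<lambda>: two shifts h and h' separate the gradients by |h - h'|/\<lambda>,
  and one integration by parts gains \<lambda>^(1-\<rho>)/|h - h'|. Hence the spacing
  \<lambda>^(1-\<rho>). As the frequencies fill a region of diameter about \<lambda>, there are
  \<lambda>^\<rho> steps in each of n - 1 directions, and the square root in Cauchy-Schwarz turns
  the number of shifts into the gain \<lambda>^(-\<rho>(n-1)/2). The linear phase in z contributes
  only a constant of modulus 1 to a product of two shifted copies, so no critical point has to be
  located and the bound is uniform in z. The obstacle is that neither the symbol nor the phase has
  any regularity in x. All estimates are therefore made for frozen x, with constants independent of
  x, and end in a pointwise bound of the kernel by an integrable function of z alone.\<close>

lemma partial_has_derivative: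
  "(f has_derivative f') (at x) \<Longrightarrow> partial i f x = f' (axis i 1)"
  unfolding partial_def using frechet_derivative_at by fastforce

text \<open>Both functions have the same derivatives in the sense of \<open>has_derivative\<close>,
  so the choice inside \<open>frechet_derivative\<close> is the same even where no derivative
  exists.\<close>

lemma partial_cong_open:
  assumes "open U" "x \<in> U" "\<And>y. y \<in> U \<Longrightarrow> f y = g y"
  shows "partial i f x = partial i g x"
proof -
  have "(f has_derivative f') (at x) \<longleftrightarrow> (g has_derivative f') (at x)" for f'
    using has_derivative_transform_within_open[of f f' x UNIV U g] has_derivative_transform_within_open[of g f' x UNIV U f] assms by auto
  then show ?thesis unfolding partial_def frechet_derivative_def by simp
qed

lemma differentiable_cong_open:
  assumes "open U" "x \<in> U" "\<And>y. y \<in> U \<Longrightarrow> f y = g y" "f differentiable at x"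
  shows "g differentiable at x"
  using has_derivative_transform_within_open[of f _ x UNIV U g] assms by (auto simp: differentiable_def)

text \<open>A family \<open>f p\<close> satisfies \<open>symb k U B w f\<close> if the derivatives of \<open>f p\<close> of order \<open>j \<le> k\<close> are
  bounded by \<open>A\<^sub>j w\<^sub>p B\<^sub>p\<^sup>j\<close> on \<open>U p\<close>, with constants \<open>A\<^sub>j\<close> independent of the parameter \<open>p\<close>. Dyadic
  scales, base points and shifts all enter as parameters, which takes care of the uniformity of
  every constant below.\<close>

primrec symb :: "nat \<Rightarrow> ('p \<Rightarrow> (real^'n) set) \<Rightarrow> ('p \<Rightarrow> real) \<Rightarrow> ('p \<Rightarrow> real) \<Rightarrow>
   ('p \<Rightarrow> real^'n \<Rightarrow> 'b::real_normed_vector) \<Rightarrow> bool"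
  where
    "symb 0 U B w f \<longleftrightarrow> (\<exists>A. \<forall>p. \<forall>x\<in>U p. norm (f p x) \<le> A * w p)"
  | "symb (Suc k) U B w f \<longleftrightarrow> (\<exists>A. \<forall>p. \<forall>x\<in>U p. norm (f p x) \<le> A * w p) \<and>
       (\<forall>p. \<forall>x\<in>U p. f p differentiable at x) \<and>
       (\<forall>i. symb k U B (\<lambda>p. w p * B p) (\<lambda>p. partial i (f p)))"

lemma symb_bound:
  "symb k U B w f \<Longrightarrow> \<exists>A. \<forall>p. \<forall>x\<in>U p. norm (f p x) \<le> A * w p"
  by (cases k) auto

lemma symb_bound_nonneg:
  assumes "symb k U B w f" "\<And>p. 0 \<le> w p"
  obtains A where "0 \<le> A" "\<And>p x. x \<in> U p \<Longrightarrow> norm (f p x) \<le> A * w p"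
proof -
  obtain A where A: "\<And>p x. x \<in> U p \<Longrightarrow> norm (f p x) \<le> A * w p"
    using symb_bound[OF assms(1)] by blast
  have "norm (f p x) \<le> max 0 A * w p" if "x \<in> U p" for p x
    using A[OF that] mult_right_mono[of A "max 0 A" "w p"] assms(2)[of p] by linarith
  then show ?thesis using that[of "max 0 A"] by auto
qed

lemma symb_SucI:
  assumes "\<And>p x. x \<in> U p \<Longrightarrow> norm (f p x) \<le> A * w p"
    "\<And>p x. x \<in> U p \<Longrightarrow> f p differentiable at x"
    "\<And>i. symb k U B (\<lambda>p. w p * B p) (\<lambda>p. partial i (f p))"
  shows "symb (Suc k) U B w f"
  using assms by auto

lemma symb_SucD:
  assumes "symb (Suc k) U B w f"
  shows "\<And>p x. x \<in> U p \<Longrightarrow> f p differentiable at x"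
    "\<And>i. symb k U B (\<lambda>p. w p * B p) (\<lambda>p. partial i (f p))"
  using assms by auto

lemma symb_cong:
  assumes "\<And>p. open (U p)" "\<And>p x. x \<in> U p \<Longrightarrow> f p x = g p x" "symb k U B w f"
  shows "symb k U B w g"
  using assms
proof (induction k arbitrary: w f g)
  case 0
  then show ?case by simp
next
  case (Suc k)
  obtain A where A: "\<And>p x. x \<in> U p \<Longrightarrow> norm (f p x) \<le> A * w p"
    using Suc.prems(3) by auto
  have d: "f p differentiable at x" if "x \<in> U p" for p x using Suc.prems(3) that by auto
  have "symb k U B (\<lambda>p. w p * B p) (\<lambda>p. partial i (g p))" for i
  proof (rule Suc.IH[of "\<lambda>p. partial i (f p)", OF Suc.prems(1)])
    show "partial i (f p) x = partial i (g p) x" if "x \<in> U p" for p x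
      by (rule partial_cong_open[OF Suc.prems(1) that Suc.prems(2)])
    show "symb k U B (\<lambda>p. w p * B p) (\<lambda>p. partial i (f p))" using Suc.prems(3) by auto
  qed
  moreover have "g p differentiable at x" if "x \<in> U p" for p x
    by (rule differentiable_cong_open[OF Suc.prems(1) that Suc.prems(2) d[OF that]])
  moreover have "norm (g p x) \<le> A * w p" if "x \<in> U p" for p x
    using A[OF that] Suc.prems(2)[OF that] by simp
  ultimately show ?case by (auto intro: exI[of _ A])
qed

lemma symb_decrement: "symb (Suc k) U B w f \<Longrightarrow> symb k U B w f"
  by (induction k arbitrary: w f) auto

lemma symb_reparam:
  assumes "symb k U B w f" "\<And>q. V q \<subseteq> U (\<pi> q)"
  shows "symb k V (\<lambda>q. B (\<pi> q)) (\<lambda>q. w (\<pi> q)) (\<lambda>q. f (\<pi> q))"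
  using assms(1)
proof (induction k arbitrary: w f)
  case 0
  then show ?case using assms(2) by simp blast
next
  case (Suc k w f)
  obtain A where A: "\<And>p x. x \<in> U p \<Longrightarrow> norm (f p x) \<le> A * w p"
    using symb_bound[OF Suc.prems] by blast
  show ?case
  proof (rule symb_SucI)
    show "norm (f (\<pi> p) x) \<le> A * w (\<pi> p)" if "x \<in> V p" for p x using that assms(2) A by blast
    show "f (\<pi> p) differentiable at x" if "x \<in> V p" for p x
      using that assms(2) symb_SucD(1)[OF Suc.prems] by blast
    show "symb k V (\<lambda>q. B (\<pi> q)) (\<lambda>p. w (\<pi> p) * B (\<pi> p)) (\<lambda>p. partial i (f (\<pi> p)))" for i
      using Suc.IH[OF symb_SucD(2)[OF Suc.prems]] by simp
  qed
qed

lemma symb_subset: "symb k U B w f \<Longrightarrow> (\<And>q. V q \<subseteq> U q) \<Longrightarrow> symb k V B w f"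
  using symb_reparam[of k U B w f V "\<lambda>q. q"] by auto

text \<open>Passing to a derivative turns \<open>C\<close> into \<open>C * D\<close>, which is
  harmless because every order of differentiation has its own constant. Parameters with empty
  \<open>U p\<close> satisfy every bound, so the comparison is asked only of the others.\<close>

lemma symb_weight_mono:
  assumes "symb k U B w f" "\<And>p. U p \<noteq> {} \<Longrightarrow> 0 \<le> w p \<and> w p \<le> C * w' p \<and> 0 \<le> B p \<and> B p \<le> D * B' p"
  shows "symb k U B' w' f"
  using assms
proof (induction k arbitrary: w w' C f)
  case 0
  then obtain A where A: "\<And>p x. x \<in> U p \<Longrightarrow> norm (f p x) \<le> A * w p" by auto
  have "norm (f p x) \<le> (max 0 A * C) * w' p" if "x \<in> U p" for p x
  proof -
    have "norm (f p x) \<le> max 0 A * w p"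
      using A[OF that] mult_right_mono[of A "max 0 A" "w p"] 0(2)[of p] that by fastforce
    also have "\<dots> \<le> max 0 A * (C * w' p)" using 0(2)[of p] that by (intro mult_left_mono) auto
    finally show ?thesis by (simp add: mult.assoc)
  qed
  then show ?case by auto
next
  case (Suc k)
  obtain A where A: "\<And>p x. x \<in> U p \<Longrightarrow> norm (f p x) \<le> A * w p" using Suc.prems by auto
  have "norm (f p x) \<le> (max 0 A * C) * w' p" if "x \<in> U p" for p x
  proof -
    have "norm (f p x) \<le> max 0 A * w p"
      using A[OF that] mult_right_mono[of A "max 0 A" "w p"] Suc(3)[of p] that by fastforce
    also have "\<dots> \<le> max 0 A * (C * w' p)" using Suc(3)[of p] that by (intro mult_left_mono) auto
    finally show ?thesis by (simp add: mult.assoc)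
  qed
  moreover have "symb k U B' (\<lambda>p. w' p * B' p) (\<lambda>p. partial i (f p))" for i
  proof (rule Suc.IH[of "\<lambda>p. w p * B p" _ "C * D"])
    show "symb k U B (\<lambda>p. w p * B p) (\<lambda>p. partial i (f p))" using Suc.prems by auto
    show "0 \<le> w p * B p \<and> w p * B p \<le> C * D * (w' p * B' p) \<and> 0 \<le> B p \<and> B p \<le> D * B' p"
      if "U p \<noteq> {}" for p
    proof -
      have "w p * B p \<le> (C * w' p) * (D * B' p)"
        using Suc(3)[OF that] by (intro mult_mono) auto
      then show ?thesis using Suc(3)[OF that] by (auto simp: algebra_simps)
    qed
  qed
  ultimately show ?case using Suc.prems by auto
qed

section \<open>Rules of differentiation and closure properties of symbol bounds\<close>

lemma partial_linear:
  assumes "bounded_linear L" "f differentiable at x"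
  shows "partial i (\<lambda>x. L (f x)) x = L (partial i f x)"
  unfolding partial_has_derivative[OF bounded_linear.has_derivative[OF assms(1) iffD1[OF frechet_derivative_works assms(2)]]]
  by (simp add: partial_def)

lemma partial_add:
  assumes "f differentiable at x" "g differentiable at x"
  shows "partial i (\<lambda>x. f x + g x) x = partial i f x + partial i g x"
  unfolding partial_has_derivative[OF has_derivative_add[OF assms[unfolded frechet_derivative_works]]]
  by (simp add: partial_def)

lemma partial_mult:
  fixes f g :: "real^'n \<Rightarrow> 'b::real_normed_algebra"
  assumes "f differentiable at x" "g differentiable at x"
  shows "partial i (\<lambda>x. f x * g x) x = f x * partial i g x + partial i f x * g x"
  unfolding partial_has_derivative[OF has_derivative_mult[OF assms[unfolded frechet_derivative_works]]]
  by (simp add: partial_def)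

lemma partial_inverse:
  fixes f :: "real^'n \<Rightarrow> 'b::real_normed_field"
  assumes "f differentiable at x" "f x \<noteq> 0"
  shows "partial i (\<lambda>x. inverse (f x)) x = - (inverse (f x) * partial i f x * inverse (f x))"
    "(\<lambda>x. inverse (f x)) differentiable at x"
proof -
  have d: "((\<lambda>x. inverse (f x)) has_derivative
     (\<lambda>h. - (inverse (f x) * frechet_derivative f (at x) h * inverse (f x)))) (at x)"
    using Deriv.has_derivative_inverse[OF assms(2) assms(1)[unfolded frechet_derivative_works]] .
  show "partial i (\<lambda>x. inverse (f x)) x = - (inverse (f x) * partial i f x * inverse (f x))"
    unfolding partial_has_derivative[OF d] by (simp add: partial_def)
  show "(\<lambda>x. inverse (f x)) differentiable at x" using d by (auto simp: differentiable_def)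
qed

lemma partial_cis:
  fixes f :: "real^'n \<Rightarrow> real"
  assumes "f differentiable at x"
  shows "partial i (\<lambda>x. cis (f x)) x = of_real (partial i f x) * (\<i> * cis (f x))"
    "(\<lambda>x. cis (f x)) differentiable at x"
proof -
  have d: "((\<lambda>x. cis (f x)) has_derivative
     (\<lambda>h. frechet_derivative f (at x) h *\<^sub>R (\<i> * cis (f x)))) (at x)"
    using has_derivative_cis[OF assms(1)[unfolded frechet_derivative_works]] .
  show "partial i (\<lambda>x. cis (f x)) x = of_real (partial i f x) * (\<i> * cis (f x))"
    unfolding partial_has_derivative[OF d] by (simp add: partial_def scaleR_conv_of_real)
  show "(\<lambda>x. cis (f x)) differentiable at x" using d by (auto simp: differentiable_def)
qed

lemma symb_linear:
  assumes "bounded_linear L" "symb k U B w f"  "\<And>p. open (U p)" "\<And>p. 0 \<le> w p" "\<And>p. 0 \<le> B p"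
  shows "symb k U B w (\<lambda>p x. L (f p x))"
  using assms(2,4)
proof (induction k arbitrary: w f)
  have zero: "\<exists>A. \<forall>p. \<forall>x\<in>U p. norm (L (f p x)) \<le> A * w p"
    if f: "symb k U B w f" and w: "\<And>p. 0 \<le> w p" for k w f
  proof -
    obtain K where K: "K > 0" "\<And>x. norm (L x) \<le> norm x * K"
      using bounded_linear.pos_bounded[OF assms(1)] by blast
    obtain A where A: "0 \<le> A" "\<And>p x. x \<in> U p \<Longrightarrow> norm (f p x) \<le> A * w p"
      using symb_bound_nonneg[OF f w] by blast
    have "norm (L (f p x)) \<le> (A * K) * w p" if x: "x \<in> U p" for p x
    proof -
      have "norm (L (f p x)) \<le> norm (f p x) * K" by (rule K)
      also have "\<dots> \<le> (A * w p) * K" using A(2)[OF x] K(1) by (intro mult_right_mono) auto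
      finally show ?thesis by (simp add: algebra_simps)
    qed
    then show ?thesis by blast
  qed
  {
    case (0 w f)
    then show ?case using zero[of 0 w f] by simp
  next
    case (Suc k w f)
    note d = symb_SucD[OF Suc.prems(1)]
    obtain A where A: "\<And>p x. x \<in> U p \<Longrightarrow> norm (L (f p x)) \<le> A * w p"
      using zero[OF Suc.prems] by blast
    show ?case
    proof (rule symb_SucI[OF A])
      have "symb k U B (\<lambda>p. w p * B p) (\<lambda>p x. L (partial i (f p) x))" for i
        using d(2) Suc.prems(2) assms(5) by (intro Suc.IH) auto
      then show "symb k U B (\<lambda>p. w p * B p) (\<lambda>p. partial i (\<lambda>x. L (f p x)))" for i
        by (rule symb_cong[OF assms(3), rotated 1]) (simp add: partial_linear[OF assms(1)] d(1))
      show "(\<lambda>x. L (f p x)) differentiable at x" if "x \<in> U p" for p x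
        using bounded_linear.has_derivative[OF assms(1) iffD1[OF frechet_derivative_works d(1)[OF that]]]
        by (auto simp: differentiable_def)
    qed
  }
qed

lemma symb_add:
  assumes "symb k U B w f" "symb k U B w g" "\<And>p. open (U p)"
  shows "symb k U B w (\<lambda>p x. f p x + g p x)"
  using assms(1,2)
proof (induction k arbitrary: w f g)
  have zero: "\<exists>A. \<forall>p. \<forall>x\<in>U p. norm (f p x + g p x) \<le> A * w p"
    if f: "symb k U B w f" and g: "symb k U B w g" for k w f g
  proof -
    obtain A where A: "\<And>p x. x \<in> U p \<Longrightarrow> norm (f p x) \<le> A * w p" using symb_bound[OF f] by blast
    obtain A' where A': "\<And>p x. x \<in> U p \<Longrightarrow> norm (g p x) \<le> A' * w p" using symb_bound[OF g] by blast
    have "norm (f p x + g p x) \<le> (A + A') * w p" if "x \<in> U p" for p x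
      using A[OF that] A'[OF that] norm_triangle_ineq[of "f p x" "g p x"] by (simp add: algebra_simps)
    then show ?thesis by blast
  qed
  {
    case (0 w f g)
    then show ?case using zero[of 0 w f g] by simp
  next
    case (Suc k w f g)
    note d = symb_SucD[OF Suc.prems(1)] and e = symb_SucD[OF Suc.prems(2)]
    obtain A where A: "\<And>p x. x \<in> U p \<Longrightarrow> norm (f p x + g p x) \<le> A * w p"
      using zero[OF Suc.prems] by blast
    show ?case
    proof (rule symb_SucI[OF A])
      have "symb k U B (\<lambda>p. w p * B p) (\<lambda>p x. partial i (f p) x + partial i (g p) x)" for i
        using d(2) e(2) by (intro Suc.IH) auto
      then show "symb k U B (\<lambda>p. w p * B p) (\<lambda>p. partial i (\<lambda>x. f p x + g p x))" for i
        by (rule symb_cong[OF assms(3), rotated 1]) (simp add: partial_add d(1) e(1))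
    qed (use d(1) e(1) in \<open>auto intro!: differentiable_add\<close>)
  }
qed

lemma symb_mult:
  fixes f g :: "'p \<Rightarrow> real^'n \<Rightarrow> 'b::real_normed_algebra"
  assumes "symb k U B w f" "symb k U B v g" "\<And>p. open (U p)" "\<And>p. 0 \<le> w p" "\<And>p. 0 \<le> v p" "\<And>p. 0 \<le> B p"
  shows "symb k U B (\<lambda>p. w p * v p) (\<lambda>p x. f p x * g p x)"
  using assms(1,2,4,5)
proof (induction k arbitrary: w v f g)
  have zero: "\<exists>A. \<forall>p. \<forall>x\<in>U p. norm (f p x * g p x) \<le> A * (w p * v p)"
    if f: "symb k U B w f" and g: "symb k U B v g" and w: "\<And>p. 0 \<le> w p" and v: "\<And>p. 0 \<le> v p"
    for k w v and f g :: "'p \<Rightarrow> real^'n \<Rightarrow> 'b"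
  proof -
    obtain A where A: "0 \<le> A" "\<And>p x. x \<in> U p \<Longrightarrow> norm (f p x) \<le> A * w p"
      using symb_bound_nonneg[OF f w] by blast
    obtain A' where A': "0 \<le> A'" "\<And>p x. x \<in> U p \<Longrightarrow> norm (g p x) \<le> A' * v p"
      using symb_bound_nonneg[OF g v] by blast
    have "norm (f p x * g p x) \<le> (A * A') * (w p * v p)" if x: "x \<in> U p" for p x
    proof -
      have "norm (f p x * g p x) \<le> norm (f p x) * norm (g p x)" by (rule norm_mult_ineq)
      also have "\<dots> \<le> (A * w p) * (A' * v p)" using A A' x w by (intro mult_mono) auto
      finally show ?thesis by (simp add: algebra_simps)
    qed
    then show ?thesis by blast
  qed
  {
    case (0 w v f g)
    then show ?case using zero[of 0 w f v g] by simp
  next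
    case (Suc k w v f g)
    note d = symb_SucD[OF Suc.prems(1)] and e = symb_SucD[OF Suc.prems(2)]
    obtain A where A: "\<And>p x. x \<in> U p \<Longrightarrow> norm (f p x * g p x) \<le> A * (w p * v p)"
      using zero[OF Suc.prems] by blast
    show ?case
    proof (rule symb_SucI[OF A])
      have a: "symb k U B (\<lambda>p. w p * (v p * B p)) (\<lambda>p x. f p x * partial i (g p) x)" for i
        by (rule Suc.IH[OF symb_decrement[OF Suc.prems(1)] e(2)]) (use Suc.prems assms(6) in auto)
      have b: "symb k U B (\<lambda>p. (w p * B p) * v p) (\<lambda>p x. partial i (f p) x * g p x)" for i
        by (rule Suc.IH[OF d(2) symb_decrement[OF Suc.prems(2)]]) (use Suc.prems assms(6) in auto)
      have "symb k U B (\<lambda>p. (w p * v p) * B p) (\<lambda>p x. f p x * partial i (g p) x + partial i (f p) x * g p x)" for i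
        using a[of i] b[of i] assms(3) by (intro symb_add) (auto simp: algebra_simps)
      then show "symb k U B (\<lambda>p. (w p * v p) * B p) (\<lambda>p. partial i (\<lambda>x. f p x * g p x))" for i
        by (rule symb_cong[OF assms(3), rotated 1]) (simp add: partial_mult d(1) e(1))
    qed (use d(1) e(1) in \<open>auto intro!: differentiable_mult\<close>)
  }
qed

lemma partial_const: "partial i (\<lambda>x. c) = (\<lambda>x. 0)"
  using partial_has_derivative[OF has_derivative_const] by auto

lemma symb_const:
  fixes c :: "'p \<Rightarrow> 'b::real_normed_vector"
  assumes "\<And>p. norm (c p) \<le> A * w p"
  shows "symb k U B w (\<lambda>p x. c p)"
proof -
  have 0: "symb k U B w (\<lambda>p x. 0 :: 'b)" for k w
  proof (induction k arbitrary: w)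
    case (Suc k w)
    show ?case by (rule symb_SucI[where A=0]) (simp_all add: partial_const Suc)
  qed (auto intro!: exI[of _ 0])
  show ?thesis
  proof (cases k)
    case (Suc l)
    show ?thesis unfolding Suc by (rule symb_SucI[OF assms]) (simp_all add: partial_const 0)
  qed (use assms in auto)
qed

text \<open>The derivative of \<open>1/f\<close> contains \<open>1/f\<close> twice, already
  controlled to the lower order, and the weights \<open>1/w\<close>, \<open>w B\<close>,
  \<open>1/w\<close> multiply to \<open>B/w\<close>. The lower bound \<open>c * w\<close> keeps the
  constants uniform in the parameter.\<close>

lemma symb_inverse:
  fixes f :: "'p \<Rightarrow> real^'n \<Rightarrow> 'b::real_normed_field"
  assumes "symb k U B w f" "0 < c" "\<And>p x. x \<in> U p \<Longrightarrow> c * w p \<le> norm (f p x)"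
    "\<And>p. open (U p)" "\<And>p. 0 < w p" "\<And>p. 0 \<le> B p"
  shows "symb k U B (\<lambda>p. inverse (w p)) (\<lambda>p x. inverse (f p x))"
  using assms(1)
proof (induction k)
  have 1: "norm (inverse (f p x)) \<le> inverse c * inverse (w p)" if "x \<in> U p" for p x
    using le_imp_inverse_le[OF assms(3)[OF that]] assms(2,5) by (simp add: norm_inverse)
  {
    case 0
    then show ?case using 1 by auto
  next
    case (Suc k)
    note d = symb_SucD[OF Suc.prems(1)]
    have nz: "f p x \<noteq> 0" if "x \<in> U p" for p x
      using assms(3)[OF that] assms(2,5) by (metis mult_pos_pos norm_zero not_le)
    show ?case
    proof (rule symb_SucI[OF 1])
      have IH: "symb k U B (\<lambda>p. inverse (w p)) (\<lambda>p x. inverse (f p x))"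
        by (rule Suc.IH[OF symb_decrement[OF Suc.prems]])
      have wp: "0 \<le> w p" for p using assms(5)[of p] by simp
      have "symb k U B (\<lambda>p. (inverse (w p) * (w p * B p)) * inverse (w p))
         (\<lambda>p x. (inverse (f p x) * partial i (f p) x) * inverse (f p x))" for i
        using IH d(2) assms(4,6) wp by (intro symb_mult) auto
      then have "symb k U B (\<lambda>p. (inverse (w p) * (w p * B p)) * inverse (w p))
         (\<lambda>p x. - ((inverse (f p x) * partial i (f p) x) * inverse (f p x)))" for i
        by (rule symb_linear[OF bounded_linear_minus[OF bounded_linear_ident]]) (use assms(4,6) wp in auto)
      moreover have "inverse (w p) * (w p * B p) * inverse (w p) = inverse (w p) * B p" for p
        using assms(5)[of p] by (simp add: field_simps)
      ultimately have "symb k U B (\<lambda>p. inverse (w p) * B p)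
         (\<lambda>p x. - ((inverse (f p x) * partial i (f p) x) * inverse (f p x)))" for i by simp
      then show "symb k U B (\<lambda>p. inverse (w p) * B p) (\<lambda>p. partial i (\<lambda>x. inverse (f p x)))" for i
        by (rule symb_cong[OF assms(4), rotated 1]) (simp add: partial_inverse d(1) nz)
    qed (use d(1) nz in \<open>auto intro!: partial_inverse(2)\<close>)
  }
qed

text \<open>The size of \<open>f\<close> does not matter because \<open>cis\<close> has modulus
  \<open>1\<close>. Its gradient is given the weight \<open>B\<close>, so that differentiating the
  exponential costs as much as differentiating any other symbol.\<close>

lemma symb_cis:
  fixes f :: "'p \<Rightarrow> real^'n \<Rightarrow> real"
  assumes "\<And>i. symb k U B B (\<lambda>p. partial i (f p))" "\<And>p x. x \<in> U p \<Longrightarrow> f p differentiable at x"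
    "\<And>p. open (U p)" "\<And>p. 0 \<le> B p"
  shows "symb (Suc k) U B (\<lambda>p. 1) (\<lambda>p x. cis (f p x))"
  using assms(1)
proof (induction k)
  have step: "symb (Suc k) U B (\<lambda>p. 1) (\<lambda>p x. cis (f p x))"
    if c: "symb k U B (\<lambda>p. 1) (\<lambda>p x. cis (f p x))" and f: "\<And>i. symb k U B B (\<lambda>p. partial i (f p))" for k
  proof (rule symb_SucI[where A=1])
    have 1: "symb k U B (\<lambda>p. 1) (\<lambda>p x. \<i> * cis (f p x))"
      by (rule symb_linear[OF bounded_linear_mult_right c assms(3)]) (use assms(4) in auto)
    have 2: "symb k U B B (\<lambda>p x. of_real (partial i (f p) x) :: complex)" for i
      by (rule symb_linear[OF bounded_linear_of_real f assms(3)]) (use assms(4) in auto)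
    have "symb k U B (\<lambda>p. B p * 1) (\<lambda>p x. of_real (partial i (f p) x) * (\<i> * cis (f p x)))" for i
      by (rule symb_mult[OF 2 1 assms(3)]) (use assms(4) in auto)
    then have "symb k U B (\<lambda>p. B p * 1) (\<lambda>p. partial i (\<lambda>x. cis (f p x)))" for i
      by (rule symb_cong[OF assms(3), rotated 1]) (simp add: partial_cis assms(2))
    then show "symb k U B (\<lambda>p. 1 * B p) (\<lambda>p. partial i (\<lambda>x. cis (f p x)))" for i by simp
  qed (use assms(2) in \<open>auto intro!: partial_cis(2) exI[of _ 1]\<close>)
  {
    case 0
    show ?case by (rule step) (use 0 in \<open>auto intro!: exI[of _ 1]\<close>)
  next
    case (Suc k)
    show ?case by (rule step[OF Suc.IH[OF symb_decrement[OF Suc.prems]] Suc.prems])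
  }
qed

section \<open>Translations and differences of symbols\<close>

lemma has_derivative_translate:
  fixes x :: "'a::real_normed_vector"
  assumes "f differentiable at (x + h)"
  shows "((\<lambda>x. f (x + h)) has_derivative frechet_derivative f (at (x+h))) (at x)"
proof -
  have "((\<lambda>x. x + h) has_derivative (\<lambda>x. x)) (at x)" by (auto intro!: derivative_eq_intros)
  moreover have "(f has_derivative frechet_derivative f (at (x+h))) (at (x+h))"
    using assms by (simp add: frechet_derivative_works)
  ultimately show ?thesis
    using has_derivative_compose[of "\<lambda>x. x + h" "\<lambda>x. x" x UNIV f] by auto
qed

lemma differentiable_translate:
  "f differentiable at (x + h) \<Longrightarrow> (\<lambda>x. f (x + h)) differentiable at (x::'a::real_normed_vector)"
  using has_derivative_translate differentiableI by blast

lemma partial_translate: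
  assumes "f differentiable at (x + h)"
  shows "partial i (\<lambda>x. f (x + h)) x = partial i f (x + h)"
  by (simp add: partial_has_derivative[OF has_derivative_translate[OF assms]]) (simp add: partial_def)

lemma open_translate_vimage: "open U \<Longrightarrow> open {x. x + h \<in> (U::'a::real_normed_vector set)}"
  using open_vimage[of U "\<lambda>x. x + h"] by (auto simp: vimage_def continuous_on_add)

lemma symb_translate:
  assumes "symb k U B w f" "\<And>p. open (U p)"
  shows "symb k (\<lambda>p. {x. x + h p \<in> U p}) B w (\<lambda>p x. f p (x + h p))"
  using assms(1)
proof (induction k arbitrary: w f)
  case 0
  then show ?case by auto
next
  case (Suc k w f)
  note d = symb_SucD[OF Suc.prems(1)]
  obtain A where A: "\<And>p x. x \<in> U p \<Longrightarrow> norm (f p x) \<le> A * w p"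
    using symb_bound[OF Suc.prems] by blast
  show ?case
  proof (rule symb_SucI)
    show "symb k (\<lambda>p. {x. x + h p \<in> U p}) B (\<lambda>p. w p * B p) (\<lambda>p. partial i (\<lambda>x. f p (x + h p)))" for i
      by (rule symb_cong[where f = "\<lambda>p x. partial i (f p) (x + h p)", OF _ _ Suc.IH[OF d(2)]])
        (use d assms(2) in \<open>auto simp: partial_translate open_translate_vimage\<close>)
    show "norm (f p (x + h p)) \<le> A * w p" if "x \<in> {x. x + h p \<in> U p}" for p x using that A by auto
  qed (auto intro!: differentiable_translate d(1))
qed

lemma frechet_eq_sum_partial:
  assumes "f differentiable at x"
  shows "frechet_derivative f (at x) v = (\<Sum>i\<in>UNIV. v $ i *\<^sub>R partial i f x)"
proof -
  have bl: "bounded_linear (frechet_derivative f (at x))"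
    using assms frechet_derivative_works has_derivative_bounded_linear by blast
  then interpret bounded_linear "frechet_derivative f (at x)" .
  have "frechet_derivative f (at x) v = frechet_derivative f (at x) (\<Sum>i\<in>UNIV. v $ i *\<^sub>R axis i 1)"
    using basis_expansion[of v] by (simp add: scalar_mult_eq_scaleR)
  then show ?thesis by (simp add: partial_def sum scaleR)
qed

lemma lipschitz_partial:
  fixes f :: "real^'n \<Rightarrow> 'b::real_normed_vector"
  assumes "convex S" "x \<in> S" "y \<in> S" "\<And>z. z \<in> S \<Longrightarrow> f differentiable at z"
    "\<And>i z. z \<in> S \<Longrightarrow> norm (partial i f z) \<le> A"
  shows "norm (f x - f y) \<le> real CARD('n) * A * norm (x - y)"
proof -
  have "onorm (frechet_derivative f (at z)) \<le> real CARD('n) * A" if "z \<in> S" for z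
  proof (rule onorm_le)
    fix v
    have A0: "0 \<le> A" using assms(5)[OF that] norm_ge_zero order_trans by blast
    have "norm (frechet_derivative f (at z) v) \<le> (\<Sum>i\<in>(UNIV::'n set). norm (v $ i *\<^sub>R partial i f z))"
      unfolding frechet_eq_sum_partial[OF assms(4)[OF that]] by (rule norm_sum)
    also have "\<dots> \<le> (\<Sum>i\<in>(UNIV::'n set). norm v * A)"
      by (intro sum_mono) (auto intro!: mult_mono component_le_norm_cart assms(5) that)
    finally show "norm (frechet_derivative f (at z) v) \<le> real CARD('n) * A * norm v" by (simp add: algebra_simps)
  qed
  then show ?thesis
    by (intro differentiable_bound[of S f "\<lambda>z. frechet_derivative f (at z)"])
      (use assms in \<open>auto simp: frechet_derivative_works intro: has_derivative_at_withinI\<close>)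
qed

lemma sum_abs_bound:
  fixes A :: "'n::finite \<Rightarrow> real"
  assumes "x \<le> A i * c" "0 \<le> c"
  shows "x \<le> (\<Sum>i\<in>UNIV. \<bar>A i\<bar>) * c"
proof -
  have "A i \<le> \<bar>A i\<bar>" by simp
  also have "\<dots> \<le> (\<Sum>i\<in>UNIV. \<bar>A i\<bar>)" by (rule member_le_sum) auto
  finally show ?thesis using assms by (meson mult_right_mono order_trans)
qed

text \<open>The mean value theorem exchanges one derivative, with its cost \<open>B\<close>, for the
  distance of the two shifts; hence one order is spent. Convexity keeps the segment between the
  shifted points inside \<open>U p\<close>.\<close>

lemma symb_difference:
  fixes f :: "'p \<Rightarrow> real^'n \<Rightarrow> 'b::real_normed_vector"
  assumes "symb (Suc k) U B w f" "\<And>p. open (U p)" "\<And>p. convex (U p)" "\<And>p. 0 \<le> w p" "\<And>p. 0 \<le> B p"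
  shows "symb k (\<lambda>p. {x. x + h p \<in> U p \<and> x + h' p \<in> U p}) B (\<lambda>p. w p * B p * norm (h p - h' p))
    (\<lambda>p x. f p (x + h p) - f p (x + h' p))"
  using assms(1,4)
proof (induction k arbitrary: w f)
  have zero: "\<exists>A. \<forall>p. \<forall>x\<in>{x. x + h p \<in> U p \<and> x + h' p \<in> U p}. norm (f p (x + h p) - f p (x + h' p)) \<le> A * (w p * B p * norm (h p - h' p))"
    if f: "symb (Suc k) U B w f" and w: "\<And>p. 0 \<le> w p" for k w and f :: "'p \<Rightarrow> real^'n \<Rightarrow> 'b"
  proof -
    note d = symb_SucD[OF f]
    have "\<exists>A. \<forall>p. \<forall>x\<in>U p. norm (partial i (f p) x) \<le> A * (w p * B p)" for i
      using symb_bound[OF d(2)] by blast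
    then obtain A where A: "\<And>i p x. x \<in> U p \<Longrightarrow> norm (partial i (f p) x) \<le> A i * (w p * B p)" by metis
    define A' where "A' = (\<Sum>i\<in>UNIV. \<bar>A i\<bar>)"
    have A': "norm (partial i (f p) x) \<le> A' * (w p * B p)" if "x \<in> U p" for i p x
      unfolding A'_def by (rule sum_abs_bound[OF A[OF that]]) (use w assms(5) in auto)
    have "norm (f p (x + h p) - f p (x + h' p)) \<le> (real CARD('n) * A') * (w p * B p * norm (h p - h' p))"
      if "x + h p \<in> U p" "x + h' p \<in> U p" for p x
      using lipschitz_partial[OF assms(3) that, of "f p" "A' * (w p * B p)"] d(1) A' by (simp add: algebra_simps)
    then show ?thesis by blast
  qed
  {
    case (0 w f)
    then show ?case using zero[OF 0] by simp
  next
    case (Suc k w f)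
    note d = symb_SucD[OF Suc.prems(1)]
    let ?V = "\<lambda>p. {x. x + h p \<in> U p \<and> x + h' p \<in> U p}"
    have o: "open (?V p)" for p
      using open_Int[OF open_translate_vimage[OF assms(2)] open_translate_vimage[OF assms(2)], of "h p" p "h' p" p]
      by (simp add: Int_def)
    obtain A where A: "\<And>p x. x \<in> ?V p \<Longrightarrow> norm (f p (x + h p) - f p (x + h' p)) \<le> A * (w p * B p * norm (h p - h' p))"
      using zero[OF Suc.prems] by blast
    show ?case
    proof (rule symb_SucI[OF A])
      have "symb k ?V B (\<lambda>p. (w p * B p) * B p * norm (h p - h' p))
        (\<lambda>p x. partial i (f p) (x + h p) - partial i (f p) (x + h' p))" for i
        by (rule Suc.IH[OF d(2)]) (use Suc.prems assms(5) in auto)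
      then have "symb k ?V B (\<lambda>p. (w p * B p) * B p * norm (h p - h' p))
        (\<lambda>p. partial i (\<lambda>x. f p (x + h p) - f p (x + h' p)))" for i
      proof (rule symb_cong[OF o, rotated 1])
        fix p x assume x: "x \<in> ?V p"
        show "partial i (f p) (x + h p) - partial i (f p) (x + h' p) = partial i (\<lambda>x. f p (x + h p) - f p (x + h' p)) x"
          using x d(1)
          by (subst partial_has_derivative[OF has_derivative_diff[OF has_derivative_translate has_derivative_translate]])
             (auto simp: partial_def)
      qed
      then show "symb k ?V B (\<lambda>p. w p * B p * norm (h p - h' p) * B p)
        (\<lambda>p. partial i (\<lambda>x. f p (x + h p) - f p (x + h' p)))" for i by (simp add: algebra_simps)
    qed (auto intro!: derivative_intros differentiable_translate d(1))
  }
qed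

text \<open>The direction of an integration by parts will depend on the parameter. There are
  finitely many directions, so the sum of their constants serves all parameters at once.\<close>

lemma symb_choice:
  fixes g :: "'n::finite \<Rightarrow> 'p \<Rightarrow> real^'n \<Rightarrow> 'b::real_normed_vector"
  assumes "\<And>j. symb k U B w (g j)" "\<And>p. 0 \<le> w p" "\<And>p. 0 \<le> B p"
  shows "symb k U B w (\<lambda>p. g (i p) p)"
  using assms(1,2)
proof (induction k arbitrary: w g)
  have zero: "\<exists>A. \<forall>p. \<forall>x\<in>U p. norm (g (i p) p x) \<le> A * w p"
    if g: "\<And>j. symb k U B w (g j)" and w: "\<And>p. 0 \<le> w p" for k w and g :: "'n \<Rightarrow> 'p \<Rightarrow> real^'n \<Rightarrow> 'b"
  proof -
    have "\<exists>A. \<forall>p. \<forall>x\<in>U p. norm (g j p x) \<le> A * w p" for j using g symb_bound by blast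
    then obtain A where A: "\<And>j p x. x \<in> U p \<Longrightarrow> norm (g j p x) \<le> A j * w p" by metis
    have "norm (g (i p) p x) \<le> (\<Sum>j\<in>UNIV. \<bar>A j\<bar>) * w p" if "x \<in> U p" for p x
      by (rule sum_abs_bound[OF A[OF that] w])
    then show ?thesis by blast
  qed
  {
    case (0 w g)
    then show ?case using zero[of 0 w g] by simp
  next
    case (Suc k w g)
    obtain A where A: "\<And>p x. x \<in> U p \<Longrightarrow> norm (g (i p) p x) \<le> A * w p"
      using zero[where g=g, OF Suc.prems] by blast
    show ?case
    proof (rule symb_SucI[OF A])
      show "symb k U B (\<lambda>p. w p * B p) (\<lambda>p. partial j (g (i p) p))" for j
        by (rule Suc.IH[of "\<lambda>p. w p * B p" "\<lambda>l p. partial j (g l p)"])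
          (use Suc.prems(2) assms(3) symb_SucD(2)[OF Suc.prems(1)] in auto)
    qed (auto intro: symb_SucD(1)[OF Suc.prems(1)])
  }
qed

lemma symb_partial_dep:
  fixes f :: "'p \<Rightarrow> real^'n \<Rightarrow> 'b::real_normed_vector"
  assumes "symb (Suc k) U B w f" "\<And>p. 0 \<le> w p" "\<And>p. 0 \<le> B p"
  shows "symb k U B (\<lambda>p. w p * B p) (\<lambda>p. partial (i p) (f p))"
  by (rule symb_choice[where g = "\<lambda>i p. partial i (f p)"]) (use assms symb_SucD(2)[OF assms(1)] in auto)

lemma partials_snoc: "partials (\<alpha> @ [i]) f = partials \<alpha> (partial i f)"
  by (induction \<alpha>) auto

text \<open>\<open>symb\<close> applies the innermost derivative first, whereas
  \<open>partials\<close> has the outermost one at the head of the list; the induction therefore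
  appends at the end.\<close>

lemma symb_of_partials:
  fixes f :: "'p \<Rightarrow> real^'n \<Rightarrow> 'c::real_normed_vector"
  assumes "\<And>\<alpha>. length \<alpha> \<le> k \<Longrightarrow> \<exists>A. \<forall>p. \<forall>x\<in>U p. norm (partials \<alpha> (f p) x) \<le> A * (w p * B p ^ length \<alpha>)"
    "\<And>\<alpha> p x. length \<alpha> < k \<Longrightarrow> x \<in> U p \<Longrightarrow> partials \<alpha> (f p) differentiable at x"
  shows "symb k U B w f"
proof -
  show ?thesis using assms
  proof (induction k arbitrary: w f)
    case (0 w f)
    then show ?case using 0(1)[of "[]"] by simp
  next
    case (Suc k w f)
    have "symb k U B (\<lambda>p. w p * B p) (\<lambda>p. partial i (f p))" for i
    proof (rule Suc.IH)
      fix \<alpha> :: "'n list"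
      show "\<exists>A. \<forall>p. \<forall>x\<in>U p. norm (partials \<alpha> (partial i (f p)) x) \<le> A * (w p * B p * B p ^ length \<alpha>)" if "length \<alpha> \<le> k"
        using Suc.prems(1)[of "\<alpha> @ [i]"] that by (simp add: partials_snoc algebra_simps)
      show "partials \<alpha> (partial i (f p)) differentiable at x" if "length \<alpha> < k" "x \<in> U p" for p x
        using Suc.prems(2)[of "\<alpha> @ [i]" x p] that by (simp add: partials_snoc)
    qed
    then show ?case using Suc.prems(1)[of "[]"] Suc.prems(2)[of "[]"] by auto
  qed
qed

subsection \<open>The majorant of the kernel\<close>

text \<open>Any exponent strictly between \<open>-n - 1\<close> and \<open>-n\<close> would do: \<open>decay\<close> has to be integrable, and at
  \<open>-n - 1\<close> the dyadic sum over the low frequencies diverges logarithmically.\<close>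

definition decay :: "real^'n \<Rightarrow> real"
  where "decay z = (1 + norm z) powr (- (real CARD('n) + 1/2))"

lemma decay_pos: "0 < decay z" and decay_nonneg: "0 \<le> decay z"
  by (auto simp: decay_def intro!: powr_gt_zero[THEN iffD2] add_pos_nonneg, smt (verit) norm_ge_zero)

lemma decay_le_1: "decay z \<le> 1"
  unfolding decay_def using powr_mono2'[of "- (real CARD('a) + 1/2)" 1 "1 + norm z"] by simp

lemma continuous_on_decay: "continuous_on S decay"
  unfolding decay_def by (intro continuous_intros) (auto, smt (verit) norm_ge_zero)

lemma borel_measurable_decay [measurable]: "decay \<in> borel_measurable borel"
  by (intro borel_measurable_continuous_onI continuous_on_decay)

lemma decay_le_scaled:
  fixes y z :: "real^'n"
  assumes "1 + norm z \<le> L * (1 + norm y)" "0 < L"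
  shows "decay y \<le> L powr (real CARD('n) + 1/2) * decay z"
proof -
  let ?s = "real CARD('n) + 1/2"
  have "(1 + norm z) powr ?s \<le> (L * (1 + norm y)) powr ?s"
    using assms by (intro powr_mono2) auto
  also have "\<dots> = L powr ?s * (1 + norm y) powr ?s"
    by (rule powr_mult)
  finally have 1: "(1 + norm z) powr ?s \<le> L powr ?s * (1 + norm y) powr ?s" .
  have p: "(1 + norm z) powr ?s > 0" "(1 + norm y) powr ?s > 0"
    using norm_ge_zero[of z] norm_ge_zero[of y] by (simp_all add: add_nonneg_eq_0_iff)
  show ?thesis using 1 p unfolding decay_def powr_minus by (simp add: field_simps)
qed

lemma decay_dyadic:
  fixes z :: "real^'n"
  obtains k :: nat where "norm z < 2 ^ k" "decay z \<le> 2 powr (real CARD('n) + 1/2) * (2 ^ k) powr (- (real CARD('n) + 1/2))"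
proof -
  let ?s = "real CARD('n) + 1/2"
  \<comment> \<open>Minimality is what bounds \<open>2 ^ k\<close> from above by
    \<open>2 * (1 + norm z)\<close>.\<close>
  define k where "k = (LEAST k::nat. norm z < 2 ^ k)"
  obtain k0 :: nat where "norm z < 2 ^ k0" using real_arch_pow[of 2] by auto
  then have k: "norm z < 2 ^ k" unfolding k_def by (rule LeastI)
  have "2 ^ k \<le> 2 * (1 + norm z)"
  proof (cases k)
    case (Suc l)
    then have "\<not> norm z < 2 ^ l" using not_less_Least[of l "\<lambda>k. norm z < 2 ^ k"] unfolding k_def by auto
    then show ?thesis using Suc by simp
  next
    case 0
    then show ?thesis using norm_ge_zero[of z] by simp
  qed
  then have "(2 ^ k) powr ?s \<le> (2 * (1 + norm z)) powr ?s"
    by (intro powr_mono2) auto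
  also have "\<dots> = 2 powr ?s * (1 + norm z) powr ?s"
    by (rule powr_mult)
  finally have 1: "(2 ^ k) powr ?s \<le> 2 powr ?s * (1 + norm z) powr ?s" .
  have p: "(1 + norm z) powr ?s > 0" "((2::real) ^ k) powr ?s > 0"
    using norm_ge_zero[of z] by (simp_all add: add_nonneg_eq_0_iff)
  have "decay z \<le> 2 powr ?s * (2 ^ k) powr (- ?s)"
    using 1 p unfolding decay_def powr_minus by (simp add: field_simps)
  with k show ?thesis by (rule that)
qed

text \<open>The term of one suitable ball already suffices. In this form, integration against
  \<open>decay\<close> becomes a series of averages over dyadic balls.\<close>

lemma decay_le_suminf:
  fixes z :: "real^'n"
  shows "ennreal (decay z) \<le> (\<Sum>k. ennreal (2 powr (real CARD('n) + 1/2) * (2 ^ k) powr (- (real CARD('n) + 1/2)))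
    * indicator (ball (0::real^'n) (2 ^ k)) z)"
proof -
  let ?s = "real CARD('n) + 1/2"
  obtain k :: nat where k: "norm z < 2 ^ k" "decay z \<le> 2 powr ?s * (2 ^ k) powr (- ?s)" by (rule decay_dyadic)
  let ?f = "\<lambda>k. ennreal (2 powr ?s * (2 ^ k) powr (- ?s)) * indicator (ball (0::real^'n) (2 ^ k)) z"
  have "ennreal (decay z) \<le> ?f k" using k by (simp add: ennreal_leI)
  also have "\<dots> = sum ?f {k}" by (subst sum.insert) auto
  also have "\<dots> \<le> (\<Sum>l. ?f l)" by (rule sum_le_suminf) auto
  finally show ?thesis .
qed

text \<open>Volume against decay: the \<open>n\<close> powers of the radius \<open>2 ^ k\<close>
  cancel, and the remaining half power makes both the integral of \<open>decay\<close> and the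
  series of averages geometric.\<close>

lemma dyadic_weight:
  "(2 ^ k) powr (- (real n + 1/2)) * 2 ^ (k * n) = (2 powr (-1/2::real)) ^ k"
proof -
  have 1: "(2 ^ k :: real) = 2 powr real k" by (rule powr_realpow[symmetric]) simp
  have 2: "(2 ^ (k * n) :: real) = 2 powr (real k * real n)"
    by (subst of_nat_mult[symmetric], rule powr_realpow[symmetric]) simp
  have 3: "(2 powr (-1/2::real)) ^ k = 2 powr (-1/2 * real k)"
    by (simp only: powr_power) (simp add: mult.commute)
  have 4: "real k * (- (real n + 1/2)) + real k * real n = -1/2 * real k" by (simp add: algebra_simps)
  show ?thesis unfolding 1 2 3 powr_powr powr_add[symmetric] 4 ..
qed

lemma integrable_decay: "integrable lborel (decay :: real^'n \<Rightarrow> real)"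
proof (rule integrableI_nonneg)
  let ?n = "real CARD('n)" let ?s = "?n + 1/2"
  let ?V = "measure lborel (ball (0::real^'n) 1)"
  have ball: "emeasure lborel (ball (0::real^'n) (2^k)) = ennreal (2 ^ (k * CARD('n)) * ?V)" for k :: nat
  proof -
    have "measure lborel (ball (0::real^'n) (2^k)) = (2^k) ^ CARD('n) * ?V"
      using content_ball_conv_unit_ball[of "2^k" "0::real^'n"] by simp
    then show ?thesis
      using emeasure_bounded_finite[OF bounded_ball, of "0::real^'n" "2^k"]
      by (subst emeasure_eq_ennreal_measure) (auto simp: power_mult)
  qed
  have "(\<integral>\<^sup>+z. ennreal (decay (z::real^'n)) \<partial>lborel)
      \<le> (\<integral>\<^sup>+z. (\<Sum>k. ennreal (2 powr ?s * (2 ^ k) powr (- ?s)) * indicator (ball (0::real^'n) (2 ^ k)) z) \<partial>lborel)"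
    by (rule nn_integral_mono) (rule decay_le_suminf)
  also have "\<dots> = (\<Sum>k. ennreal (2 powr ?s * (2 ^ k) powr (- ?s)) * emeasure lborel (ball (0::real^'n) (2^k)))"
  proof (subst nn_integral_suminf)
    show "(\<lambda>z. ennreal (2 powr ?s * (2 ^ k) powr (- ?s)) * indicator (ball (0::real^'n) (2 ^ k)) z) \<in> borel_measurable lborel" for k :: nat
      by (intro borel_measurable_times_ennreal borel_measurable_const borel_measurable_indicator) simp
    show "(\<Sum>k. \<integral>\<^sup>+z. ennreal (2 powr ?s * (2 ^ k) powr (- ?s)) * indicator (ball (0::real^'n) (2 ^ k)) z \<partial>lborel)
      = (\<Sum>k. ennreal (2 powr ?s * (2 ^ k) powr (- ?s)) * emeasure lborel (ball (0::real^'n) (2^k)))"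
      by (intro suminf_cong nn_integral_cmult_indicator) simp
  qed
  also have "\<dots> = (\<Sum>k. ennreal (2 powr ?s * ?V * (2 powr (-1/2)) ^ k))"
  proof (intro suminf_cong)
    fix k :: nat
    have *: "(2 ^ k) powr (- ?s) * 2 ^ (k * CARD('n)) = (2 powr (-1/2::real)) ^ k" by (rule dyadic_weight)
    have "p * a * (b * v) = p * v * (a * b)" for p a b v :: real by simp
    then have "2 powr ?s * (2 ^ k) powr (- ?s) * (2 ^ (k * CARD('n)) * ?V) = 2 powr ?s * ?V * (2 powr (-1/2::real)) ^ k"
      unfolding *[symmetric] .
    then show "ennreal (2 powr ?s * (2 ^ k) powr (- ?s)) * emeasure lborel (ball (0::real^'n) (2^k)) =
      ennreal (2 powr ?s * ?V * (2 powr (-1/2)) ^ k)"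
      unfolding ball by (subst ennreal_mult[symmetric]) auto
  qed
  also have "\<dots> < \<infinity>"
  proof -
    have "2 powr (-1/2) < (1::real)" using powr_less_mono[of "-1/2" 0 "2::real"] by simp
    then have "summable (\<lambda>k. 2 powr ?s * ?V * (2 powr (-1/2::real)) ^ k)"
      by (intro summable_mult summable_geometric) auto
    then show ?thesis by (subst suminf_ennreal2) auto
  qed
  finally show "(\<integral>\<^sup>+z. ennreal (decay (z::real^'n)) \<partial>lborel) < \<infinity>" .
qed (auto simp: decay_nonneg)

subsection \<open>Integration by parts\<close>

lemma integral_translate:
  fixes f :: "real^'n \<Rightarrow> 'b::{banach,second_countable_topology}"
  assumes "f \<in> borel_measurable borel"
  shows "(LBINT x. f (x + h)) = (LBINT x. f x)"
    "integrable lborel (\<lambda>x. f (x + h)) \<longleftrightarrow> integrable lborel f"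
proof -
  have "integral\<^sup>L (distr lborel borel ((+) h)) f = (LBINT x. f (h + x))"
    by (rule integral_distr) (use assms in auto)
  then show "(LBINT x. f (x + h)) = (LBINT x. f x)" by (simp add: lborel_distr_plus add.commute)
  have "integrable (distr lborel borel ((+) h)) f = integrable lborel (\<lambda>x. f (h + x))"
    by (rule integrable_distr_eq) (use assms in auto)
  then show "integrable lborel (\<lambda>x. f (x + h)) \<longleftrightarrow> integrable lborel f"
    by (simp add: lborel_distr_plus add.commute)
qed

text \<open>Difference quotients integrate to \<open>0\<close> by translation invariance, and the
  mean value theorem dominates them by a multiple of \<open>decay\<close>. This avoids iterated
  integrals and applies to Schwartz functions as well as to functions of bounded support.\<close>

lemma integral_partial_eq_0:
  fixes f :: "real^'n \<Rightarrow> 'b::{banach,second_countable_topology}"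
  assumes d: "\<And>x. f differentiable at x" and "\<And>x. norm (f x) \<le> C * decay x"
    and C: "\<And>x. norm (partial i f x) \<le> C * decay x"
  shows "integrable lborel f" "integrable lborel (partial i f)" "(LBINT x. partial i f x) = 0"
proof -
  have meas: "f \<in> borel_measurable borel"
    by (intro borel_measurable_continuous_onI continuous_at_imp_continuous_on ballI differentiable_imp_continuous_within d)
  show int: "integrable lborel f"
    by (rule Bochner_Integration.integrable_bound[of _ "\<lambda>x. C * decay x"])
      (use assms(2) meas in \<open>auto intro!: integrable_decay integrable_mult_right AE_I2 intro: order_trans[OF _ abs_ge_self]\<close>)
  \<comment> \<open>The price of comparing \<open>decay\<close> at two points of distance at most
    \<open>1\<close>, for which \<open>1 + norm\<close> changes at most by the factor
    \<open>2\<close>.\<close>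
  define L where "L = (2::real) powr (real CARD('n) + 1/2)"
  have C0: "0 \<le> C" using assms(2)[of 0] decay_pos[of "0::real^'n"] norm_ge_zero[of "f 0"]
    by (smt (verit) mult_neg_pos)
  define e where "e = (axis i 1 :: real^'n)"
  have e1: "norm e = 1" by (simp add: e_def norm_axis_1)
  define g where "g k x = real (Suc k) *\<^sub>R (f (x + (1 / real (Suc k)) *\<^sub>R e) - f x)" for k x
  have lim: "(\<lambda>k. g k x) \<longlonglongrightarrow> partial i f x" for x
  proof -
    have "((\<lambda>t. f (x + t *\<^sub>R e)) has_vector_derivative partial i f x) (at 0)"
    proof -
      have "((\<lambda>t::real. x + t *\<^sub>R e) has_derivative (\<lambda>t. t *\<^sub>R e)) (at 0)"
        by (auto intro!: derivative_eq_intros)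
      moreover have "(f has_derivative frechet_derivative f (at x)) (at (x + 0 *\<^sub>R e))"
        using d by (simp add: frechet_derivative_works)
      ultimately have "((\<lambda>t. f (x + t *\<^sub>R e)) has_derivative (\<lambda>t. frechet_derivative f (at x) (t *\<^sub>R e))) (at 0)"
        by (rule has_derivative_compose)
      moreover have "frechet_derivative f (at x) (t *\<^sub>R e) = t *\<^sub>R partial i f x" for t
        using linear_cmul[OF linear_frechet_derivative[OF d]] by (simp add: partial_def e_def)
      ultimately show ?thesis by (simp add: has_vector_derivative_def)
    qed
    then have "((\<lambda>h. inverse h *\<^sub>R (f (x + h *\<^sub>R e) - f x)) \<longlongrightarrow> partial i f x) (at 0)"
    proof -
      assume "((\<lambda>t. f (x + t *\<^sub>R e)) has_vector_derivative partial i f x) (at 0)"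
      then have "((\<lambda>h. norm (f (x + h *\<^sub>R e) - f x - h *\<^sub>R partial i f x) / norm h) \<longlongrightarrow> 0) (at 0)"
        by (simp add: has_vector_derivative_def has_derivative_at)
      moreover have "norm (f (x + h *\<^sub>R e) - f x - h *\<^sub>R partial i f x) / norm h
          = norm (inverse h *\<^sub>R (f (x + h *\<^sub>R e) - f x) - partial i f x)" if "h \<noteq> 0" for h
      proof -
        have "inverse h *\<^sub>R (f (x + h *\<^sub>R e) - f x) - partial i f x
           = inverse h *\<^sub>R (f (x + h *\<^sub>R e) - f x - h *\<^sub>R partial i f x)"
          using that by (simp add: scaleR_diff_right)
        show ?thesis unfolding \<open>inverse h *\<^sub>R _ - _ = _\<close> norm_scaleR by (simp add: divide_inverse abs_inverse)
      qed
      then have "\<forall>\<^sub>F h in at 0. norm (f (x + h *\<^sub>R e) - f x - h *\<^sub>R partial i f x) / norm h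
          = norm (inverse h *\<^sub>R (f (x + h *\<^sub>R e) - f x) - partial i f x)"
        by (simp add: eventually_at_filter)
      ultimately have "((\<lambda>h. norm (inverse h *\<^sub>R (f (x + h *\<^sub>R e) - f x) - partial i f x)) \<longlongrightarrow> 0) (at 0)"
        by (rule Lim_transform_eventually)
      then have "((\<lambda>h. inverse h *\<^sub>R (f (x + h *\<^sub>R e) - f x) - partial i f x) \<longlongrightarrow> 0) (at 0)"
        by (rule tendsto_norm_zero_cancel)
      then show ?thesis by (rule LIM_zero_cancel)
    qed
    moreover have "filterlim (\<lambda>k. 1 / real (Suc k)) (at 0) sequentially"
      by (auto simp: filterlim_at LIMSEQ_Suc[OF lim_1_over_n] simp del: of_nat_Suc)
    ultimately have "(\<lambda>k. inverse (1 / real (Suc k)) *\<^sub>R (f (x + (1 / real (Suc k)) *\<^sub>R e) - f x)) \<longlonglongrightarrow> partial i f x"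
      by (rule filterlim_compose)
    then show ?thesis by (simp add: g_def)
  qed
  have bound: "norm (g k x) \<le> C * L * decay x" for k x
  proof -
    define t where "t = 1 / real (Suc k)"
    have t: "0 < t" "t \<le> 1" by (auto simp: t_def)
    have "norm (f (x + t *\<^sub>R e) - f (x + 0 *\<^sub>R e)) \<le> (C * L * decay x) * norm (t - 0)"
    proof (rule differentiable_bound[of "{0..t}" "\<lambda>t. f (x + t *\<^sub>R e)" "\<lambda>s r. r *\<^sub>R partial i f (x + s *\<^sub>R e)"])
      fix s assume s: "s \<in> {0..t}"
      have "((\<lambda>t::real. x + t *\<^sub>R e) has_derivative (\<lambda>t. t *\<^sub>R e)) (at s)"
        by (auto intro!: derivative_eq_intros)
      moreover have "(f has_derivative frechet_derivative f (at (x + s *\<^sub>R e))) (at (x + s *\<^sub>R e))"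
        using d by (simp add: frechet_derivative_works)
      ultimately have "((\<lambda>t. f (x + t *\<^sub>R e)) has_derivative (\<lambda>t. frechet_derivative f (at (x + s *\<^sub>R e)) (t *\<^sub>R e))) (at s)"
        by (rule has_derivative_compose)
      moreover have "frechet_derivative f (at (x + s *\<^sub>R e)) (t *\<^sub>R e) = t *\<^sub>R partial i f (x + s *\<^sub>R e)" for t
        using linear_cmul[OF linear_frechet_derivative[OF d]] by (simp add: partial_def e_def)
      ultimately show "((\<lambda>t. f (x + t *\<^sub>R e)) has_derivative (\<lambda>r. r *\<^sub>R partial i f (x + s *\<^sub>R e))) (at s within {0..t})"
        by (simp add: has_derivative_at_withinI)
      have lin: "1 + a \<le> 2 * (1 + r)" if "a \<le> r + b" "b \<le> 1" "0 \<le> r" for a b r :: real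
        using that by argo
      have "norm x \<le> norm (x + s *\<^sub>R e) + norm (s *\<^sub>R e)"
        by (metis add_diff_cancel_right' norm_triangle_ineq4)
      moreover have "norm (s *\<^sub>R e) \<le> 1" using s t e1 by auto
      ultimately have "1 + norm x \<le> 2 * (1 + norm (x + s *\<^sub>R e))"
        using lin[OF _ _ norm_ge_zero[of "x + s *\<^sub>R e"]] by blast
      then have dec: "decay (x + s *\<^sub>R e) \<le> L * decay x" unfolding L_def by (intro decay_le_scaled) auto
      have "norm (partial i f (x + s *\<^sub>R e)) \<le> C * decay (x + s *\<^sub>R e)" by (rule C)
      also have "\<dots> \<le> C * (L * decay x)" by (intro mult_left_mono dec C0)
      finally have bd: "norm (partial i f (x + s *\<^sub>R e)) \<le> C * (L * decay x)" .
      show "onorm (\<lambda>r. r *\<^sub>R partial i f (x + s *\<^sub>R e)) \<le> C * L * decay x"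
      proof (intro onorm_le)
        fix r :: real
        from bd have "\<bar>r\<bar> * norm (partial i f (x + s *\<^sub>R e)) \<le> \<bar>r\<bar> * (C * (L * decay x))"
          by (rule mult_left_mono) simp
        then show "norm (r *\<^sub>R partial i f (x + s *\<^sub>R e)) \<le> C * L * decay x * norm r"
          by (simp add: mult_ac)
      qed
    qed (use t in auto)
    then have "norm (f (x + t *\<^sub>R e) - f x) \<le> C * L * decay x * t" using t by simp
    moreover have "norm (g k x) = norm (f (x + t *\<^sub>R e) - f x) / t"
      unfolding g_def t_def[symmetric] norm_scaleR by (simp add: t_def)
    ultimately show ?thesis using t by (simp only:) (simp add: divide_le_eq)
  qed
  have gm: "g k \<in> borel_measurable lborel" for k using meas unfolding g_def by measurable
  have pm: "partial i f \<in> borel_measurable lborel"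
    by (rule borel_measurable_LIMSEQ_metric[OF gm lim])
  have domi: "integrable lborel (\<lambda>x. C * L * decay (x::real^'n))" by (intro integrable_mult_right integrable_decay)
  show "integrable lborel (partial i f)"
    by (rule integrable_dominated_convergence[OF pm gm domi AE_I2 AE_I2]) (rule lim bound)+
  have "(\<lambda>k. integral\<^sup>L lborel (g k)) \<longlonglongrightarrow> integral\<^sup>L lborel (partial i f)"
    by (rule integral_dominated_convergence[OF pm gm domi AE_I2 AE_I2]) (rule lim bound)+
  moreover have "integral\<^sup>L lborel (g k) = 0" for k
    unfolding g_def using int integral_translate[OF meas] by (simp add: Bochner_Integration.integral_diff)
  ultimately show "(LBINT x. partial i f x) = 0" by (simp add: LIMSEQ_const_iff)
qed

text \<open>Brings amplitudes of bounded support under the hypotheses of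
  \<open>integral_partial_eq_0\<close>.\<close>

lemma bounded_support_decay:
  fixes f :: "real^'n \<Rightarrow> 'b::real_normed_vector"
  assumes "bounded K" "\<And>x. x \<notin> K \<Longrightarrow> f x = 0" "\<And>x. norm (f x) \<le> M"
  obtains C where "\<And>x. norm (f x) \<le> C * decay x" "0 \<le> C"
proof -
  obtain R where R: "\<And>x. x \<in> K \<Longrightarrow> norm x \<le> R" using assms(1) by (auto simp: bounded_iff)
  let ?s = "real CARD('n) + 1/2"
  have M: "0 \<le> M" using assms(3)[of 0] norm_ge_zero order_trans by blast
  let ?C = "M * (1 + \<bar>R\<bar>) powr ?s"
  have "norm (f x) \<le> ?C * decay x" for x
  proof (cases "x \<in> K")
    case True
    have "decay (0::real^'n) \<le> (1 + \<bar>R\<bar>) powr ?s * decay x"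
      by (rule decay_le_scaled) (use R[OF True] in auto)
    then have "1 \<le> (1 + \<bar>R\<bar>) powr ?s * decay x" by (simp add: decay_def)
    then have "M * 1 \<le> M * ((1 + \<bar>R\<bar>) powr ?s * decay x)" using M by (rule mult_left_mono)
    then show ?thesis using assms(3)[of x] by (simp add: mult.assoc)
  next
    case False
    then show ?thesis using assms(2) M decay_nonneg[of x] by simp
  qed
  then show ?thesis by (rule that) (use M in auto)
qed

text \<open>Stated for arbitrary \<open>f\<close>: the integral of a non-integrable function is
  \<open>0\<close>, and \<open>M\<close> is nonnegative as a bound of a norm.\<close>

lemma integral_bound_support:
  fixes f :: "real^'n \<Rightarrow> 'b::{banach,second_countable_topology}"
  assumes "closed K" "bounded K" "\<And>x. x \<notin> K \<Longrightarrow> f x = 0" "\<And>x. norm (f x) \<le> M"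
  shows "norm (LBINT x. f x) \<le> M * measure lborel K"
proof (cases "integrable lborel f")
  case True
  have Kfin: "emeasure lborel K < \<infinity>" using assms(2) by (rule emeasure_bounded_finite)
  have "norm (LBINT x. f x) \<le> (LBINT x. M * indicator K x)"
  proof (rule Bochner_Integration.integral_norm_bound_integral[OF True])
    show "integrable lborel (\<lambda>x. M * indicator K x :: real)"
      using Kfin assms(1) by (intro integrable_mult_right) auto
    show "norm (f x) \<le> M * indicator K x" for x using assms(3,4) by (cases "x \<in> K") auto
  qed
  also have "\<dots> = M * measure lborel K" using assms(1) Kfin by simp
  finally show ?thesis .
next
  case False
  have "0 \<le> M" using assms(4)[of 0] norm_ge_zero order_trans by blast
  then show ?thesis using False by (simp add: not_integrable_integral_eq)
qed

text \<open>The open sets \<open>U\<close> and \<open>- K\<close> cover the whole space, and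
  \<open>F\<close> vanishes on the second.\<close>

lemma differentiable_zero_extension:
  assumes "open U" "closed K" "K \<subseteq> U" "\<And>x. x \<notin> K \<Longrightarrow> F x = 0" "\<And>x. x \<in> U \<Longrightarrow> F differentiable at x"
  shows "F differentiable at x" "x \<notin> K \<Longrightarrow> partial i F x = 0"
proof -
  have *: "F differentiable at x \<and> partial i F x = 0" if "x \<notin> K"
  proof -
    have o: "open (- K)" "x \<in> - K" using assms(2) that by auto
    have "F differentiable at x"
      by (rule differentiable_cong_open[OF o, of "\<lambda>x. 0"]) (use assms(4) in auto)
    moreover have "partial i F x = partial i (\<lambda>x. 0) x"
      by (rule partial_cong_open[OF o]) (use assms(4) in auto)
    ultimately show ?thesis by (simp add: partial_const)
  qed
  then show "F differentiable at x" "x \<notin> K \<Longrightarrow> partial i F x = 0" using assms(3,5) by blast+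
qed

lemma integrable_continuous_support:
  fixes f :: "real^'n \<Rightarrow> 'b::{banach,second_countable_topology}"
  assumes "closed K" "bounded K" "\<And>x. x \<notin> K \<Longrightarrow> f x = 0" "continuous_on UNIV f"
  shows "integrable lborel f"
proof -
  have "integrable lborel (\<lambda>x. indicator K x *\<^sub>R f x)"
    using assms by (intro borel_integrable_compact) (auto simp: compact_eq_bounded_closed intro: continuous_on_subset)
  moreover have "(\<lambda>x. indicator K x *\<^sub>R f x) = f" using assms(3) by (auto simp: fun_eq_iff indicator_def)
  ultimately show ?thesis by simp
qed

lemma continuous_on_differentiable_UNIV: "(\<And>x. f differentiable at x) \<Longrightarrow> continuous_on UNIV f"
  by (simp add: continuous_at_imp_continuous_on differentiable_imp_continuous_within)

text \<open>An equality rather than an estimate, so that the step can be iterated before any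
  absolute value is taken inside the integral. The new amplitude \<open>g'\<close> is a separate
  function because the formula for it is meaningful only on \<open>U\<close>.\<close>

lemma integration_by_parts_phase:
  fixes g :: "real^'n \<Rightarrow> complex" and Q :: "real^'n \<Rightarrow> real"
  assumes "open U" "closed K" "bounded K" "K \<subseteq> U"
    and Q: "\<And>x. x \<in> U \<Longrightarrow> Q differentiable at x" "\<And>x. x \<in> U \<Longrightarrow> partial i Q x \<noteq> 0"
    and dQ: "\<And>x. x \<in> U \<Longrightarrow> partial i Q differentiable at x"
    and g: "\<And>x. x \<notin> K \<Longrightarrow> g x = 0" "\<And>x. x \<in> U \<Longrightarrow> g differentiable at x" "\<And>x. x \<in> U \<Longrightarrow> norm (g x) \<le> M"
    and g': "\<And>x. x \<in> U \<Longrightarrow> norm (g' x) \<le> M'" "\<And>x. x \<notin> K \<Longrightarrow> g' x = 0"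
      "\<And>x. x \<in> U \<Longrightarrow> g' x = partial i (\<lambda>x. g x * inverse (of_real (partial i Q x))) x"
    and \<mu>: "0 < \<mu>"
  shows "norm (LBINT x. cis (\<mu> * Q x) * g x) = norm (LBINT x. cis (\<mu> * Q x) * g' x) / \<mu>"
proof -
  let ?q = "\<lambda>x. complex_of_real (partial i Q x)"
  let ?E = "\<lambda>x. cis (\<mu> * Q x)"
  \<comment> \<open>The derivative of \<open>F\<close> is
    \<open>\<i> * \<mu> * E * g + E * g'\<close> on \<open>U\<close>. Since it integrates to
    \<open>0\<close>, the amplitude \<open>g\<close> may be exchanged for \<open>g'\<close> at the
    gain \<open>1 / \<mu>\<close>.\<close>
  define F where "F x = ?E x * (g x * inverse (?q x))" for x
  have dq: "?q differentiable at x" if "x \<in> U" for x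
    using bounded_linear.has_derivative[OF bounded_linear_of_real iffD1[OF frechet_derivative_works dQ[OF that]]]
    by (auto simp: differentiable_def)
  have dE: "?E differentiable at x" "partial i ?E x = of_real (\<mu> * partial i Q x) * (\<i> * ?E x)" if "x \<in> U" for x
  proof -
    have d: "(\<lambda>x. \<mu> * Q x) differentiable at x" using Q(1)[OF that] by (intro differentiable_mult) auto
    have "partial i (\<lambda>x. \<mu> * Q x) x = \<mu> * partial i Q x"
      by (rule partial_linear[OF bounded_linear_mult_right Q(1)[OF that]])
    then show "?E differentiable at x" "partial i ?E x = of_real (\<mu> * partial i Q x) * (\<i> * ?E x)"
      using partial_cis[OF d] by auto
  qed
  have dG: "(\<lambda>x. g x * inverse (?q x)) differentiable at x" if "x \<in> U" for x
    using that g(2) dq Q(2) by (intro differentiable_mult partial_inverse(2)) auto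
  have dF: "F differentiable at x" "partial i F x = (if x \<in> U then \<i> * \<mu> * (?E x * g x) + ?E x * g' x else 0)" for x
  proof -
    have z: "F x = 0" if "x \<notin> K" for x using g(1)[OF that] by (simp add: F_def)
    have d: "F differentiable at x" if "x \<in> U" for x
      unfolding F_def by (rule differentiable_mult[OF dE(1)[OF that] dG[OF that]])
    show "F differentiable at x" by (rule differentiable_zero_extension[OF assms(1,2,4) z d])
    show "partial i F x = (if x \<in> U then \<i> * \<mu> * (?E x * g x) + ?E x * g' x else 0)"
    proof (cases "x \<in> U")
      case True
      then show ?thesis unfolding F_def
        using g'(3)[OF True] Q(2)[OF True]
        by (subst partial_mult[OF dE(1)[OF True] dG[OF True]]) (simp add: dE(2) field_simps)
    next
      case False
      then have "x \<notin> K" using assms(4) by auto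
      then show ?thesis using differentiable_zero_extension(2)[OF assms(1,2,4) z d] False by simp
    qed
  qed
  let ?H = "\<lambda>x. ?E x * g x"
  have dH: "?H differentiable at x" for x
    by (rule differentiable_zero_extension[OF assms(1,2,4)]) (use dE g in \<open>auto intro!: differentiable_mult\<close>)
  have iH: "integrable lborel ?H"
    by (rule integrable_continuous_support[OF assms(2,3)])
      (use g dH in \<open>auto intro: continuous_on_differentiable_UNIV\<close>)
  have "compact K" using assms by (simp add: compact_eq_bounded_closed)
  then have "bounded (F ` K)" using dF(1)
    by (intro compact_imp_bounded compact_continuous_image continuous_on_subset[OF continuous_on_differentiable_UNIV[of F]]) auto
  then obtain MF where MF: "\<And>x. x \<in> K \<Longrightarrow> norm (F x) \<le> MF" by (auto simp: bounded_iff)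
  have "norm (F x) \<le> max 0 MF" for x using MF[of x] g(1)[of x] by (cases "x \<in> K") (auto simp: F_def)
  then obtain C1 where C1: "\<And>x. norm (F x) \<le> C1 * decay x" "0 \<le> C1"
    using bounded_support_decay[OF assms(3), of F "max 0 MF"] g(1) by (auto simp: F_def)
  have b: "norm (partial i F x) \<le> max 0 (\<mu> * M + M')" for x
  proof (cases "x \<in> U")
    case True
    have "norm (partial i F x) \<le> norm (\<i> * \<mu> * (?E x * g x)) + norm (?E x * g' x)"
      using True by (simp add: dF(2) norm_triangle_ineq)
    also have "\<dots> \<le> \<mu> * M + M'"
      using g(3)[OF True] g'(1)[OF True] \<mu> by (auto simp: norm_mult intro!: add_mono mult_left_mono)
    finally show ?thesis by simp
  qed (simp add: dF(2))
  have z: "partial i F x = 0" if "x \<notin> K" for x using g(1)[OF that] g'(2)[OF that] by (simp add: dF(2))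
  obtain C2 where C2: "\<And>x. norm (partial i F x) \<le> C2 * decay x" "0 \<le> C2"
    by (rule bounded_support_decay[OF assms(3), of "partial i F" "max 0 (\<mu> * M + M')"]) (use z b in auto)
  have "norm (F x) \<le> max C1 C2 * decay x" "norm (partial i F x) \<le> max C1 C2 * decay x" for x
    using C1(1)[of x] C2(1)[of x] mult_right_mono[of C1 "max C1 C2" "decay x"] mult_right_mono[of C2 "max C1 C2" "decay x"] decay_nonneg[of x]
    by auto
  note I = integral_partial_eq_0[OF dF(1) this]
  have eq: "?E x * g' x = partial i F x - \<i> * \<mu> * ?H x" for x
    using g(1)[of x] g'(2)[of x] assms(4) by (cases "x \<in> K") (auto simp: dF(2))
  have "(LBINT x. ?E x * g' x) = (LBINT x. partial i F x) - (LBINT x. \<i> * \<mu> * ?H x)"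
    unfolding eq using I(2) iH by (intro Bochner_Integration.integral_diff) auto
  also have "\<dots> = - (\<i> * \<mu> * (LBINT x. ?H x))" using I(3) by simp
  finally have "norm (LBINT x. ?E x * g' x) = \<mu> * norm (LBINT x. ?H x)" using \<mu> by (simp add: norm_mult)
  then show ?thesis using \<mu> by simp
qed

text \<open>Every integration by parts replaces \<open>g\<close> by the derivative of
  \<open>g\<close> divided by the derivative of \<open>Q\<close>, which multiplies the weight by
  \<open>B\<close> and gains \<open>1 / \<mu>\<close>. The phase is normalised so that
  \<open>Q\<close> has derivative of size \<open>1\<close> in the direction \<open>i p\<close>, and
  its true size sits in \<open>\<mu>\<close>.\<close>

lemma nonstationary_phase:
  fixes g :: "'p \<Rightarrow> real^'n \<Rightarrow> complex" and Q :: "'p \<Rightarrow> real^'n \<Rightarrow> real"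
  assumes U: "\<And>p. open (U p)" and K: "\<And>p. closed (K p)" "\<And>p. bounded (K p)" "\<And>p. K p \<subseteq> U p"
    and B: "\<And>p. 0 \<le> B p" and \<mu>: "\<And>p. 0 < \<mu> p"
    and Q: "\<And>p x. x \<in> U p \<Longrightarrow> Q p differentiable at x"
    and q: "symb N U B (\<lambda>p. 1) (\<lambda>p. partial (i p) (Q p))"
    and c: "0 < c" "\<And>p x. x \<in> U p \<Longrightarrow> c \<le> \<bar>partial (i p) (Q p) x\<bar>"
    and g: "symb N U B w g" "\<And>p x. x \<notin> K p \<Longrightarrow> g p x = 0" "\<And>p. 0 \<le> w p"
  shows "\<exists>A\<ge>0. \<forall>p. norm (LBINT x. cis (\<mu> p * Q p x) * g p x) \<le> A * w p * (B p / \<mu> p) ^ N * measure lborel (K p)"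
  using q g
proof (induction N arbitrary: w g)
  case (0 w g)
  obtain A where A: "0 \<le> A" "\<And>p x. x \<in> U p \<Longrightarrow> norm (g p x) \<le> A * w p"
    using symb_bound_nonneg[OF 0(2) 0(4)] by blast
  have "norm (LBINT x. cis (\<mu> p * Q p x) * g p x) \<le> A * w p * measure lborel (K p)" for p
  proof (rule integral_bound_support[OF K(1,2)])
    show "norm (cis (\<mu> p * Q p x) * g p x) \<le> A * w p" for x
      using A(2)[of x p] 0(3)[of x p] K(3)[of p] A(1) 0(4)[of p] by (cases "x \<in> K p") (auto simp: norm_mult)
  qed (use 0(3) in auto)
  then show ?case using A(1) by auto
next
  case (Suc N w g)
  let ?q = "\<lambda>p x. complex_of_real (partial (i p) (Q p) x)"
  let ?G = "\<lambda>p x. g p x * inverse (?q p x)"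
  \<comment> \<open>Cut off to \<open>U p\<close>, because outside it the quotient may divide by
    \<open>0\<close> and its derivative is uncontrolled.\<close>
  define g' where "g' p x = (if x \<in> U p then partial (i p) (?G p) x else 0)" for p x
  have "symb (Suc N) U B (\<lambda>p. 1) ?q"
    by (rule symb_linear[OF bounded_linear_of_real Suc.prems(1) U _ B]) auto
  then have "symb (Suc N) U B (\<lambda>p. inverse 1) (\<lambda>p x. inverse (?q p x))"
    by (rule symb_inverse[OF _ c(1) _ U]) (use c(2) B in auto)
  then have G: "symb (Suc N) U B w ?G"
    using symb_mult[OF Suc.prems(2) _ U Suc.prems(4) _ B, of "\<lambda>p. 1" "\<lambda>p x. inverse (?q p x)"] by simp
  have sg': "symb N U B (\<lambda>p. w p * B p) g'"
    by (rule symb_cong[OF U _ symb_partial_dep[OF G Suc.prems(4) B, of i]]) (auto simp: g'_def)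
  have nz: "partial (i p) (Q p) x \<noteq> 0" if "x \<in> U p" for p x using c(1) c(2)[OF that] by auto
  have z: "g' p x = 0" if "x \<notin> K p" for p x
  proof (cases "x \<in> U p")
    case True
    have dG: "?G p differentiable at x" if "x \<in> U p" for x using symb_SucD(1)[OF G that] .
    have "partial (i p) (?G p) x = 0"
      by (rule differentiable_zero_extension(2)[OF U K(1,3) _ dG that]) (use Suc.prems(3) in auto)
    then show ?thesis by (simp add: g'_def)
  qed (simp add: g'_def)
  obtain A where A: "A \<ge> 0" "\<And>p. norm (LBINT x. cis (\<mu> p * Q p x) * g' p x) \<le> A * (w p * B p) * (B p / \<mu> p) ^ N * measure lborel (K p)"
    using Suc.IH[OF symb_decrement[OF Suc.prems(1)] sg' z] Suc.prems(4) B by auto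
  obtain M where M: "\<And>p x. x \<in> U p \<Longrightarrow> norm (g p x) \<le> M * w p" using symb_bound[OF Suc.prems(2)] by blast
  obtain M' where M': "\<And>p x. x \<in> U p \<Longrightarrow> norm (g' p x) \<le> M' * (w p * B p)" using symb_bound[OF sg'] by blast
  have "norm (LBINT x. cis (\<mu> p * Q p x) * g p x) \<le> A * w p * (B p / \<mu> p) ^ Suc N * measure lborel (K p)" for p
  proof -
    have "norm (LBINT x. cis (\<mu> p * Q p x) * g p x) = norm (LBINT x. cis (\<mu> p * Q p x) * g' p x) / \<mu> p"
      by (rule integration_by_parts_phase[OF U K Q nz _ Suc.prems(3) _ M M' z _ \<mu>])
        (use symb_SucD(1)[OF Suc.prems(1)] symb_SucD(1)[OF Suc.prems(2)] in \<open>auto simp: g'_def\<close>)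
    also have "\<dots> \<le> (A * (w p * B p) * (B p / \<mu> p) ^ N * measure lborel (K p)) / \<mu> p"
      using A(2)[of p] \<mu>[of p] by (intro divide_right_mono) auto
    finally show ?thesis by (simp add: field_simps)
  qed
  then show ?case using A(1) by blast
qed

section \<open>Sums, powers and scaled distances as symbols\<close>

lemma symb_mono:
  assumes "symb k U B w f" "\<And>p. 0 \<le> w p" "\<And>p. w p \<le> C * w' p" "\<And>p. 0 \<le> B p" "\<And>p. B p \<le> D * B' p"
  shows "symb k U B' w' f"
  by (rule symb_weight_mono[OF assms(1), of C w' D]) (use assms in auto)

lemma symb_one: "symb k U B (\<lambda>p. 1) (\<lambda>p x. 1 :: 'b::real_normed_algebra_1)"
  by (rule symb_const[where A=1]) auto

lemma symb_diff:
  assumes "symb k U B w f" "symb k U B w g" "\<And>p. open (U p)" "\<And>p. 0 \<le> w p" "\<And>p. 0 \<le> B p"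
  shows "symb k U B w (\<lambda>p x. f p x - g p x)"
  using symb_add[OF assms(1) symb_linear[OF bounded_linear_minus[OF bounded_linear_ident] assms(2-5)] assms(3)] by simp

lemma symb_sum:
  assumes "finite I" "\<And>i. i \<in> I \<Longrightarrow> symb k U B w (f i)" "\<And>p. open (U p)" "\<And>p. 0 \<le> w p"
  shows "symb k U B w (\<lambda>p x. \<Sum>i\<in>I. f i p x)"
  using assms(1,2)
proof (induction I)
  case empty
  show ?case by (simp, rule symb_const[where A=0]) simp
next
  case (insert i I)
  have "symb k U B w (\<lambda>p x. f i p x + (\<Sum>i\<in>I. f i p x))"
    using insert assms(3) by (intro symb_add) auto
  then show ?case using insert by simp
qed

lemma symb_power:
  fixes f :: "'p \<Rightarrow> real^'n \<Rightarrow> 'b::real_normed_algebra_1"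
  assumes "symb k U B (\<lambda>p. 1) f" "\<And>p. open (U p)" "\<And>p. 0 \<le> B p"
  shows "symb k U B (\<lambda>p. 1) (\<lambda>p x. f p x ^ m)"
proof (induction m)
  case 0
  then show ?case by (simp add: symb_one)
next
  case (Suc m)
  then show ?case using symb_mult[OF assms(1) Suc.IH assms(2) _ _ assms(3)] by simp
qed

text \<open>The square of the norm is a polynomial, hence smooth at the centre as well, and its
  derivatives scale with \<open>1 / r\<close> on balls of radius comparable to
  \<open>r\<close>.\<close>

lemma symb_scaled_dist:
  fixes \<zeta> :: "'p \<Rightarrow> real^'n"
  assumes r: "\<And>p. 0 < r p"
  shows "symb k (\<lambda>p. ball (\<zeta> p) (R * r p)) (\<lambda>p. inverse (r p)) (\<lambda>p. 1) (\<lambda>p x. (norm (x - \<zeta> p) / r p)\<^sup>2)"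
proof -
  let ?U = "\<lambda>p. ball (\<zeta> p) (R * r p)" and ?B = "\<lambda>p. inverse (r p)"
  have B: "0 \<le> ?B p" for p using r[of p] by simp
  have f: "symb k ?U ?B (\<lambda>p. 1) (\<lambda>p x. (x - \<zeta> p) $ j / r p)" for j and k :: nat
  proof (cases k)
    have b: "norm ((x - \<zeta> p) $ j / r p) \<le> \<bar>R\<bar> * 1" if "x \<in> ?U p" for x p
    proof -
      have "\<bar>(x - \<zeta> p) $ j\<bar> \<le> norm (x - \<zeta> p)" by (rule component_le_norm_cart)
      also have "\<dots> \<le> \<bar>R\<bar> * r p" using that r[of p] by (auto simp: dist_norm norm_minus_commute abs_mult intro: order_trans[OF less_imp_le mult_right_mono])
      finally show ?thesis using r[of p] by (simp add: divide_le_eq)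
    qed
    {
      case 0
      show ?thesis unfolding 0 symb.simps using b by blast
    next
      case (Suc l)
      have d: "((\<lambda>x. (x - \<zeta> p) $ j / r p) has_derivative (\<lambda>v. v $ j / r p)) (at x)" for p x
        by (auto intro!: derivative_eq_intros bounded_linear.has_derivative[OF bounded_linear_vec_nth] simp: divide_inverse)
      have "partial i (\<lambda>x. (x - \<zeta> p) $ j / r p) = (\<lambda>x. axis i 1 $ j / r p)" for i p
        using partial_has_derivative[OF d] by auto
      moreover have "symb l ?U ?B (\<lambda>p. 1 * inverse (r p)) (\<lambda>p x. axis i (1::real) $ j / r p)" for i
        by (rule symb_const[where A=1]) (use r in \<open>auto simp: axis_def divide_inverse less_imp_le\<close>)
      ultimately show ?thesis unfolding Suc
        using b differentiableI[OF d] by (intro symb_SucI[where A="\<bar>R\<bar>"]) simp_all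
    }
  qed
  have "symb k ?U ?B (\<lambda>p. 1) (\<lambda>p x. \<Sum>j\<in>UNIV. ((x - \<zeta> p) $ j / r p) ^ 2)"
    by (rule symb_sum[OF _ symb_power[OF f]]) (use B in auto)
  moreover have "(\<Sum>j\<in>UNIV. ((x - \<zeta> p) $ j / r p) ^ 2) = (norm (x - \<zeta> p) / r p)\<^sup>2" for p x
    by (simp add: norm_vec_def L2_set_def power_divide sum_nonneg flip: sum_divide_distrib)
  ultimately show ?thesis by simp
qed

subsection \<open>Cutoff functions of finite smoothness\<close>

text \<open>A truncated power has \<open>m - 1\<close> continuous derivatives (for positive
  \<open>m\<close>). Only finitely many integrations by parts are ever made, so this elementary
  function can replace a flat \<open>C^\<infinity>\<close> function.\<close>

definition pospow :: "nat \<Rightarrow> real \<Rightarrow> real"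
  where "pospow m t = max 0 t ^ m"

lemma pospow_nonneg: "0 \<le> pospow m t" by (simp add: pospow_def)

lemma continuous_on_pospow: "continuous_on S f \<Longrightarrow> continuous_on S (\<lambda>x. pospow m (f x))"
  unfolding pospow_def by (intro continuous_intros)

lemma DERIV_pospow: "(pospow (Suc (Suc m)) has_field_derivative (real (Suc (Suc m)) * pospow (Suc m) t)) (at t)"
proof -
  consider "t > 0" | "t < 0" | "t = 0" by linarith
  then show ?thesis
  proof cases
    case 1
    have "((\<lambda>t. t ^ Suc (Suc m)) has_field_derivative (real (Suc (Suc m)) * pospow (Suc m) t)) (at t)"
      using 1 DERIV_pow[of "Suc (Suc m)" t] by (simp add: pospow_def)
    then show ?thesis
      by (rule has_field_derivative_transform_within_open[of _ _ _ "{0<..}"]) (use 1 in \<open>auto simp: pospow_def\<close>)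
  next
    case 2
    have "((\<lambda>t. 0) has_field_derivative (real (Suc (Suc m)) * pospow (Suc m) t)) (at t)"
      using 2 by (auto simp: pospow_def)
    then show ?thesis
      by (rule has_field_derivative_transform_within_open[of _ _ _ "{..<0}"]) (use 2 in \<open>auto simp: pospow_def\<close>)
  next
    case 3
    have "((\<lambda>h. pospow (Suc (Suc m)) h / h) \<longlongrightarrow> 0) (at 0)"
    proof (rule Lim_null_comparison)
      show "\<forall>\<^sub>F h in at 0. norm (pospow (Suc (Suc m)) h / h) \<le> \<bar>h\<bar> ^ Suc m"
      proof (rule always_eventually, rule allI)
        fix h :: real
        have "\<bar>pospow (Suc (Suc m)) h\<bar> \<le> \<bar>h\<bar> ^ Suc (Suc m)"
          unfolding abs_of_nonneg[OF pospow_nonneg] unfolding pospow_def by (rule power_mono) auto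
        then have "\<bar>pospow (Suc (Suc m)) h\<bar> / \<bar>h\<bar> \<le> \<bar>h\<bar> ^ Suc (Suc m) / \<bar>h\<bar>"
          by (rule divide_right_mono) simp
        also have "\<dots> \<le> \<bar>h\<bar> ^ Suc m" by (cases "h = 0") auto
        finally show "norm (pospow (Suc (Suc m)) h / h) \<le> \<bar>h\<bar> ^ Suc m" by simp
      qed
      show "((\<lambda>h::real. \<bar>h\<bar> ^ Suc m) \<longlongrightarrow> 0) (at 0)"
        by (auto intro!: tendsto_eq_intros)
    qed
    then show ?thesis using 3 by (simp add: DERIV_def pospow_def)
  qed
qed

text \<open>Each derivative lowers the exponent by one, and \<open>k < m\<close> keeps it positive
  up to order \<open>k\<close>.\<close>

lemma symb_pospow:
  fixes f :: "'p \<Rightarrow> real^'n \<Rightarrow> real"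
  assumes "symb k U B (\<lambda>p. 1) f" "\<And>p. open (U p)" "\<And>p. 0 \<le> B p" "k < m"
  shows "symb k U B (\<lambda>p. 1) (\<lambda>p x. pospow m (f p x))"
  using assms(1,4)
proof (induction k arbitrary: m)
  have zero: "\<exists>A. \<forall>p. \<forall>x\<in>U p. norm (pospow m (f p x)) \<le> A * 1" for m :: nat
  proof -
    obtain A where A: "0 \<le> A" "\<And>p x. x \<in> U p \<Longrightarrow> norm (f p x) \<le> A * 1"
      using symb_bound_nonneg[OF assms(1)] by (metis zero_le_one)
    have "norm (pospow m (f p x)) \<le> A ^ m * 1" if "x \<in> U p" for p x
      using A(2)[OF that] A(1) by (auto simp: pospow_def max_def intro!: power_mono)
    then show ?thesis by blast
  qed
  {
    case (0 m)
    then show ?case using zero by simp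
  next
    case (Suc k m)
    obtain m' where m: "m = Suc (Suc m')" using Suc.prems(2) by (metis Suc_lessE Suc_less_eq lessE not_less_zero old.nat.exhaust)
    obtain A where A: "\<And>p x. x \<in> U p \<Longrightarrow> norm (pospow m (f p x)) \<le> A * 1" using zero[of m] by blast
    note d = symb_SucD[OF Suc.prems(1)]
    have der: "((\<lambda>x. pospow m (f p x)) has_derivative (\<lambda>v. real m * pospow (Suc m') (f p x) * frechet_derivative (f p) (at x) v)) (at x)"
      if "x \<in> U p" for p x
      using has_derivative_compose[OF iffD1[OF frechet_derivative_works d(1)[OF that]] DERIV_pospow[of m', unfolded has_field_derivative_def]]
      unfolding m .
    show ?case
    proof (rule symb_SucI[OF A])
      have F: "symb k U B (\<lambda>p. 1 * (1 * B p)) (\<lambda>p x. (real m * pospow (Suc m') (f p x)) * partial i (f p) x)" for i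
        using Suc m by (intro symb_mult[OF _ d(2) assms(2)] symb_linear[OF bounded_linear_mult_right] assms(2) assms(3) Suc.IH symb_decrement[OF Suc.prems(1)]) (auto simp: assms(3))
      have "symb k U B (\<lambda>p. 1 * (1 * B p)) (\<lambda>p. partial i (\<lambda>x. pospow m (f p x)))" for i
        by (rule symb_cong[OF assms(2) _ F[of i]]) (simp add: partial_has_derivative[OF der], simp add: partial_def)
      then show "symb k U B (\<lambda>p. 1 * B p) (\<lambda>p. partial i (\<lambda>x. pospow m (f p x)))" for i by simp
    qed (use der in \<open>auto simp: differentiable_def\<close>)
  }
qed

text \<open>The usual quotient of two one-sided functions of
  \<open>s = (norm \<xi> / lam)\<^sup>2\<close>: it is \<open>1\<close> for \<open>s \<le> 1\<close>
  and \<open>0\<close> for \<open>s \<ge> 4\<close>.\<close>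

definition cutoff :: "nat \<Rightarrow> real \<Rightarrow> real^'n \<Rightarrow> real"
  where "cutoff m lam \<xi> = pospow m (4 - (norm \<xi> / lam)\<^sup>2) /
    (pospow m (4 - (norm \<xi> / lam)\<^sup>2) + pospow m ((norm \<xi> / lam)\<^sup>2 - 1))"

lemma cutoff_denominator: "1 \<le> pospow m (4 - s) + pospow m (s - 1)"
\<comment> \<open>At the midpoint of \<open>1\<close> and \<open>4\<close> the larger base changes;
  on either side it is at least \<open>3/2\<close>.\<close>
proof (cases "s \<le> 5/2")
  case True
  then have "1 \<le> pospow m (4 - s)" by (auto simp: pospow_def intro!: one_le_power)
  then show ?thesis using pospow_nonneg[of m "s - 1"] by linarith
next
  case False
  then have "1 \<le> pospow m (s - 1)" by (auto simp: pospow_def intro!: one_le_power)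
  then show ?thesis using pospow_nonneg[of m "4 - s"] by linarith
qed

lemma cutoff_bounds: "0 \<le> cutoff m lam \<xi>" "cutoff m lam \<xi> \<le> 1"
  using cutoff_denominator[of m "(norm \<xi> / lam)\<^sup>2"] pospow_nonneg[of m "4 - (norm \<xi> / lam)\<^sup>2"] pospow_nonneg[of m "(norm \<xi> / lam)\<^sup>2 - 1"]
  by (auto simp: cutoff_def divide_le_eq)

lemma cutoff_eq_1: "0 < m \<Longrightarrow> 0 < lam \<Longrightarrow> norm \<xi> \<le> lam \<Longrightarrow> cutoff m lam \<xi> = 1"
proof -
  assume a: "0 < m" "0 < lam" "norm \<xi> \<le> lam"
  then have "(norm \<xi> / lam)\<^sup>2 \<le> 1" by (simp add: power_le_one)
  then have "pospow m ((norm \<xi> / lam)\<^sup>2 - 1) = 0" using a by (simp add: pospow_def)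
  then show ?thesis using cutoff_denominator[of m "(norm \<xi> / lam)\<^sup>2"] by (simp add: cutoff_def)
qed

lemma cutoff_eq_0: "0 < m \<Longrightarrow> 0 < lam \<Longrightarrow> 2 * lam \<le> norm \<xi> \<Longrightarrow> cutoff m lam \<xi> = 0"
proof -
  assume a: "0 < m" "0 < lam" "2 * lam \<le> norm \<xi>"
  then have "2\<^sup>2 \<le> (norm \<xi> / lam)\<^sup>2" by (intro power_mono) (auto simp: le_divide_eq)
  then have "pospow m (4 - (norm \<xi> / lam)\<^sup>2) = 0" using a by (simp add: pospow_def)
  then show ?thesis by (simp add: cutoff_def)
qed

lemma continuous_on_cutoff: "continuous_on S (cutoff m lam)"
  unfolding cutoff_def divide_inverse
proof (intro continuous_intros continuous_on_pospow ballI)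
  show "pospow m (4 - (norm \<xi> * inverse lam)\<^sup>2) + pospow m ((norm \<xi> * inverse lam)\<^sup>2 - 1) \<noteq> 0" for \<xi> :: "real^'a"
    using cutoff_denominator[of m "(norm \<xi> * inverse lam)\<^sup>2"] by linarith
qed

lemma symb_cutoff:
  assumes "\<And>p. 0 < lam p" "k < m"
  shows "symb k (\<lambda>p. ball (0::real^'n) (R * lam p)) (\<lambda>p. inverse (lam p)) (\<lambda>p. 1) (\<lambda>p. cutoff m (lam p))"
proof -
  let ?U = "\<lambda>p. ball (0::real^'n) (R * lam p)" and ?B = "\<lambda>p. inverse (lam p)"
  have B: "0 \<le> ?B p" for p using assms(1)[of p] by simp
  let ?s = "\<lambda>p (x::real^'n). (norm x / lam p)\<^sup>2"
  have s: "symb k ?U ?B (\<lambda>p. 1) ?s" using symb_scaled_dist[OF assms(1), of k "\<lambda>p. 0" R] by simp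
  have c: "symb k ?U ?B (\<lambda>p. 1) (\<lambda>p x. c)" for c :: real by (rule symb_const[where A="\<bar>c\<bar>"]) simp
  have 1: "symb k ?U ?B (\<lambda>p. 1) (\<lambda>p x. pospow m (4 - ?s p x))"
    using B assms(2) by (intro symb_pospow symb_diff s c) auto
  have 2: "symb k ?U ?B (\<lambda>p. 1) (\<lambda>p x. pospow m (?s p x - 1))"
    using B assms(2) by (intro symb_pospow symb_diff s c) auto
  have "symb k ?U ?B (\<lambda>p. inverse 1) (\<lambda>p x. inverse (pospow m (4 - ?s p x) + pospow m (?s p x - 1)))"
  proof (rule symb_inverse[OF symb_add[OF 1 2], where c=1])
    show "1 * 1 \<le> norm (pospow m (4 - ?s p x) + pospow m (?s p x - 1))" for p x
      using cutoff_denominator[of m "?s p x"] by simp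
  qed (use B in auto)
  then have "symb k ?U ?B (\<lambda>p. 1 * 1) (\<lambda>p x. pospow m (4 - ?s p x) * inverse (pospow m (4 - ?s p x) + pospow m (?s p x - 1)))"
    using B by (intro symb_mult[OF 1]) auto
  moreover have "cutoff m (lam p) = (\<lambda>x. pospow m (4 - ?s p x) * inverse (pospow m (4 - ?s p x) + pospow m (?s p x - 1)))" for p
    by (simp add: fun_eq_iff cutoff_def divide_inverse)
  ultimately show ?thesis by simp
qed

text \<open>Nonstationary phase for the linear phase \<open>z \<bullet> x\<close>, with
  \<open>\<mu> = norm z\<close> and a direction in which the unit vector along \<open>z\<close> has
  a coordinate of size at least \<open>1/n\<close>. The point \<open>z\<close> joins the parameters,
  so \<open>A\<close> does not depend on it.\<close>

lemma fourier_decay: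
  fixes g :: "'q \<Rightarrow> real^'n \<Rightarrow> complex"
  assumes U: "\<And>p. open (U p)" and K: "\<And>p. closed (K p)" "\<And>p. bounded (K p)" "\<And>p. K p \<subseteq> U p"
    and B: "\<And>p. 0 \<le> B p"
    and g: "symb N U B w g" "\<And>p x. x \<notin> K p \<Longrightarrow> g p x = 0" "\<And>p. 0 \<le> w p"
  shows "\<exists>A\<ge>0. \<forall>p z. z \<noteq> 0 \<longrightarrow> norm (LBINT x. cis (z \<bullet> x) * g p x) \<le> A * w p * (B p / norm z) ^ N * measure lborel (K p)"
proof -
  \<comment> \<open>The values at \<open>z = 0\<close> are dummies: the uniform lemma wants a unit
    vector and a positive \<open>\<mu>\<close> for every parameter.\<close>
  define e where "e z = (if z = 0 then axis undefined 1 else z /\<^sub>R norm z)" for z :: "real^'n"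
  define \<mu> where "\<mu> z = (if z = 0 then 1 else norm z)" for z :: "real^'n"
  have e1: "norm (e z) = 1" for z by (simp add: e_def norm_axis_1)
  have "\<exists>i. 1 / real CARD('n) \<le> \<bar>e z $ i\<bar>" for z
  proof (rule ccontr)
    assume "\<nexists>i. 1 / real CARD('n) \<le> \<bar>e z $ i\<bar>"
    then have "(\<Sum>i\<in>UNIV. \<bar>e z $ i\<bar>) < (\<Sum>i\<in>(UNIV::'n set). 1 / real CARD('n))"
      by (intro sum_strict_mono) (auto simp: not_le)
    then show False using norm_le_l1_cart[of "e z"] e1[of z] by simp
  qed
  then obtain i where i: "\<And>z. 1 / real CARD('n) \<le> \<bar>e z $ i z\<bar>" by metis
  have d: "((\<lambda>x. e z \<bullet> x) has_derivative (\<lambda>v. e z \<bullet> v)) (at x)" for z x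
    by (auto intro!: derivative_eq_intros)
  have p: "partial j (\<lambda>x. e z \<bullet> x) = (\<lambda>x. e z $ j)" for j z
    using partial_has_derivative[OF d] by (auto simp: inner_axis)
  have "\<exists>A\<ge>0. \<forall>p. norm (LBINT x. cis (\<mu> (snd p) * (e (snd p) \<bullet> x)) * g (fst p) x)
      \<le> A * w (fst p) * (B (fst p) / \<mu> (snd p)) ^ N * measure lborel (K (fst p))"
  proof (rule nonstationary_phase[where U = "\<lambda>p. U (fst p)" and i = "\<lambda>p. i (snd p)" and c = "1 / real CARD('n)"])
    show "symb N (\<lambda>p. U (fst p)) (\<lambda>p. B (fst p)) (\<lambda>p. w (fst p)) (\<lambda>p. g (fst p))"
      by (rule symb_reparam[OF g(1)]) simp
    show "symb N (\<lambda>p. U (fst p)) (\<lambda>p. B (fst p)) (\<lambda>p. 1) (\<lambda>p. partial (i (snd p)) (\<lambda>x. e (snd p) \<bullet> x))"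
      unfolding p
    proof (rule symb_const[where A=1])
      show "norm (e (snd p) $ i (snd p)) \<le> 1 * 1" for p :: "'q \<times> (real^'n)"
        using component_le_norm_cart[of "e (snd p)"] e1[of "snd p"] by simp
    qed
    show "0 < \<mu> (snd p)" for p :: "'q \<times> (real^'n)" by (simp add: \<mu>_def)
    show "1 / real CARD('n) \<le> \<bar>partial (i (snd p)) (\<lambda>x. e (snd p) \<bullet> x) x\<bar>" for p :: "'q \<times> (real^'n)" and x
      unfolding p by (rule i)
    show "(\<lambda>x. e (snd p) \<bullet> x) differentiable at x" for p :: "'q \<times> (real^'n)" and x using d differentiableI by blast
  qed (use U K B g in auto)
  then obtain A where A: "A \<ge> 0" "\<And>p z. norm (LBINT x. cis (\<mu> z * (e z \<bullet> x)) * g p x)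
      \<le> A * w p * (B p / \<mu> z) ^ N * measure lborel (K p)" by auto
  show ?thesis
  proof (intro exI[of _ A] conjI allI impI)
    show "norm (LBINT x. cis (z \<bullet> x) * g p x) \<le> A * w p * (B p / norm z) ^ N * measure lborel (K p)" if "z \<noteq> 0" for p z
    proof -
      have "\<mu> z = norm z" "\<mu> z * (e z \<bullet> x) = z \<bullet> x" for x using that by (simp_all add: e_def \<mu>_def)
      then show ?thesis using A(2)[of z p] by simp
    qed
  qed (rule A)
qed

lemma norm_cis_minus_1_le: "norm (cis t - 1) \<le> \<bar>t\<bar>"
proof -
  have "norm (cis t - cis 0) \<le> 1 * norm (t - 0)"
  proof (rule differentiable_bound[of UNIV cis "\<lambda>s r. r *\<^sub>R (\<i> * cis s)"])
    show "(cis has_derivative (\<lambda>r. r *\<^sub>R (\<i> * cis s))) (at s within UNIV)" for s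
      using has_derivative_cis[OF has_derivative_ident, of s UNIV] by simp
    show "onorm (\<lambda>r. r *\<^sub>R (\<i> * cis s)) \<le> 1" for s by (rule onorm_le) (simp add: norm_mult)
  qed auto
  then show ?thesis by simp
qed

lemma jbracket_ge: "1 \<le> jbracket \<xi>" "norm \<xi> \<le> jbracket \<xi>"
  unfolding jbracket_def by (simp, rule real_le_rsqrt, simp)

text \<open>Euler's identity, by differentiating along the ray through \<xi> at the parameter
  \<open>1\<close>.\<close>

lemma hom1_euler:
  fixes f :: "real^'n \<Rightarrow> real"
  assumes "f differentiable at \<xi>" "\<And>t. 0 < t \<Longrightarrow> f (t *\<^sub>R \<xi>) = t * f \<xi>"
  shows "f \<xi> = (\<Sum>i\<in>UNIV. \<xi> $ i * partial i f \<xi>)"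
proof -
  have "((\<lambda>t::real. t *\<^sub>R \<xi>) has_derivative (\<lambda>t. t *\<^sub>R \<xi>)) (at 1)" by (auto intro!: derivative_eq_intros)
  moreover have "(f has_derivative frechet_derivative f (at \<xi>)) (at (1 *\<^sub>R \<xi>))"
    using assms(1) by (simp add: frechet_derivative_works)
  ultimately have "((\<lambda>t. f (t *\<^sub>R \<xi>)) has_derivative (\<lambda>t. frechet_derivative f (at \<xi>) (t *\<^sub>R \<xi>))) (at 1)"
    by (rule has_derivative_compose)
  then have "((\<lambda>t. t * f \<xi>) has_derivative (\<lambda>t. frechet_derivative f (at \<xi>) (t *\<^sub>R \<xi>))) (at 1)"
    by (rule has_derivative_transform_within_open[of _ _ _ _ "{0<..}"]) (use assms(2) in auto)
  moreover have "((\<lambda>t. t * f \<xi>) has_derivative (\<lambda>t. t * f \<xi>)) (at (1::real))"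
    by (auto intro!: derivative_eq_intros)
  ultimately have "(\<lambda>t. frechet_derivative f (at \<xi>) (t *\<^sub>R \<xi>)) = (\<lambda>t. t * f \<xi>)"
    by (rule has_derivative_unique)
  from fun_cong[OF this, of 1] have "frechet_derivative f (at \<xi>) \<xi> = f \<xi>" by simp
  then show ?thesis using frechet_eq_sum_partial[OF assms(1), of \<xi>] by simp
qed

subsection \<open>The dyadic pieces of the symbol\<close>

text \<open>The bounds hold for every \<open>x\<close> here, not just for almost every \<open>x\<close>: in the final proof the data at
  the exceptional points are replaced by the data at one good point.\<close>

locale fio_data =
  fixes a :: "real^'n \<Rightarrow> real^'n \<Rightarrow> complex" and \<theta> :: "real^'n \<Rightarrow> real^'n \<Rightarrow> real" and m \<rho> :: real
  assumes m_neg: "m < 0" and rho: "0 \<le> \<rho>" "\<rho> \<le> 1"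
    and a_smooth: "\<And>x. smooth_on UNIV (a x)"
    and a_bound: "\<And>\<alpha>. \<exists>C. \<forall>x \<xi>. jbracket \<xi> powr (- m + \<rho> * real (length \<alpha>)) * norm (partials \<alpha> (a x) \<xi>) \<le> C"
    and th_smooth: "\<And>x. smooth_on (- {0}) (\<theta> x)"
    and th_hom: "\<And>x \<xi> t. \<xi> \<noteq> 0 \<Longrightarrow> t > 0 \<Longrightarrow> \<theta> x (t *\<^sub>R \<xi>) = t * \<theta> x \<xi>"
    and th_bound: "\<And>\<alpha>. length \<alpha> \<ge> 1 \<Longrightarrow> \<exists>C. \<forall>x \<xi>. \<xi> \<noteq> 0 \<longrightarrow>
        norm \<xi> powr (- 1 + real (length \<alpha>)) * \<bar>partials \<alpha> (\<theta> x) \<xi>\<bar> \<le> C"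
begin

lemma a_differentiable: "partials \<alpha> (a x) differentiable at \<xi>"
  using a_smooth by (auto simp: smooth_on_def)

lemma th_differentiable: "\<xi> \<noteq> 0 \<Longrightarrow> partials \<alpha> (\<theta> x) differentiable at \<xi>"
  using th_smooth by (auto simp: smooth_on_def)

lemma a_partial_bound:
  obtains C where "0 \<le> C" "\<And>x \<xi>. norm (partials \<alpha> (a x) \<xi>) \<le> C * jbracket \<xi> powr (m - \<rho> * real (length \<alpha>))"
proof -
  obtain C where C: "\<And>x \<xi>. jbracket \<xi> powr (- m + \<rho> * real (length \<alpha>)) * norm (partials \<alpha> (a x) \<xi>) \<le> C"
    using a_bound by blast
  have "norm (partials \<alpha> (a x) \<xi>) \<le> C * jbracket \<xi> powr (m - \<rho> * real (length \<alpha>))" for x \<xi>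
  proof -
    have j: "0 < jbracket \<xi> powr (m - \<rho> * real (length \<alpha>))" using jbracket_ge(1)[of \<xi>] by simp
    have "jbracket \<xi> powr (- m + \<rho> * real (length \<alpha>)) * jbracket \<xi> powr (m - \<rho> * real (length \<alpha>)) = 1"
      using jbracket_ge(1)[of \<xi>] by (simp flip: powr_add)
    then have "norm (partials \<alpha> (a x) \<xi>) = (jbracket \<xi> powr (- m + \<rho> * real (length \<alpha>)) * norm (partials \<alpha> (a x) \<xi>)) * jbracket \<xi> powr (m - \<rho> * real (length \<alpha>))"
      by (simp add: mult_ac)
    also have "\<dots> \<le> C * jbracket \<xi> powr (m - \<rho> * real (length \<alpha>))"
      using C j by (intro mult_right_mono) auto
    finally show ?thesis .
  qed
  moreover have "0 \<le> C" using C[of 0 undefined] by (smt (verit) mult_nonneg_nonneg norm_ge_zero powr_ge_zero)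
  ultimately show ?thesis using that by blast
qed

text \<open>All exponents \<open>m - \<rho> * |\<alpha>|\<close> are nonpositive, so a lower bound
  on \<open>norm x\<close> suffices. The factor \<open>1/8\<close> admits the annuli as well as
  balls of radius \<open>lam / 16\<close> around points of norm at least
  \<open>lam / 4\<close>.\<close>

lemma symb_a_outside:
  assumes "\<And>p. 1 \<le> lam p" "\<And>p x. x \<in> U p \<Longrightarrow> lam p / 8 \<le> norm x"
  shows "symb k U (\<lambda>p. lam p powr - \<rho>) (\<lambda>p. lam p powr m) (\<lambda>p. a (X p))"
proof (rule symb_of_partials)
  fix \<alpha> :: "'n list"
  let ?s = "m - \<rho> * real (length \<alpha>)"
  obtain C where C: "0 \<le> C" "\<And>x \<xi>. norm (partials \<alpha> (a x) \<xi>) \<le> C * jbracket \<xi> powr ?s"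
    using a_partial_bound[of \<alpha>] by blast
  have "norm (partials \<alpha> (a (X p)) x) \<le> (C * 8 powr (- ?s)) * (lam p powr m * (lam p powr - \<rho>) ^ length \<alpha>)"
    if x: "x \<in> U p" for p x
  proof -
    have s: "?s \<le> 0" using m_neg rho(1) mult_nonneg_nonneg[of \<rho> "real (length \<alpha>)", OF _ of_nat_0_le_iff] by argo
    have l: "0 < lam p" using assms(1)[of p] by simp
    have "jbracket x powr ?s \<le> (lam p / 8) powr ?s"
      by (rule powr_mono2'[OF s]) (use assms(2)[OF x] jbracket_ge(2)[of x] l in auto)
    also have "\<dots> = 8 powr (- ?s) * lam p powr ?s"
      unfolding powr_divide powr_minus[of 8] by (simp only: divide_inverse inverse_inverse_eq mult.commute)
    also have "lam p powr ?s = lam p powr m * (lam p powr - \<rho>) ^ length \<alpha>"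
    proof -
      have "lam p powr m * (lam p powr - \<rho>) ^ length \<alpha> = lam p powr (m + real (length \<alpha>) * - \<rho>)"
        using l by (simp only: powr_power powr_add)
      also have "m + real (length \<alpha>) * - \<rho> = ?s" by simp
      finally show ?thesis ..
    qed
    finally have "C * jbracket x powr ?s \<le> C * (8 powr (- ?s) * (lam p powr m * (lam p powr - \<rho>) ^ length \<alpha>))"
      by (rule mult_left_mono[OF _ C(1)])
    then show ?thesis using C(2)[of "X p" x] by (simp only: mult.assoc)
  qed
  then show "\<exists>A. \<forall>p. \<forall>x\<in>U p. norm (partials \<alpha> (a (X p)) x) \<le> A * (lam p powr m * (lam p powr - \<rho>) ^ length \<alpha>)"
    by blast
qed (rule a_differentiable)

lemma symb_a: "symb k U (\<lambda>p. 1) (\<lambda>p. 1) (\<lambda>p. a (X p))"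
proof (rule symb_of_partials)
  fix \<alpha> :: "'n list"
  let ?s = "m - \<rho> * real (length \<alpha>)"
  obtain C where C: "0 \<le> C" "\<And>x \<xi>. norm (partials \<alpha> (a x) \<xi>) \<le> C * jbracket \<xi> powr ?s"
    using a_partial_bound[of \<alpha>] by blast
  have s: "?s \<le> 0" using m_neg rho(1) mult_nonneg_nonneg[of \<rho> "real (length \<alpha>)", OF _ of_nat_0_le_iff] by argo
  have "jbracket x powr ?s \<le> 1" for x :: "real^'n"
    using powr_mono2'[OF s, of 1 "jbracket x"] jbracket_ge(1)[of x] by simp
  then have "norm (partials \<alpha> (a (X p)) x) \<le> C * (1 * 1 ^ length \<alpha>)" for p x
    using C(2)[of "X p" x] mult_left_mono[of "jbracket x powr ?s" 1 C] C(1) by fastforce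
  then show "\<exists>A. \<forall>p. \<forall>x\<in>U p. norm (partials \<alpha> (a (X p)) x) \<le> A * (1 * 1 ^ length \<alpha>)" by blast
qed (rule a_differentiable)

text \<open>The gradient of \<theta> is homogeneous of degree \<open>0\<close>: it has size
  \<open>1\<close> at every scale, and each further derivative gains \<open>1 / lam\<close>, for
  small \<open>lam\<close> as for large.\<close>

lemma symb_th:
  assumes "\<And>p. 0 < lam p" "\<And>p x. x \<in> U p \<Longrightarrow> lam p / 8 \<le> norm x"
  shows "symb k U (\<lambda>p. inverse (lam p)) (\<lambda>p. 1) (\<lambda>p. partial i (\<theta> (X p)))"
proof (rule symb_of_partials)
  fix \<alpha> :: "'n list"
  obtain C where C: "\<And>x \<xi>. \<xi> \<noteq> 0 \<Longrightarrow> norm \<xi> powr (- 1 + real (length (\<alpha> @ [i]))) * \<bar>partials (\<alpha> @ [i]) (\<theta> x) \<xi>\<bar> \<le> C"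
    using th_bound[of "\<alpha> @ [i]"] by auto
  have "norm (partials \<alpha> (partial i (\<theta> (X p))) x) \<le> (C * 8 ^ length \<alpha>) * (1 * inverse (lam p) ^ length \<alpha>)"
    if x: "x \<in> U p" for p x
  proof -
    let ?d = "norm (partials \<alpha> (partial i (\<theta> (X p))) x)"
    have n: "0 < norm x" "lam p / 8 \<le> norm x" using assms(1)[of p] assms(2)[OF x] by auto
    have l: "0 < lam p" by (rule assms)
    have "norm x ^ length \<alpha> * ?d \<le> C"
      using C[of x "X p"] n by (auto simp: partials_snoc powr_realpow)
    moreover have "(lam p / 8) ^ length \<alpha> * ?d \<le> norm x ^ length \<alpha> * ?d"
      using n l by (intro mult_right_mono power_mono) auto
    ultimately have "(lam p / 8) ^ length \<alpha> * ?d \<le> C" by linarith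
    then show ?thesis using l by (simp add: power_divide field_simps)
  qed
  then show "\<exists>A. \<forall>p. \<forall>x\<in>U p. norm (partials \<alpha> (partial i (\<theta> (X p))) x) \<le> A * (1 * inverse (lam p) ^ length \<alpha>)"
    by blast
next
  fix \<alpha> :: "'n list" and p x assume "x \<in> U p"
  then have "x \<noteq> 0" using assms(1)[of p] assms(2)[of x p] by auto
  then show "partials \<alpha> (partial i (\<theta> (X p))) differentiable at x"
    unfolding partials_snoc[symmetric] by (rule th_differentiable)
qed

text \<open>The uniform bounds on \<theta> start at order \<open>1\<close>; Euler's identity
  recovers order \<open>0\<close> from the gradient.\<close>

lemma th_linear_bound:
  obtains C where "0 \<le> C" "\<And>x \<xi>. \<xi> \<noteq> 0 \<Longrightarrow> \<bar>\<theta> x \<xi>\<bar> \<le> C * norm \<xi>"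
proof -
  have "\<exists>C. \<forall>x \<xi>. \<xi> \<noteq> 0 \<longrightarrow> \<bar>partial i (\<theta> x) \<xi>\<bar> \<le> C" for i
    using th_bound[of "[i]"] by auto
  then obtain C where C: "\<And>i x \<xi>. \<xi> \<noteq> 0 \<Longrightarrow> \<bar>partial i (\<theta> x) \<xi>\<bar> \<le> C i" by metis
  have C0: "0 \<le> C i" for i using order_trans[OF abs_ge_zero C[of "axis i 1" i 0]] by (simp add: axis_eq_0_iff)
  have "\<bar>\<theta> x \<xi>\<bar> \<le> (\<Sum>i\<in>UNIV. C i) * norm \<xi>" if "\<xi> \<noteq> 0" for x \<xi>
  proof -
    have "\<theta> x \<xi> = (\<Sum>i\<in>UNIV. \<xi> $ i * partial i (\<theta> x) \<xi>)"
      using th_differentiable[OF that, of "[]"] th_hom[OF that] by (intro hom1_euler) auto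
    also have "\<bar>\<dots>\<bar> \<le> (\<Sum>i\<in>UNIV. norm \<xi> * C i)"
      by (rule order_trans[OF sum_abs]) (auto simp: abs_mult intro!: sum_mono mult_mono component_le_norm_cart C that)
    finally show ?thesis by (simp add: sum_distrib_left mult.commute)
  qed
  then show ?thesis using that[of "\<Sum>i\<in>UNIV. C i"] C0 by (simp add: sum_nonneg)
qed

text \<open>An open annulus around the closed support \<open>annulus'\<close> of a dyadic shell;
  together they form the pair \<open>U\<close>, \<open>K\<close> of the nonstationary phase
  lemmas.\<close>

definition annulus :: "real \<Rightarrow> (real^'n) set"
  where "annulus l = {\<xi>. l / 4 < norm \<xi> \<and> norm \<xi> < 4 * l}"

definition annulus' :: "real \<Rightarrow> (real^'n) set"
  where "annulus' l = {\<xi>. l / 2 \<le> norm \<xi> \<and> norm \<xi> \<le> 2 * l}"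

lemma annulus: "open (annulus l)" "closed (annulus' l)" "bounded (annulus' l)" "0 < l \<Longrightarrow> annulus' l \<subseteq> annulus l"
  "\<xi> \<in> annulus l \<Longrightarrow> l / 8 \<le> norm \<xi>" "annulus l \<subseteq> ball 0 (4 * l)"
proof -
  show "open (annulus l)" unfolding annulus_def by (intro open_Collect_conj open_Collect_less continuous_intros)
  show "closed (annulus' l)" unfolding annulus'_def by (intro closed_Collect_conj closed_Collect_le continuous_intros)
  show "bounded (annulus' l)" unfolding annulus'_def by (rule boundedI[of _ "2 * l"]) auto
  show "0 < l \<Longrightarrow> annulus' l \<subseteq> annulus l" by (auto simp: annulus_def annulus'_def)
  show "\<xi> \<in> annulus l \<Longrightarrow> l / 8 \<le> norm \<xi>" unfolding annulus_def mem_Collect_eq using norm_ge_zero[of \<xi>] by argo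
  show "annulus l \<subseteq> ball 0 (4 * l)" by (auto simp: annulus_def)
qed

definition shell :: "nat \<Rightarrow> real \<Rightarrow> real^'n \<Rightarrow> real"
  where "shell k l \<xi> = cutoff k l \<xi> - cutoff k (l / 2) \<xi>"

lemma shell_zero: "0 < k \<Longrightarrow> 0 < l \<Longrightarrow> \<xi> \<notin> annulus' l \<Longrightarrow> shell k l \<xi> = 0"
  by (auto simp: shell_def annulus'_def cutoff_eq_0 cutoff_eq_1)

lemma symb_shell:
  assumes "\<And>p. 0 < lam p" "k < N"
  shows "symb k (\<lambda>p. ball 0 (R * lam p)) (\<lambda>p. inverse (lam p)) (\<lambda>p. 1) (\<lambda>p. shell N (lam p))"
proof -
  have l: "0 \<le> inverse (lam p)" for p using assms(1)[of p] by simp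
  have 1: "symb k (\<lambda>p. ball (0::real^'n) (R * lam p)) (\<lambda>p. inverse (lam p)) (\<lambda>p. 1) (\<lambda>p. cutoff N (lam p))"
    by (rule symb_cutoff) (use assms in auto)
  have "symb k (\<lambda>p. ball (0::real^'n) (R * lam p)) (\<lambda>p. inverse (lam p / 2)) (\<lambda>p. 1) (\<lambda>p. cutoff N (lam p / 2))"
    by (rule symb_subset[OF symb_cutoff[of "\<lambda>p. lam p / 2" k N "2 * R"]]) (use assms in auto)
  then have 2: "symb k (\<lambda>p. ball (0::real^'n) (R * lam p)) (\<lambda>p. inverse (lam p)) (\<lambda>p. 1) (\<lambda>p. cutoff N (lam p / 2))"
    by (rule symb_mono[where C=1 and D=2]) (use assms(1) in \<open>simp_all add: less_imp_le inverse_eq_divide\<close>)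
  have "symb k (\<lambda>p. ball (0::real^'n) (R * lam p)) (\<lambda>p. inverse (lam p)) (\<lambda>p. 1) (\<lambda>p x. cutoff N (lam p) x - cutoff N (lam p / 2) x)"
    by (rule symb_diff[OF 1 2]) (use l in auto)
  then show ?thesis by (simp add: shell_def[abs_def])
qed

lemma symb_shell_annulus:
  assumes "\<And>p. 0 < lam p" "k < N"
  shows "symb k (\<lambda>p. annulus (lam p)) (\<lambda>p. inverse (lam p)) (\<lambda>p. 1) (\<lambda>p. shell N (lam p))"
  by (rule symb_subset[OF symb_shell[OF assms, of 4]]) (use annulus in auto)

text \<open>\<open>B\<close> has to dominate the size \<open>1\<close> of the gradient of \<theta>
  and the rate \<open>1 / lam\<close> of its derivatives. It will be \<open>1\<close> at high
  frequencies and \<open>1 / lam\<close> at low ones.\<close>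

lemma symb_cis_th:
  assumes "\<And>p. 0 < lam p" "\<And>p. open (U p)" "\<And>p x. x \<in> U p \<Longrightarrow> lam p / 8 \<le> norm x"
    and B: "\<And>p. 1 \<le> B p" "\<And>p. inverse (lam p) \<le> B p"
  shows "symb (Suc k) U B (\<lambda>p. 1) (\<lambda>p x. cis (\<theta> (X p) x))"
proof (rule symb_cis)
  show "symb k U B B (\<lambda>p. partial i (\<theta> (X p)))" for i
    by (rule symb_mono[OF symb_th[OF assms(1,3), where k=k], where C=1 and D=1])
      (use assms(1) B in \<open>auto simp: less_imp_le\<close>)
  show "\<theta> (X p) differentiable at x" if "x \<in> U p" for p x
  proof -
    have "x \<noteq> 0" using assms(1)[of p] assms(3)[OF that] by auto
    then show ?thesis using th_differentiable[of x "[]"] by simp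
  qed
  show "0 \<le> B p" for p using B(1)[of p] by simp
qed (use assms in auto)

text \<open>At order \<open>0\<close> the gain \<open>lam\<close> comes from
  \<open>|cis t - 1| \<le> |t|\<close> and the linear bound on \<theta>. From order \<open>1\<close>
  on the constant \<open>1\<close> has disappeared, and the bound of the exponential itself is just
  what is required.\<close>

lemma symb_cis_th_minus_1:
  assumes "\<And>p. 0 < lam p" "\<And>p. lam p \<le> 1"
  shows "symb (Suc k) (\<lambda>p. annulus (lam p)) (\<lambda>p. inverse (lam p)) lam (\<lambda>p x. cis (\<theta> (X p) x) - 1)"
proof -
  let ?U = "\<lambda>p. annulus (lam p)" and ?B = "\<lambda>p. inverse (lam p)"
  obtain C where C: "0 \<le> C" "\<And>x \<xi>. \<xi> \<noteq> 0 \<Longrightarrow> \<bar>\<theta> x \<xi>\<bar> \<le> C * norm \<xi>" using th_linear_bound by blast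
  have l: "0 \<le> inverse (lam p)" "1 \<le> inverse (lam p)" for p using assms[of p] by (auto simp: one_le_inverse_iff)
  have E: "symb (Suc k) ?U ?B (\<lambda>p. 1) (\<lambda>p x. cis (\<theta> (X p) x))"
    by (rule symb_cis_th[OF assms(1)]) (use l annulus in auto)
  show ?thesis
  proof (rule symb_SucI)
    show "norm (cis (\<theta> (X p) x) - 1) \<le> (4 * C) * lam p" if x: "x \<in> ?U p" for p x
    proof -
      have x0: "x \<noteq> 0" "norm x \<le> 4 * lam p" using x assms(1)[of p] by (auto simp: annulus_def)
      have "norm (cis (\<theta> (X p) x) - 1) \<le> \<bar>\<theta> (X p) x\<bar>"
        by (rule norm_cis_minus_1_le)
      also have "\<dots> \<le> C * norm x" by (rule C(2)[OF x0(1)])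
      also have "\<dots> \<le> C * (4 * lam p)" by (rule mult_left_mono[OF x0(2) C(1)])
      finally show ?thesis by simp
    qed
    have d: "(\<lambda>x. cis (\<theta> (X p) x)) differentiable at x" if "x \<in> ?U p" for p x
      using symb_SucD(1)[OF E that] .
    then show "(\<lambda>x. cis (\<theta> (X p) x) - 1) differentiable at x" if "x \<in> ?U p" for p x
      using that by (intro differentiable_diff) auto
    show "symb k ?U ?B (\<lambda>p. lam p * ?B p) (\<lambda>p. partial i (\<lambda>x. cis (\<theta> (X p) x) - 1))" for i
    proof (rule symb_cong[OF annulus(1)])
      have dt: "\<theta> (X p) differentiable at x" if "x \<in> ?U p" for p x
      proof -
        have "x \<noteq> 0" using that assms(1)[of p] by (auto simp: annulus_def)
        then show ?thesis using th_differentiable[of x "[]"] by simp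
      qed
      have "symb k ?U ?B (\<lambda>p. 1) (\<lambda>p x. complex_of_real (partial i (\<theta> (X p)) x))"
        by (rule symb_linear[OF bounded_linear_of_real symb_th]) (use l assms annulus in auto)
      moreover have "symb k ?U ?B (\<lambda>p. 1) (\<lambda>p x. \<i> * cis (\<theta> (X p) x))"
        by (rule symb_linear[OF bounded_linear_mult_right symb_decrement[OF E]]) (use l annulus in auto)
      ultimately have "symb k ?U ?B (\<lambda>p. 1 * 1) (\<lambda>p x. complex_of_real (partial i (\<theta> (X p)) x) * (\<i> * cis (\<theta> (X p) x)))"
        by (rule symb_mult) (use l annulus in auto)
      \<comment> \<open>The first derivative uses up the gain \<open>lam\<close> entirely.\<close>
      moreover have "lam p * ?B p = 1 * 1" for p using assms(1)[of p] by simp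
      ultimately show "symb k ?U ?B (\<lambda>p. lam p * ?B p) (\<lambda>p x. complex_of_real (partial i (\<theta> (X p)) x) * (\<i> * cis (\<theta> (X p) x)))"
        by simp
      show "complex_of_real (partial i (\<theta> (X p)) x) * (\<i> * cis (\<theta> (X p) x)) = partial i (\<lambda>x. cis (\<theta> (X p) x) - 1) x"
        if x: "x \<in> ?U p" for p x
        using partial_add[OF d[OF x] differentiable_const, of i "- 1"] partial_cis(1)[OF dt[OF x], of i]
        by (simp add: partial_const)
    qed
  qed
qed

definition high :: "nat \<Rightarrow> real^'n \<Rightarrow> real \<Rightarrow> real^'n \<Rightarrow> complex"
  where "high N x l \<xi> = cis (\<theta> x \<xi>) * a x \<xi> * of_real (shell N l \<xi>)"

text \<open>Subtracting \<open>1\<close> gains a factor \<open>|\<xi>|\<close> near the singularity of \<open>\<theta>\<close> at \<open>0\<close>. The smooth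
  remainder \<open>a \<chi>(\<xi>)\<close> is \<open>base\<close>.\<close>

definition low :: "nat \<Rightarrow> real^'n \<Rightarrow> real \<Rightarrow> real^'n \<Rightarrow> complex"
  where "low N x l \<xi> = (cis (\<theta> x \<xi>) - 1) * a x \<xi> * of_real (shell N l \<xi>)"

definition base :: "nat \<Rightarrow> real^'n \<Rightarrow> real^'n \<Rightarrow> complex"
  where "base N x \<xi> = a x \<xi> * of_real (cutoff N 1 \<xi>)"

text \<open>The rate is \<open>B = 1\<close> although symbol and shell would allow better, since
  \<open>cis \<theta>\<close> oscillates at unit rate at every scale. Integration by parts against
  the linear phase thus gains \<open>1 / norm z\<close> but no power of \<open>lam\<close>; the
  summability has to come from \<open>high_sup_bound\<close>.\<close>

lemma symb_high:
  assumes "\<And>p. 1 \<le> lam p" "k < N"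
  shows "symb k (\<lambda>p. annulus (lam p)) (\<lambda>p. 1) (\<lambda>p. lam p powr m) (\<lambda>p. high N (X p) (lam p))"
proof -
  have l: "0 < lam p" "inverse (lam p) \<le> 1" for p using assms(1)[of p] by (auto simp: inverse_le_1_iff)
  have 1: "symb k (\<lambda>p. annulus (lam p)) (\<lambda>p. 1) (\<lambda>p. 1) (\<lambda>p x. cis (\<theta> (X p) x))"
    by (rule symb_decrement, rule symb_cis_th[OF l(1)]) (use l annulus in auto)
  have 2: "symb k (\<lambda>p. annulus (lam p)) (\<lambda>p. 1) (\<lambda>p. lam p powr m) (\<lambda>p. a (X p))"
    by (rule symb_mono[OF symb_a_outside[OF assms(1), where k=k], where C=1 and D=1])
      (use annulus assms(1) powr_mono[of "-\<rho>" 0] rho in \<open>auto\<close>)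
  have "symb k (\<lambda>p. annulus (lam p)) (\<lambda>p. 1) (\<lambda>p. 1) (\<lambda>p. shell N (lam p))"
    by (rule symb_mono[OF symb_shell_annulus[OF l(1) assms(2)], where C=1 and D=1]) (use l in \<open>auto simp: less_imp_le\<close>)
  then have 3: "symb k (\<lambda>p. annulus (lam p)) (\<lambda>p. 1) (\<lambda>p. 1) (\<lambda>p x. complex_of_real (shell N (lam p) x))"
    by (rule symb_linear[OF bounded_linear_of_real]) (use annulus in auto)
  have "symb k (\<lambda>p. annulus (lam p)) (\<lambda>p. 1) (\<lambda>p. (1 * lam p powr m) * 1)
     (\<lambda>p x. cis (\<theta> (X p) x) * a (X p) x * complex_of_real (shell N (lam p) x))"
    by (intro symb_mult 1 2 3 annulus) auto
  then show ?thesis by (simp add: high_def[abs_def])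
qed

lemma symb_low:
  assumes "\<And>p. 0 < lam p" "\<And>p. lam p \<le> 1" "k < N"
  shows "symb k (\<lambda>p. annulus (lam p)) (\<lambda>p. inverse (lam p)) lam (\<lambda>p. low N (X p) (lam p))"
proof -
  have l: "0 \<le> inverse (lam p)" "1 \<le> inverse (lam p)" "0 \<le> lam p" for p using assms(1,2)[of p] by (auto simp: one_le_inverse_iff)
  have 1: "symb k (\<lambda>p. annulus (lam p)) (\<lambda>p. inverse (lam p)) lam (\<lambda>p x. cis (\<theta> (X p) x) - 1)"
    by (rule symb_decrement, rule symb_cis_th_minus_1[OF assms(1,2)])
  have 2: "symb k (\<lambda>p. annulus (lam p)) (\<lambda>p. inverse (lam p)) (\<lambda>p. 1) (\<lambda>p. a (X p))"
    by (rule symb_mono[OF symb_a, where C=1 and D=1]) (use l in auto)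
  have 3: "symb k (\<lambda>p. annulus (lam p)) (\<lambda>p. inverse (lam p)) (\<lambda>p. 1) (\<lambda>p x. complex_of_real (shell N (lam p) x))"
    by (rule symb_linear[OF bounded_linear_of_real symb_shell_annulus[OF assms(1,3)]]) (use annulus l in auto)
  have "symb k (\<lambda>p. annulus (lam p)) (\<lambda>p. inverse (lam p)) (\<lambda>p. (lam p * 1) * 1)
     (\<lambda>p x. (cis (\<theta> (X p) x) - 1) * a (X p) x * complex_of_real (shell N (lam p) x))"
    by (intro symb_mult 1 2 3 annulus) (use l in auto)
  then show ?thesis by (simp add: low_def[abs_def])
qed

lemma symb_base:
  assumes "k < N"
  shows "symb k (\<lambda>p. ball 0 4) (\<lambda>p. 1) (\<lambda>p. 1) (\<lambda>p. base N (X p))"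
proof -
  have "symb k (\<lambda>p. ball (0::real^'n) 4) (\<lambda>p. 1) (\<lambda>p. 1) (\<lambda>p. cutoff N 1)"
    using symb_cutoff[of "\<lambda>p. 1" k N 4] assms by simp
  then have "symb k (\<lambda>p. ball (0::real^'n) 4) (\<lambda>p. 1) (\<lambda>p. 1) (\<lambda>p x. complex_of_real (cutoff N 1 x))"
    by (rule symb_linear[OF bounded_linear_of_real]) auto
  then have "symb k (\<lambda>p. ball 0 4) (\<lambda>p. 1) (\<lambda>p. 1 * 1) (\<lambda>p x. a (X p) x * complex_of_real (cutoff N 1 x))"
    by (intro symb_mult symb_a) auto
  then show ?thesis by (simp add: base_def[abs_def])
qed

end

subsection \<open>Nondegeneracy of the phase\<close>

text \<open>By Cramer's rule the left side is the absolute value of the determinant with column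
  \<open>k\<close> replaced by \<open>A *v x\<close>; each term of its expansion has exactly one
  factor from that column. It makes the injectivity of a matrix with bounded entries and determinant
  away from \<open>0\<close> quantitative.\<close>

lemma cramer_bound:
  fixes A :: "real^'n^'n"
  assumes "\<And>i j. \<bar>A $ i $ j\<bar> \<le> H"
  shows "\<bar>x $ k\<bar> * \<bar>det A\<bar> \<le> fact CARD('n) * (H ^ (CARD('n) - 1) * norm (A *v x))"
proof -
  define B :: "real^'n^'n" where "B = (\<chi> i j. if j = k then (A *v x) $ i else A $ i $ j)"
  define g where "g j = (if j = k then norm (A *v x) else H)" for j
  have Bg: "\<bar>B $ i $ j\<bar> \<le> g j" for i j
    using assms by (simp add: B_def g_def component_le_norm_cart)
  have "\<bar>det B\<bar> \<le> (\<Sum>p | p permutes (UNIV::'n set). \<bar>of_int (sign p) * (\<Prod>i\<in>UNIV. B $ i $ p i)\<bar>)"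
    unfolding det_def by (rule sum_abs)
  also have "\<dots> \<le> (\<Sum>p | p permutes (UNIV::'n set). H ^ (CARD('n) - 1) * norm (A *v x))"
  proof (rule sum_mono)
    fix p :: "'n \<Rightarrow> 'n" assume "p \<in> {p. p permutes UNIV}"
    then have p: "p permutes UNIV" by simp
    have "\<bar>of_int (sign p) * (\<Prod>i\<in>UNIV. B $ i $ p i)\<bar> = (\<Prod>i\<in>UNIV. \<bar>B $ i $ p i\<bar>)"
      by (simp add: abs_mult abs_prod sign_def)
    also have "\<dots> \<le> (\<Prod>i\<in>UNIV. g (p i))" by (intro prod_mono) (simp add: Bg)
    also have "\<dots> = (\<Prod>j\<in>UNIV. g j)" using prod.permute[OF p, of g] by (simp add: o_def)
    also have "\<dots> = g k * (\<Prod>j\<in>UNIV - {k}. g j)" by (rule prod.remove) auto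
    also have "(\<Prod>j\<in>UNIV - {k}. g j) = (\<Prod>j\<in>UNIV - {k}. H)" by (rule prod.cong) (auto simp: g_def)
    also have "\<dots> = H ^ (CARD('n) - 1)" by (simp add: card_Diff_singleton)
    finally show "\<bar>of_int (sign p) * (\<Prod>i\<in>UNIV. B $ i $ p i)\<bar> \<le> H ^ (CARD('n) - 1) * norm (A *v x)"
      by (simp add: g_def mult.commute)
  qed
  also have "\<dots> = fact CARD('n) * (H ^ (CARD('n) - 1) * norm (A *v x))"
    by (simp add: card_permutations[OF refl])
  finally show ?thesis using cramer_lemma[of k A x] by (simp add: B_def abs_mult)
qed

text \<open>The projection is \<open>1 - u u^T\<close>, so \<open>P M P\<close> extended by the
  identity is an honest matrix with determinant at least \<open>c\<close> in modulus, to which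
  \<open>cramer_bound\<close> applies on the complement of \<open>u\<close>. The hyperplane
  \<open>d $ k = 0\<close> is transversal to \<open>u\<close> because \<open>u $ k\<close> is not
  small. Transposes occur since \<open>M\<close> is not assumed symmetric and the derivative of the
  \<open>i\<close>-th partial derivative sits in column \<open>i\<close> of the Hessian.\<close>

lemma det_corank1_lower_bound:
  fixes M :: "real^'n^'n"
  assumes H: "\<And>i j. \<bar>M $ i $ j\<bar> \<le> H" and c: "0 < c" "c \<le> \<bar>det_corank1 M\<bar>"
    and u: "norm u = 1" "M *v u = 0" "transpose M *v u = 0"
    and k: "1 \<le> real CARD('n) * \<bar>u $ k\<bar>" and d: "d $ k = 0"
  defines "H' \<equiv> real CARD('n) * (real CARD('n) * (2 * H)) * 2 + 3"
  shows "c * norm d \<le> real CARD('n) * (1 + real CARD('n)) * fact CARD('n) * H' ^ (CARD('n) - 1) * norm (transpose M *v d)"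
proof -
  let ?n = "real CARD('n)"
  define V where "V = orthogonal_comp {v. M *v v = 0}"
  define W where "W = {v. u \<bullet> v = 0}"
  define P where "P = matrix (closest_point V)"
  have uu: "u \<bullet> u = 1" "u \<noteq> 0" using u(1) by (auto simp: dot_square_norm)
  \<comment> \<open>A nonzero value excludes the default branch of \<open>det_corank1\<close>; so
    the kernel is exactly the line through \<open>u\<close>.\<close>
  have dimV: "dim V = CARD('n) - 1" and det: "det_corank1 M = det (P ** M ** P + (mat 1 - P))"
    using c by (auto simp: det_corank1_def V_def P_def Let_def split: if_splits)
  have VW: "V \<subseteq> W" using u(2) by (auto simp: V_def W_def orthogonal_comp_def orthogonal_def inner_commute)
  have dimW: "dim W = CARD('n) - 1" unfolding W_def using dim_hyperplane[OF uu(2)] by simp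
  have sW: "subspace W" unfolding W_def by (rule subspace_hyperplane)
  have "V = W"
    by (rule subspace_dim_equal[OF _ sW VW]) (auto simp: V_def subspace_orthogonal_comp dimV[unfolded V_def] dimW)
  have cp: "closest_point V v = v - (u \<bullet> v) *\<^sub>R u" for v
  proof (rule closest_point_unique[symmetric])
    show "convex V" "closed V" unfolding \<open>V = W\<close> using sW by (auto intro: subspace_imp_convex closed_subspace)
    show "v - (u \<bullet> v) *\<^sub>R u \<in> V" unfolding \<open>V = W\<close> W_def by (simp add: inner_diff_right uu)
    show "\<forall>z\<in>V. dist v (v - (u \<bullet> v) *\<^sub>R u) \<le> dist v z"
    proof
      fix z assume "z \<in> V"
      then have z: "u \<bullet> z = 0" unfolding \<open>V = W\<close> W_def by simp
      have "\<bar>u \<bullet> (v - z)\<bar> \<le> norm u * norm (v - z)" by (rule Cauchy_Schwarz_ineq2)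
      then show "dist v (v - (u \<bullet> v) *\<^sub>R u) \<le> dist v z" using z u(1) by (simp add: dist_norm inner_diff_right)
    qed
  qed
  have P: "P $ i $ j = (if i = j then 1 else 0) - u $ i * u $ j" for i j
    unfolding P_def matrix_def by (simp add: cp inner_axis) (simp add: axis_def)
  have Pv: "P *v v = v - (u \<bullet> v) *\<^sub>R u" for v
  proof -
    have "(P *v v) $ i = (\<Sum>j\<in>UNIV. (if i = j then v $ j else 0) - u $ i * (u $ j * v $ j))" for i
      unfolding matrix_vector_mult_def P by (simp, intro sum.cong) (auto simp: algebra_simps)
    then show ?thesis by (simp add: vec_eq_iff sum_subtractf inner_vec_def mult.commute flip: sum_distrib_left)
  qed
  have PT: "transpose P = P" by (simp add: vec_eq_iff transpose_def P mult.commute)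
  define E where "E = P ** M ** P + (mat 1 - P)"
  have ET: "transpose E = P ** transpose M ** P + (mat 1 - P)"
  proof -
    have "transpose E = transpose (P ** M ** P) + (mat 1 - transpose P)"
      unfolding E_def by (auto simp: vec_eq_iff transpose_def mat_def)
    then show ?thesis by (simp add: matrix_transpose_mul PT matrix_mul_assoc)
  qed
  have E_apply: "transpose E *v w = P *v (transpose M *v w)" if "u \<bullet> w = 0" for w
  proof -
    have "P *v w = w" using that by (simp add: Pv)
    then show ?thesis unfolding ET
      by (simp add: matrix_vector_mult_add_rdistrib matrix_vector_mult_diff_rdistrib flip: matrix_vector_mul_assoc)
  qed
  have Pn: "norm (P *v v) \<le> norm v" for v
  proof -
    have "(norm (P *v v))\<^sup>2 = (norm v)\<^sup>2 - (u \<bullet> v)\<^sup>2"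
      unfolding Pv power2_norm_eq_inner by (simp add: inner_diff_left inner_diff_right uu inner_commute power2_eq_square)
    then have "(norm (P *v v))\<^sup>2 \<le> (norm v)\<^sup>2" by simp
    then show ?thesis by (rule power2_le_imp_le) simp
  qed
  have H0: "0 \<le> H" using H[of k k] by linarith
  have Pb: "\<bar>P $ i $ j\<bar> \<le> 2" for i j
  proof -
    have "\<bar>u $ i * u $ j\<bar> \<le> 1 * 1" unfolding abs_mult
      using component_le_norm_cart[of u i] component_le_norm_cart[of u j] u(1) by (intro mult_mono) auto
    then show ?thesis unfolding P by (smt (verit))
  qed
  have PM: "\<bar>(P ** M) $ i $ j\<bar> \<le> ?n * (2 * H)" for i j
  proof -
    have "\<bar>(P ** M) $ i $ j\<bar> \<le> (\<Sum>l\<in>(UNIV::'n set). 2 * H)"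
      unfolding matrix_matrix_mult_def by (simp del: sum_constant, rule order_trans[OF sum_abs sum_mono])
        (auto simp: abs_mult intro!: mult_mono Pb H)
    then show ?thesis by simp
  qed
  have PMP: "\<bar>(P ** M ** P) $ i $ j\<bar> \<le> ?n * (?n * (2 * H)) * 2" for i j
  proof -
    have "\<bar>((P ** M) ** P) $ i $ j\<bar> \<le> (\<Sum>l\<in>(UNIV::'n set). (?n * (2 * H)) * 2)"
    proof -
      have "\<bar>(P ** M) $ i $ l * P $ l $ j\<bar> \<le> (?n * (2 * H)) * 2" for l
        unfolding abs_mult by (rule mult_mono[OF PM Pb]) (use H0 in auto)
      then show ?thesis
        unfolding matrix_matrix_mult_def[of "P ** M"] by (simp del: sum_constant, intro order_trans[OF sum_abs sum_mono]) auto
    qed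
    then show ?thesis by simp
  qed
  \<comment> \<open>Entries of \<open>P\<close> are at most \<open>2\<close>, each of the two matrix
    products adds a factor \<open>n\<close>, and the summand \<open>3\<close> in \<open>H'\<close>
    comes from \<open>mat 1 - P\<close>.\<close>
  have EH: "\<bar>transpose E $ i $ j\<bar> \<le> H'" for i j
  proof -
    have "\<bar>E $ j $ i\<bar> \<le> \<bar>(P ** M ** P) $ j $ i\<bar> + \<bar>mat 1 $ j $ i\<bar> + \<bar>P $ j $ i\<bar>"
      unfolding E_def by simp
    moreover have "\<bar>(mat 1 :: real^'n^'n) $ j $ i\<bar> \<le> 1" by (simp add: mat_def)
    ultimately show ?thesis using PMP[of j i] Pb[of j i] unfolding H'_def transpose_def by simp
  qed
  \<comment> \<open>The part of \<open>d\<close> orthogonal to \<open>u\<close>; the rest is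
    annihilated by \<open>transpose M\<close>.\<close>
  define w where "w = d - (u \<bullet> d) *\<^sub>R u"
  have uw: "u \<bullet> w = 0" by (simp add: w_def inner_diff_right uu)
  have Mw: "transpose M *v w = transpose M *v d"
    unfolding w_def using u(3) by (simp add: matrix_vector_mult_diff_distrib matrix_vector_mult_scaleR)
  have nw: "c * norm w \<le> ?n * fact CARD('n) * H' ^ (CARD('n) - 1) * norm (transpose M *v d)"
  proof -
    have "\<bar>w $ l\<bar> * c \<le> fact CARD('n) * (H' ^ (CARD('n) - 1) * norm (transpose M *v d))" for l
    proof -
      have "\<bar>w $ l\<bar> * c \<le> \<bar>w $ l\<bar> * \<bar>det (transpose E)\<bar>"
        using c(2) unfolding det E_def[symmetric] det_transpose by (intro mult_left_mono) auto
      also have "\<dots> \<le> fact CARD('n) * (H' ^ (CARD('n) - 1) * norm (transpose E *v w))"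
        by (rule cramer_bound[OF EH])
      also have "norm (transpose E *v w) \<le> norm (transpose M *v d)"
        unfolding E_apply[OF uw] Mw by (rule Pn)
      finally show ?thesis using H0 by (simp add: mult_left_mono H'_def)
    qed
    then have "(\<Sum>l\<in>UNIV. \<bar>w $ l\<bar> * c) \<le> (\<Sum>l\<in>(UNIV::'n set). fact CARD('n) * (H' ^ (CARD('n) - 1) * norm (transpose M *v d)))"
      by (intro sum_mono)
    moreover have "c * norm w \<le> (\<Sum>l\<in>UNIV. \<bar>w $ l\<bar> * c)"
      using mult_left_mono[OF norm_le_l1_cart[of w], of c] c(1) by (simp add: sum_distrib_left mult.commute)
    ultimately show ?thesis by (simp add: mult.assoc)
  qed
  \<comment> \<open>As \<open>d $ k = 0\<close>, the coordinate \<open>w $ k\<close> is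
    \<open>- (u \<bullet> d) * u $ k\<close>. Dividing by \<open>u $ k\<close>, of modulus at least
    \<open>1/n\<close>, recovers the component along \<open>u\<close>.\<close>
  have "norm d \<le> (1 + ?n) * norm w"
  proof -
    have "\<bar>u \<bullet> d\<bar> * \<bar>u $ k\<bar> = \<bar>w $ k\<bar>" using d by (simp add: w_def abs_mult)
    also have "\<dots> \<le> norm w" by (rule component_le_norm_cart)
    finally have *: "?n * (\<bar>u \<bullet> d\<bar> * \<bar>u $ k\<bar>) \<le> ?n * norm w" by (rule mult_left_mono) simp
    have "\<bar>u \<bullet> d\<bar> * 1 \<le> \<bar>u \<bullet> d\<bar> * (?n * \<bar>u $ k\<bar>)" by (rule mult_left_mono[OF k]) simp
    also have "\<dots> = ?n * (\<bar>u \<bullet> d\<bar> * \<bar>u $ k\<bar>)" by simp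
    also note *
    finally have "\<bar>u \<bullet> d\<bar> \<le> ?n * norm w" by simp
    moreover have "norm d \<le> norm w + norm ((u \<bullet> d) *\<^sub>R u)" unfolding w_def by (metis diff_add_cancel norm_triangle_ineq)
    ultimately show ?thesis using u(1) by (simp add: algebra_simps)
  qed
  then have "c * norm d \<le> (1 + ?n) * (c * norm w)" using c(1) by (simp add: mult_ac mult_left_mono)
  also have "\<dots> \<le> (1 + ?n) * (?n * fact CARD('n) * H' ^ (CARD('n) - 1) * norm (transpose M *v d))"
    by (rule mult_left_mono[OF nw]) simp
  finally show ?thesis by (simp add: mult_ac)
qed

text \<open>\<open>s\<close> is the factor of homogeneity: \<open>s = t\<close> is used for \<theta>
  and \<open>s = 1\<close> for its first derivatives.\<close>

lemma partial_scale:
  fixes f :: "real^'n \<Rightarrow> real"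
  assumes "0 < t" "\<xi> \<noteq> 0" "f differentiable at \<xi>" "f differentiable at (t *\<^sub>R \<xi>)"
    "\<And>\<eta>. \<eta> \<noteq> 0 \<Longrightarrow> f (t *\<^sub>R \<eta>) = s * f \<eta>"
  shows "t * partial i f (t *\<^sub>R \<xi>) = s * partial i f \<xi>"
proof -
  have "((\<lambda>\<eta>. t *\<^sub>R \<eta>) has_derivative (\<lambda>v. t *\<^sub>R v)) (at \<xi>)" by (auto intro!: derivative_eq_intros)
  moreover have "(f has_derivative frechet_derivative f (at (t *\<^sub>R \<xi>))) (at (t *\<^sub>R \<xi>))"
    using assms by (simp add: frechet_derivative_works)
  ultimately have d: "((\<lambda>\<eta>. f (t *\<^sub>R \<eta>)) has_derivative (\<lambda>v. frechet_derivative f (at (t *\<^sub>R \<xi>)) (t *\<^sub>R v))) (at \<xi>)"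
    by (rule has_derivative_compose)
  have "partial i (\<lambda>\<eta>. f (t *\<^sub>R \<eta>)) \<xi> = t * partial i f (t *\<^sub>R \<xi>)"
    unfolding partial_has_derivative[OF d]
    using linear_cmul[OF linear_frechet_derivative[OF assms(4)], of t "axis i 1"] by (simp add: partial_def)
  moreover have "partial i (\<lambda>\<eta>. f (t *\<^sub>R \<eta>)) \<xi> = partial i (\<lambda>\<eta>. s * f \<eta>) \<xi>"
    by (rule partial_cong_open[of "- {0}"]) (use assms in auto)
  moreover have "partial i (\<lambda>\<eta>. s * f \<eta>) \<xi> = s * partial i f \<xi>"
    by (rule partial_linear[OF bounded_linear_mult_right assms(3)])
  ultimately show ?thesis by simp
qed

lemma hom0_euler:
  fixes f :: "real^'n \<Rightarrow> real"
  assumes "f differentiable at \<xi>" "\<And>t. 0 < t \<Longrightarrow> f (t *\<^sub>R \<xi>) = f \<xi>"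
  shows "(\<Sum>i\<in>UNIV. \<xi> $ i * partial i f \<xi>) = 0"
proof -
  have "((\<lambda>t::real. t *\<^sub>R \<xi>) has_derivative (\<lambda>t. t *\<^sub>R \<xi>)) (at 1)" by (auto intro!: derivative_eq_intros)
  moreover have "(f has_derivative frechet_derivative f (at \<xi>)) (at (1 *\<^sub>R \<xi>))"
    using assms(1) by (simp add: frechet_derivative_works)
  ultimately have "((\<lambda>t. f (t *\<^sub>R \<xi>)) has_derivative (\<lambda>t. frechet_derivative f (at \<xi>) (t *\<^sub>R \<xi>))) (at 1)"
    by (rule has_derivative_compose)
  then have "((\<lambda>t. f \<xi>) has_derivative (\<lambda>t. frechet_derivative f (at \<xi>) (t *\<^sub>R \<xi>))) (at 1)"
    by (rule has_derivative_transform_within_open[of _ _ _ _ "{0<..}"]) (use assms(2) in auto)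
  moreover have "((\<lambda>t. f \<xi>) has_derivative (\<lambda>t. 0)) (at (1::real))"
    by (auto intro!: derivative_eq_intros)
  ultimately have "(\<lambda>t. frechet_derivative f (at \<xi>) (t *\<^sub>R \<xi>)) = (\<lambda>t. 0)"
    by (rule has_derivative_unique)
  from fun_cong[OF this, of 1] have "frechet_derivative f (at \<xi>) \<xi> = 0" by simp
  then show ?thesis using frechet_eq_sum_partial[OF assms(1), of \<xi>] by simp
qed

context fio_data begin

lemma d_th_hom0:
  assumes "\<xi> \<noteq> 0" "0 < t"
  shows "partial i (\<theta> x) (t *\<^sub>R \<xi>) = partial i (\<theta> x) \<xi>"
  using partial_scale[of t \<xi> "\<theta> x" t i] th_differentiable[of \<xi> "[]" x] th_differentiable[of "t *\<^sub>R \<xi>" "[]" x] assms th_hom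
  by auto

lemma dd_th_hom:
  assumes "\<xi> \<noteq> 0" "0 < t"
  shows "t * partial j (partial i (\<theta> x)) (t *\<^sub>R \<xi>) = partial j (partial i (\<theta> x)) \<xi>"
  using partial_scale[of t \<xi> "partial i (\<theta> x)" 1 j] th_differentiable[of \<xi> "[i]" x] th_differentiable[of "t *\<^sub>R \<xi>" "[i]" x] assms d_th_hom0
  by auto

text \<open>Euler's identity of degree \<open>0\<close> for each first derivative yields the kernel
  of the transpose; differentiating Euler's identity of degree \<open>1\<close> for \<theta> yields
  the other. Thus both kernels are obtained without interchanging derivatives.\<close>

lemma hessian_kernel:
  assumes "\<xi> \<noteq> 0"
  shows "hessian (\<theta> x) \<xi> *v \<xi> = 0" "transpose (hessian (\<theta> x) \<xi>) *v \<xi> = 0"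
proof -
  have d: "\<theta> x differentiable at \<eta>" "partial i (\<theta> x) differentiable at \<eta>" if "\<eta> \<noteq> 0" for i \<eta>
    using th_differentiable[OF that, of "[]" x] th_differentiable[OF that, of "[i]" x] by auto
  have "(\<Sum>j\<in>UNIV. \<xi> $ j * partial j (partial i (\<theta> x)) \<xi>) = 0" for i
    by (rule hom0_euler[OF d(2)[OF assms]]) (use d_th_hom0 assms in auto)
  then show "transpose (hessian (\<theta> x) \<xi>) *v \<xi> = 0"
    by (simp add: vec_eq_iff matrix_vector_mult_def transpose_def hessian_def mult.commute)
  have "(\<Sum>j\<in>UNIV. \<xi> $ j * partial i (partial j (\<theta> x)) \<xi>) = 0" for i
  proof -
    have euler: "\<theta> x \<eta> = (\<Sum>j\<in>UNIV. \<eta> $ j * partial j (\<theta> x) \<eta>)" if "\<eta> \<noteq> 0" for \<eta>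
      by (rule hom1_euler[OF d(1)[OF that]]) (use th_hom that in auto)
    have nth: "((\<lambda>\<eta>. \<eta> $ j) has_derivative (\<lambda>v. v $ j)) (at \<xi>)" for j
      by (rule bounded_linear_imp_has_derivative[OF bounded_linear_vec_nth])
    have "((\<lambda>\<eta>. \<Sum>j\<in>UNIV. \<eta> $ j * partial j (\<theta> x) \<eta>) has_derivative
      (\<lambda>v. \<Sum>j\<in>UNIV. \<xi> $ j * frechet_derivative (partial j (\<theta> x)) (at \<xi>) v + v $ j * partial j (\<theta> x) \<xi>)) (at \<xi>)"
      by (intro has_derivative_sum has_derivative_mult nth) (use d(2)[OF assms] in \<open>simp add: frechet_derivative_works\<close>)
    from partial_has_derivative[OF this, of i]
    have "partial i (\<lambda>\<eta>. \<Sum>j\<in>UNIV. \<eta> $ j * partial j (\<theta> x) \<eta>) \<xi>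
        = (\<Sum>j\<in>UNIV. \<xi> $ j * partial i (partial j (\<theta> x)) \<xi>) + (\<Sum>j\<in>UNIV. axis i 1 $ j * partial j (\<theta> x) \<xi>)"
      by (simp add: partial_def[of i "partial _ _"] sum.distrib)
    moreover have "(\<Sum>j\<in>UNIV. axis i 1 $ j * partial j (\<theta> x) \<xi>) = partial i (\<theta> x) \<xi>"
      by (simp add: axis_def if_distrib[of "\<lambda>x. x * _"] cong: if_cong)
    moreover have "partial i (\<theta> x) \<xi> = partial i (\<lambda>\<eta>. \<Sum>j\<in>UNIV. \<eta> $ j * partial j (\<theta> x) \<eta>) \<xi>"
      by (rule partial_cong_open[of "- {0}"]) (use assms euler in auto)
    ultimately show ?thesis by simp
  qed
  then show "hessian (\<theta> x) \<xi> *v \<xi> = 0"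
    by (simp add: vec_eq_iff matrix_vector_mult_def hessian_def mult.commute)
qed

text \<open>By homogeneity the radial direction is the kernel of the Hessian, and it is transversal to the
  hyperplane \<open>d\<^sub>k = 0\<close> if \<open>k\<close> is chosen with \<open>n |\<zeta>\<^sub>k| \<ge> |\<zeta>|\<close>.\<close>

lemma nondegenerate:
  assumes c: "0 < c" "\<And>x \<xi>. norm \<xi> = 1 \<Longrightarrow> c \<le> \<bar>det_corank1 (hessian (\<theta> x) \<xi>)\<bar>"
  obtains \<delta> c1 :: real where "0 < \<delta>" "\<delta> \<le> 1/32" "0 < c1"
    "\<And>x l \<zeta>. 0 < l \<Longrightarrow> l / 4 \<le> norm \<zeta> \<Longrightarrow> norm \<zeta> \<le> 4 * l \<Longrightarrow>
      \<exists>k. \<forall>d. d $ k = 0 \<longrightarrow> (\<exists>i. \<forall>y\<in>ball \<zeta> (2 * \<delta> * l). \<forall>y'\<in>ball \<zeta> (2 * \<delta> * l). y - y' = d \<longrightarrow>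
        c1 * norm d / l \<le> \<bar>partial i (\<theta> x) y - partial i (\<theta> x) y'\<bar>)"
proof -
  let ?n = "real CARD('n)"
  have "\<exists>C. \<forall>x \<xi>. \<xi> \<noteq> 0 \<longrightarrow> norm \<xi> * \<bar>partial i (partial j (\<theta> x)) \<xi>\<bar> \<le> C" for i j
    using th_bound[of "[i, j]"] by simp
  then obtain C2 where C2: "\<And>i j x \<xi>. \<xi> \<noteq> 0 \<Longrightarrow> norm \<xi> * \<bar>partial i (partial j (\<theta> x)) \<xi>\<bar> \<le> C2 i j" by metis
  have "\<exists>C. \<forall>x \<xi>. \<xi> \<noteq> 0 \<longrightarrow> (norm \<xi>)\<^sup>2 * \<bar>partial k (partial i (partial j (\<theta> x))) \<xi>\<bar> \<le> C" for i j k
    using th_bound[of "[k, i, j]"] by (auto simp: powr_numeral)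
  then have "\<forall>i j k. \<exists>C. \<forall>x \<xi>. \<xi> \<noteq> 0 \<longrightarrow> (norm \<xi>)\<^sup>2 * \<bar>partial k (partial i (partial j (\<theta> x))) \<xi>\<bar> \<le> C" by blast
  then obtain C3 where "\<forall>i j k x \<xi>. \<xi> \<noteq> 0 \<longrightarrow> (norm \<xi>)\<^sup>2 * \<bar>partial k (partial i (partial j (\<theta> x))) \<xi>\<bar> \<le> C3 i j k"
    unfolding choice_iff by blast
  then have C3: "\<And>i j k x \<xi>. \<xi> \<noteq> 0 \<Longrightarrow> (norm \<xi>)\<^sup>2 * \<bar>partial k (partial i (partial j (\<theta> x))) \<xi>\<bar> \<le> C3 i j k" by blast
  define H where "H = (\<Sum>i\<in>UNIV. \<Sum>j\<in>UNIV. \<bar>C2 i j\<bar>)"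
  define L where "L = (\<Sum>i\<in>UNIV. \<Sum>j\<in>UNIV. \<Sum>k\<in>UNIV. \<bar>C3 i j k\<bar>)"
  have C2H: "C2 i j \<le> H" for i j
  proof -
    have "\<bar>C2 i j\<bar> \<le> (\<Sum>j\<in>UNIV. \<bar>C2 i j\<bar>)" by (rule member_le_sum) auto
    also have "\<dots> \<le> H" unfolding H_def by (rule member_le_sum) (auto simp: sum_nonneg)
    finally show ?thesis by simp
  qed
  have C3L: "C3 i j k \<le> L" for i j k
  proof -
    have "\<bar>C3 i j k\<bar> \<le> (\<Sum>k\<in>UNIV. \<bar>C3 i j k\<bar>)" by (rule member_le_sum) auto
    also have "\<dots> \<le> (\<Sum>j\<in>UNIV. \<Sum>k\<in>UNIV. \<bar>C3 i j k\<bar>)" by (rule member_le_sum) (auto simp: sum_nonneg)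
    also have "\<dots> \<le> L" unfolding L_def by (rule member_le_sum) (auto simp: sum_nonneg)
    finally show ?thesis by simp
  qed
  have H0: "0 \<le> H" "0 \<le> L" unfolding H_def L_def by (auto intro!: sum_nonneg)
  define H' where "H' = ?n * (?n * (2 * H)) * 2 + 3"
  define \<Lambda> where "\<Lambda> = ?n * (1 + ?n) * fact CARD('n) * H' ^ (CARD('n) - 1)"
  have n1: "1 \<le> ?n" by (simp add: Suc_leI)
  have "0 < H'" using H0 by (simp add: H'_def add_nonneg_pos)
  then have \<Lambda>: "0 < \<Lambda>" unfolding \<Lambda>_def by simp
  define \<kappa> where "\<kappa> = c / \<Lambda>"
  have \<kappa>: "0 < \<kappa>" using c(1) \<Lambda> by (simp add: \<kappa>_def)
  \<comment> \<open>The bound \<open>1/32\<close> keeps the balls of radius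
    \<open>2 \<delta> l\<close> in the region \<open>norm \<xi> \<ge> l / 8\<close>. In the other
    bound \<open>1024 n^3\<close> is the product of \<open>128 n\<close> from the Lipschitz
    estimate, \<open>n\<close> from the sum over coordinates and \<open>8 n\<close> from
    \<open>c1\<close>.\<close>
  define \<delta> where "\<delta> = min (1/32) (\<kappa> / (1024 * ?n ^ 3 * (L + 1)))"
  have \<delta>: "0 < \<delta>" "\<delta> \<le> 1/32" "1024 * ?n ^ 3 * (L + 1) * \<delta> \<le> \<kappa>"
  proof -
    have p: "0 < 1024 * ?n ^ 3 * (L + 1)" using H0 by simp
    then show "0 < \<delta>" "\<delta> \<le> 1/32" using \<kappa> unfolding \<delta>_def by auto
    have "\<delta> \<le> \<kappa> / (1024 * ?n ^ 3 * (L + 1))" unfolding \<delta>_def by simp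
    then show "1024 * ?n ^ 3 * (L + 1) * \<delta> \<le> \<kappa>" using p by (simp add: pos_le_divide_eq mult_ac)
  qed
  \<comment> \<open>Half of the lower bound \<open>\<kappa> / (4 n)\<close> valid at the centre; the
    other half absorbs the variation of the second derivatives over the ball.\<close>
  define c1 where "c1 = \<kappa> / (8 * ?n)"
  have c1: "0 < c1" using \<kappa> by (simp add: c1_def)
  show ?thesis
  proof (rule that[OF \<delta>(1,2) c1])
    fix x \<zeta> :: "real^'n" and l :: real
    assume l: "0 < l" "l / 4 \<le> norm \<zeta>" "norm \<zeta> \<le> 4 * l"
    define r where "r = norm \<zeta>"
    define u where "u = \<zeta> /\<^sub>R r"
    have r: "0 < r" using l unfolding r_def by linarith
    have u: "norm u = 1" "u \<noteq> 0" "r *\<^sub>R u = \<zeta>" using r by (auto simp: u_def r_def)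
    define M where "M = hessian (\<theta> x) u"
    have Mb: "\<bar>M $ i $ j\<bar> \<le> H" for i j
      using C2[OF u(2), of i j x] C2H[of i j] u(1) by (simp add: M_def hessian_def)
    have "\<exists>k. 1 / ?n \<le> \<bar>u $ k\<bar>"
    proof (rule ccontr)
      assume "\<nexists>k. 1 / ?n \<le> \<bar>u $ k\<bar>"
      then have "(\<Sum>i\<in>UNIV. \<bar>u $ i\<bar>) < (\<Sum>i\<in>(UNIV::'n set). 1 / ?n)"
        by (intro sum_strict_mono) (auto simp: not_le)
      then show False using norm_le_l1_cart[of u] u(1) by simp
    qed
    then obtain k where k: "1 \<le> ?n * \<bar>u $ k\<bar>" by (auto simp: divide_le_eq mult.commute)
    have ball: "l / 8 \<le> norm \<xi>" "\<xi> \<noteq> 0" if "\<xi> \<in> ball \<zeta> (2 * \<delta> * l)" for \<xi>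
    proof -
      have "norm \<zeta> \<le> norm \<xi> + dist \<zeta> \<xi>" by (metis add.commute dist_norm norm_triangle_sub)
      moreover have "2 * \<delta> * l \<le> 1/16 * l" using \<delta>(2) l(1) by (intro mult_right_mono) auto
      ultimately show "l / 8 \<le> norm \<xi>" using that l unfolding mem_ball by argo
      then show "\<xi> \<noteq> 0" using l(1) by auto
    qed
    show "\<exists>k. \<forall>d. d $ k = 0 \<longrightarrow> (\<exists>i. \<forall>y\<in>ball \<zeta> (2 * \<delta> * l). \<forall>y'\<in>ball \<zeta> (2 * \<delta> * l). y - y' = d \<longrightarrow>
        c1 * norm d / l \<le> \<bar>partial i (\<theta> x) y - partial i (\<theta> x) y'\<bar>)"
    \<comment> \<open>The index \<open>k\<close> depends on the centre only, since all shifts have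
      to lie in one hyperplane. The direction \<open>i\<close> of differentiation may change with
      the difference \<open>d\<close> of two shifts, but must serve all points of the ball.\<close>
    proof (rule exI[of _ k], intro allI impI)
      fix d :: "real^'n" assume d: "d $ k = 0"
      have "c * norm d \<le> \<Lambda> * norm (transpose M *v d)"
        unfolding \<Lambda>_def H'_def
        by (rule det_corank1_lower_bound[OF Mb c(1) _ u(1) _ _ k d])
          (use hessian_kernel[OF u(2), of x] c(2)[OF u(1)] in \<open>auto simp: M_def\<close>)
      then have Md: "\<kappa> * norm d \<le> norm (transpose M *v d)" using \<Lambda> by (simp add: \<kappa>_def field_simps)
      have "\<exists>i. \<kappa> * norm d / ?n \<le> \<bar>(transpose M *v d) $ i\<bar>"
      proof (rule ccontr)
        assume "\<nexists>i. \<kappa> * norm d / ?n \<le> \<bar>(transpose M *v d) $ i\<bar>"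
        then have "(\<Sum>i\<in>UNIV. \<bar>(transpose M *v d) $ i\<bar>) < (\<Sum>i\<in>(UNIV::'n set). \<kappa> * norm d / ?n)"
          by (intro sum_strict_mono) (auto simp: not_le)
        then show False using norm_le_l1_cart[of "transpose M *v d"] Md by simp
      qed
      then obtain i where i: "\<kappa> * norm d / ?n \<le> \<bar>(transpose M *v d) $ i\<bar>" by blast
      let ?f = "partial i (\<theta> x)"
      have Mi: "(transpose M *v d) $ i = r * (\<Sum>j\<in>UNIV. d $ j * partial j ?f \<zeta>)"
      proof -
        have "partial j ?f u = r * partial j ?f \<zeta>" for j using dd_th_hom[OF u(2) r, of j i x] u(3) by simp
        then show ?thesis
          by (simp add: matrix_vector_mult_def transpose_def M_def hessian_def sum_distrib_left mult_ac)
      qed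
      have low: "\<kappa> * norm d / ?n \<le> 4 * l * \<bar>\<Sum>j\<in>UNIV. d $ j * partial j ?f \<zeta>\<bar>"
        using i r mult_right_mono[of r "4 * l" "\<bar>\<Sum>j\<in>UNIV. d $ j * partial j ?f \<zeta>\<bar>"] l(3)
        unfolding Mi by (simp add: abs_mult r_def)
      show "\<exists>i. \<forall>y\<in>ball \<zeta> (2 * \<delta> * l). \<forall>y'\<in>ball \<zeta> (2 * \<delta> * l). y - y' = d \<longrightarrow>
        c1 * norm d / l \<le> \<bar>partial i (\<theta> x) y - partial i (\<theta> x) y'\<bar>"
      proof (intro exI[of _ i] ballI impI)
        fix y y' assume y: "y \<in> ball \<zeta> (2 * \<delta> * l)" "y' \<in> ball \<zeta> (2 * \<delta> * l)" "y - y' = d"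
        have seg: "y' + s *\<^sub>R d \<in> ball \<zeta> (2 * \<delta> * l)" if "0 \<le> s" "s \<le> 1" for s
        proof -
          have "y' + s *\<^sub>R d = (1 - s) *\<^sub>R y' + s *\<^sub>R y" unfolding y(3)[symmetric] by (simp add: algebra_simps)
          then show ?thesis using convexD[OF convex_ball y(2,1), of "1 - s" s] that by simp
        qed
        have fd: "?f differentiable at \<xi>" "partial j ?f differentiable at \<xi>" if "\<xi> \<in> ball \<zeta> (2 * \<delta> * l)" for j \<xi>
          using th_differentiable[OF ball(2)[OF that], of "[i]"] th_differentiable[OF ball(2)[OF that], of "[j, i]"] by auto
        have der: "((\<lambda>s. ?f (y' + s *\<^sub>R d)) has_derivative (\<lambda>t. t * frechet_derivative ?f (at (y' + s *\<^sub>R d)) d)) (at s)"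
          if "0 \<le> s" "s \<le> 1" for s
        proof -
          have "((\<lambda>t::real. y' + t *\<^sub>R d) has_derivative (\<lambda>t. t *\<^sub>R d)) (at s)" by (auto intro!: derivative_eq_intros)
          moreover have "(?f has_derivative frechet_derivative ?f (at (y' + s *\<^sub>R d))) (at (y' + s *\<^sub>R d))"
            using fd(1)[OF seg[OF that]] by (simp add: frechet_derivative_works)
          ultimately have "((\<lambda>t. ?f (y' + t *\<^sub>R d)) has_derivative (\<lambda>t. frechet_derivative ?f (at (y' + s *\<^sub>R d)) (t *\<^sub>R d))) (at s)"
            by (rule has_derivative_compose)
          then show ?thesis using linear_cmul[OF linear_frechet_derivative[OF fd(1)[OF seg[OF that]]]] by simp
        qed
        have "continuous_on {0..1} (\<lambda>s. ?f (y' + s *\<^sub>R d))"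
          using der by (intro continuous_at_imp_continuous_on ballI has_derivative_continuous) (auto simp: has_derivative_at_withinI)
        \<comment> \<open>The mean value theorem in one variable gives a single point \<eta> for all
          terms of the directional derivative, which is then compared with the centre.\<close>
        then obtain s where s: "0 < s" "s < 1" "?f (y' + 1 *\<^sub>R d) - ?f (y' + 0 *\<^sub>R d) = (1 - 0) * frechet_derivative ?f (at (y' + s *\<^sub>R d)) d"
          using mvt[of 0 1 "\<lambda>s. ?f (y' + s *\<^sub>R d)" "\<lambda>s t. t * frechet_derivative ?f (at (y' + s *\<^sub>R d)) d"] der by auto
        define \<eta> where "\<eta> = y' + s *\<^sub>R d"
        have \<eta>: "\<eta> \<in> ball \<zeta> (2 * \<delta> * l)" unfolding \<eta>_def by (rule seg) (use s in auto)
        have "y' + 1 *\<^sub>R d = y" using y(3) by (simp add: algebra_simps flip: y(3))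
        then have diff: "?f y - ?f y' = (\<Sum>j\<in>UNIV. d $ j * partial j ?f \<eta>)"
          using s(3) frechet_eq_sum_partial[OF fd(1)[OF \<eta>], of d] by (simp add: \<eta>_def)
        have near: "\<bar>partial j ?f \<eta> - partial j ?f \<zeta>\<bar> \<le> 128 * ?n * L * \<delta> / l" for j
        proof -
          have "norm (partial j ?f \<eta> - partial j ?f \<zeta>) \<le> ?n * (64 * L / l\<^sup>2) * norm (\<eta> - \<zeta>)"
          proof (rule lipschitz_partial[OF convex_ball \<eta>])
            show "\<zeta> \<in> ball \<zeta> (2 * \<delta> * l)" using \<delta> l by simp
            show "partial j ?f differentiable at z" if "z \<in> ball \<zeta> (2 * \<delta> * l)" for z by (rule fd[OF that])
            show "norm (partial k (partial j ?f) z) \<le> 64 * L / l\<^sup>2" if "z \<in> ball \<zeta> (2 * \<delta> * l)" for k z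
            proof -
              have "(l / 8)\<^sup>2 * \<bar>partial k (partial j ?f) z\<bar> \<le> (norm z)\<^sup>2 * \<bar>partial k (partial j ?f) z\<bar>"
                using ball(1)[OF that] l by (intro mult_right_mono power_mono) auto
              also have "\<dots> \<le> L" using C3[OF ball(2)[OF that], of k j i x] C3L by (meson order_trans)
              finally show ?thesis using l by (simp add: field_simps power2_eq_square)
            qed
          qed
          also have "\<dots> \<le> ?n * (64 * L / l\<^sup>2) * (2 * \<delta> * l)"
            using \<eta> H0 by (intro mult_left_mono) (auto simp: dist_norm norm_minus_commute)
          also have "\<dots> = 128 * ?n * L * \<delta> / l" using l by (simp add: power2_eq_square)
          finally show ?thesis by simp
        qed
        have "\<bar>(\<Sum>j\<in>UNIV. d $ j * partial j ?f \<eta>) - (\<Sum>j\<in>UNIV. d $ j * partial j ?f \<zeta>)\<bar>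
            = \<bar>\<Sum>j\<in>UNIV. d $ j * (partial j ?f \<eta> - partial j ?f \<zeta>)\<bar>"
          by (simp add: sum_subtractf right_diff_distrib)
        also have "\<dots> \<le> (\<Sum>j\<in>(UNIV::'n set). norm d * (128 * ?n * L * \<delta> / l))"
        proof (rule order_trans[OF sum_abs sum_mono])
          show "\<bar>d $ j * (partial j ?f \<eta> - partial j ?f \<zeta>)\<bar> \<le> norm d * (128 * ?n * L * \<delta> / l)" for j
            unfolding abs_mult by (intro mult_mono component_le_norm_cart near) auto
        qed
        also have "\<dots> = norm d / (8 * ?n * l) * (1024 * ?n ^ 3 * L * \<delta>)"
          using l by (simp add: field_simps power3_eq_cube)
        also have "\<dots> \<le> norm d / (8 * ?n * l) * \<kappa>"
        proof (rule mult_left_mono)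
          have "1024 * ?n ^ 3 * L * \<delta> \<le> 1024 * ?n ^ 3 * (L + 1) * \<delta>" using \<delta> by (intro mult_right_mono mult_left_mono) auto
          then show "1024 * ?n ^ 3 * L * \<delta> \<le> \<kappa>" using \<delta>(3) by linarith
        qed (use l in auto)
        finally have e1: "\<bar>(\<Sum>j\<in>UNIV. d $ j * partial j ?f \<eta>) - (\<Sum>j\<in>UNIV. d $ j * partial j ?f \<zeta>)\<bar> \<le> c1 * norm d / l"
          by (simp add: c1_def mult_ac)
        have e2: "2 * (c1 * norm d / l) \<le> \<bar>\<Sum>j\<in>UNIV. d $ j * partial j ?f \<zeta>\<bar>"
          using low l by (simp add: c1_def field_simps)
        show "c1 * norm d / l \<le> \<bar>?f y - ?f y'\<bar>" unfolding diff using e1 e2 by linarith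
      qed
    qed
  qed
qed

end

subsection \<open>Van der Corput differencing\<close>

text \<open>The sum \<open>S\<close> of all shifts has integral \<open>card I\<close> times that of
  \<open>F\<close>. It lives on a slightly larger ball, so Cauchy-Schwarz bounds the integral by the
  square integral of \<open>S\<close>, which expands into correlations of pairs of shifts.\<close>

lemma van_der_corput:
  fixes F :: "real^'n \<Rightarrow> complex" and h :: "'i \<Rightarrow> real^'n"
  assumes cont: "continuous_on UNIV F" and supp: "\<And>x. x \<notin> cball \<zeta> R \<Longrightarrow> F x = 0"
    and h: "\<And>i. i \<in> I \<Longrightarrow> norm (h i) \<le> R'" and I: "finite I" and R: "0 < R" "0 \<le> R'"
  shows "(real (card I) * norm (LBINT x. F x))\<^sup>2 \<le> measure lborel (cball \<zeta> (R + R')) *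
    (\<Sum>i\<in>I. \<Sum>j\<in>I. norm (LBINT x. F (x + h i) * cnj (F (x + h j))))"
proof -
  define D where "D = cball \<zeta> (R + R')"
  define S where "S x = (\<Sum>i\<in>I. F (x + h i))" for x
  have Fm: "F \<in> borel_measurable borel" using cont by (rule borel_measurable_continuous_onI)
  have cF: "continuous_on UNIV (\<lambda>x. F (x + c))" for c
    by (intro continuous_on_compose2[OF cont] continuous_intros) auto
  have z: "F (x + h i) = 0" if "x \<notin> D" "i \<in> I" for x i
  proof (rule supp)
    have "dist \<zeta> x \<le> dist \<zeta> (x + h i) + norm (h i)"
      using dist_triangle[of \<zeta> x "x + h i"] by (simp add: dist_norm)
    then show "x + h i \<notin> cball \<zeta> R" using that h[OF that(2)] by (auto simp: D_def)
  qed
  have D: "closed D" "bounded D" by (auto simp: D_def)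
  have fin: "emeasure lborel D < \<infinity>" using D(2) by (rule emeasure_bounded_finite)
  have V: "0 < measure lborel D" unfolding D_def using R content_cball_pos[of "R + R'" \<zeta>] by simp
  have intF: "integrable lborel (\<lambda>x. F (x + h i))" if "i \<in> I" for i
    by (rule integrable_continuous_support[OF D z[OF _ that] cF])
  have "(LBINT x. S x) = (\<Sum>i\<in>I. LBINT x. F (x + h i))"
    unfolding S_def by (rule Bochner_Integration.integral_sum) (rule intF)
  also have "\<dots> = of_nat (card I) * (LBINT x. F x)" by (simp add: integral_translate[OF Fm])
  finally have S: "(LBINT x. S x) = of_nat (card I) * (LBINT x. F x)" .
  have cS: "continuous_on UNIV S" unfolding S_def by (intro continuous_on_sum cF)
  have zS: "S x = 0" if "x \<notin> D" for x unfolding S_def using z[OF that] by simp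
  have iS: "integrable lborel (\<lambda>x. norm (S x))"
    by (rule integrable_continuous_support[OF D]) (use zS cS in \<open>auto intro: continuous_on_norm\<close>)
  have iS2: "integrable lborel (\<lambda>x. (norm (S x))\<^sup>2)"
    by (rule integrable_continuous_support[OF D]) (use zS cS in \<open>auto intro: continuous_on_norm continuous_on_power\<close>)
  \<comment> \<open>The mean of \<open>norm (S x)\<close> over \<open>D\<close>. Cauchy-Schwarz is
    obtained as nonnegativity of the integral of \<open>(norm (S x) - e)\<^sup>2\<close>.\<close>
  define e where "e = (LBINT x. norm (S x)) / measure lborel D"
  have "0 \<le> (LBINT x. (norm (S x))\<^sup>2 - 2 * e * norm (S x) + e\<^sup>2 * indicator D x)"
  proof (rule integral_nonneg_AE, rule AE_I2)
    fix x
    have "(norm (S x))\<^sup>2 - 2 * e * norm (S x) + e\<^sup>2 = (norm (S x) - e)\<^sup>2" by (simp add: power2_diff mult_ac)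
    then show "0 \<le> (norm (S x))\<^sup>2 - 2 * e * norm (S x) + e\<^sup>2 * indicator D x"
      using zS[of x] by (cases "x \<in> D") auto
  qed
  also have "\<dots> = (LBINT x. (norm (S x))\<^sup>2) - 2 * e * (LBINT x. norm (S x)) + e\<^sup>2 * measure lborel D"
    using iS iS2 fin D(1) by (simp add: Bochner_Integration.integral_add Bochner_Integration.integral_diff)
  also have "\<dots> = (LBINT x. (norm (S x))\<^sup>2) - (LBINT x. norm (S x))\<^sup>2 / measure lborel D"
    using V by (simp add: e_def field_simps power2_eq_square)
  finally have "(LBINT x. norm (S x))\<^sup>2 \<le> measure lborel D * (LBINT x. (norm (S x))\<^sup>2)"
    using V by (simp add: field_simps)
  moreover have "(real (card I) * norm (LBINT x. F x))\<^sup>2 \<le> (LBINT x. norm (S x))\<^sup>2"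
    using integral_norm_bound[of lborel S] unfolding S by (intro power_mono) (auto simp: norm_mult)
  moreover have "(LBINT x. (norm (S x))\<^sup>2) \<le> (\<Sum>i\<in>I. \<Sum>j\<in>I. norm (LBINT x. F (x + h i) * cnj (F (x + h j))))"
  proof -
    have int: "integrable lborel (\<lambda>x. F (x + h i) * cnj (F (x + h j)))" if "i \<in> I" for i j
      by (rule integrable_continuous_support[OF D]) (use z[OF _ that] in \<open>auto intro!: continuous_intros cF\<close>)
    have "complex_of_real ((norm (S x))\<^sup>2) = (\<Sum>i\<in>I. \<Sum>j\<in>I. F (x + h i) * cnj (F (x + h j)))" for x
      unfolding complex_norm_square S_def by (simp add: sum_product)
    then have "complex_of_real (LBINT x. (norm (S x))\<^sup>2) = (LBINT x. (\<Sum>i\<in>I. \<Sum>j\<in>I. F (x + h i) * cnj (F (x + h j))))"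
      by (simp flip: integral_complex_of_real)
    also have "\<dots> = (\<Sum>i\<in>I. \<Sum>j\<in>I. (LBINT x. F (x + h i) * cnj (F (x + h j))))"
      using int by (simp add: Bochner_Integration.integral_sum)
    finally have "norm (complex_of_real (LBINT x. (norm (S x))\<^sup>2)) \<le> (\<Sum>i\<in>I. \<Sum>j\<in>I. norm (LBINT x. F (x + h i) * cnj (F (x + h j))))"
      by (simp only:) (intro order_trans[OF norm_sum] sum_mono norm_sum)
    then show ?thesis by simp
  qed
  ultimately show ?thesis using V unfolding D_def[symmetric] by (meson mult_left_mono less_imp_le order_trans)
qed

section \<open>Localisation to balls and the auxiliary sums\<close>

definition bump :: "nat \<Rightarrow> real \<Rightarrow> real^'n \<Rightarrow> real^'n \<Rightarrow> real"
  where "bump N r \<zeta> \<xi> = pospow N (1 - (norm (\<xi> - \<zeta>) / r)\<^sup>2)"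

lemma bump_zero: "0 < N \<Longrightarrow> 0 < r \<Longrightarrow> \<xi> \<notin> cball \<zeta> r \<Longrightarrow> bump N r \<zeta> \<xi> = 0"
proof -
  assume a: "0 < N" "0 < r" "\<xi> \<notin> cball \<zeta> r"
  then have "1 \<le> norm (\<xi> - \<zeta>) / r" by (auto simp: dist_norm norm_minus_commute)
  then have "1 \<le> (norm (\<xi> - \<zeta>) / r)\<^sup>2" by (rule one_le_power)
  then show ?thesis using a by (simp add: bump_def pospow_def)
qed

lemma continuous_on_bump: "0 < r \<Longrightarrow> continuous_on S (\<lambda>p. bump N r (fst p) (snd p))"
  unfolding bump_def by (intro continuous_on_pospow continuous_intros) auto

text \<open>Averaging the localised integrals over the centre \<open>\<zeta>\<close> avoids a partition of unity.\<close>

lemma bump_average: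
  fixes G :: "real^'n \<Rightarrow> complex"
  assumes cont: "continuous_on UNIV G" and supp: "\<And>x. x \<notin> K \<Longrightarrow> G x = 0" and K: "closed K" "bounded K"
    and r: "0 < r" and N: "0 < N"
    and S: "closed S" "bounded S" "\<And>\<zeta>. \<zeta> \<notin> S \<Longrightarrow> (LBINT \<xi>. G \<xi> * of_real (bump N r \<zeta> \<xi>)) = 0"
    and b: "\<And>\<zeta>. norm (LBINT \<xi>. G \<xi> * of_real (bump N r \<zeta> \<xi>)) \<le> b"
  shows "(3/4) ^ N * measure lborel (ball (0::real^'n) (r/2)) * norm (LBINT \<xi>. G \<xi>) \<le> b * measure lborel S"
proof -
  \<comment> \<open>The total mass of a bump. It is bounded below by the mass on the ball of half
    the radius, where the base of the power is at least \<open>3/4\<close>.\<close>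
  define J where "J = (LBINT \<zeta>. bump N r (0::real^'n) \<zeta>)"
  have cb: "continuous_on UNIV (bump N r \<zeta>)" for \<zeta> :: "real^'n"
    unfolding bump_def by (intro continuous_on_pospow continuous_intros) (use r in auto)
  have ib: "integrable lborel (bump N r (0::real^'n))"
    by (rule integrable_continuous_support[of "cball 0 r"]) (use bump_zero[OF N r, of _ "0::real^'n"] cb in auto)
  have "(3/4) ^ N * measure lborel (ball (0::real^'n) (r/2)) = (LBINT \<zeta>. (3/4) ^ N * indicator (ball (0::real^'n) (r/2)) \<zeta>)"
    using emeasure_bounded_finite[OF bounded_ball, of "0::real^'n" "r/2"] by simp
  also have "\<dots> \<le> J" unfolding J_def
  proof (rule integral_mono[OF _ ib])
    show "integrable lborel (\<lambda>\<zeta>. (3/4) ^ N * indicator (ball (0::real^'n) (r/2)) \<zeta> :: real)"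
      using emeasure_bounded_finite[OF bounded_ball, of "0::real^'n" "r/2"] by (intro integrable_mult_right) auto
    fix \<zeta> :: "real^'n"
    show "(3/4) ^ N * indicator (ball (0::real^'n) (r/2)) \<zeta> \<le> bump N r 0 \<zeta>"
    proof (cases "\<zeta> \<in> ball 0 (r/2)")
      case True
      then have "(norm \<zeta> / r)\<^sup>2 \<le> (1/2)\<^sup>2" using r by (intro power_mono) (auto simp: divide_le_eq)
      moreover have "(1/2)\<^sup>2 = (1/4::real)" by (simp add: power2_eq_square)
      ultimately have "3/4 \<le> 1 - (norm \<zeta> / r)\<^sup>2" by linarith
      then have "3/4 \<le> max 0 (1 - (norm \<zeta> / r)\<^sup>2)" by (rule order_trans) (rule max.cobounded2)
      then have "(3/4) ^ N \<le> max 0 (1 - (norm \<zeta> / r)\<^sup>2) ^ N" by (rule power_mono) simp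
      then show ?thesis using True by (simp add: bump_def pospow_def)
    qed (simp add: bump_def pospow_nonneg)
  qed
  finally have J: "(3/4) ^ N * measure lborel (ball (0::real^'n) (r/2)) \<le> J" .
  have J0: "0 \<le> J" unfolding J_def by (rule integral_nonneg_AE) (simp add: bump_def pospow_nonneg)
  \<comment> \<open>A bump depends on the difference of point and centre only, so integrating over
    the centre gives the same \<open>J\<close> at every point.\<close>
  have inner: "(LBINT \<zeta>. G \<xi> * of_real (bump N r \<zeta> \<xi>)) = G \<xi> * of_real J" for \<xi>
  proof -
    have "(LBINT \<zeta>. bump N r \<zeta> \<xi>) = (LBINT \<zeta>. bump N r 0 (\<zeta> + (- \<xi>)))"
      by (simp add: bump_def norm_minus_commute)
    also have "\<dots> = J" unfolding J_def
      by (rule integral_translate(1)[OF borel_measurable_continuous_onI[OF cb]])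
    finally show ?thesis by (simp add: integral_complex_of_real)
  qed
  obtain R where R: "\<And>x. x \<in> K \<Longrightarrow> norm x \<le> R" using K(2) by (auto simp: bounded_iff)
  let ?f = "\<lambda>\<xi> \<zeta>. G \<xi> * complex_of_real (bump N r \<zeta> \<xi>)"
  have cG: "continuous_on UNIV (\<lambda>p. G (fst p))" by (intro continuous_on_compose2[OF cont] continuous_intros) auto
  have "continuous_on UNIV (\<lambda>p. ?f (fst p) (snd p))"
    using continuous_on_compose2[OF continuous_on_bump[OF r, of UNIV N] continuous_on_swap[of UNIV]]
    by (intro continuous_intros cG) (auto simp: prod.swap_def)
  then have "integrable lborel (\<lambda>p. indicator (cball (0::real^'n) R \<times> cball (0::real^'n) (R + r)) p *\<^sub>R ?f (fst p) (snd p))"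
    by (intro borel_integrable_compact compact_Times compact_cball) (auto intro: continuous_on_subset)
  moreover have "indicator (cball (0::real^'n) R \<times> cball (0::real^'n) (R + r)) p *\<^sub>R ?f (fst p) (snd p) = ?f (fst p) (snd p)" for p
  proof (cases "fst p \<in> K")
    case True
    have "norm (snd p) \<le> norm (fst p) + dist (snd p) (fst p)" by (metis add.commute dist_norm norm_triangle_sub)
    then show ?thesis using R[OF True] bump_zero[OF N r, of "fst p" "snd p"]
      by (cases "dist (snd p) (fst p) \<le> r") (auto simp: indicator_def mem_Times_iff)
  qed (use supp in auto)
  ultimately have int: "integrable (lborel \<Otimes>\<^sub>M lborel) (\<lambda>(\<xi>, \<zeta>). ?f \<xi> \<zeta>)"
    unfolding lborel_prod by (simp add: case_prod_unfold)
  have "(LBINT \<zeta>. (LBINT \<xi>. ?f \<xi> \<zeta>)) = (LBINT \<xi>. (LBINT \<zeta>. ?f \<xi> \<zeta>))"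
    by (rule lborel_pair.Fubini_integral[OF int])
  also have "\<dots> = (LBINT \<xi>. G \<xi>) * of_real J" unfolding inner by simp
  finally have "norm (LBINT \<xi>. G \<xi>) * J = norm (LBINT \<zeta>. (LBINT \<xi>. ?f \<xi> \<zeta>))" using J0 by (simp add: norm_mult)
  also have "\<dots> \<le> b * measure lborel S" by (rule integral_bound_support[OF S b])
  finally show ?thesis using mult_right_mono[OF J norm_ge_zero[of "LBINT \<xi>. G \<xi>"]] by (simp add: mult.commute)
qed

lemma symb_bump:
  assumes "\<And>p. 0 < r p" "k < N"
  shows "symb k (\<lambda>p. ball (\<zeta> p) (2 * r p)) (\<lambda>p. inverse (r p)) (\<lambda>p. 1) (\<lambda>p. bump N (r p) (\<zeta> p :: real^'n))"
proof -
  let ?U = "\<lambda>p. ball (\<zeta> p) (2 * r p)"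
  have B: "0 \<le> inverse (r p)" for p using assms(1)[of p] by simp
  have "symb k ?U (\<lambda>p. inverse (r p)) (\<lambda>p. 1) (\<lambda>p x. 1 - (norm (x - \<zeta> p) / r p)\<^sup>2)"
    by (rule symb_diff[OF symb_one symb_scaled_dist[OF assms(1)]]) (use B in auto)
  then have "symb k ?U (\<lambda>p. inverse (r p)) (\<lambda>p. 1) (\<lambda>p x. pospow N (1 - (norm (x - \<zeta> p) / r p)\<^sup>2))"
    by (rule symb_pospow) (use B assms in auto)
  then show ?thesis by (simp add: bump_def[abs_def])
qed

text \<open>A Schur-type row sum in one coordinate, uniform in the row \<open>a\<close> and the
  length \<open>M\<close>. Splitting at \<open>a\<close> leaves two pieces of the convergent series
  of inverse squares; the maximum with \<open>1\<close> takes care of the diagonal.\<close>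

lemma inverse_square_sum_bound:
  obtains T where "0 < T" "\<And>(a::nat) M. (\<Sum>l<M. inverse ((max 1 \<bar>real a - real l\<bar>)\<^sup>2)) \<le> T"
proof -
  define f where "f s = inverse ((max 1 (real s))\<^sup>2)" for s :: nat
  have "summable (\<lambda>s. inverse ((real s) ^ 2))" by (rule inverse_power_summable) simp
  then have sf: "summable f"
    by (rule summable_cong[THEN iffD1, rotated]) (auto simp: f_def max_def eventually_at_top_linorder intro!: exI[of _ 1])
  have f0: "0 \<le> f s" for s by (simp add: f_def)
  have "(\<Sum>l<M. inverse ((max 1 \<bar>real a - real l\<bar>)\<^sup>2)) \<le> 2 * suminf f" for a M
  proof -
    have "(\<Sum>l<M. inverse ((max 1 \<bar>real a - real l\<bar>)\<^sup>2)) = (\<Sum>l\<in>{..<M} \<inter> {..a}. f (a - l)) + (\<Sum>l\<in>{..<M} - {..a}. f (l - a))"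
    proof -
      have "(\<Sum>l<M. inverse ((max 1 \<bar>real a - real l\<bar>)\<^sup>2)) = (\<Sum>l\<in>{..<M} \<inter> {..a}. inverse ((max 1 \<bar>real a - real l\<bar>)\<^sup>2)) + (\<Sum>l\<in>{..<M} - {..a}. inverse ((max 1 \<bar>real a - real l\<bar>)\<^sup>2))"
        by (rule sum.Int_Diff) simp
      then show ?thesis by (simp add: f_def of_nat_diff)
    qed
    also have "(\<Sum>l\<in>{..<M} \<inter> {..a}. f (a - l)) = sum f ((\<lambda>l. a - l) ` ({..<M} \<inter> {..a}))"
      by (rule sum.reindex_cong[symmetric]) (auto simp: inj_on_def)
    also have "\<dots> \<le> suminf f" by (rule sum_le_suminf[OF sf]) (auto simp: f0)
    also have "(\<Sum>l\<in>{..<M} - {..a}. f (l - a)) = sum f ((\<lambda>l. l - a) ` ({..<M} - {..a}))"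
      by (rule sum.reindex_cong[symmetric]) (auto simp: inj_on_def)
    also have "\<dots> \<le> suminf f" by (rule sum_le_suminf[OF sf]) (auto simp: f0)
    finally show ?thesis by simp
  qed
  moreover have "0 < suminf f" by (rule suminf_pos2[OF sf, of 0]) (auto simp: f0, simp add: f_def)
  ultimately show ?thesis using that[of "2 * suminf f"] by simp
qed

lemma measure_cball_translate: "measure lborel (cball (\<zeta>::real^'n) r) = measure lborel (cball (0::real^'n) r)"
proof (cases "0 \<le> r")
  case True
  then show ?thesis using content_ball_conv_unit_ball[of r \<zeta>] content_ball_conv_unit_ball[of r "0::real^'n"]
    by (simp add: content_cball_conv_ball)
qed simp

lemma measure_le_cball:
  assumes "closed K" "K \<subseteq> cball (\<zeta>::real^'n) r"
  shows "measure lborel K \<le> measure lborel (cball (0::real^'n) r)"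
proof -
  have "measure lborel K \<le> measure lborel (cball \<zeta> r)"
    by (rule measure_mono_fmeasurable[OF assms(2) _ fmeasurable_compact[OF compact_cball]])
      (simp add: assms(1) borel_closed)
  then show ?thesis unfolding measure_cball_translate[of \<zeta>] .
qed

lemma partial_translate_diff:
  assumes "f differentiable at (x + h)" "f differentiable at (x + h')"
  shows "partial i (\<lambda>x. f (x + h) - f (x + h')) x = partial i f (x + h) - partial i f (x + h')"
    "(\<lambda>x. f (x + h) - f (x + h')) differentiable at x"
proof -
  note d = has_derivative_diff[OF assms[THEN has_derivative_translate]]
  show "partial i (\<lambda>x. f (x + h) - f (x + h')) x = partial i f (x + h) - partial i f (x + h')"
    unfolding partial_has_derivative[OF d] by (simp add: partial_def)
  show "(\<lambda>x. f (x + h) - f (x + h')) differentiable at x" using d differentiableI by blast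
qed

section \<open>Almost orthogonality of the shifted pieces\<close>

context fio_data begin

text \<open>The localised integrand without its factor \<open>cis \<theta>\<close>. That factor goes
  into the phase, so that each derivative of what remains carries \<open>lam powr - \<rho>\<close>
  instead of \<open>1\<close>.\<close>

definition piece :: "nat \<Rightarrow> real \<Rightarrow> real^'n \<Rightarrow> real \<Rightarrow> real^'n \<Rightarrow> real^'n \<Rightarrow> complex"
  where "piece N \<delta> x l \<zeta> \<xi> = a x \<xi> * of_real (shell N l \<xi>) * of_real (bump N (\<delta> * l) \<zeta> \<xi>)"

lemma symb_piece:
  assumes lam: "\<And>p. 1 \<le> lam p" and k: "k < N" and \<delta>: "0 < \<delta>"
    and W: "\<And>p. open (W p)" "\<And>p. W p \<subseteq> ball (Z p) (2 * (\<delta> * lam p))"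
      "\<And>p x. x \<in> W p \<Longrightarrow> lam p / 8 \<le> norm x" "\<And>p x. x \<in> W p \<Longrightarrow> norm x < 5 * lam p"
  shows "symb k W (\<lambda>p. lam p powr - \<rho>) (\<lambda>p. lam p powr m) (\<lambda>p. piece N \<delta> (X p) (lam p) (Z p))"
proof -
  have l: "0 < lam p" for p using lam[of p] by simp
  have inv: "inverse (lam p) \<le> lam p powr - \<rho>" for p
    using powr_mono[of "-1" "-\<rho>" "lam p"] rho lam[of p] l[of p] by (simp add: powr_minus)
  have 1: "symb k W (\<lambda>p. lam p powr - \<rho>) (\<lambda>p. lam p powr m) (\<lambda>p. a (X p))"
    by (rule symb_a_outside[OF lam W(3)])
  have "symb k W (\<lambda>p. lam p powr - \<rho>) (\<lambda>p. 1) (\<lambda>p. shell N (lam p))"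
    by (rule symb_mono[OF symb_subset[OF symb_shell[OF l k, of 5]], where C=1 and D=1])
      (use W(4) inv l in \<open>auto simp: less_imp_le\<close>)
  then have 2: "symb k W (\<lambda>p. lam p powr - \<rho>) (\<lambda>p. 1) (\<lambda>p x. complex_of_real (shell N (lam p) x))"
    by (rule symb_linear[OF bounded_linear_of_real _ W(1)]) auto
  have "symb k W (\<lambda>p. inverse (\<delta> * lam p)) (\<lambda>p. 1) (\<lambda>p. bump N (\<delta> * lam p) (Z p))"
    by (rule symb_subset[OF symb_bump[OF _ k]]) (use W(2) l \<delta> in auto)
  then have "symb k W (\<lambda>p. lam p powr - \<rho>) (\<lambda>p. 1) (\<lambda>p. bump N (\<delta> * lam p) (Z p))"
    by (rule symb_mono[where C=1 and D="inverse \<delta>"])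
      (use \<delta> inv l in \<open>auto simp: less_imp_le inverse_mult_distrib intro!: mult_left_mono\<close>)
  then have 3: "symb k W (\<lambda>p. lam p powr - \<rho>) (\<lambda>p. 1) (\<lambda>p x. complex_of_real (bump N (\<delta> * lam p) (Z p) x))"
    by (rule symb_linear[OF bounded_linear_of_real _ W(1)]) auto
  have "symb k W (\<lambda>p. lam p powr - \<rho>) (\<lambda>p. lam p powr m * 1 * 1)
     (\<lambda>p x. a (X p) x * of_real (shell N (lam p) x) * of_real (bump N (\<delta> * lam p) (Z p) x))"
    by (intro symb_mult 1 2 3 W(1)) auto
  then show ?thesis by (simp add: piece_def[abs_def])
qed

text \<open>The difference of the two shifted phases has a first derivative of size
  \<open>\<mu> = norm (h - h') / lam\<close>, from below by nondegeneracy and from above with all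
  its derivatives by \<open>symb_difference\<close>. After division by \<open>\<mu>\<close> it is a
  phase for \<open>nonstationary_phase\<close> with rate \<open>lam powr - \<rho>\<close>, whose
  gain is the quotient of rate and \<open>\<mu>\<close>.\<close>

lemma pair_estimate:
  fixes X Z h h' :: "'q \<Rightarrow> real^'n" and lam :: "'q \<Rightarrow> real"
  assumes lam1: "\<And>p. 1 \<le> lam p" and \<delta>: "0 < \<delta>" "\<delta> \<le> 1/32" and c1: "0 < c1" and k: "k < N"
    and nd: "\<And>x l \<zeta> d. 0 < l \<Longrightarrow> l / 4 \<le> norm \<zeta> \<Longrightarrow> norm \<zeta> \<le> 4 * l \<Longrightarrow> d $ kk x l \<zeta> = 0 \<Longrightarrow>
      (\<exists>i. \<forall>y\<in>ball \<zeta> (2 * \<delta> * l). \<forall>y'\<in>ball \<zeta> (2 * \<delta> * l). y - y' = d \<longrightarrow>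
        c1 * norm d / l \<le> \<bar>partial i (\<theta> x) y - partial i (\<theta> x) y'\<bar>)"
  shows "\<exists>A\<ge>0. \<forall>p. lam p / 4 \<le> norm (Z p) \<and> norm (Z p) \<le> 4 * lam p \<and>
      (h p - h' p) $ kk (X p) (lam p) (Z p) = 0 \<and> h p \<noteq> h' p \<longrightarrow>
    norm (LBINT \<xi>. cis (\<theta> (X p) (\<xi> + h p) - \<theta> (X p) (\<xi> + h' p)) *
        (piece N \<delta> (X p) (lam p) (Z p) (\<xi> + h p) * cnj (piece N \<delta> (X p) (lam p) (Z p) (\<xi> + h' p))))
      \<le> A * (lam p powr m)\<^sup>2 * (lam p powr - \<rho> * lam p / norm (h p - h' p)) ^ k * measure lborel (cball (0::real^'n) (\<delta> * lam p))"
proof -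
  have "\<forall>x l \<zeta> d. \<exists>i. 0 < l \<and> l / 4 \<le> norm \<zeta> \<and> norm \<zeta> \<le> 4 * l \<and> d $ kk x l \<zeta> = 0 \<longrightarrow>
      (\<forall>y\<in>ball \<zeta> (2 * \<delta> * l). \<forall>y'\<in>ball \<zeta> (2 * \<delta> * l). y - y' = d \<longrightarrow>
        c1 * norm d / l \<le> \<bar>partial i (\<theta> x) y - partial i (\<theta> x) y'\<bar>)"
    using nd by blast
  then obtain ii where ii: "\<forall>x l \<zeta> d. 0 < l \<and> l / 4 \<le> norm \<zeta> \<and> norm \<zeta> \<le> 4 * l \<and> d $ kk x l \<zeta> = 0 \<longrightarrow>
      (\<forall>y\<in>ball \<zeta> (2 * \<delta> * l). \<forall>y'\<in>ball \<zeta> (2 * \<delta> * l). y - y' = d \<longrightarrow>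
        c1 * norm d / l \<le> \<bar>partial (ii x l \<zeta> d) (\<theta> x) y - partial (ii x l \<zeta> d) (\<theta> x) y'\<bar>)"
    unfolding choice_iff by blast
  define ok where "ok p \<longleftrightarrow> lam p / 4 \<le> norm (Z p) \<and> norm (Z p) \<le> 4 * lam p \<and> (h p - h' p) $ kk (X p) (lam p) (Z p) = 0 \<and> h p \<noteq> h' p" for p
  \<comment> \<open>Parameters that violate the side conditions get an empty domain. The uniform
    lemmas then hold for them vacuously, and no subtype of admissible parameters is needed.\<close>
  define W where "W p = (if ok p then ball (Z p) (2 * \<delta> * lam p) else {})" for p
  define U where "U p = {x. x + h p \<in> W p \<and> x + h' p \<in> W p}" for p
  define K where "K p = (if ok p then {x. x + h p \<in> cball (Z p) (\<delta> * lam p) \<and> x + h' p \<in> cball (Z p) (\<delta> * lam p)} else {})" for p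
  define i where "i p = ii (X p) (lam p) (Z p) (h p - h' p)" for p
  \<comment> \<open>The value \<open>1\<close> for equal shifts is a dummy that keeps
    \<open>\<mu>\<close> positive.\<close>
  define \<mu> where "\<mu> p = (if h p = h' p then 1 else norm (h p - h' p) / lam p)" for p
  define Q where "Q p x = (\<theta> (X p) (x + h p) - \<theta> (X p) (x + h' p)) * inverse (\<mu> p)" for p x
  define b where "b p = piece N \<delta> (X p) (lam p) (Z p)" for p
  define g where "g p x = (if ok p then b p (x + h p) * cnj (b p (x + h' p)) else 0)" for p x
  have l: "0 < lam p" for p using lam1[of p] by simp
  have \<mu>: "0 < \<mu> p" for p using l by (simp add: \<mu>_def)
  have W: "open (W p)" "convex (W p)" for p by (auto simp: W_def)
  have Wn: "lam p / 8 \<le> norm x \<and> norm x < 5 * lam p \<and> x \<noteq> 0" if "x \<in> W p" for p x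
  proof -
    have x: "ok p" "dist (Z p) x < 2 * \<delta> * lam p" using that by (auto simp: W_def split: if_splits)
    have "2 * \<delta> * lam p \<le> 1/16 * lam p" using \<delta>(2) l by (intro mult_right_mono) (auto simp: less_imp_le)
    moreover have "norm (Z p) \<le> norm x + dist (Z p) x" "norm x \<le> norm (Z p) + dist (Z p) x"
      by (metis add.commute dist_norm norm_triangle_sub, metis add.commute dist_commute dist_norm norm_triangle_sub)
    ultimately have "lam p / 8 \<le> norm x \<and> norm x < 5 * lam p" using x l[of p] unfolding ok_def by argo
    then show ?thesis using l[of p] by auto
  qed
  have inv: "inverse (lam p) \<le> lam p powr - \<rho>" for p
    using powr_mono[of "-1" "-\<rho>" "lam p"] rho lam1[of p] l[of p] by (simp add: powr_minus)
  have U: "open (U p)" for p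
    unfolding U_def using open_Int[OF open_translate_vimage[OF W(1)] open_translate_vimage[OF W(1)], of "h p" p "h' p" p]
    by (simp add: Int_def)
  have dth: "\<theta> (X p) differentiable at (x + h p)" "\<theta> (X p) differentiable at (x + h' p)" if "x \<in> U p" for p x
  proof -
    have "x + h p \<noteq> 0" "x + h' p \<noteq> 0"
      using that Wn[of "x + h p" p] Wn[of "x + h' p" p] unfolding U_def by auto
    then show "\<theta> (X p) differentiable at (x + h p)" "\<theta> (X p) differentiable at (x + h' p)"
      using th_differentiable[of "x + h p" "[]" "X p"] th_differentiable[of "x + h' p" "[]" "X p"] by simp_all
  qed
  have pQ: "partial j (Q p) x = inverse (\<mu> p) * (partial j (\<theta> (X p)) (x + h p) - partial j (\<theta> (X p)) (x + h' p))"
    "Q p differentiable at x" if "x \<in> U p" for p x j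
  proof -
    note D = partial_translate_diff[OF dth[OF that]]
    show "partial j (Q p) x = inverse (\<mu> p) * (partial j (\<theta> (X p)) (x + h p) - partial j (\<theta> (X p)) (x + h' p))"
      unfolding Q_def using partial_linear[OF bounded_linear_mult_left D(2), of j "inverse (\<mu> p)"] D(1) by simp
    show "Q p differentiable at x" unfolding Q_def using D(2) by (intro differentiable_mult) auto
  qed
  have "\<exists>A\<ge>0. \<forall>p. norm (LBINT x. cis (\<mu> p * Q p x) * g p x) \<le> A * (lam p powr m * lam p powr m) * (lam p powr - \<rho> / \<mu> p) ^ k * measure lborel (K p)"
  proof (rule nonstationary_phase[OF U, where i=i and c=c1])
    show "closed (K p)" for p
    proof -
      have "closed {x. x + h p \<in> cball (Z p) (\<delta> * lam p) \<and> x + h' p \<in> cball (Z p) (\<delta> * lam p)}"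
        unfolding mem_cball by (intro closed_Collect_conj closed_Collect_le continuous_intros)
      then show ?thesis by (simp add: K_def)
    qed
    show "bounded (K p)" for p
      by (rule bounded_subset[OF bounded_cball[of "Z p - h p" "\<delta> * lam p"]]) (auto simp: K_def dist_norm algebra_simps)
    show "K p \<subseteq> U p" for p
    proof -
      have "\<delta> * lam p < 2 * \<delta> * lam p" using \<delta> l[of p] by simp
      then show ?thesis by (auto simp: K_def U_def W_def)
    qed
    show "0 \<le> lam p powr - \<rho>" for p by simp
    show "0 < \<mu> p" for p by (rule \<mu>)
    show "Q p differentiable at x" if "x \<in> U p" for p x by (rule pQ[OF that])
    show "0 < c1" by (rule c1)
    show "c1 \<le> \<bar>partial (i p) (Q p) x\<bar>" if x: "x \<in> U p" for p x
    proof -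
      have ok: "ok p" and in_ball: "x + h p \<in> ball (Z p) (2 * \<delta> * lam p)" "x + h' p \<in> ball (Z p) (2 * \<delta> * lam p)"
        using x by (auto simp: U_def W_def split: if_splits)
      have "c1 * norm (h p - h' p) / lam p \<le> \<bar>partial (i p) (\<theta> (X p)) (x + h p) - partial (i p) (\<theta> (X p)) (x + h' p)\<bar>"
        using ii[rule_format, of "lam p" "Z p" "h p - h' p" "X p", OF _ in_ball] ok l[of p] by (simp add: ok_def i_def)
      then have "c1 * \<mu> p \<le> \<bar>partial (i p) (\<theta> (X p)) (x + h p) - partial (i p) (\<theta> (X p)) (x + h' p)\<bar>"
        using ok by (simp add: ok_def \<mu>_def)
      then show ?thesis unfolding pQ(1)[OF x] using \<mu>[of p] by (simp add: abs_mult field_simps)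
    qed
    show "symb k U (\<lambda>p. lam p powr - \<rho>) (\<lambda>p. 1) (\<lambda>p. partial (i p) (Q p))"
    proof (rule symb_cong[OF U])
      \<comment> \<open>One order more than required, since \<open>symb_difference\<close> spends
        it.\<close>
      have "symb (Suc k) W (\<lambda>p. inverse (lam p)) (\<lambda>p. 1) (\<lambda>p. partial (i p) (\<theta> (X p)))"
        by (rule symb_choice[where g = "\<lambda>i p. partial i (\<theta> (X p))"], rule symb_th)
          (use l Wn in \<open>auto simp: less_imp_le\<close>)
      from symb_difference[OF this W(1,2), of h h']
      have "symb k U (\<lambda>p. inverse (lam p)) (\<lambda>p. 1 * inverse (lam p) * norm (h p - h' p))
         (\<lambda>p x. partial (i p) (\<theta> (X p)) (x + h p) - partial (i p) (\<theta> (X p)) (x + h' p))"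
        using l by (simp add: U_def[abs_def] less_imp_le)
      moreover have "symb k U (\<lambda>p. inverse (lam p)) (\<lambda>p. inverse (\<mu> p)) (\<lambda>p x. inverse (\<mu> p))"
        by (rule symb_const[where A=1]) (use \<mu> in \<open>simp add: less_imp_le\<close>)
      ultimately have "symb k U (\<lambda>p. inverse (lam p)) (\<lambda>p. inverse (\<mu> p) * (1 * inverse (lam p) * norm (h p - h' p)))
         (\<lambda>p x. inverse (\<mu> p) * (partial (i p) (\<theta> (X p)) (x + h p) - partial (i p) (\<theta> (X p)) (x + h' p)))"
        by (intro symb_mult U) (use l \<mu> in \<open>auto simp: less_imp_le\<close>)
      then show "symb k U (\<lambda>p. lam p powr - \<rho>) (\<lambda>p. 1)
         (\<lambda>p x. inverse (\<mu> p) * (partial (i p) (\<theta> (X p)) (x + h p) - partial (i p) (\<theta> (X p)) (x + h' p)))"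
      proof (rule symb_mono[where C=1 and D=1])
        show "inverse (\<mu> p) * (1 * inverse (lam p) * norm (h p - h' p)) \<le> 1 * 1" for p
        proof (cases "h p = h' p")
          case False
          then show ?thesis using l[of p] by (simp add: \<mu>_def)
        qed simp
      qed (use l \<mu> inv in \<open>auto simp: less_imp_le\<close>)
    qed (simp add: pQ)
    show "symb k U (\<lambda>p. lam p powr - \<rho>) (\<lambda>p. lam p powr m * lam p powr m) g"
    proof (rule symb_cong[OF U])
      have b: "symb k W (\<lambda>p. lam p powr - \<rho>) (\<lambda>p. lam p powr m) b"
        unfolding b_def by (rule symb_piece[OF lam1 k \<delta>(1) W(1)]) (use Wn in \<open>auto simp: W_def mult.assoc\<close>)
      have 1: "symb k U (\<lambda>p. lam p powr - \<rho>) (\<lambda>p. lam p powr m) (\<lambda>p x. b p (x + h p))"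
        by (rule symb_subset[OF symb_translate[OF b W(1), of h]]) (auto simp: U_def)
      have "symb k U (\<lambda>p. lam p powr - \<rho>) (\<lambda>p. lam p powr m) (\<lambda>p x. b p (x + h' p))"
        by (rule symb_subset[OF symb_translate[OF b W(1), of h']]) (auto simp: U_def)
      then have 2: "symb k U (\<lambda>p. lam p powr - \<rho>) (\<lambda>p. lam p powr m) (\<lambda>p x. cnj (b p (x + h' p)))"
        by (rule symb_linear[OF bounded_linear_cnj _ U]) auto
      show "symb k U (\<lambda>p. lam p powr - \<rho>) (\<lambda>p. lam p powr m * lam p powr m) (\<lambda>p x. b p (x + h p) * cnj (b p (x + h' p)))"
        by (rule symb_mult[OF 1 2 U]) auto
    qed (auto simp: g_def U_def W_def split: if_splits)
    show "g p x = 0" if "x \<notin> K p" for p x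
    proof -
      have "0 < \<delta> * lam p" using \<delta> l[of p] by simp
      then show ?thesis using that bump_zero[of N "\<delta> * lam p" "x + h p" "Z p"] bump_zero[of N "\<delta> * lam p" "x + h' p" "Z p"] k
        by (auto simp: g_def K_def b_def piece_def split: if_splits)
    qed
  qed auto
  then obtain A where A: "0 \<le> A" "\<And>p. norm (LBINT x. cis (\<mu> p * Q p x) * g p x) \<le> A * (lam p powr m * lam p powr m) * (lam p powr - \<rho> / \<mu> p) ^ k * measure lborel (K p)"
    by blast
  have clK: "closed (K p)" for p
  proof -
    have "closed {x. x + h p \<in> cball (Z p) (\<delta> * lam p) \<and> x + h' p \<in> cball (Z p) (\<delta> * lam p)}"
      unfolding mem_cball by (intro closed_Collect_conj closed_Collect_le continuous_intros)
    then show ?thesis by (simp add: K_def)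
  qed
  show ?thesis
  proof (rule exI[of _ A], intro conjI allI impI A(1))
    fix p
    assume a: "lam p / 4 \<le> norm (Z p) \<and> norm (Z p) \<le> 4 * lam p \<and>
      (h p - h' p) $ kk (X p) (lam p) (Z p) = 0 \<and> h p \<noteq> h' p"
    have ok: "ok p" using a by (simp add: ok_def)
    have \<mu>p: "\<mu> p = norm (h p - h' p) / lam p" using a by (simp add: \<mu>_def)
    have "\<mu> p * Q p \<xi> = \<theta> (X p) (\<xi> + h p) - \<theta> (X p) (\<xi> + h' p)" for \<xi> using \<mu>[of p] by (simp add: Q_def)
    then have "norm (LBINT \<xi>. cis (\<theta> (X p) (\<xi> + h p) - \<theta> (X p) (\<xi> + h' p)) * (piece N \<delta> (X p) (lam p) (Z p) (\<xi> + h p) * cnj (piece N \<delta> (X p) (lam p) (Z p) (\<xi> + h' p))))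
        = norm (LBINT x. cis (\<mu> p * Q p x) * g p x)"
      using ok by (simp add: g_def b_def)
    also have "\<dots> \<le> A * (lam p powr m * lam p powr m) * (lam p powr - \<rho> / \<mu> p) ^ k * measure lborel (K p)" by (rule A)
    also have "\<dots> \<le> A * (lam p powr m * lam p powr m) * (lam p powr - \<rho> / \<mu> p) ^ k * measure lborel (cball (0::real^'n) (\<delta> * lam p))"
    proof (rule mult_left_mono[OF measure_le_cball[OF clK]])
      show "K p \<subseteq> cball (Z p - h p) (\<delta> * lam p)" by (auto simp: K_def dist_norm algebra_simps)
      show "0 \<le> A * (lam p powr m * lam p powr m) * (lam p powr - \<rho> / \<mu> p) ^ k" using A(1) \<mu>[of p] by simp
    qed
    also have "lam p powr - \<rho> / \<mu> p = lam p powr - \<rho> * lam p / norm (h p - h' p)" unfolding \<mu>p by simp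
    also have "lam p powr m * lam p powr m = (lam p powr m)\<^sup>2" by (simp add: power2_eq_square)
    finally show "norm (LBINT \<xi>. cis (\<theta> (X p) (\<xi> + h p) - \<theta> (X p) (\<xi> + h' p)) * (piece N \<delta> (X p) (lam p) (Z p) (\<xi> + h p) * cnj (piece N \<delta> (X p) (lam p) (Z p) (\<xi> + h' p))))
      \<le> A * (lam p powr m)\<^sup>2 * (lam p powr - \<rho> * lam p / norm (h p - h' p)) ^ k * measure lborel (cball (0::real^'n) (\<delta> * lam p))" .
  qed
qed

text \<open>Serves the diagonal terms, where equal shifts leave no oscillation to exploit.\<close>

lemma piece_bound:
  obtains A where "0 \<le> A" "\<And>N \<delta> x l \<zeta> \<xi>. 0 < N \<Longrightarrow> 1 \<le> l \<Longrightarrow> norm (piece N \<delta> x l \<zeta> \<xi>) \<le> A * l powr m"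
proof -
  obtain C where C: "0 \<le> C" "\<And>x \<xi>. norm (partials [] (a x) \<xi>) \<le> C * jbracket \<xi> powr (m - \<rho> * real (length ([]::'n list)))"
    using a_partial_bound[of "[]"] by blast
  have "norm (piece N \<delta> x l \<zeta> \<xi>) \<le> (C * 2 powr - m) * l powr m" if N: "0 < N" and l: "1 \<le> l" for N \<delta> x l \<zeta> \<xi>
  proof (cases "\<xi> \<in> annulus' l")
    case True
    have "jbracket \<xi> powr m \<le> (l / 2) powr m"
      by (rule powr_mono2') (use m_neg True l jbracket_ge(2)[of \<xi>] in \<open>auto simp: annulus'_def\<close>)
    also have "\<dots> = 2 powr - m * l powr m"
      unfolding powr_divide powr_minus[of 2] by (simp only: divide_inverse inverse_inverse_eq mult.commute)
    finally have "C * jbracket \<xi> powr m \<le> C * (2 powr - m * l powr m)" by (rule mult_left_mono[OF _ C(1)])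
    then have 1: "norm (a x \<xi>) \<le> (C * 2 powr - m) * l powr m" using C(2)[of x \<xi>] by (simp add: mult.assoc)
    have 2: "\<bar>shell N l \<xi>\<bar> \<le> 1"
      using cutoff_bounds[of N l \<xi>] cutoff_bounds[of N "l/2" \<xi>] unfolding shell_def by linarith
    have "\<bar>bump N (\<delta> * l) \<zeta> \<xi>\<bar> \<le> 1" by (auto simp: bump_def pospow_def max_def intro!: power_le_one)
    with 1 2 have "norm (a x \<xi>) * \<bar>shell N l \<xi>\<bar> * \<bar>bump N (\<delta> * l) \<zeta> \<xi>\<bar> \<le> (C * 2 powr - m) * l powr m * 1 * 1"
      using C(1) by (intro mult_mono) auto
    then show ?thesis by (simp add: piece_def norm_mult)
  next
    case False
    then show ?thesis using shell_zero[OF N _ False] l C(1) by (simp add: piece_def)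
  qed
  then show ?thesis using that[of "C * 2 powr - m"] C(1) by simp
qed

lemma high_continuous:
  assumes "1 < N" "1 \<le> l"
  shows "continuous_on UNIV (high N x l)" "\<xi> \<notin> annulus' l \<Longrightarrow> high N x l \<xi> = 0"
proof -
  have z: "high N x l \<xi> = 0" if "\<xi> \<notin> annulus' l" for \<xi>
    using shell_zero[OF _ _ that] assms by (simp add: high_def)
  then show "\<xi> \<notin> annulus' l \<Longrightarrow> high N x l \<xi> = 0" .
  \<comment> \<open>The one-point parameter space extracts differentiability of a single function
    from the uniform bound.\<close>
  have "symb (Suc 0) (\<lambda>p::unit. annulus l) (\<lambda>p. 1) (\<lambda>p. l powr m) (\<lambda>p. high N x l)"
    by (rule symb_high) (use assms in auto)
  from symb_SucD(1)[OF this] have d: "high N x l differentiable at \<xi>" if "\<xi> \<in> annulus l" for \<xi> using that by auto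
  show "continuous_on UNIV (high N x l)"
    by (rule continuous_on_differentiable_UNIV)
      (rule differentiable_zero_extension[OF annulus(1,2,4) z d], use assms in auto)
qed

text \<open>The shifts are \<open>\<lambda>\<^bsup>1-\<rho>\<^esup> \<mu>\<close>, where \<open>\<mu>\<close> has integer coordinates in \<open>[0, \<lambda>\<^sup>\<rho>)\<close> and
  \<open>\<mu>\<^sub>k = 0\<close>; the order \<open>2 n\<close> in the almost orthogonality makes the double sum over the shifts
  comparable to its diagonal.\<close>

lemma local_sup_bound:
  assumes \<delta>: "0 < \<delta>" "\<delta> \<le> 1/32" and c1: "0 < c1" and N: "2 * CARD('n) < N"
    and nd: "\<And>x l \<zeta> d. 0 < l \<Longrightarrow> l / 4 \<le> norm \<zeta> \<Longrightarrow> norm \<zeta> \<le> 4 * l \<Longrightarrow> d $ kk x l \<zeta> = 0 \<Longrightarrow>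
      (\<exists>i. \<forall>y\<in>ball \<zeta> (2 * \<delta> * l). \<forall>y'\<in>ball \<zeta> (2 * \<delta> * l). y - y' = d \<longrightarrow>
        c1 * norm d / l \<le> \<bar>partial i (\<theta> x) y - partial i (\<theta> x) y'\<bar>)"
  obtains A where "0 \<le> A" "\<And>x z j \<zeta>. 2 ^ j / 4 \<le> norm \<zeta> \<Longrightarrow> norm \<zeta> \<le> 4 * 2 ^ j \<Longrightarrow>
    norm (LBINT \<xi>. cis (z \<bullet> \<xi>) * high N x (2 ^ j) \<xi> * of_real (bump N (\<delta> * 2 ^ j) \<zeta> \<xi>))
      \<le> A * (2 ^ j) powr (m + real CARD('n) - \<rho> * (real CARD('n) - 1) / 2)"
proof -
  let ?n = "real CARD('n)"
  define V where "V = measure lborel (ball (0::real^'n) 1)"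
  have V: "0 < V" unfolding V_def using content_ball_pos[of 1 "0::real^'n"] by simp
  have cb: "measure lborel (cball (0::real^'n) r) = r ^ CARD('n) * V" if "0 \<le> r" for r
    using content_ball_conv_unit_ball[OF that, of "0::real^'n"] by (simp add: content_cball_conv_ball V_def)
  obtain A0 where A0: "0 \<le> A0" "\<And>N \<delta> x l \<zeta> \<xi>. 0 < N \<Longrightarrow> 1 \<le> l \<Longrightarrow> norm (piece N \<delta> x l \<zeta> \<xi>) \<le> A0 * l powr m"
    using piece_bound by blast
  obtain A1 where A1: "0 \<le> A1" "\<And>x j \<zeta> h h'. 2 ^ j / 4 \<le> norm \<zeta> \<Longrightarrow> norm \<zeta> \<le> 4 * 2 ^ j \<Longrightarrow>
      (h - h') $ kk x (2 ^ j) \<zeta> = 0 \<Longrightarrow> h \<noteq> h' \<Longrightarrow>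
    norm (LBINT \<xi>. cis (\<theta> x (\<xi> + h) - \<theta> x (\<xi> + h')) *
        (piece N \<delta> x (2 ^ j) \<zeta> (\<xi> + h) * cnj (piece N \<delta> x (2 ^ j) \<zeta> (\<xi> + h'))))
      \<le> A1 * ((2 ^ j) powr m)\<^sup>2 * ((2 ^ j) powr - \<rho> * 2 ^ j / norm (h - h')) ^ (2 * CARD('n)) * measure lborel (cball (0::real^'n) (\<delta> * 2 ^ j))"
  proof -
    \<comment> \<open>Point, dyadic exponent, centre and both shifts are packed into one tuple;
      hence \<open>A1\<close> is independent of all of them.\<close>
    have lam1: "1 \<le> (2::real) ^ fst (snd p)" for p :: "(real^'n) \<times> nat \<times> (real^'n) \<times> (real^'n) \<times> (real^'n)" by simp
    note pe = pair_estimate[where X = fst and lam = "\<lambda>p. 2 ^ fst (snd p)" and Z = "\<lambda>p. fst (snd (snd p))"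
        and h = "\<lambda>p. fst (snd (snd (snd p)))" and h' = "\<lambda>p. snd (snd (snd (snd p)))", OF lam1 \<delta> c1 N nd]
    obtain A1 where A1: "0 \<le> A1" "\<forall>p::(real^'n) \<times> nat \<times> (real^'n) \<times> (real^'n) \<times> (real^'n).
       2 ^ fst (snd p) / 4 \<le> norm (fst (snd (snd p))) \<and> norm (fst (snd (snd p))) \<le> 4 * 2 ^ fst (snd p) \<and>
       (fst (snd (snd (snd p))) - snd (snd (snd (snd p)))) $ kk (fst p) (2 ^ fst (snd p)) (fst (snd (snd p))) = 0 \<and>
       fst (snd (snd (snd p))) \<noteq> snd (snd (snd (snd p))) \<longrightarrow>
      norm (LBINT \<xi>. cis (\<theta> (fst p) (\<xi> + fst (snd (snd (snd p)))) - \<theta> (fst p) (\<xi> + snd (snd (snd (snd p))))) *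
        (piece N \<delta> (fst p) (2 ^ fst (snd p)) (fst (snd (snd p))) (\<xi> + fst (snd (snd (snd p)))) *
         cnj (piece N \<delta> (fst p) (2 ^ fst (snd p)) (fst (snd (snd p))) (\<xi> + snd (snd (snd (snd p)))))))
      \<le> A1 * ((2 ^ fst (snd p)) powr m)\<^sup>2 * ((2 ^ fst (snd p)) powr - \<rho> * 2 ^ fst (snd p) / norm (fst (snd (snd (snd p))) - snd (snd (snd (snd p))))) ^ (2 * CARD('n))
        * measure lborel (cball (0::real^'n) (\<delta> * 2 ^ fst (snd p)))"
      using pe by blast
    have "norm (LBINT \<xi>. cis (\<theta> x (\<xi> + h) - \<theta> x (\<xi> + h')) *
        (piece N \<delta> x (2 ^ j) \<zeta> (\<xi> + h) * cnj (piece N \<delta> x (2 ^ j) \<zeta> (\<xi> + h'))))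
      \<le> A1 * ((2 ^ j) powr m)\<^sup>2 * ((2 ^ j) powr - \<rho> * 2 ^ j / norm (h - h')) ^ (2 * CARD('n)) * measure lborel (cball (0::real^'n) (\<delta> * 2 ^ j))"
      if "2 ^ j / 4 \<le> norm \<zeta>" "norm \<zeta> \<le> 4 * 2 ^ j" "(h - h') $ kk x (2 ^ j) \<zeta> = 0" "h \<noteq> h'" for x j \<zeta> h h'
      using A1(2)[rule_format, of "(x, j, \<zeta>, h, h')"] that by simp
    then show ?thesis by (rule that[OF A1(1)])
  qed
  obtain T where T: "0 < T" "\<And>(a::nat) M. (\<Sum>l<M. inverse ((max 1 \<bar>real a - real l\<bar>)\<^sup>2)) \<le> T"
    using inverse_square_sum_bound by blast
  define A' where "A' = A1 + A0\<^sup>2"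
  define C where "C = A' * T ^ (CARD('n) - 1) * (1 + ?n) ^ CARD('n) * V\<^sup>2"
  have A'0: "0 \<le> A'" "A1 \<le> A'" "A0\<^sup>2 \<le> A'" using A1(1) by (auto simp: A'_def)
  have C0: "0 \<le> C" using A'0 T(1) by (simp add: C_def)
  show ?thesis
  proof (rule that[of "sqrt C"])
    fix x z \<zeta> :: "real^'n" and j :: nat
    define l :: real where "l = 2 ^ j"
    assume "2 ^ j / 4 \<le> norm \<zeta>" "norm \<zeta> \<le> 4 * 2 ^ j"
    note \<zeta> = this
    have l: "1 \<le> l" "0 < l" by (auto simp: l_def)
    define k where "k = kk x l \<zeta>"
    define s where "s = l powr (1 - \<rho>)"
    define M where "M = nat \<lceil>l powr \<rho>\<rceil>"
    \<comment> \<open>Extensionality fixes the value at \<open>k\<close>, so distinct members of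
      \<open>I\<close> differ in another coordinate and give distinct shifts.\<close>
    define I where "I = PiE (UNIV - {k}) (\<lambda>_. {..<M})"
    define h :: "('n \<Rightarrow> nat) \<Rightarrow> real^'n" where "h f = (\<chi> i. if i = k then 0 else s * real (f i))" for f
    define F where "F \<xi> = cis (z \<bullet> \<xi>) * high N x l \<xi> * of_real (bump N (\<delta> * l) \<zeta> \<xi>)" for \<xi>
    \<comment> \<open>The share of the decay charged to one coordinate. It is \<open>1\<close> for
      equal entries, so the diagonal terms obey the same product bound.\<close>
    define q where "q a b = inverse ((max 1 \<bar>real a - real b\<bar>)\<^sup>2)" for a b :: nat
    have q0: "0 \<le> q a b" for a b by (simp add: q_def)
    have s0: "0 < s" using l by (simp add: s_def)
    have sl: "s = l powr - \<rho> * l" using l powr_add[of l "-\<rho>" 1] by (simp add: s_def algebra_simps)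
    have lr: "1 \<le> l powr \<rho>" using ge_one_powr_ge_zero[of l \<rho>] l rho by simp
    have M: "l powr \<rho> \<le> real M" "real M < l powr \<rho> + 1" "1 \<le> M" unfolding M_def using lr by linarith+
    have finI: "finite I" unfolding I_def by (intro finite_PiE) auto
    have cardI: "card I = M ^ (CARD('n) - 1)" unfolding I_def by (subst card_PiE) (auto simp: card_Diff_singleton)
    have dl: "0 < \<delta> * l" "\<delta> * l \<le> l" using \<delta> l by auto
    have "0 < CARD('n)" by simp
    then have N1: "1 < N" using N by linarith
    then have N0: "0 < N" by simp
    have hk: "(h f - h g) $ k = 0" for f g by (simp add: h_def)
    have hnorm: "norm (h f) \<le> ?n * l" if f: "f \<in> I" for f
    proof -
      have "norm (h f) \<le> (\<Sum>i\<in>UNIV. \<bar>h f $ i\<bar>)" by (rule norm_le_l1_cart)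
      also have "\<dots> \<le> (\<Sum>i\<in>(UNIV::'n set). l)"
      proof (rule sum_mono)
        fix i
        show "\<bar>h f $ i\<bar> \<le> l"
        proof (cases "i = k")
          case False
          then have "f i < M" using f by (auto simp: I_def PiE_def)
          then have "real (f i) + 1 \<le> real M" by linarith
          then have "real (f i) \<le> l powr \<rho>" using M(2) by linarith
          then have "s * real (f i) \<le> s * l powr \<rho>" using s0 by (intro mult_left_mono) auto
          also have "s * l powr \<rho> = l" using l by (simp add: s_def flip: powr_add)
          finally show ?thesis using False s0 by (simp add: h_def)
        qed (use l in \<open>simp add: h_def\<close>)
      qed
      finally show ?thesis by simp
    qed
    have Feq: "F \<xi> = cis (z \<bullet> \<xi> + \<theta> x \<xi>) * piece N \<delta> x l \<zeta> \<xi>" for \<xi>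
      by (simp add: F_def high_def piece_def mult_ac flip: cis_mult)
    have pair: "norm (LBINT \<xi>. F (\<xi> + h f) * cnj (F (\<xi> + h g)))
        \<le> A' * (l powr m)\<^sup>2 * (\<Prod>i\<in>UNIV - {k}. q (f i) (g i)) * measure lborel (cball (0::real^'n) (\<delta> * l))"
      if f: "f \<in> I" and g: "g \<in> I" for f g
    proof -
      define P where "P \<xi> = cis (\<theta> x (\<xi> + h f) - \<theta> x (\<xi> + h g)) * (piece N \<delta> x l \<zeta> (\<xi> + h f) * cnj (piece N \<delta> x l \<zeta> (\<xi> + h g)))" for \<xi>
      \<comment> \<open>The linear phase in \<open>z\<close> cancels up to a constant of modulus
        \<open>1\<close>; this makes the bound uniform in \<open>z\<close>.\<close>
      have "F (\<xi> + h f) * cnj (F (\<xi> + h g)) = cis (z \<bullet> (h f - h g)) * P \<xi>" for \<xi>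
      proof -
        have "cis (z \<bullet> (\<xi> + h f) + \<theta> x (\<xi> + h f)) * cis (- (z \<bullet> (\<xi> + h g) + \<theta> x (\<xi> + h g)))
            = cis (z \<bullet> (h f - h g)) * cis (\<theta> x (\<xi> + h f) - \<theta> x (\<xi> + h g))"
          unfolding cis_mult by (simp add: inner_diff_right inner_add_right algebra_simps)
        then show ?thesis unfolding Feq P_def by (simp add: cis_cnj mult_ac)
      qed
      then have eq: "norm (LBINT \<xi>. F (\<xi> + h f) * cnj (F (\<xi> + h g))) = norm (LBINT \<xi>. P \<xi>)"
        by (simp add: norm_mult)
      show ?thesis
      proof (cases "f = g")
        case True
        have "norm (LBINT \<xi>. P \<xi>) \<le> (A0 * l powr m)\<^sup>2 * measure lborel (cball (\<zeta> - h f) (\<delta> * l))"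
        proof (rule integral_bound_support)
          show "P \<xi> = 0" if "\<xi> \<notin> cball (\<zeta> - h f) (\<delta> * l)" for \<xi>
          proof -
            have "\<xi> + h f \<notin> cball \<zeta> (\<delta> * l)" using that by (auto simp: dist_norm algebra_simps)
            then have "bump N (\<delta> * l) \<zeta> (\<xi> + h f) = 0" by (rule bump_zero[OF N0 dl(1)])
            then show ?thesis by (simp add: P_def piece_def)
          qed
          show "norm (P \<xi>) \<le> (A0 * l powr m)\<^sup>2" for \<xi>
            using A0 N0 l by (simp add: P_def norm_mult power2_eq_square mult_mono)
        qed auto
        also have "\<dots> = A0\<^sup>2 * (l powr m)\<^sup>2 * (\<Prod>i\<in>UNIV - {k}. q (f i) (g i)) * measure lborel (cball (0::real^'n) (\<delta> * l))"
          using measure_cball_translate[of "\<zeta> - h f" "\<delta> * l"] by (simp add: True q_def power_mult_distrib)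
        also have "\<dots> \<le> A' * (l powr m)\<^sup>2 * (\<Prod>i\<in>UNIV - {k}. q (f i) (g i)) * measure lborel (cball (0::real^'n) (\<delta> * l))"
          using A'0 q0 by (intro mult_right_mono prod_nonneg) auto
        finally show ?thesis unfolding eq .
      next
        case False
        then obtain i0 where i0: "f i0 \<noteq> g i0" by auto
        then have i0k: "i0 \<noteq> k" using f g by (auto simp: I_def PiE_def extensional_def)
        define d where "d = norm (h f - h g)"
        have di: "s * \<bar>real (f i) - real (g i)\<bar> \<le> d" if "i \<noteq> k" for i
          using component_le_norm_cart[of "h f - h g" i] that s0 by (simp add: h_def d_def abs_mult flip: right_diff_distrib)
        have "1 \<le> \<bar>real (f i0) - real (g i0)\<bar>" using i0 by linarith
        then have "s * 1 \<le> s * \<bar>real (f i0) - real (g i0)\<bar>" using s0 by (intro mult_left_mono) auto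
        then have sd: "s \<le> d" using di[OF i0k] by linarith
        have d0: "0 < d" using sd s0 by linarith
        have ne: "h f \<noteq> h g" using d0 by (auto simp: d_def)
        have qi: "(s / d)\<^sup>2 \<le> q (f i) (g i)" if "i \<in> UNIV - {k}" for i
        proof -
          have "max 1 \<bar>real (f i) - real (g i)\<bar> \<le> d / s"
          proof (rule max.boundedI)
            show "1 \<le> d / s" using sd s0 by simp
            show "\<bar>real (f i) - real (g i)\<bar> \<le> d / s"
              using di[of i] that s0 by (simp add: le_divide_eq mult.commute)
          qed
          then have "(max 1 \<bar>real (f i) - real (g i)\<bar>)\<^sup>2 \<le> (d / s)\<^sup>2" by (rule power_mono) simp
          then have "inverse ((d / s)\<^sup>2) \<le> q (f i) (g i)" unfolding q_def
            by (rule le_imp_inverse_le, intro zero_less_power less_le_trans[OF zero_less_one max.cobounded1])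
          then show ?thesis by (simp add: power_divide inverse_eq_divide)
        qed
        \<comment> \<open>Each coordinate difference is at most \<open>d / s\<close>, so two powers
          of \<open>s / d\<close> pay for each of the \<open>n - 1\<close> coordinates; the order
          \<open>2 n\<close> is more than sufficient and \<open>s / d \<le> 1\<close>.\<close>
        have "(s / d) ^ (2 * CARD('n)) \<le> ((s / d)\<^sup>2) ^ (CARD('n) - 1)"
          unfolding power_mult by (rule power_decreasing) (use s0 d0 sd in \<open>auto simp: power_le_one\<close>)
        also have "\<dots> = (\<Prod>i\<in>UNIV - {k}. (s / d)\<^sup>2)" by (simp add: card_Diff_singleton)
        also have "\<dots> \<le> (\<Prod>i\<in>UNIV - {k}. q (f i) (g i))" by (rule prod_mono) (use qi in auto)
        finally have pr: "(s / d) ^ (2 * CARD('n)) \<le> (\<Prod>i\<in>UNIV - {k}. q (f i) (g i))" .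
        have "norm (LBINT \<xi>. P \<xi>) \<le> A1 * (l powr m)\<^sup>2 * (s / d) ^ (2 * CARD('n)) * measure lborel (cball (0::real^'n) (\<delta> * l))"
          unfolding P_def d_def sl unfolding l_def by (rule A1(2)[OF \<zeta> _ ne]) (use hk in \<open>simp add: k_def l_def\<close>)
        also have "\<dots> \<le> A' * (l powr m)\<^sup>2 * (\<Prod>i\<in>UNIV - {k}. q (f i) (g i)) * measure lborel (cball (0::real^'n) (\<delta> * l))"
          using A'0 pr s0 d0 by (intro mult_mono mult_right_mono) auto
        finally show ?thesis unfolding eq .
      qed
    qed
    define D where "D = A' * (l powr m)\<^sup>2 * measure lborel (cball (0::real^'n) (\<delta> * l))"
    have D0: "0 \<le> D" using A'0 by (simp add: D_def)
    have "(\<Sum>f\<in>I. \<Sum>g\<in>I. norm (LBINT \<xi>. F (\<xi> + h f) * cnj (F (\<xi> + h g))))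
        \<le> (\<Sum>f\<in>I. \<Sum>g\<in>I. D * (\<Prod>i\<in>UNIV - {k}. q (f i) (g i)))"
      using pair by (intro sum_mono) (simp add: D_def mult_ac)
    \<comment> \<open>The sum of a product over all functions factorises into one sum per
      coordinate, each of them bounded by \<open>T\<close>.\<close>
    also have "\<dots> = (\<Sum>f\<in>I. D * (\<Prod>i\<in>UNIV - {k}. \<Sum>b<M. q (f i) b))"
      unfolding I_def by (subst prod_sum_PiE) (auto simp: sum_distrib_left)
    also have "\<dots> \<le> (\<Sum>f\<in>I. D * T ^ (CARD('n) - 1))"
    proof (rule sum_mono, rule mult_left_mono[OF _ D0])
      fix f
      have "(\<Prod>i\<in>UNIV - {k}. \<Sum>b<M. q (f i) b) \<le> (\<Prod>i\<in>UNIV - {k}. T)"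
        by (rule prod_mono) (use T(2) in \<open>auto simp: q_def sum_nonneg\<close>)
      then show "(\<Prod>i\<in>UNIV - {k}. \<Sum>b<M. q (f i) b) \<le> T ^ (CARD('n) - 1)" by (simp add: card_Diff_singleton)
    qed
    also have "\<dots> = real (card I) * (D * T ^ (CARD('n) - 1))" by simp
    finally have sums: "(\<Sum>f\<in>I. \<Sum>g\<in>I. norm (LBINT \<xi>. F (\<xi> + h f) * cnj (F (\<xi> + h g)))) \<le> real (card I) * (D * T ^ (CARD('n) - 1))" .
    have cF: "continuous_on UNIV F"
      unfolding F_def bump_def
      by (intro continuous_intros continuous_on_pospow high_continuous(1)) (use N1 l dl in auto)
    have "(real (card I) * norm (LBINT \<xi>. F \<xi>))\<^sup>2 \<le> measure lborel (cball \<zeta> (\<delta> * l + ?n * l)) *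
       (\<Sum>f\<in>I. \<Sum>g\<in>I. norm (LBINT \<xi>. F (\<xi> + h f) * cnj (F (\<xi> + h g))))"
      by (rule van_der_corput[OF cF _ hnorm finI]) (use bump_zero[OF N0 dl(1)] dl l in \<open>auto simp: F_def\<close>)
    also have "\<dots> \<le> ((1 + ?n) * l) ^ CARD('n) * V * (real (card I) * (D * T ^ (CARD('n) - 1)))"
    proof (rule mult_mono[OF _ sums])
      have "measure lborel (cball \<zeta> (\<delta> * l + ?n * l)) = (\<delta> * l + ?n * l) ^ CARD('n) * V"
        using dl l by (subst measure_cball_translate, subst cb) auto
      also have "\<dots> \<le> ((1 + ?n) * l) ^ CARD('n) * V"
        using dl l V by (intro mult_right_mono power_mono) (auto simp: algebra_simps)
      finally show "measure lborel (cball \<zeta> (\<delta> * l + ?n * l)) \<le> ((1 + ?n) * l) ^ CARD('n) * V" .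
    qed (use l V in \<open>auto simp: sum_nonneg\<close>)
    also have "D \<le> A' * (l powr m)\<^sup>2 * (l ^ CARD('n) * V)"
      unfolding D_def using cb[of "\<delta> * l"] dl l V A'0 by (intro mult_left_mono) (auto intro!: mult_right_mono power_mono)
    finally have "(real (card I) * norm (LBINT \<xi>. F \<xi>))\<^sup>2 \<le>
      ((1 + ?n) * l) ^ CARD('n) * V * (real (card I) * (A' * (l powr m)\<^sup>2 * (l ^ CARD('n) * V) * T ^ (CARD('n) - 1)))"
      using l V T(1) by (simp add: mult_left_mono mult_right_mono)
    also have "\<dots> = real (card I) * (C * (l powr m)\<^sup>2 * (l ^ CARD('n))\<^sup>2)"
      by (simp add: C_def power_mult_distrib power2_eq_square mult_ac)
    \<comment> \<open>The left side contains \<open>card I\<close> twice, the right side once for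
      the rows of the double sum. The surplus factor, at least
      \<open>l powr (\<rho> * (n - 1))\<close>, is the gain.\<close>
    finally have main: "real (card I) * (norm (LBINT \<xi>. F \<xi>))\<^sup>2 \<le> C * (l powr m)\<^sup>2 * (l ^ CARD('n))\<^sup>2"
    proof -
      have c: "0 < real (card I)" using M(3) by (simp add: cardI)
      assume "(real (card I) * norm (LBINT \<xi>. F \<xi>))\<^sup>2 \<le> real (card I) * (C * (l powr m)\<^sup>2 * (l ^ CARD('n))\<^sup>2)"
      then have "real (card I) * (real (card I) * (norm (LBINT \<xi>. F \<xi>))\<^sup>2) \<le> real (card I) * (C * (l powr m)\<^sup>2 * (l ^ CARD('n))\<^sup>2)"
        by (simp add: power2_eq_square mult_ac)
      then show ?thesis using c by simp
    qed
    have n1: "real (CARD('n) - 1) = ?n - 1" by (simp add: of_nat_diff Suc_leI)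
    have "l powr (\<rho> * (?n - 1)) = (l powr \<rho>) ^ (CARD('n) - 1)"
      using l by (simp add: powr_power n1 mult.commute)
    also have "\<dots> \<le> real (card I)" unfolding cardI using M(1) lr by (simp add: power_mono)
    finally have "l powr (\<rho> * (?n - 1)) * (norm (LBINT \<xi>. F \<xi>))\<^sup>2 \<le> C * (l powr m)\<^sup>2 * (l ^ CARD('n))\<^sup>2"
      using main mult_right_mono[of "l powr (\<rho> * (?n - 1))" "real (card I)" "(norm (LBINT \<xi>. F \<xi>))\<^sup>2"] by simp
    then have "l powr - (\<rho> * (?n - 1)) * (l powr (\<rho> * (?n - 1)) * (norm (LBINT \<xi>. F \<xi>))\<^sup>2) \<le> l powr - (\<rho> * (?n - 1)) * (C * (l powr m)\<^sup>2 * (l ^ CARD('n))\<^sup>2)"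
      by (rule mult_left_mono) simp
    then have "(norm (LBINT \<xi>. F \<xi>))\<^sup>2 \<le> C * (l powr - (\<rho> * (?n - 1)) * (l powr m)\<^sup>2 * (l ^ CARD('n))\<^sup>2)"
      using l by (simp add: mult_ac powr_minus)
    also have "l powr - (\<rho> * (?n - 1)) * (l powr m)\<^sup>2 * (l ^ CARD('n))\<^sup>2 = (l powr (m + ?n - \<rho> * (?n - 1) / 2))\<^sup>2"
    proof -
      have 1: "(l powr e)\<^sup>2 = l powr (2 * e)" for e using l by (simp add: powr_power)
      have 2: "l ^ CARD('n) = l powr ?n" using l by (simp add: powr_realpow)
      have 3: "- (\<rho> * (?n - 1)) + 2 * m + 2 * ?n = 2 * (m + ?n - \<rho> * (?n - 1) / 2)" by argo
      show ?thesis unfolding 2 1 powr_add[symmetric] 3 ..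
    qed
    finally have "norm (LBINT \<xi>. F \<xi>) \<le> sqrt (C * (l powr (m + ?n - \<rho> * (?n - 1) / 2))\<^sup>2)"
      by (rule real_le_rsqrt)
    also have "\<dots> = sqrt C * l powr (m + ?n - \<rho> * (?n - 1) / 2)" by (simp add: real_sqrt_mult)
    finally show "norm (LBINT \<xi>. cis (z \<bullet> \<xi>) * high N x (2 ^ j) \<xi> * of_real (bump N (\<delta> * 2 ^ j) \<zeta> \<xi>))
      \<le> sqrt C * (2 ^ j) powr (m + ?n - \<rho> * (?n - 1) / 2)"
      by (simp add: F_def l_def)
  qed (use C0 in simp)
qed

text \<open>Passing from local to global integrals costs the ratio of the volumes of the set of
  centres and of a ball of radius \<open>\<delta> * l / 2\<close>. Both scale like
  \<open>l ^ n\<close>, so \<open>A2\<close> does not depend on the scale.\<close>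

lemma high_sup_bound:
  assumes c: "0 < c" "\<And>x \<xi>. norm \<xi> = 1 \<Longrightarrow> c \<le> \<bar>det_corank1 (hessian (\<theta> x) \<xi>)\<bar>"
    and N: "2 * CARD('n) < N"
  obtains A where "0 \<le> A" "\<And>x z j. norm (LBINT \<xi>. cis (z \<bullet> \<xi>) * high N x (2 ^ j) \<xi>)
      \<le> A * (2 ^ j) powr (m + real CARD('n) - \<rho> * (real CARD('n) - 1) / 2)"
proof -
  let ?n = "real CARD('n)"
  let ?e = "m + ?n - \<rho> * (?n - 1) / 2"
  define V where "V = measure lborel (ball (0::real^'n) 1)"
  have V: "0 < V" unfolding V_def using content_ball_pos[of 1 "0::real^'n"] by simp
  have bl: "measure lborel (ball (0::real^'n) r) = r ^ CARD('n) * V" if "0 \<le> r" for r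
    using content_ball_conv_unit_ball[OF that, of "0::real^'n"] by (simp add: V_def)
  have cb: "measure lborel (cball (0::real^'n) r) = r ^ CARD('n) * V" if "0 \<le> r" for r
    using bl[OF that] by (simp add: content_cball_conv_ball)
  obtain \<delta> c1 :: real where \<delta>: "0 < \<delta>" "\<delta> \<le> 1/32" and c1: "0 < c1" and
    nd0: "\<And>x l \<zeta>. 0 < l \<Longrightarrow> l / 4 \<le> norm \<zeta> \<Longrightarrow> norm \<zeta> \<le> 4 * l \<Longrightarrow>
      \<exists>k. \<forall>d. d $ k = 0 \<longrightarrow> (\<exists>i. \<forall>y\<in>ball \<zeta> (2 * \<delta> * l). \<forall>y'\<in>ball \<zeta> (2 * \<delta> * l). y - y' = d \<longrightarrow>
        c1 * norm d / l \<le> \<bar>partial i (\<theta> x) y - partial i (\<theta> x) y'\<bar>)"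
    using nondegenerate[OF c] by blast
  have "\<forall>x l \<zeta>. \<exists>k. 0 < l \<and> l / 4 \<le> norm \<zeta> \<and> norm \<zeta> \<le> 4 * l \<longrightarrow>
      (\<forall>d. d $ k = 0 \<longrightarrow> (\<exists>i. \<forall>y\<in>ball \<zeta> (2 * \<delta> * l). \<forall>y'\<in>ball \<zeta> (2 * \<delta> * l). y - y' = d \<longrightarrow>
        c1 * norm d / l \<le> \<bar>partial i (\<theta> x) y - partial i (\<theta> x) y'\<bar>))"
    using nd0 by blast
  then obtain kk where kk: "\<forall>x l \<zeta>. 0 < l \<and> l / 4 \<le> norm \<zeta> \<and> norm \<zeta> \<le> 4 * l \<longrightarrow>
      (\<forall>d. d $ kk x l \<zeta> = 0 \<longrightarrow> (\<exists>i. \<forall>y\<in>ball \<zeta> (2 * \<delta> * l). \<forall>y'\<in>ball \<zeta> (2 * \<delta> * l). y - y' = d \<longrightarrow>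
        c1 * norm d / l \<le> \<bar>partial i (\<theta> x) y - partial i (\<theta> x) y'\<bar>))"
    unfolding choice_iff by blast
  obtain A where A: "0 \<le> A" "\<And>x z j \<zeta>. 2 ^ j / 4 \<le> norm \<zeta> \<Longrightarrow> norm \<zeta> \<le> 4 * 2 ^ j \<Longrightarrow>
    norm (LBINT \<xi>. cis (z \<bullet> \<xi>) * high N x (2 ^ j) \<xi> * of_real (bump N (\<delta> * 2 ^ j) \<zeta> \<xi>)) \<le> A * (2 ^ j) powr ?e"
    by (rule local_sup_bound[OF \<delta> c1 N, of kk]) (use kk in blast)+
  define A2 where "A2 = A * 4 ^ CARD('n) / ((3/4) ^ N * (\<delta> / 2) ^ CARD('n))"
  show ?thesis
  proof (rule that[of A2])
    show "0 \<le> A2" using A(1) \<delta> by (simp add: A2_def)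
    fix x z :: "real^'n" and j :: nat
    define l :: real where "l = 2 ^ j"
    have l: "1 \<le> l" "0 < l" by (auto simp: l_def)
    have dl: "0 < \<delta> * l" using \<delta> l by simp
    have "0 < CARD('n)" by simp
    then have N0: "0 < N" "1 < N" using N by linarith+
    define G where "G \<xi> = cis (z \<bullet> \<xi>) * high N x l \<xi>" for \<xi>
    define S where "S = {\<zeta>::real^'n. l / 4 \<le> norm \<zeta> \<and> norm \<zeta> \<le> 4 * l}"
    have cG: "continuous_on UNIV G" unfolding G_def by (intro continuous_intros high_continuous(1) N0 l)
    have zero: "(LBINT \<xi>. G \<xi> * of_real (bump N (\<delta> * l) \<zeta> \<xi>)) = 0" if "\<zeta> \<notin> S" for \<zeta>
    proof -
      have "G \<xi> * of_real (bump N (\<delta> * l) \<zeta> \<xi>) = 0" for \<xi>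
      proof (cases "\<xi> \<in> annulus' l \<and> \<xi> \<in> cball \<zeta> (\<delta> * l)")
        case True
        \<comment> \<open>A bump that meets the support of the shell has its centre between
          \<open>l / 2 - l / 32\<close> and \<open>2 * l + l / 32\<close>, hence in
          \<open>S\<close>.\<close>
        have "\<delta> * l \<le> 1/32 * l" using \<delta>(2) l by (intro mult_right_mono) auto
        moreover have "norm \<zeta> \<le> norm \<xi> + dist \<zeta> \<xi>" "norm \<xi> \<le> norm \<zeta> + dist \<zeta> \<xi>"
          by (metis add.commute dist_norm norm_triangle_sub, metis add.commute dist_commute dist_norm norm_triangle_sub)
        ultimately have "\<zeta> \<in> S" using True l unfolding S_def annulus'_def mem_Collect_eq mem_cball by argo
        then show ?thesis using that by simp
      next
        case False
        then show ?thesis using high_continuous(2)[OF N0(2) l(1)] bump_zero[OF N0(1) dl] by (auto simp: G_def)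
      qed
      then show ?thesis by (simp only: Bochner_Integration.integral_zero)
    qed
    have b: "norm (LBINT \<xi>. G \<xi> * of_real (bump N (\<delta> * l) \<zeta> \<xi>)) \<le> A * l powr ?e" for \<zeta>
    proof (cases "\<zeta> \<in> S")
      case True
      then show ?thesis using A(2)[of j \<zeta> z x] by (simp add: G_def S_def l_def)
    qed (simp add: zero A(1))
    have S: "closed S" "bounded S" "S \<subseteq> cball 0 (4 * l)"
    proof -
      show "closed S" unfolding S_def by (intro closed_Collect_conj closed_Collect_le continuous_intros)
      show s: "S \<subseteq> cball 0 (4 * l)" by (auto simp: S_def)
      show "bounded S" by (rule bounded_subset[OF bounded_cball s])
    qed
    have "(3/4) ^ N * measure lborel (ball (0::real^'n) (\<delta> * l / 2)) * norm (LBINT \<xi>. G \<xi>) \<le> A * l powr ?e * measure lborel S"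
      by (rule bump_average[OF cG _ annulus(2,3) dl N0(1) S(1,2) zero b])
        (use high_continuous(2)[OF N0(2) l(1)] in \<open>auto simp: G_def\<close>)
    also have "\<dots> \<le> A * l powr ?e * ((4 * l) ^ CARD('n) * V)"
      using measure_le_cball[OF S(1,3)] cb[of "4 * l"] l A(1) by (intro mult_left_mono) auto
    finally have "(3/4) ^ N * ((\<delta> * l / 2) ^ CARD('n) * V) * norm (LBINT \<xi>. G \<xi>) \<le> A * l powr ?e * ((4 * l) ^ CARD('n) * V)"
      using bl[of "\<delta> * l / 2"] dl by simp
    then have "(l ^ CARD('n) * V) * ((3/4) ^ N * (\<delta> / 2) ^ CARD('n) * norm (LBINT \<xi>. G \<xi>)) \<le> (l ^ CARD('n) * V) * (A * 4 ^ CARD('n) * l powr ?e)"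
      by (simp add: power_mult_distrib power_divide mult_ac)
    moreover have "0 < l ^ CARD('n) * V" using l V by simp
    ultimately have "(3/4) ^ N * (\<delta> / 2) ^ CARD('n) * norm (LBINT \<xi>. G \<xi>) \<le> A * 4 ^ CARD('n) * l powr ?e"
      using mult_le_cancel_left_pos by blast
    moreover have "0 < (3/4::real) ^ N * (\<delta> / 2) ^ CARD('n)" using \<delta> by simp
    ultimately have "norm (LBINT \<xi>. G \<xi>) \<le> A2 * l powr ?e" by (simp add: A2_def field_simps)
    then show "norm (LBINT \<xi>. cis (z \<bullet> \<xi>) * high N x (2 ^ j) \<xi>) \<le> A2 * (2 ^ j) powr ?e" by (simp add: G_def l_def)
  qed
qed

end

subsection \<open>Bounds for the kernel\<close>

text \<open>In \<open>X = X^(1-t) * X^t\<close> a small \<open>t\<close> sacrifices only half of the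
  negative exponent \<open>e\<close>, whatever \<open>\<sigma>\<close> is, and a large
  \<open>k\<close> turns the power \<open>t\<close> of the decay into the desired order
  \<open>s\<close>. The number \<open>k\<close> is chosen before \<open>A\<close> and
  \<open>D\<close>, because those depend on the smoothness of the cutoffs, which in turn has to
  exceed \<open>k\<close>.\<close>

lemma interpolation:
  fixes e \<sigma> s :: real
  assumes e: "e < 0" and s: "0 < s"
  obtains k :: nat where "\<And>A D. 0 \<le> A \<Longrightarrow> 0 \<le> D \<Longrightarrow> \<exists>C\<ge>0. \<forall>X l r. 1 \<le> l \<longrightarrow> 0 \<le> X \<longrightarrow> 1 \<le> r \<longrightarrow>
    X \<le> A * l powr e \<longrightarrow> X \<le> D * l powr \<sigma> * (1 / r) ^ k \<longrightarrow> X \<le> C * l powr (e / 2) * r powr - s"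
proof -
  \<comment> \<open>The bound \<open>1/4\<close> costs one quarter of \<open>e\<close> and the other
    bound keeps \<open>\<sigma> * t\<close> below another quarter, which leaves
    \<open>e / 2\<close>.\<close>
  define t where "t = min (1/4) (- e / (4 * (\<bar>\<sigma>\<bar> + 1)))"
  have "0 < - e / (4 * (\<bar>\<sigma>\<bar> + 1))" using e by (intro divide_pos_pos) auto
  then have t: "0 < t" by (simp add: t_def)
  have t': "t \<le> 1/4" unfolding t_def by (rule min.cobounded1)
  have "t \<le> - e / (4 * (\<bar>\<sigma>\<bar> + 1))" by (simp add: t_def)
  then have "t * (4 * (\<bar>\<sigma>\<bar> + 1)) \<le> - e" by (rule iffD1[OF pos_le_divide_eq, rotated]) simp
  then have st: "4 * (t * \<bar>\<sigma>\<bar>) \<le> - e" using t by (simp add: algebra_simps)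
  have ex: "e * (1 - t) + \<sigma> * t \<le> e / 2"
  proof -
    have "\<sigma> * t \<le> t * \<bar>\<sigma>\<bar>" using t mult_left_mono[of \<sigma> "\<bar>\<sigma>\<bar>" t] by (simp add: mult.commute)
    moreover have "- e * t \<le> - e * (1/4)" by (rule mult_left_mono) (use e t' in auto)
    ultimately show ?thesis using st by (simp add: algebra_simps)
  qed
  define k where "k = nat \<lceil>s / t\<rceil>"
  have "s / t \<le> real k" unfolding k_def by linarith
  then have k: "s \<le> real k * t" using t by (simp add: pos_divide_le_eq)
  show ?thesis
  proof (rule that[of k])
    fix A D :: real assume AD: "0 \<le> A" "0 \<le> D"
    show "\<exists>C\<ge>0. \<forall>X l r. 1 \<le> l \<longrightarrow> 0 \<le> X \<longrightarrow> 1 \<le> r \<longrightarrow>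
      X \<le> A * l powr e \<longrightarrow> X \<le> D * l powr \<sigma> * (1 / r) ^ k \<longrightarrow> X \<le> C * l powr (e / 2) * r powr - s"
    proof (intro exI[of _ "A powr (1 - t) * D powr t"] conjI allI impI)
      fix X l r :: real
      assume l: "1 \<le> l" and X: "0 \<le> X" "X \<le> A * l powr e" "X \<le> D * l powr \<sigma> * (1 / r) ^ k" and r: "1 \<le> r"
      have "X = X powr (1 - t) * X powr t"
        using X(1) by (cases "X = 0") (auto simp flip: powr_add)
      also have "\<dots> \<le> (A * l powr e) powr (1 - t) * (D * l powr \<sigma> * (1 / r) ^ k) powr t"
        using X t t' by (intro mult_mono powr_mono2) auto
      also have "(A * l powr e) powr (1 - t) = A powr (1 - t) * l powr (e * (1 - t))"
        using AD by (simp add: powr_mult powr_powr)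
      also have "(D * l powr \<sigma> * (1 / r) ^ k) powr t = D powr t * l powr (\<sigma> * t) * r powr - (real k * t)"
      proof -
        have "(1 / r) ^ k = r powr - real k" using r by (simp add: powr_minus powr_realpow power_divide inverse_eq_divide)
        then show ?thesis using AD r by (simp add: powr_mult powr_powr)
      qed
      also have "A powr (1 - t) * l powr (e * (1 - t)) * (D powr t * l powr (\<sigma> * t) * r powr - (real k * t))
          = A powr (1 - t) * D powr t * l powr (e * (1 - t) + \<sigma> * t) * r powr - (real k * t)"
        by (simp add: powr_add mult_ac)
      also have "\<dots> \<le> A powr (1 - t) * D powr t * l powr (e / 2) * r powr - s"
        by (rule mult_mono[OF mult_left_mono[OF powr_mono[OF ex l]] powr_mono[OF _ r]]) (use k in auto)
      finally show "X \<le> A powr (1 - t) * D powr t * l powr (e / 2) * r powr - s" .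
    qed simp
  qed
qed

text \<open>For \<open>norm z \<ge> 1\<close> the quantity \<open>(1 + norm z) / 2\<close> is at
  most \<open>norm z\<close>, and for smaller \<open>z\<close> it is at most \<open>1\<close>; the
  constant is the price of the division by \<open>2\<close>.\<close>

lemma le_decayI:
  fixes z :: "real^'n"
  assumes "0 \<le> P" "X \<le> P" "1 \<le> norm z \<Longrightarrow> X \<le> P * norm z powr - (real CARD('n) + 1/2)"
  shows "X \<le> P * 2 powr (real CARD('n) + 1/2) * decay z"
proof -
  let ?s = "real CARD('n) + 1/2"
  have d: "2 powr ?s * decay z = ((1 + norm z) / 2) powr - ?s"
  proof -
    have "((1 + norm z) / 2) powr - ?s = (1 + norm z) powr - ?s / 2 powr - ?s" by (rule powr_divide)
    then show ?thesis by (simp add: decay_def powr_minus[of 2] field_simps)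
  qed
  show ?thesis
  proof (cases "1 \<le> norm z")
    case True
    have "norm z powr - ?s \<le> ((1 + norm z) / 2) powr - ?s"
      by (rule powr_mono2') (use True in auto)
    then have "P * norm z powr - ?s \<le> P * (2 powr ?s * decay z)" unfolding d using assms(1) by (rule mult_left_mono)
    then show ?thesis using assms(3)[OF True] by (simp add: mult.assoc)
  next
    case False
    have "0 < 1 + norm z" using norm_ge_zero[of z] by linarith
    then have "1 \<le> ((1 + norm z) / 2) powr - ?s"
      using powr_mono2'[of "- ?s" "(1 + norm z) / 2" 1] False by simp
    then have "P * 1 \<le> P * (2 powr ?s * decay z)" unfolding d using assms(1) by (rule mult_left_mono)
    then show ?thesis using assms(2) by (simp add: mult.assoc)
  qed
qed

text \<open>The estimate of order \<open>0\<close> that accompanies \<open>fourier_decay\<close>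
  near \<open>z = 0\<close>.\<close>

lemma integral_symb_bound:
  fixes g :: "'q \<Rightarrow> real^'n \<Rightarrow> complex"
  assumes K: "\<And>p. closed (K p)" "\<And>p. bounded (K p)" "\<And>p. K p \<subseteq> U p"
    and g: "symb N U B w g" "\<And>p x. x \<notin> K p \<Longrightarrow> g p x = 0" "\<And>p. 0 \<le> w p"
  shows "\<exists>A\<ge>0. \<forall>p z. norm (LBINT x. cis (z \<bullet> x) * g p x) \<le> A * w p * measure lborel (K p)"
proof -
  obtain A where A: "0 \<le> A" "\<And>p x. x \<in> U p \<Longrightarrow> norm (g p x) \<le> A * w p"
    using symb_bound_nonneg[OF g(1,3)] by blast
  have "norm (LBINT x. cis (z \<bullet> x) * g p x) \<le> A * w p * measure lborel (K p)" for p z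
  proof (rule integral_bound_support[OF K(1,2)])
    show "norm (cis (z \<bullet> x) * g p x) \<le> A * w p" for x
      using A(2)[of x p] g(2)[of x p] K(3)[of p] A(1) g(3)[of p] by (cases "x \<in> K p") (auto simp: norm_mult)
  qed (use g in auto)
  then show ?thesis using A(1) by blast
qed

context fio_data begin

lemma measure_annulus':
  assumes "0 \<le> l" shows "measure lborel (annulus' l) \<le> (2 ^ CARD('n) * measure lborel (ball (0::real^'n) 1)) * l ^ CARD('n)"
proof -
  have "measure lborel (annulus' l) \<le> measure lborel (cball (0::real^'n) (2 * l))"
    by (rule measure_le_cball[OF annulus(2), of _ 0]) (auto simp: annulus'_def)
  also have "\<dots> = (2 * l) ^ CARD('n) * measure lborel (ball (0::real^'n) 1)"
    using content_ball_conv_unit_ball[of "2 * l" "0::real^'n"] assms by (simp add: content_cball_conv_ball)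
  finally show ?thesis by (simp add: power_mult_distrib mult_ac)
qed

text \<open>Interpolates between smallness without decay (\<open>high_sup_bound\<close>) and decay
  with a growing constant (\<open>fourier_decay\<close>). The ratio and the threshold precede
  \<open>N\<close>, since one common \<open>N\<close> has to serve the high, low and smooth parts of
  the decomposition.\<close>

lemma high_kernel:
  assumes c: "0 < c" "\<And>x \<xi>. norm \<xi> = 1 \<Longrightarrow> c \<le> \<bar>det_corank1 (hessian (\<theta> x) \<xi>)\<bar>"
    and m: "m < - ((real CARD('n) + 1) / 2) * \<rho> + real CARD('n) * (\<rho> - 1)"
  shows "\<exists>r N0. 0 < r \<and> r < 1 \<and> (\<forall>N>N0. \<exists>C\<ge>0. \<forall>x z j.
    norm (LBINT \<xi>. cis (z \<bullet> \<xi>) * high N x (2 ^ j) \<xi>) \<le> C * r ^ j * decay z)"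
proof -
  let ?n = "real CARD('n)"
  define e where "e = m + ?n - \<rho> * (?n - 1) / 2"
  \<comment> \<open>The hypothesis on \<open>m\<close>, rearranged.\<close>
  have e: "e < 0" using m unfolding e_def by (simp add: field_simps)
  let ?s = "?n + 1/2"
  obtain k where k: "\<And>A D. 0 \<le> A \<Longrightarrow> 0 \<le> D \<Longrightarrow> \<exists>C\<ge>0. \<forall>X l r. 1 \<le> l \<longrightarrow> 0 \<le> X \<longrightarrow> 1 \<le> r \<longrightarrow>
    X \<le> A * l powr e \<longrightarrow> X \<le> D * l powr (m + ?n) * (1 / r) ^ k \<longrightarrow> X \<le> C * l powr (e / 2) * r powr - ?s"
    using interpolation[OF e, of ?s "m + ?n"] by auto
  define r where "r = (2::real) powr (e / 2)"
  have r: "0 < r" "r < 1" using e powr_less_mono[of "e/2" 0 "2::real"] by (auto simp: r_def)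
  show ?thesis
  \<comment> \<open>The cutoffs need more than \<open>2 n\<close> orders for the almost
    orthogonality and more than \<open>k\<close> for the decay.\<close>
  proof (rule exI[of _ r], rule exI[of _ "max (2 * CARD('n)) k"], intro conjI r, intro allI impI)
    fix N assume N: "max (2 * CARD('n)) k < N"
    obtain A where A: "0 \<le> A" "\<And>x z j. norm (LBINT \<xi>. cis (z \<bullet> \<xi>) * high N x (2 ^ j) \<xi>) \<le> A * (2 ^ j) powr e"
      using high_sup_bound[OF c, of N] N unfolding e_def by auto
    define V where "V = 2 ^ CARD('n) * measure lborel (ball (0::real^'n) 1)"
    have V: "0 \<le> V" by (simp add: V_def)
    have N0: "0 < N" using N by simp
    have "\<exists>D\<ge>0. \<forall>(p::(real^'n) \<times> nat) z. z \<noteq> 0 \<longrightarrow> norm (LBINT \<xi>. cis (z \<bullet> \<xi>) * high N (fst p) (2 ^ snd p) \<xi>)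
        \<le> D * (2 ^ snd p) powr m * (1 / norm z) ^ k * measure lborel (annulus' (2 ^ snd p))"
      by (rule fourier_decay[OF annulus(1-4) _ symb_high[where lam = "\<lambda>p. 2 ^ snd p" and k=k]])
        (use N N0 high_def shell_zero in auto)
    then obtain D where D: "0 \<le> D" "\<And>x j z. z \<noteq> 0 \<Longrightarrow> norm (LBINT \<xi>. cis (z \<bullet> \<xi>) * high N x (2 ^ j) \<xi>)
        \<le> D * (2 ^ j) powr m * (1 / norm z) ^ k * measure lborel (annulus' (2 ^ j))" by auto
    have D': "norm (LBINT \<xi>. cis (z \<bullet> \<xi>) * high N x (2 ^ j) \<xi>) \<le> (D * V) * (2 ^ j) powr (m + ?n) * (1 / norm z) ^ k"
      if "z \<noteq> 0" for x j z
    proof -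
      have "norm (LBINT \<xi>. cis (z \<bullet> \<xi>) * high N x (2 ^ j) \<xi>)
          \<le> D * (2 ^ j) powr m * (1 / norm z) ^ k * (V * (2 ^ j) ^ CARD('n))"
        by (rule order_trans[OF D(2)[OF that] mult_left_mono]) (use measure_annulus'[of "2^j"] D(1) V_def in auto)
      also have "\<dots> = (D * V) * (2 ^ j) powr (m + ?n) * (1 / norm z) ^ k"
        by (simp add: powr_add powr_realpow mult_ac)
      finally show ?thesis .
    qed
    obtain C where C: "0 \<le> C" "\<And>X l r. 1 \<le> l \<Longrightarrow> 0 \<le> X \<Longrightarrow> 1 \<le> r \<Longrightarrow>
      X \<le> A * l powr e \<Longrightarrow> X \<le> (D * V) * l powr (m + ?n) * (1 / r) ^ k \<Longrightarrow> X \<le> C * l powr (e / 2) * r powr - ?s"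
      using k[OF A(1), of "D * V"] D(1) V by auto
    show "\<exists>C\<ge>0. \<forall>x z j. norm (LBINT \<xi>. cis (z \<bullet> \<xi>) * high N x (2 ^ j) \<xi>) \<le> C * r ^ j * decay z"
    proof (intro exI[of _ "(A + C) * 2 powr ?s"] conjI allI)
      fix x z :: "real^'n" and j :: nat
      have rj: "r ^ j = (2 ^ j) powr (e / 2)" by (simp add: r_def powr_power powr_powr mult.commute flip: powr_realpow)
      let ?X = "norm (LBINT \<xi>. cis (z \<bullet> \<xi>) * high N x (2 ^ j) \<xi>)"
      have "?X \<le> ((A + C) * r ^ j) * 2 powr ?s * decay z"
      proof (rule le_decayI)
        have "A * (2 ^ j) powr e \<le> A * r ^ j" unfolding rj using A(1) e by (intro mult_left_mono powr_mono) auto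
        also have "\<dots> \<le> (A + C) * r ^ j" using C(1) r by (intro mult_right_mono) auto
        finally show "?X \<le> (A + C) * r ^ j" using A(2)[where z=z and x=x and j=j] by linarith
        show "?X \<le> (A + C) * r ^ j * norm z powr - ?s" if z: "1 \<le> norm z"
        proof -
          have "z \<noteq> 0" using z by auto
          then have "?X \<le> C * (2 ^ j) powr (e / 2) * norm z powr - ?s"
            using A(2)[where z=z and x=x and j=j] D'[where z=z and x=x and j=j] z by (intro C(2)) auto
          also have "\<dots> \<le> (A + C) * r ^ j * norm z powr - ?s" unfolding rj using A(1) by (intro mult_right_mono) auto
          finally show ?thesis .
        qed
      qed (use A(1) C(1) r in auto)
      then show "?X \<le> (A + C) * 2 powr ?s * r ^ j * decay z" by (simp add: mult_ac)
    qed (use A(1) C(1) in auto)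
  qed
qed

text \<open>Size \<open>l\<close> on a set of volume about \<open>l ^ n\<close> gives
  \<open>l ^ (n + 1)\<close>, and integration by parts at the rate \<open>1 / l\<close> gives decay
  in \<open>l * norm z\<close>. Spending \<open>n + 1/2\<close> of the \<open>n + 1\<close> powers
  of \<open>l\<close> on the decay leaves \<open>l powr (1/2)\<close> for the summation over the
  scales.\<close>

lemma low_kernel:
  assumes N: "CARD('n) + 1 < N"
  shows "\<exists>C\<ge>0. \<forall>x z j. norm (LBINT \<xi>. cis (z \<bullet> \<xi>) * low N x (1 / 2 ^ j) \<xi>) \<le> C * (2 powr - (1/2)) ^ j * decay z"
proof -
  let ?n = "real CARD('n)" let ?s = "?n + 1/2"
  define V where "V = 2 ^ CARD('n) * measure lborel (ball (0::real^'n) 1)"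
  have V: "0 \<le> V" by (simp add: V_def)
  let ?l = "\<lambda>p::(real^'n) \<times> nat. 1 / 2 ^ snd p :: real"
  have sl: "symb (CARD('n) + 1) (\<lambda>p. annulus (?l p)) (\<lambda>p. inverse (?l p)) ?l (\<lambda>p. low N (fst p) (?l p))"
    by (rule symb_low) (use N in auto)
  have z: "low N (fst p) (?l p) x = 0" if "x \<notin> annulus' (?l p)" for p :: "(real^'n) \<times> nat" and x
    using shell_zero[OF _ _ that, of N] N by (simp add: low_def)
  have "\<exists>D\<ge>0. \<forall>p z. norm (LBINT \<xi>. cis (z \<bullet> \<xi>) * low N (fst p) (?l p) \<xi>) \<le> D * ?l p * measure lborel (annulus' (?l p))"
    by (rule integral_symb_bound[OF annulus(2-4) sl z]) auto
  then obtain D0 where D0: "0 \<le> D0" "\<And>x j z. norm (LBINT \<xi>. cis (z \<bullet> \<xi>) * low N x (1 / 2 ^ j) \<xi>) \<le> D0 * (1 / 2 ^ j) * measure lborel (annulus' (1 / 2 ^ j))"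
    by auto
  have "\<exists>D\<ge>0. \<forall>p z. z \<noteq> 0 \<longrightarrow> norm (LBINT \<xi>. cis (z \<bullet> \<xi>) * low N (fst p) (?l p) \<xi>)
      \<le> D * ?l p * (inverse (?l p) / norm z) ^ (CARD('n) + 1) * measure lborel (annulus' (?l p))"
    by (rule fourier_decay[OF annulus(1-4) _ sl z]) auto
  then obtain D1 where D1: "0 \<le> D1" "\<And>x j z. z \<noteq> 0 \<Longrightarrow> norm (LBINT \<xi>. cis (z \<bullet> \<xi>) * low N x (1 / 2 ^ j) \<xi>)
      \<le> D1 * (1 / 2 ^ j) * (inverse (1 / 2 ^ j) / norm z) ^ (CARD('n) + 1) * measure lborel (annulus' (1 / 2 ^ j))"
    by (auto simp: inverse_eq_divide)
  define C where "C = (D0 + D1) * V"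
  have C0: "0 \<le> C" using D0(1) D1(1) V by (simp add: C_def)
  show ?thesis
  proof (intro exI[of _ "C * 2 powr ?s"] conjI allI)
    fix x z :: "real^'n" and j :: nat
    define l :: real where "l = 1 / 2 ^ j"
    have l: "0 < l" "l \<le> 1" by (auto simp: l_def)
    have lj: "(2 powr - (1/2)) ^ j = l powr (1/2)"
      by (simp add: l_def powr_divide powr_minus power_divide powr_power powr_powr mult.commute inverse_eq_divide flip: powr_realpow)
    let ?X = "norm (LBINT \<xi>. cis (z \<bullet> \<xi>) * low N x l \<xi>)"
    have ln: "l * l ^ CARD('n) = l powr (?n + 1)" using l by (simp add: powr_add powr_realpow)
    have meas: "measure lborel (annulus' l) \<le> V * l ^ CARD('n)" using measure_annulus'[of l] l by (simp add: V_def)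
    have X0: "?X \<le> C * l powr (?n + 1)"
    proof -
      have "?X \<le> D0 * l * (V * l ^ CARD('n))"
        using order_trans[OF D0(2)[where z=z and x=x and j=j, folded l_def] mult_left_mono[OF meas]] D0(1) l by auto
      also have "\<dots> = D0 * V * l powr (?n + 1)" by (simp add: mult_ac flip: ln)
      also have "\<dots> \<le> C * l powr (?n + 1)" unfolding C_def using D1(1) V by (intro mult_right_mono) auto
      finally show ?thesis .
    qed
    have "?X \<le> (C * l powr (1/2)) * 2 powr ?s * decay z"
    proof (rule le_decayI)
      have "C * l powr (?n + 1) \<le> C * l powr (1/2)" using l C0 by (intro mult_left_mono powr_mono') auto
      then show "?X \<le> C * l powr (1/2)" using X0 by linarith
      show "?X \<le> C * l powr (1/2) * norm z powr - ?s" if z1: "1 \<le> norm z"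
      proof -
        have z0: "z \<noteq> 0" using z1 by auto
        have eq: "l powr (1/2) * norm z powr - ?s = l powr (?n + 1) * (l * norm z) powr - ?s"
        proof -
          have "(l * norm z) powr - ?s = l powr - ?s * norm z powr - ?s" by (rule powr_mult)
          moreover have "l powr (?n + 1) * l powr - ?s = l powr (1/2)" by (simp flip: powr_add)
          ultimately show ?thesis by (metis mult.assoc)
        qed
        have "?X \<le> C * (l powr (?n + 1) * (l * norm z) powr - ?s)"
        \<comment> \<open>If \<open>l * norm z\<close> is at most \<open>1\<close>, its negative
          power is at least \<open>1\<close> and the trivial bound suffices. Otherwise decay of
          order \<open>n + 1\<close> is stronger than that of order \<open>n + 1/2\<close>.\<close>
        proof (cases "l * norm z \<le> 1")
          case True
          have "0 < l * norm z" using l z0 by simp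
          then have "1 \<le> (l * norm z) powr - ?s"
            using powr_mono2'[of "- ?s" "l * norm z" 1] True by simp
          then have "l powr (?n + 1) * 1 \<le> l powr (?n + 1) * (l * norm z) powr - ?s" by (rule mult_left_mono) simp
          then have "C * l powr (?n + 1) \<le> C * (l powr (?n + 1) * (l * norm z) powr - ?s)" using C0 by (simp add: mult_left_mono)
          then show ?thesis using X0 by linarith
        next
          case False
          have "(inverse l / norm z) ^ (CARD('n) + 1) = (l * norm z) powr - (?n + 1)"
          proof -
            have "inverse l / norm z = inverse (l * norm z)" by (simp add: field_simps)
            moreover have "(l * norm z) powr - (?n + 1) = inverse ((l * norm z) ^ (CARD('n) + 1))"
              using powr_realpow[of "l * norm z" "CARD('n) + 1"] l z1 False by (simp only: powr_minus) (simp add: add.commute)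
            ultimately show ?thesis by (simp only: power_inverse)
          qed
          also have "\<dots> \<le> (l * norm z) powr - ?s" using False by (intro powr_mono) auto
          finally have p: "(inverse l / norm z) ^ (CARD('n) + 1) \<le> (l * norm z) powr - ?s" .
          have "?X \<le> D1 * l * (inverse l / norm z) ^ (CARD('n) + 1) * (V * l ^ CARD('n))"
            using order_trans[OF D1(2)[OF z0, where x=x and j=j, folded l_def] mult_left_mono[OF meas]] D1(1) l z1 by auto
          also have "\<dots> \<le> D1 * l * (l * norm z) powr - ?s * (V * l ^ CARD('n))"
            using p D1(1) l V by (intro mult_right_mono mult_left_mono) auto
          also have "\<dots> = D1 * V * (l powr (?n + 1) * (l * norm z) powr - ?s)" by (simp add: mult_ac flip: ln)
          also have "\<dots> \<le> C * (l powr (?n + 1) * (l * norm z) powr - ?s)" unfolding C_def using D0(1) V by (intro mult_right_mono) auto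
          finally show ?thesis .
        qed
        then show ?thesis unfolding eq[symmetric] by (simp add: mult.assoc)
      qed
    qed (use C0 in auto)
    then show "norm (LBINT \<xi>. cis (z \<bullet> \<xi>) * low N x (1 / 2 ^ j) \<xi>) \<le> C * 2 powr ?s * (2 powr - (1/2)) ^ j * decay z"
      unfolding lj by (simp add: l_def mult_ac)
  qed (use C0 in auto)
qed

text \<open>Everything lives at scale \<open>1\<close> here, so \<open>n + 1\<close> integrations by
  parts give more than the required decay.\<close>

lemma base_kernel:
  assumes N: "CARD('n) + 1 < N"
  shows "\<exists>C\<ge>0. \<forall>x z. norm (LBINT \<xi>. cis (z \<bullet> \<xi>) * base N x \<xi>) \<le> C * decay z"
proof -
  let ?n = "real CARD('n)" let ?s = "?n + 1/2"
  define V where "V = measure lborel (cball (0::real^'n) 2)"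
  have V: "0 \<le> V" by (simp add: V_def)
  have sb: "symb (CARD('n) + 1) (\<lambda>p. ball 0 4) (\<lambda>p. 1) (\<lambda>p. 1) (\<lambda>p. base N p)"
    by (rule symb_base) (use N in auto)
  have z: "base N p x = 0" if "x \<notin> cball 0 2" for p x
    using cutoff_eq_0[of N 1 x] that N by (simp add: base_def)
  have "\<exists>D\<ge>0. \<forall>p z. norm (LBINT \<xi>. cis (z \<bullet> \<xi>) * base N p \<xi>) \<le> D * 1 * measure lborel (cball (0::real^'n) 2)"
    by (rule integral_symb_bound[OF _ _ _ sb z]) auto
  then obtain D0 where D0: "0 \<le> D0" "\<And>x z. norm (LBINT \<xi>. cis (z \<bullet> \<xi>) * base N x \<xi>) \<le> D0 * V"
    by (auto simp: V_def)
  have "\<exists>D\<ge>0. \<forall>p z. z \<noteq> 0 \<longrightarrow> norm (LBINT \<xi>. cis (z \<bullet> \<xi>) * base N p \<xi>)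
      \<le> D * 1 * (1 / norm z) ^ (CARD('n) + 1) * measure lborel (cball (0::real^'n) 2)"
    by (rule fourier_decay[OF _ _ _ _ _ sb z]) auto
  then obtain D1 where D1: "0 \<le> D1" "\<And>x z. z \<noteq> 0 \<Longrightarrow> norm (LBINT \<xi>. cis (z \<bullet> \<xi>) * base N x \<xi>)
      \<le> D1 * (1 / norm z) ^ (CARD('n) + 1) * V"
    by (auto simp: V_def)
  define C where "C = (D0 + D1) * V"
  have C0: "0 \<le> C" using D0(1) D1(1) V by (simp add: C_def)
  show ?thesis
  proof (intro exI[of _ "C * 2 powr ?s"] conjI allI)
    fix x z :: "real^'n"
    show "norm (LBINT \<xi>. cis (z \<bullet> \<xi>) * base N x \<xi>) \<le> C * 2 powr ?s * decay z"
    proof (rule le_decayI[OF C0])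
      have "D0 * V \<le> C" "D1 * V \<le> C" unfolding C_def using D0(1) D1(1) V by (auto intro: mult_right_mono)
      then show "norm (LBINT \<xi>. cis (z \<bullet> \<xi>) * base N x \<xi>) \<le> C" using D0(2)[where z=z and x=x] by linarith
      show "norm (LBINT \<xi>. cis (z \<bullet> \<xi>) * base N x \<xi>) \<le> C * norm z powr - ?s" if z1: "1 \<le> norm z"
      proof -
        have z0: "z \<noteq> 0" using z1 by auto
        have "(1 / norm z) ^ (CARD('n) + 1) = norm z powr - (?n + 1)"
          using powr_realpow[of "norm z" "CARD('n) + 1"] z0 by (simp only: powr_minus power_one_over) (simp add: add.commute inverse_eq_divide)
        also have "\<dots> \<le> norm z powr - ?s" using z1 by (intro powr_mono) auto
        finally have "D1 * V * (1 / norm z) ^ (CARD('n) + 1) \<le> C * norm z powr - ?s"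
          using \<open>D1 * V \<le> C\<close> C0 by (intro mult_mono) auto
        then show ?thesis using D1(2)[OF z0, of x] by (simp add: mult_ac)
      qed
    qed
  qed (use C0 in auto)
qed

end

subsection \<open>The kernel representation\<close>

text \<open>Rounding \<xi> down to a grid of mesh \<open>2^(-k)\<close> leaves countably many
  values, hence a countable patchwork of functions measurable in \<open>x\<close>; continuity in
  \<xi> yields the limit. It supplies joint measurability for symbols that are merely measurable in
  \<open>x\<close>.\<close>

lemma caratheodory_measurable:
  fixes f :: "'a \<Rightarrow> real^'n \<Rightarrow> 'b::{second_countable_topology, metric_space}"
  assumes "\<And>x. continuous_on UNIV (f x)" "\<And>\<xi>. (\<lambda>x. f x \<xi>) \<in> borel_measurable M"
  shows "(\<lambda>p. f (fst p) (snd p)) \<in> borel_measurable (M \<Otimes>\<^sub>M borel)"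
proof -
  define g where "g k \<xi> = (\<chi> i. real_of_int \<lfloor>2 ^ k * \<xi> $ i\<rfloor> / 2 ^ k)" for k :: nat and \<xi> :: "real^'n"
  have lim: "(\<lambda>k. g k \<xi>) \<longlonglongrightarrow> \<xi>" for \<xi>
  proof (rule vec_tendstoI)
    fix i
    have "norm (g k \<xi> $ i - \<xi> $ i) \<le> (1/2) ^ k" for k
    proof -
      have "\<bar>of_int \<lfloor>2 ^ k * \<xi> $ i\<rfloor> - 2 ^ k * \<xi> $ i\<bar> \<le> 1" by linarith
      then have "\<bar>of_int \<lfloor>2 ^ k * \<xi> $ i\<rfloor> - 2 ^ k * \<xi> $ i\<bar> / 2 ^ k \<le> 1 / 2 ^ k"
        by (rule divide_right_mono) simp
      moreover have "g k \<xi> $ i - \<xi> $ i = (of_int \<lfloor>2 ^ k * \<xi> $ i\<rfloor> - 2 ^ k * \<xi> $ i) / 2 ^ k"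
        by (simp add: g_def diff_divide_distrib)
      ultimately show ?thesis by (simp only: real_norm_def abs_divide) (simp add: power_divide)
    qed
    then have ev: "\<forall>\<^sub>F k in sequentially. norm (g k \<xi> $ i - \<xi> $ i) \<le> (1/2) ^ k"
      by (rule always_eventually[OF allI])
    have "(\<lambda>k. (1/2) ^ k :: real) \<longlonglongrightarrow> 0" by (rule LIMSEQ_power_zero) simp
    from Lim_null_comparison[OF ev this] have "(\<lambda>k. g k \<xi> $ i - \<xi> $ i) \<longlonglongrightarrow> 0" .
    then show "(\<lambda>k. g k \<xi> $ i) \<longlonglongrightarrow> \<xi> $ i" by (rule LIM_zero_cancel)
  qed
  have meas: "(\<lambda>p. f (fst p) (g k (snd p))) \<in> borel_measurable (M \<Otimes>\<^sub>M borel)" for k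
  proof -
    define F where "F v p = f (fst p) (\<chi> i. of_int (v i) / 2 ^ k)" for v :: "'n \<Rightarrow> int" and p :: "'a \<times> (real^'n)"
    define G where "G p = (\<lambda>i. \<lfloor>2 ^ k * snd p $ i\<rfloor>)" for p :: "'a \<times> (real^'n)"
    have "F v \<in> borel_measurable (M \<Otimes>\<^sub>M borel)" for v
      unfolding F_def by (rule measurable_compose[OF measurable_fst assms(2)])
    moreover have "G \<in> measurable (M \<Otimes>\<^sub>M borel) (count_space UNIV)"
    proof (subst measurable_count_space_eq2_countable, intro conjI ballI)
      fix v :: "'n \<Rightarrow> int"
      have "(\<lambda>x::real^'n. x $ i) \<in> borel_measurable borel" for i
        by (intro borel_measurable_continuous_onI continuous_intros)
      from measurable_compose[OF measurable_snd this]
      have [measurable]: "(\<lambda>p::'a \<times> (real^'n). snd p $ i) \<in> borel_measurable (M \<Otimes>\<^sub>M borel)" for i .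
      have [measurable]: "(\<lambda>p::'a \<times> (real^'n). \<lfloor>2 ^ k * snd p $ i\<rfloor>) \<in> measurable (M \<Otimes>\<^sub>M borel) (count_space UNIV)" for i
        by measurable
      have "G -` {v} \<inter> space (M \<Otimes>\<^sub>M borel) = {p \<in> space (M \<Otimes>\<^sub>M borel). \<forall>i\<in>UNIV. \<lfloor>2 ^ k * snd p $ i\<rfloor> = v i}"
        by (auto simp: G_def fun_eq_iff)
      also have "\<dots> \<in> sets (M \<Otimes>\<^sub>M borel)" by measurable
      finally show "G -` {v} \<inter> space (M \<Otimes>\<^sub>M borel) \<in> sets (M \<Otimes>\<^sub>M borel)" .
    qed auto
    ultimately have "(\<lambda>p. F (G p) p) \<in> borel_measurable (M \<Otimes>\<^sub>M borel)"
      by (rule measurable_compose_countable)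
    then show ?thesis by (simp add: F_def G_def g_def)
  qed
  show ?thesis
  proof (rule borel_measurable_LIMSEQ_metric[OF meas])
    show "(\<lambda>k. f (fst p) (g k (snd p))) \<longlonglongrightarrow> f (fst p) (snd p)" for p
      using assms(1)[of "fst p"] lim[of "snd p"] by (auto intro: isCont_tendsto_compose simp: continuous_on_eq_continuous_at)
  qed
qed

section \<open>Schwartz functions and their Fourier transforms\<close>

lemma schwartz_decay:
  fixes u :: "real^'n \<Rightarrow> complex"
  assumes "u \<in> schwartz"
  obtains C where "0 \<le> C" "\<And>x. norm (partials \<alpha> u x) \<le> C * decay x"
proof -
  obtain C where C: "\<And>x. (1 + norm x) ^ (CARD('n) + 1) * norm (partials \<alpha> u x) \<le> C"
    using assms unfolding schwartz_def by blast
  have C0: "0 \<le> C" using C[of 0] by (rule order_trans[rotated]) simp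
  have "norm (partials \<alpha> u x) \<le> C * decay x" for x
  proof -
    have p: "0 < 1 + norm x" using norm_ge_zero[of x] by linarith
    have X: "0 < (1 + norm x) ^ (CARD('n) + 1)" using p by (rule zero_less_power)
    have "norm (partials \<alpha> u x) \<le> C * inverse ((1 + norm x) ^ (CARD('n) + 1))"
      unfolding divide_inverse[symmetric]
      by (rule mult_imp_le_div_pos[OF X]) (use C[of x] in \<open>simp only: mult.commute\<close>)
    also have "inverse ((1 + norm x) ^ (CARD('n) + 1)) = (1 + norm x) powr - (real CARD('n) + 1)"
      using powr_realpow[OF p, of "CARD('n) + 1"] by (simp only: powr_minus) (simp add: add.commute)
    also have "\<dots> \<le> decay x" unfolding decay_def by (rule powr_mono) auto
    finally show ?thesis using C0 by (simp add: mult_left_mono)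
  qed
  then show ?thesis by (rule that[OF C0])
qed

lemma schwartz_differentiable: "u \<in> schwartz \<Longrightarrow> partials \<alpha> u differentiable at x"
  by (auto simp: schwartz_def smooth_on_def)

lemma schwartz_continuous: "u \<in> schwartz \<Longrightarrow> continuous_on UNIV u"
  using continuous_on_differentiable_UNIV[of u] schwartz_differentiable[of u "[]"] by simp

lemma schwartz_integrable:
  fixes u :: "real^'n \<Rightarrow> complex"
  assumes "u \<in> schwartz"
  shows "integrable lborel (partials \<alpha> u)" "partials \<alpha> u \<in> borel_measurable borel"
proof -
  obtain C where C: "0 \<le> C" "\<And>x. norm (partials \<alpha> u x) \<le> C * decay x" using schwartz_decay[OF assms, where \<alpha> = \<alpha>] by blast
  show m: "partials \<alpha> u \<in> borel_measurable borel"
    by (intro borel_measurable_continuous_onI continuous_on_differentiable_UNIV schwartz_differentiable assms)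
  show "integrable lborel (partials \<alpha> u)"
    by (rule Bochner_Integration.integrable_bound[of _ "\<lambda>x. C * decay x"])
      (use C m in \<open>auto intro!: integrable_decay integrable_mult_right AE_I2 intro: order_trans[OF _ abs_ge_self]\<close>)
qed

lemma borel_measurable_cis_inner: "(\<lambda>x. cis (- (x \<bullet> \<xi>))) \<in> borel_measurable borel"
  by (intro borel_measurable_continuous_onI continuous_intros)

lemma fourier_lborel:
  assumes "u \<in> borel_measurable borel"
  shows "fourier u \<xi> = (LBINT x. cis (- (x \<bullet> \<xi>)) * u x)"
proof -
  have "(\<lambda>x. cis (- (x \<bullet> \<xi>)) * u x) \<in> borel_measurable lborel"
    using assms borel_measurable_cis_inner[of \<xi>] by simp
  then show ?thesis unfolding fourier_def by (simp add: integral_completion cis_conv_exp)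
qed

text \<open>For large \<xi>, differentiating \<open>n + 1\<close> times in the direction of a
  coordinate of size at least \<open>norm \<xi> / n\<close> gives decay of order
  \<open>n + 1\<close>, more than enough for integrability.\<close>

lemma schwartz_fourier:
  fixes u :: "real^'n \<Rightarrow> complex"
  assumes u: "u \<in> schwartz"
  shows "integrable lborel (fourier u)"
proof -
  let ?n = "real CARD('n)"
  have step: "\<i> * of_real (\<xi> $ i) * (LBINT x. cis (- (x \<bullet> \<xi>)) * partials \<alpha> u x) = (LBINT x. cis (- (x \<bullet> \<xi>)) * partials (i # \<alpha>) u x)" for \<xi> i \<alpha>
  proof -
    obtain C where C: "0 \<le> C" "\<And>x. norm (partials \<alpha> u x) \<le> C * decay x" using schwartz_decay[OF u, where \<alpha> = \<alpha>] by blast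
    obtain C' where C': "0 \<le> C'" "\<And>x. norm (partials (i # \<alpha>) u x) \<le> C' * decay x" using schwartz_decay[OF u, where \<alpha> = "i # \<alpha>"] by blast
    let ?E = "\<lambda>x. cis (- (x \<bullet> \<xi>))"
    have dp: "((\<lambda>x. - (x \<bullet> \<xi>)) has_derivative (\<lambda>v. - (v \<bullet> \<xi>))) (at x)" for x by (auto intro!: derivative_eq_intros)
    have pp: "partial i (\<lambda>x. - (x \<bullet> \<xi>)) x = - \<xi> $ i" for x
      unfolding partial_has_derivative[OF dp] by (simp add: inner_axis inner_commute)
    have dE: "?E differentiable at x" "partial i ?E x = of_real (- \<xi> $ i) * (\<i> * ?E x)" for x
      using partial_cis[OF differentiableI[OF dp]] pp by auto
    have dF: "(\<lambda>x. ?E x * partials \<alpha> u x) differentiable at x" for x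
      by (intro differentiable_mult dE schwartz_differentiable u)
    have pF: "partial i (\<lambda>x. ?E x * partials \<alpha> u x) x = ?E x * partials (i # \<alpha>) u x - \<i> * of_real (\<xi> $ i) * (?E x * partials \<alpha> u x)" for x
      using partial_mult[OF dE(1) schwartz_differentiable[OF u, where \<alpha>=\<alpha>], where i=i and x=x] dE(2) by (simp add: algebra_simps)
    have b1: "norm (?E x * partials \<alpha> u x) \<le> (C + C' + \<bar>\<xi> $ i\<bar> * C) * decay x" for x
    proof -
      have "norm (?E x * partials \<alpha> u x) \<le> C * decay x" using C(2) by (simp add: norm_mult)
      also have "\<dots> \<le> (C + C' + \<bar>\<xi> $ i\<bar> * C) * decay x" using C(1) C'(1) by (intro mult_right_mono decay_nonneg) auto
      finally show ?thesis .
    qed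
    have b2: "norm (partial i (\<lambda>x. ?E x * partials \<alpha> u x) x) \<le> (C + C' + \<bar>\<xi> $ i\<bar> * C) * decay x" for x
    proof -
      have "norm (partial i (\<lambda>x. ?E x * partials \<alpha> u x) x) \<le> norm (?E x * partials (i # \<alpha>) u x) + norm (\<i> * of_real (\<xi> $ i) * (?E x * partials \<alpha> u x))"
        unfolding pF by (rule norm_triangle_ineq4)
      also have "\<dots> \<le> C' * decay x + \<bar>\<xi> $ i\<bar> * (C * decay x)"
        by (intro add_mono) (use C(2)[of x] C'(2)[of x] in \<open>auto simp: norm_mult intro!: mult_left_mono\<close>)
      also have "\<dots> \<le> (C + C' + \<bar>\<xi> $ i\<bar> * C) * decay x" using C(1) decay_nonneg[of x] by (simp add: algebra_simps)
      finally show ?thesis .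
    qed
    have i1: "integrable lborel (\<lambda>x. ?E x * partials \<alpha> u x)" and i0: "(LBINT x. partial i (\<lambda>x. ?E x * partials \<alpha> u x) x) = 0"
      using integral_partial_eq_0[OF dF b1 b2] by auto
    have i2: "integrable lborel (\<lambda>x. ?E x * partials (i # \<alpha>) u x)"
    proof (rule Bochner_Integration.integrable_bound[OF schwartz_integrable(1)[OF u, of "i # \<alpha>"]])
      show "(\<lambda>x. ?E x * partials (i # \<alpha>) u x) \<in> borel_measurable lborel"
        using schwartz_integrable(2)[OF u, of "i # \<alpha>"] borel_measurable_cis_inner[of \<xi>] by (simp del: partials.simps)
    qed (auto simp: norm_mult)
    show ?thesis using i0 i1 i2 unfolding pF by (simp add: Bochner_Integration.integral_diff)
  qed
  have um: "u \<in> borel_measurable borel" using schwartz_integrable(2)[OF u, of "[]"] by simp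
  have it: "(\<i> * of_real (\<xi> $ i)) ^ k * fourier u \<xi> = (LBINT x. cis (- (x \<bullet> \<xi>)) * partials (replicate k i) u x)" for k \<xi> i
  proof (induction k)
    case (Suc k)
    have "(\<i> * of_real (\<xi> $ i)) ^ Suc k * fourier u \<xi> = \<i> * of_real (\<xi> $ i) * ((\<i> * of_real (\<xi> $ i)) ^ k * fourier u \<xi>)" by simp
    also have "\<dots> = (LBINT x. cis (- (x \<bullet> \<xi>)) * partials (replicate (Suc k) i) u x)"
      unfolding Suc.IH step by simp
    finally show ?case .
  qed (simp add: fourier_lborel[OF um])
  define Q where "Q i = (LBINT x. norm (partials (replicate (CARD('n) + 1) i) u x))" for i
  define Q0 where "Q0 = (LBINT x. norm (u x))"
  have Q0: "0 \<le> Q0" "0 \<le> Q i" for i by (auto simp: Q0_def Q_def)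
  have b: "norm (LBINT x. cis (- (x \<bullet> \<xi>)) * partials \<alpha> u x) \<le> (LBINT x. norm (partials \<alpha> u x))" for \<alpha> \<xi>
    using integral_norm_bound[of lborel "\<lambda>x. cis (- (x \<bullet> \<xi>)) * partials \<alpha> u x"] by (simp add: norm_mult)
  have b0: "norm (fourier u \<xi>) \<le> Q0" for \<xi> using b[of \<xi> "[]"] by (simp add: fourier_lborel[OF um] Q0_def)
  have bi: "\<bar>\<xi> $ i\<bar> ^ (CARD('n) + 1) * norm (fourier u \<xi>) \<le> Q i" for \<xi> i
    using b[of \<xi> "replicate (CARD('n) + 1) i"] it[of \<xi> i "CARD('n) + 1", symmetric] by (simp add: Q_def norm_mult norm_power)
  define P where "P = Q0 + (\<Sum>i\<in>UNIV. Q i) * ?n ^ (CARD('n) + 1)"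
  have P0: "0 \<le> P" unfolding P_def using Q0 by (auto intro!: add_nonneg_nonneg mult_nonneg_nonneg sum_nonneg)
  have fb: "norm (fourier u \<xi>) \<le> P * 2 powr (?n + 1/2) * decay \<xi>" for \<xi>
  proof (rule le_decayI[OF P0])
    have "Q0 \<le> P" unfolding P_def using Q0 by (auto intro!: mult_nonneg_nonneg sum_nonneg)
    then show "norm (fourier u \<xi>) \<le> P" using b0[of \<xi>] by linarith
    assume n1: "1 \<le> norm \<xi>"
    then have n0: "0 < norm \<xi>" by linarith
    have "\<exists>i. norm \<xi> / ?n \<le> \<bar>\<xi> $ i\<bar>"
    proof (rule ccontr)
      assume "\<nexists>i. norm \<xi> / ?n \<le> \<bar>\<xi> $ i\<bar>"
      then have "(\<Sum>i\<in>UNIV. \<bar>\<xi> $ i\<bar>) < (\<Sum>i\<in>(UNIV::'n set). norm \<xi> / ?n)"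
        by (intro sum_strict_mono) (auto simp: not_le)
      then show False using norm_le_l1_cart[of \<xi>] by simp
    qed
    then obtain i where i: "norm \<xi> / ?n \<le> \<bar>\<xi> $ i\<bar>" by blast
    have "(norm \<xi> / ?n) ^ (CARD('n) + 1) * norm (fourier u \<xi>) \<le> \<bar>\<xi> $ i\<bar> ^ (CARD('n) + 1) * norm (fourier u \<xi>)"
      using i by (intro mult_right_mono power_mono) auto
    also have "\<dots> \<le> Q i" by (rule bi)
    also have "\<dots> \<le> (\<Sum>i\<in>UNIV. Q i)" by (rule member_le_sum) (auto simp: Q0)
    finally have "norm (fourier u \<xi>) \<le> (\<Sum>i\<in>UNIV. Q i) * ?n ^ (CARD('n) + 1) * inverse (norm \<xi> ^ (CARD('n) + 1))"
      using n0 by (simp add: power_divide field_simps)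
    also have "\<dots> \<le> P * inverse (norm \<xi> ^ (CARD('n) + 1))"
      unfolding P_def using Q0 by (intro mult_right_mono) auto
    also have "inverse (norm \<xi> ^ (CARD('n) + 1)) = norm \<xi> powr - (?n + 1)"
      using powr_realpow[OF n0, of "CARD('n) + 1"] by (simp only: powr_minus) (simp add: add.commute)
    also have "P * norm \<xi> powr - (?n + 1) \<le> P * norm \<xi> powr - (?n + 1/2)"
      using n1 P0 by (intro mult_left_mono powr_mono) auto
    finally show "norm (fourier u \<xi>) \<le> P * norm \<xi> powr - (?n + 1/2)" .
  qed
  have m: "fourier u \<in> borel_measurable lborel"
  proof -
    have "continuous_on UNIV (\<lambda>p. u (snd p :: real^'n))"
      by (rule continuous_on_compose2[OF schwartz_continuous[OF u]]) (auto intro: continuous_intros)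
    then have "(\<lambda>p. cis (- (snd p \<bullet> fst p)) * u (snd p)) \<in> borel_measurable (borel :: ((real^'n) \<times> (real^'n)) measure)"
      by (intro borel_measurable_continuous_onI continuous_intros)
    then have "(\<lambda>(\<xi>, x). cis (- (x \<bullet> \<xi>)) * u x) \<in> borel_measurable (lborel \<Otimes>\<^sub>M lborel)"
      unfolding lborel_prod case_prod_unfold by simp
    then have "(\<lambda>\<xi>. LBINT x. cis (- (x \<bullet> \<xi>)) * u x) \<in> borel_measurable lborel"
      by (rule lborel.borel_measurable_lebesgue_integral)
    then show ?thesis by (simp add: fourier_lborel[OF um, abs_def])
  qed
  show ?thesis
    by (rule Bochner_Integration.integrable_bound[of _ "\<lambda>x. P * 2 powr (?n + 1/2) * decay x"])
      (use fb m in \<open>auto intro!: integrable_decay integrable_mult_right AE_I2 intro: order_trans[OF _ abs_ge_self]\<close>)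
qed

section \<open>Partial sums of the dyadic decomposition and their limit\<close>

context fio_data begin

lemma low_continuous:
  assumes "1 < N" "0 < l" "l \<le> 1"
  shows "continuous_on UNIV (low N x l)" "\<xi> \<notin> annulus' l \<Longrightarrow> low N x l \<xi> = 0"
proof -
  have z: "low N x l \<xi> = 0" if "\<xi> \<notin> annulus' l" for \<xi>
    using shell_zero[OF _ _ that] assms by (simp add: low_def)
  then show "\<xi> \<notin> annulus' l \<Longrightarrow> low N x l \<xi> = 0" .
  have "symb (Suc 0) (\<lambda>p::unit. annulus l) (\<lambda>p. inverse l) (\<lambda>p. l) (\<lambda>p. low N x l)"
    by (rule symb_low) (use assms in auto)
  from symb_SucD(1)[OF this] have d: "low N x l differentiable at \<xi>" if "\<xi> \<in> annulus l" for \<xi> using that by auto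
  show "continuous_on UNIV (low N x l)"
    by (rule continuous_on_differentiable_UNIV)
      (rule differentiable_zero_extension[OF annulus(1,2,4) z d], use assms in auto)
qed

lemma base_continuous:
  assumes "0 < N"
  shows "continuous_on UNIV (base N x)" "\<xi> \<notin> cball 0 2 \<Longrightarrow> base N x \<xi> = 0"
proof -
  show "base N x \<xi> = 0" if "\<xi> \<notin> cball 0 2"
    using cutoff_eq_0[of N 1 \<xi>] that assms by (simp add: base_def)
  have "continuous_on UNIV (a x)"
    using a_differentiable[of "[]" x] by (intro continuous_on_differentiable_UNIV) simp
  then show "continuous_on UNIV (base N x)"
    unfolding base_def by (intro continuous_intros continuous_on_cutoff)
qed

text \<open>High scales start at \<open>2\<close> and low scales at \<open>1\<close>, so that both
  telescoping sums end at \<open>cutoff N 1\<close>, which is the cutoff inside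
  \<open>base\<close>.\<close>

definition partial_symbol :: "nat \<Rightarrow> nat \<Rightarrow> real^'n \<Rightarrow> real^'n \<Rightarrow> complex"
  where "partial_symbol N J x \<xi> = base N x \<xi> + (\<Sum>j<J. high N x (2 ^ Suc j) \<xi> + low N x (1 / 2 ^ j) \<xi>)"

lemma partial_symbol_eq:
  "partial_symbol N J x \<xi> = a x \<xi> * (of_real (cutoff N 1 \<xi>) + cis (\<theta> x \<xi>) * of_real (cutoff N (2 ^ J) \<xi> - cutoff N 1 \<xi>)
     + (cis (\<theta> x \<xi>) - 1) * of_real (cutoff N 1 \<xi> - cutoff N (1 / 2 ^ J) \<xi>))"
proof (induction J)
  case (Suc J)
  have s: "shell N (2 ^ Suc J) \<xi> = cutoff N (2 ^ Suc J) \<xi> - cutoff N (2 ^ J) \<xi>"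
    "shell N (1 / 2 ^ J) \<xi> = cutoff N (1 / 2 ^ J) \<xi> - cutoff N (1 / 2 ^ Suc J) \<xi>"
    by (simp_all add: shell_def mult.commute)
  have "partial_symbol N (Suc J) x \<xi> = partial_symbol N J x \<xi> + (high N x (2 ^ Suc J) \<xi> + low N x (1 / 2 ^ J) \<xi>)"
    by (simp add: partial_symbol_def)
  then show ?case unfolding Suc high_def low_def s by (simp add: algebra_simps)
qed (simp add: partial_symbol_def base_def)

text \<open>The telescoped form involves three cutoff factors whatever \<open>J\<close> is; its
  factors contribute at most \<open>1\<close>, \<open>1\<close> and \<open>2\<close>. Summing the
  pieces one by one would lose the uniformity in \<open>J\<close>.\<close>

lemma partial_symbol_bound:
  obtains C where "0 \<le> C" "\<And>N J x \<xi>. norm (partial_symbol N J x \<xi>) \<le> C" "\<And>x \<xi>. norm (a x \<xi>) \<le> C"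
proof -
  obtain C where C: "0 \<le> C" "\<And>x \<xi>. norm (partials [] (a x) \<xi>) \<le> C * jbracket \<xi> powr (m - \<rho> * real (length ([]::'n list)))"
    using a_partial_bound[of "[]"] by blast
  have a: "norm (a x \<xi>) \<le> C" for x \<xi>
  proof -
    have "jbracket \<xi> powr m \<le> 1" using powr_mono2'[of m 1 "jbracket \<xi>"] m_neg jbracket_ge(1)[of \<xi>] by simp
    then have "C * jbracket \<xi> powr m \<le> C * 1" by (rule mult_left_mono[OF _ C(1)])
    then show ?thesis using C(2)[of x \<xi>] by simp
  qed
  have "norm (partial_symbol N J x \<xi>) \<le> C * 4" for N J x \<xi>
  proof -
    let ?c = "\<lambda>l. cutoff N l \<xi>"
    have c: "\<bar>?c l\<bar> \<le> 1" "\<bar>?c l - ?c l'\<bar> \<le> 1" for l l'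
      using cutoff_bounds[of N l \<xi>] cutoff_bounds[of N l' \<xi>] by linarith+
    have e: "norm (cis (\<theta> x \<xi>) - 1) \<le> 2" using norm_triangle_ineq4[of "cis (\<theta> x \<xi>)" 1] by simp
    have "norm (of_real (?c 1) + cis (\<theta> x \<xi>) * of_real (?c (2 ^ J) - ?c 1) + (cis (\<theta> x \<xi>) - 1) * of_real (?c 1 - ?c (1 / 2 ^ J)))
        \<le> norm (complex_of_real (?c 1)) + norm (cis (\<theta> x \<xi>) * of_real (?c (2 ^ J) - ?c 1)) + norm ((cis (\<theta> x \<xi>) - 1) * of_real (?c 1 - ?c (1 / 2 ^ J)))"
      by (intro norm_triangle_mono order_refl)
    also have "\<dots> \<le> 1 + 1 + 2 * 1"
    proof (intro add_mono)
      show "norm ((cis (\<theta> x \<xi>) - 1) * complex_of_real (?c 1 - ?c (1 / 2 ^ J))) \<le> 2 * 1"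
        unfolding norm_mult norm_of_real by (rule mult_mono[OF e c(2)]) auto
    qed (use c in \<open>simp_all add: norm_mult del: of_real_diff\<close>)
    finally show ?thesis unfolding partial_symbol_eq norm_mult using a[of x \<xi>] C(1) by (intro mult_mono) auto
  qed
  moreover have "norm (a x \<xi>) \<le> C * 4" for x \<xi> using a[of x \<xi>] C(1) by linarith
  ultimately show ?thesis using that[of "C * 4"] C(1) by simp
qed

text \<open>The sequence is eventually constant: the growing cutoff reaches \<open>1\<close> and the
  shrinking one reaches \<open>0\<close>. The latter never happens at the origin, which is a null
  set.\<close>

lemma partial_symbol_tendsto:
  assumes "\<xi> \<noteq> 0" "0 < N"
  shows "(\<lambda>J. partial_symbol N J x \<xi>) \<longlonglongrightarrow> cis (\<theta> x \<xi>) * a x \<xi>"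
proof (rule tendsto_eventually)
  obtain J1 :: nat where J1: "norm \<xi> < 2 ^ J1" using real_arch_pow[of 2] by auto
  obtain J2 :: nat where J2: "(1/2) ^ J2 < norm \<xi> / 2" using real_arch_pow_inv[of "norm \<xi> / 2" "1/2"] assms(1) by auto
  show "\<forall>\<^sub>F J in sequentially. partial_symbol N J x \<xi> = cis (\<theta> x \<xi>) * a x \<xi>"
    unfolding eventually_at_top_linorder
  proof (intro exI[of _ "max J1 J2"] allI impI)
    fix J assume J: "max J1 J2 \<le> J"
    have "(2::real) ^ J1 \<le> 2 ^ J" using J by (intro power_increasing) auto
    then have "norm \<xi> \<le> 2 ^ J" using J1 by linarith
    then have 1: "cutoff N (2 ^ J) \<xi> = 1" using assms(2) by (intro cutoff_eq_1) auto
    have "(1/2::real) ^ J \<le> (1/2) ^ J2" using J by (intro power_decreasing) auto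
    then have "2 * (1 / 2 ^ J) \<le> norm \<xi>" using J2 by (simp add: power_divide)
    then have 2: "cutoff N (1 / 2 ^ J) \<xi> = 0" using assms(2) by (intro cutoff_eq_0) auto
    show "partial_symbol N J x \<xi> = cis (\<theta> x \<xi>) * a x \<xi>"
      unfolding partial_symbol_eq 1 2 by (simp add: algebra_simps)
  qed
qed

lemma partial_symbol_continuous:
  assumes "1 < N"
  shows "continuous_on UNIV (partial_symbol N J x)" "integrable lborel (partial_symbol N J x)"
proof -
  have l: "(1::real) \<le> 2 ^ Suc j" "0 < (1::real) / 2 ^ j" "(1::real) / 2 ^ j \<le> 1" for j
    by (simp_all add: self_le_power del: power_Suc)
  show c: "continuous_on UNIV (partial_symbol N J x)"
    unfolding partial_symbol_def
    by (intro continuous_on_add continuous_on_sum base_continuous high_continuous low_continuous l) (use assms in auto)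
  show "integrable lborel (partial_symbol N J x)"
  proof (rule integrable_continuous_support[OF closed_cball bounded_cball _ c])
    fix \<xi> :: "real^'n" assume "\<xi> \<notin> cball 0 (2 * 2 ^ J)"
    then have n: "2 * 2 ^ J \<le> norm \<xi>" by simp
    have one: "(1::real) \<le> 2 ^ J" by simp
    have "(1::real) / 2 ^ J \<le> 1" by simp
    then have "2 * 1 \<le> norm \<xi>" "2 * (1 / 2 ^ J) \<le> norm \<xi>" using n one by linarith+
    then have "cutoff N 1 \<xi> = 0" "cutoff N (2 ^ J) \<xi> = 0" "cutoff N (1 / 2 ^ J) \<xi> = 0"
      using n assms by (intro cutoff_eq_0; simp)+
    then show "partial_symbol N J x \<xi> = 0" by (simp add: partial_symbol_eq)
  qed
qed

lemma partial_symbol_measurable: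
  assumes "1 < N" and a_meas: "\<And>\<xi>. (\<lambda>x. a x \<xi>) \<in> borel_measurable lebesgue"
    and th_meas: "\<And>\<xi>. \<xi> \<noteq> 0 \<Longrightarrow> (\<lambda>x. \<theta> x \<xi>) \<in> borel_measurable lebesgue"
  shows "(\<lambda>p. partial_symbol N J (fst p) (snd p)) \<in> borel_measurable (lebesgue \<Otimes>\<^sub>M borel)"
proof (rule caratheodory_measurable)
  show "continuous_on UNIV (partial_symbol N J x)" for x by (rule partial_symbol_continuous[OF assms(1)])
  show "(\<lambda>x. partial_symbol N J x \<xi>) \<in> borel_measurable lebesgue" for \<xi>
  proof (cases "\<xi> = 0")
    \<comment> \<open>Measurability of \<theta> is known only away from the origin. There all
      cutoffs equal \<open>1\<close>, and the terms with \<theta> drop out.\<close>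
    case True
    have "cutoff N l (0::real^'n) = 1" if "0 < l" for l using cutoff_eq_1[of N l "0::real^'n"] assms(1) that by simp
    then have "partial_symbol N J x \<xi> = a x \<xi>" for x unfolding partial_symbol_eq True by simp
    then show ?thesis using a_meas[of \<xi>] by simp
  next
    case False
    have "(\<lambda>x. cis (\<theta> x \<xi>)) \<in> borel_measurable lebesgue"
      by (rule measurable_compose[OF th_meas[OF False]]) (intro borel_measurable_continuous_onI continuous_intros)
    then show ?thesis unfolding partial_symbol_eq using a_meas[of \<xi>]
      by (intro borel_measurable_times borel_measurable_add borel_measurable_diff borel_measurable_const)
  qed
qed

text \<open>The symbol itself need not be integrable in \<xi>, so Fubini is applied to the truncated
  symbols, which are. The frequency side then converges dominated by a multiple of the Fourier
  transform of \<open>u\<close>, and the kernel side by a multiple of \<open>u\<close>.\<close>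

lemma kernel_representation:
  assumes c: "0 < c" "\<And>x \<xi>. norm \<xi> = 1 \<Longrightarrow> c \<le> \<bar>det_corank1 (hessian (\<theta> x) \<xi>)\<bar>"
    and m: "m < - ((real CARD('n) + 1) / 2) * \<rho> + real CARD('n) * (\<rho> - 1)"
    and a_meas: "\<And>\<xi>. (\<lambda>x. a x \<xi>) \<in> borel_measurable lebesgue"
    and th_meas: "\<And>\<xi>. \<xi> \<noteq> 0 \<Longrightarrow> (\<lambda>x. \<theta> x \<xi>) \<in> borel_measurable lebesgue"
  shows "\<exists>\<kappa> C. 0 \<le> C \<and> (\<lambda>p. \<kappa> (fst p) (snd p)) \<in> borel_measurable (lebesgue \<Otimes>\<^sub>M borel) \<and>
    (\<forall>x z. norm (\<kappa> x z) \<le> C * decay z) \<and>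
    (\<forall>u\<in>schwartz. \<forall>x. (LINT \<xi>|lebesgue. exp (\<i> * of_real (\<theta> x \<xi> + x \<bullet> \<xi>)) * a x \<xi> * fourier u \<xi>)
      = (LBINT y. \<kappa> x (x - y) * u y))"
proof -
  obtain r1 N1 where r1: "0 < r1" "r1 < 1" and high:
    "\<forall>N>N1. \<exists>C\<ge>0. \<forall>x z j. norm (LBINT \<xi>. cis (z \<bullet> \<xi>) * high N x (2 ^ j) \<xi>) \<le> C * r1 ^ j * decay z"
  proof -
    have "\<exists>r N0. 0 < r \<and> r < 1 \<and> (\<forall>N>N0. \<exists>C\<ge>0. \<forall>x z j.
      norm (LBINT \<xi>. cis (z \<bullet> \<xi>) * high N x (2 ^ j) \<xi>) \<le> C * r ^ j * decay z)"
      by (rule high_kernel[OF c(1) _ m]) (rule c(2))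
    then show ?thesis using that by blast
  qed
  \<comment> \<open>One smoothness for all three kernel estimates.\<close>
  define N where "N = max N1 (CARD('n) + 1) + 1"
  have N: "N1 < N" "CARD('n) + 1 < N" "1 < N" by (auto simp: N_def)
  obtain C1 where C1: "0 \<le> C1" "\<And>x z j. norm (LBINT \<xi>. cis (z \<bullet> \<xi>) * high N x (2 ^ j) \<xi>) \<le> C1 * r1 ^ j * decay z"
    using high[rule_format, OF N(1)] by blast
  obtain C2 where C2: "0 \<le> C2" "\<And>x z j. norm (LBINT \<xi>. cis (z \<bullet> \<xi>) * low N x (1 / 2 ^ j) \<xi>) \<le> C2 * (2 powr - (1/2)) ^ j * decay z"
    using low_kernel[OF N(2)] by blast
  obtain C3 where C3: "0 \<le> C3" "\<And>x z. norm (LBINT \<xi>. cis (z \<bullet> \<xi>) * base N x \<xi>) \<le> C3 * decay z"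
    using base_kernel[OF N(2)] by blast
  obtain Ca where Ca: "0 \<le> Ca" "\<And>N J x \<xi>. norm (partial_symbol N J x \<xi>) \<le> Ca" "\<And>x \<xi>. norm (a x \<xi>) \<le> Ca"
    using partial_symbol_bound by blast
  define r where "r = max r1 (2 powr - (1/2))"
  have "2 powr - (1/2) < (1::real)" using powr_less_mono[of "- (1/2)" 0 "2::real"] by simp
  then have r: "0 < r" "r < 1" "r1 \<le> r" "2 powr - (1/2) \<le> r" using r1 by (auto simp: r_def)
  define t where "t x z j = (LBINT \<xi>. cis (z \<bullet> \<xi>) * high N x (2 ^ Suc j) \<xi>) + (LBINT \<xi>. cis (z \<bullet> \<xi>) * low N x (1 / 2 ^ j) \<xi>)" for x z j
  define k where "k J x z = (LBINT \<xi>. cis (z \<bullet> \<xi>) * partial_symbol N J x \<xi>)" for J x z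
  have t: "norm (t x z j) \<le> (C1 + C2) * decay z * r ^ j" for x z j
  proof -
    have "C1 * r1 ^ Suc j * decay z \<le> C1 * r ^ j * decay z"
    proof (intro mult_right_mono mult_left_mono decay_nonneg C1(1))
      have "r1 ^ Suc j \<le> r1 ^ j" using r1 by (intro power_decreasing) auto
      also have "\<dots> \<le> r ^ j" using r r1 by (intro power_mono) auto
      finally show "r1 ^ Suc j \<le> r ^ j" .
    qed
    moreover have "C2 * (2 powr - (1/2)) ^ j * decay z \<le> C2 * r ^ j * decay z"
      by (intro mult_right_mono mult_left_mono decay_nonneg C2(1) power_mono r) auto
    ultimately have "norm (t x z j) \<le> C1 * r ^ j * decay z + C2 * r ^ j * decay z"
      unfolding t_def using C1(2)[of z x "Suc j"] C2(2)[of z x j]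
      by (intro order_trans[OF norm_triangle_ineq] add_mono) auto
    then show ?thesis by (simp add: algebra_simps)
  qed
  have sum_r: "summable (\<lambda>j. (C1 + C2) * decay z * r ^ j)" for z :: "real^'n"
    by (rule summable_mult, rule summable_geometric) (use r in simp)
  have sum_t: "summable (t x z)" for x z
    by (rule summable_comparison_test'[OF sum_r[of z], of 0]) (rule t)
  have l: "(1::real) \<le> 2 ^ Suc j" "0 < (1::real) / 2 ^ j" "(1::real) / 2 ^ j \<le> 1" for j
    by (simp_all add: self_le_power del: power_Suc)
  have cc: "continuous_on UNIV (\<lambda>\<xi>. cis (z \<bullet> \<xi>))" for z :: "real^'n" by (intro continuous_intros)
  have k_eq: "k J x z = (LBINT \<xi>. cis (z \<bullet> \<xi>) * base N x \<xi>) + (\<Sum>j<J. t x z j)" for J x z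
  proof -
    have ib: "integrable lborel (\<lambda>\<xi>. cis (z \<bullet> \<xi>) * base N x \<xi>)"
    proof (rule integrable_continuous_support[OF closed_cball bounded_cball])
      have N0: "0 < N" using N by simp
      show "cis (z \<bullet> \<xi>) * base N x \<xi> = 0" if "\<xi> \<notin> cball 0 2" for \<xi>
        using base_continuous(2)[OF N0 that] by simp
      show "continuous_on UNIV (\<lambda>\<xi>. cis (z \<bullet> \<xi>) * base N x \<xi>)"
        by (intro continuous_on_mult cc base_continuous(1)[OF N0])
    qed
    have ih: "integrable lborel (\<lambda>\<xi>. cis (z \<bullet> \<xi>) * high N x (2 ^ Suc j) \<xi>)" for j
      by (rule integrable_continuous_support[OF annulus(2,3)[of "2 ^ Suc j"]])
        (use high_continuous[OF N(3) l(1)] cc in \<open>auto intro!: continuous_on_mult simp del: power_Suc\<close>)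
    have il: "integrable lborel (\<lambda>\<xi>. cis (z \<bullet> \<xi>) * low N x (1 / 2 ^ j) \<xi>)" for j
      by (rule integrable_continuous_support[OF annulus(2,3)[of "1 / 2 ^ j"]])
        (use low_continuous[OF N(3) l(2,3)] cc in \<open>auto intro!: continuous_on_mult\<close>)
    have "k J x z = (LBINT \<xi>. cis (z \<bullet> \<xi>) * base N x \<xi> + (\<Sum>j<J. cis (z \<bullet> \<xi>) * high N x (2 ^ Suc j) \<xi> + cis (z \<bullet> \<xi>) * low N x (1 / 2 ^ j) \<xi>))"
      unfolding k_def partial_symbol_def by (simp add: distrib_left sum_distrib_left)
    also have "\<dots> = (LBINT \<xi>. cis (z \<bullet> \<xi>) * base N x \<xi>) + (LBINT \<xi>. (\<Sum>j<J. cis (z \<bullet> \<xi>) * high N x (2 ^ Suc j) \<xi> + cis (z \<bullet> \<xi>) * low N x (1 / 2 ^ j) \<xi>))"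
      by (rule Bochner_Integration.integral_add[OF ib Bochner_Integration.integrable_sum[OF Bochner_Integration.integrable_add[OF ih il]]])
    also have "(LBINT \<xi>. (\<Sum>j<J. cis (z \<bullet> \<xi>) * high N x (2 ^ Suc j) \<xi> + cis (z \<bullet> \<xi>) * low N x (1 / 2 ^ j) \<xi>)) = (\<Sum>j<J. t x z j)"
      unfolding t_def
      by (subst Bochner_Integration.integral_sum[OF Bochner_Integration.integrable_add[OF ih il]])
        (simp add: Bochner_Integration.integral_add[OF ih il] del: power_Suc)
    finally show ?thesis .
  qed
  define C where "C = C3 + (C1 + C2) / (1 - r)"
  have C0: "0 \<le> C" using C1(1) C2(1) C3(1) r by (simp add: C_def)
  have k_bound: "norm (k J x z) \<le> C * decay z" for J x z
  proof -
    have "norm (\<Sum>j<J. t x z j) \<le> (\<Sum>j<J. (C1 + C2) * decay z * r ^ j)"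
      by (rule order_trans[OF norm_sum sum_mono]) (rule t)
    also have "\<dots> \<le> (\<Sum>j. (C1 + C2) * decay z * r ^ j)"
      by (rule sum_le_suminf[OF sum_r]) (use C1(1) C2(1) r decay_nonneg[of z] in auto)
    also have "\<dots> = (C1 + C2) * decay z * (1 / (1 - r))"
      using r by (subst suminf_mult) (auto simp: suminf_geometric)
    finally have "norm (k J x z) \<le> C3 * decay z + (C1 + C2) * decay z * (1 / (1 - r))"
      unfolding k_eq using C3(2)[of z x] by (intro order_trans[OF norm_triangle_ineq] add_mono)
    then show ?thesis by (simp add: C_def algebra_simps add_divide_distrib)
  qed
  \<comment> \<open>As a pointwise limit of kernels that are jointly measurable in \<open>x\<close>
    and \<open>z\<close>, it inherits their measurability.\<close>
  define \<kappa> where "\<kappa> x z = lim (\<lambda>J. k J x z)" for x z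
  have lim: "(\<lambda>J. k J x z) \<longlonglongrightarrow> \<kappa> x z" for x z
  proof -
    have "(\<lambda>J. \<Sum>j<J. t x z j) \<longlonglongrightarrow> (\<Sum>j. t x z j)" by (rule summable_LIMSEQ[OF sum_t])
    then have "(\<lambda>J. k J x z) \<longlonglongrightarrow> (LBINT \<xi>. cis (z \<bullet> \<xi>) * base N x \<xi>) + (\<Sum>j. t x z j)"
      unfolding k_eq by (intro tendsto_add tendsto_const)
    then show ?thesis unfolding \<kappa>_def by (rule convergentI[THEN convergent_LIMSEQ_iff[THEN iffD1]])
  qed
  have \<kappa>_bound: "norm (\<kappa> x z) \<le> C * decay z" for x z
    by (rule Lim_bounded[OF tendsto_norm[OF lim], of 0]) (use k_bound in auto)
  have k_meas: "(\<lambda>p. k J (fst p) (snd p)) \<in> borel_measurable (lebesgue \<Otimes>\<^sub>M borel)" for J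
  proof -
    have 1: "(\<lambda>q. (fst (fst q), snd q)) \<in> measurable ((lebesgue \<Otimes>\<^sub>M borel) \<Otimes>\<^sub>M lborel) (lebesgue \<Otimes>\<^sub>M (borel :: (real^'n) measure))"
      by measurable
    have 2: "(\<lambda>q. (snd (fst q), snd q)) \<in> measurable ((lebesgue \<Otimes>\<^sub>M borel) \<Otimes>\<^sub>M lborel) (borel \<Otimes>\<^sub>M (borel :: (real^'n) measure))"
      by measurable
    have "(\<lambda>q :: (real^'n) \<times> (real^'n). cis (fst q \<bullet> snd q)) \<in> borel_measurable (borel \<Otimes>\<^sub>M borel)"
      unfolding borel_prod by (intro borel_measurable_continuous_onI continuous_intros)
    from measurable_compose[OF 2 this] measurable_compose[OF 1 partial_symbol_measurable[OF N(3) a_meas th_meas, of J]]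
    have "(\<lambda>q. cis (snd (fst q) \<bullet> snd q) * partial_symbol N J (fst (fst q)) (snd q)) \<in> borel_measurable ((lebesgue \<Otimes>\<^sub>M borel) \<Otimes>\<^sub>M lborel)"
      by (intro borel_measurable_times) simp_all
    then show ?thesis unfolding k_def
      by (intro lborel.borel_measurable_lebesgue_integral) (simp add: case_prod_unfold)
  qed
  have \<kappa>_meas: "(\<lambda>p. \<kappa> (fst p) (snd p)) \<in> borel_measurable (lebesgue \<Otimes>\<^sub>M borel)"
    by (rule borel_measurable_LIMSEQ_metric[OF k_meas lim])
  have rep: "(LINT \<xi>|lebesgue. exp (\<i> * of_real (\<theta> x \<xi> + x \<bullet> \<xi>)) * a x \<xi> * fourier u \<xi>) = (LBINT y. \<kappa> x (x - y) * u y)"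
    if u: "u \<in> schwartz" for u x
  proof -
    have ui: "integrable lborel u" and um: "u \<in> borel_measurable borel" using schwartz_integrable[OF u, of "[]"] by auto
    have uc: "continuous_on UNIV u" by (rule schwartz_continuous[OF u])
    have fi: "integrable lborel (fourier u)" by (rule schwartz_fourier[OF u])
    \<comment> \<open>The integrand is bounded by a product of an integrable function of \<xi> and
      one of \<open>y\<close>, so the order of integration may be exchanged.\<close>
    have fub: "(LBINT \<xi>. cis (x \<bullet> \<xi>) * partial_symbol N J x \<xi> * fourier u \<xi>) = (LBINT y. k J x (x - y) * u y)" for J
    proof -
      let ?S = "partial_symbol N J x"
      define f where "f \<xi> y = cis ((x - y) \<bullet> \<xi>) * ?S \<xi> * u y" for \<xi> y
      have nf: "norm (f \<xi> y) = norm (?S \<xi>) * norm (u y)" for \<xi> y by (simp add: f_def norm_mult)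
      have "continuous_on UNIV (\<lambda>p. f (fst p) (snd p))"
        unfolding f_def
        by (intro continuous_intros continuous_on_compose2[OF uc] continuous_on_compose2[OF partial_symbol_continuous(1)[OF N(3)]]) auto
      then have fm: "(\<lambda>(\<xi>, y). f \<xi> y) \<in> borel_measurable (lborel \<Otimes>\<^sub>M lborel)"
        unfolding lborel_prod case_prod_unfold by (simp add: borel_measurable_continuous_onI)
      have f\<xi>: "integrable lborel (\<lambda>y. f \<xi> y)" for \<xi>
      proof (rule Bochner_Integration.integrable_bound[of _ "\<lambda>y. norm (?S \<xi>) * norm (u y)"])
        show "integrable lborel (\<lambda>y. norm (?S \<xi>) * norm (u y))" using ui by (intro integrable_mult_right integrable_norm)
        show "f \<xi> \<in> borel_measurable lborel" unfolding f_def
          using um by (intro borel_measurable_times borel_measurable_const)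
            (auto intro!: borel_measurable_continuous_onI continuous_intros)
      qed (simp add: nf)
      have int: "integrable (lborel \<Otimes>\<^sub>M lborel) (\<lambda>(\<xi>, y). f \<xi> y)"
      proof (rule lborel_pair.Fubini_integrable[OF fm])
        show "integrable lborel (\<lambda>\<xi>. LBINT y. norm (case (\<xi>, y) of (\<xi>, y) \<Rightarrow> f \<xi> y))"
          using partial_symbol_continuous(2)[OF N(3), of J x] by (simp add: nf)
      qed (use f\<xi> in simp)
      have "(LBINT y. (LBINT \<xi>. f \<xi> y)) = (LBINT \<xi>. (LBINT y. f \<xi> y))"
        by (rule lborel_pair.Fubini_integral[OF int])
      moreover have "(LBINT \<xi>. f \<xi> y) = k J x (x - y) * u y" for y
        unfolding f_def k_def by simp
      moreover have "(LBINT y. f \<xi> y) = cis (x \<bullet> \<xi>) * ?S \<xi> * fourier u \<xi>" for \<xi>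
      proof -
        have "f \<xi> y = (cis (x \<bullet> \<xi>) * ?S \<xi>) * (cis (- (y \<bullet> \<xi>)) * u y)" for y
        proof -
          have "cis ((x - y) \<bullet> \<xi>) = cis (x \<bullet> \<xi>) * cis (- (y \<bullet> \<xi>))" by (simp add: inner_diff_left cis_mult)
          then show ?thesis unfolding f_def by (simp only: mult_ac)
        qed
        then show ?thesis by (simp add: fourier_lborel[OF um])
      qed
      ultimately show ?thesis by simp
    qed
    define G where "G \<xi> = cis (\<theta> x \<xi> + x \<bullet> \<xi>) * a x \<xi> * fourier u \<xi>" for \<xi>
    have Gm: "G \<in> borel_measurable lborel"
    proof -
      \<comment> \<open>Continuity of the phase is known off the origin only; changing a function at
        a single point does not affect Borel measurability.\<close>
      have "continuous_on (- {0}) (\<lambda>\<xi>. \<theta> x \<xi>)"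
        using th_differentiable[of _ "[]" x] by (intro continuous_at_imp_continuous_on ballI differentiable_imp_continuous_within) auto
      then have "(\<lambda>\<xi>. if \<xi> \<in> - {0} then \<theta> x \<xi> else \<theta> x 0) \<in> borel_measurable borel"
        by (intro borel_measurable_continuous_on_if) auto
      moreover have "(\<lambda>\<xi>. if \<xi> \<in> - {0} then \<theta> x \<xi> else \<theta> x 0) = \<theta> x" by auto
      ultimately have "\<theta> x \<in> borel_measurable borel" by simp
      then have "(\<lambda>\<xi>. \<theta> x \<xi> + x \<bullet> \<xi>) \<in> borel_measurable borel" by measurable
      from measurable_compose[OF this, of cis borel]
      have "(\<lambda>\<xi>. cis (\<theta> x \<xi> + x \<bullet> \<xi>)) \<in> borel_measurable borel"
        by (simp add: borel_measurable_continuous_onI continuous_on_cis continuous_on_id)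
      moreover have "a x \<in> borel_measurable borel"
        using a_differentiable[of "[]" x] by (intro borel_measurable_continuous_onI continuous_on_differentiable_UNIV) simp
      moreover have "fourier u \<in> borel_measurable borel" using borel_measurable_integrable[OF fi] by simp
      ultimately show ?thesis unfolding G_def by simp
    qed
    have L: "(\<lambda>J. (LBINT \<xi>. cis (x \<bullet> \<xi>) * partial_symbol N J x \<xi> * fourier u \<xi>)) \<longlonglongrightarrow> (LBINT \<xi>. G \<xi>)"
    proof (rule integral_dominated_convergence[OF Gm, where w = "\<lambda>\<xi>. Ca * norm (fourier u \<xi>)"])
      show "(\<lambda>\<xi>. cis (x \<bullet> \<xi>) * partial_symbol N J x \<xi> * fourier u \<xi>) \<in> borel_measurable lborel" for J
        using borel_measurable_integrable[OF fi] borel_measurable_continuous_onI[OF partial_symbol_continuous(1)[OF N(3), of J x]]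
          borel_measurable_continuous_onI[OF cc[of x]] by simp
      show "integrable lborel (\<lambda>\<xi>. Ca * norm (fourier u \<xi>))" using fi by (intro integrable_mult_right integrable_norm)
      \<comment> \<open>At the origin the partial sums may converge to another value.\<close>
      have "AE \<xi> in lborel. \<xi> \<noteq> (0::real^'n)" by (rule AE_lborel_singleton)
      then show "AE \<xi> in lborel. (\<lambda>J. cis (x \<bullet> \<xi>) * partial_symbol N J x \<xi> * fourier u \<xi>) \<longlonglongrightarrow> G \<xi>"
      proof (rule AE_mp, intro AE_I2 impI)
        fix \<xi> :: "real^'n" assume "\<xi> \<noteq> 0"
        then have "(\<lambda>J. cis (x \<bullet> \<xi>) * partial_symbol N J x \<xi> * fourier u \<xi>) \<longlonglongrightarrow> cis (x \<bullet> \<xi>) * (cis (\<theta> x \<xi>) * a x \<xi>) * fourier u \<xi>"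
          using N by (intro tendsto_mult tendsto_const partial_symbol_tendsto) auto
        then show "(\<lambda>J. cis (x \<bullet> \<xi>) * partial_symbol N J x \<xi> * fourier u \<xi>) \<longlonglongrightarrow> G \<xi>"
          by (simp add: G_def mult_ac flip: cis_mult)
      qed
      show "AE \<xi> in lborel. norm (cis (x \<bullet> \<xi>) * partial_symbol N J x \<xi> * fourier u \<xi>) \<le> Ca * norm (fourier u \<xi>)" for J
        using Ca(2) by (intro AE_I2) (simp add: norm_mult mult_right_mono)
    qed
    have dec: "(\<lambda>y. x - y) \<in> measurable borel (borel :: (real^'n) measure)" by measurable
    have km: "(\<lambda>z. k J x z) \<in> borel_measurable borel" for J
      using measurable_Pair2[OF k_meas[of J], of x] by simp
    have \<kappa>m: "(\<lambda>z. \<kappa> x z) \<in> borel_measurable borel"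
      using measurable_Pair2[OF \<kappa>_meas, of x] by simp
    have R: "(\<lambda>J. (LBINT y. k J x (x - y) * u y)) \<longlonglongrightarrow> (LBINT y. \<kappa> x (x - y) * u y)"
    proof (rule integral_dominated_convergence[where w = "\<lambda>y. C * norm (u y)"])
      show "(\<lambda>y. \<kappa> x (x - y) * u y) \<in> borel_measurable lborel"
        using measurable_compose[OF dec \<kappa>m] um by simp
      show "(\<lambda>y. k J x (x - y) * u y) \<in> borel_measurable lborel" for J
        using measurable_compose[OF dec km[of J]] um by simp
      show "integrable lborel (\<lambda>y. C * norm (u y))" using ui by (intro integrable_mult_right integrable_norm)
      show "AE y in lborel. (\<lambda>J. k J x (x - y) * u y) \<longlonglongrightarrow> \<kappa> x (x - y) * u y"
        by (intro AE_I2 tendsto_mult lim tendsto_const)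
      have "norm (k J x z) \<le> C" for J z
        using k_bound[of J x z] mult_left_mono[OF decay_le_1 C0, of z] by simp
      then show "AE y in lborel. norm (k J x (x - y) * u y) \<le> C * norm (u y)" for J
        by (intro AE_I2) (simp add: norm_mult mult_right_mono)
    qed
    have "(LBINT \<xi>. G \<xi>) = (LBINT y. \<kappa> x (x - y) * u y)"
      by (rule LIMSEQ_unique[OF L[unfolded fub] R])
    moreover have "(LINT \<xi>|lebesgue. exp (\<i> * of_real (\<theta> x \<xi> + x \<bullet> \<xi>)) * a x \<xi> * fourier u \<xi>) = (LBINT \<xi>. G \<xi>)"
    proof -
      have "G = (\<lambda>\<xi>. exp (\<i> * of_real (\<theta> x \<xi> + x \<bullet> \<xi>)) * a x \<xi> * fourier u \<xi>)"
        unfolding G_def cis_conv_exp ..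
      then show ?thesis using integral_completion[OF Gm] by simp
    qed
    ultimately show ?thesis by simp
  qed
  show ?thesis by (intro exI[of _ \<kappa>] exI[of _ C] conjI allI ballI C0 \<kappa>_meas \<kappa>_bound rep)
qed

end

subsection \<open>Weighted estimates\<close>

text \<open>Weights and functions are only Lebesgue measurable, so Tonelli's theorem is used for the
  completed measure in both variables.\<close>

lemma sigma_finite_lebesgue: "sigma_finite_measure (lebesgue :: 'a::euclidean_space measure)"
proof
  show "\<exists>A::'a set set. countable A \<and> A \<subseteq> sets lebesgue \<and> \<Union>A = space lebesgue \<and> (\<forall>a\<in>A. emeasure lebesgue a \<noteq> \<infinity>)"
  proof (intro exI[of _ "range (\<lambda>n::nat. ball (0::'a) (real n))"] conjI ballI)
    show "\<Union> (range (\<lambda>n::nat. ball (0::'a) (real n))) = space lebesgue"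
      using reals_Archimedean2 by (auto simp: dist_norm)
    show "emeasure lebesgue a \<noteq> \<infinity>" if a_range: "a \<in> range (\<lambda>n::nat. ball (0::'a) (real n))" for a
    proof -
      obtain n :: nat where a: "a = ball 0 (real n)" using a_range by blast
      then show ?thesis using emeasure_bounded_finite[OF bounded_ball, of "0::'a" "real n"] by simp
    qed
  qed auto
qed

interpretation lebesgue: sigma_finite_measure "lebesgue :: 'a::euclidean_space measure"
  by (rule sigma_finite_lebesgue)

interpretation lebesgue_pair: pair_sigma_finite "lebesgue :: 'a::euclidean_space measure" "lebesgue :: 'b::euclidean_space measure" ..

lemma measurable_lebesgue_ident: "(\<lambda>x. x) \<in> measurable lebesgue (borel :: 'a::euclidean_space measure)"
  by (rule measurable_completion) simp

lemma measurable_indicator_ball: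
  "(\<lambda>p. indicator (ball (fst p) r) (snd p) :: ennreal) \<in> borel_measurable (lebesgue \<Otimes>\<^sub>M (lebesgue :: 'a::euclidean_space measure))"
proof -
  have "fst \<in> measurable (lebesgue \<Otimes>\<^sub>M lebesgue) (borel :: 'a measure)" "snd \<in> measurable (lebesgue \<Otimes>\<^sub>M lebesgue) (borel :: 'a measure)"
    using measurable_compose[OF measurable_fst measurable_lebesgue_ident] measurable_compose[OF measurable_snd measurable_lebesgue_ident]
    by auto
  then have d: "(\<lambda>p. dist (fst p) (snd p)) \<in> borel_measurable (lebesgue \<Otimes>\<^sub>M (lebesgue :: 'a measure))"
    by (rule borel_measurable_dist)
  have "(\<lambda>p. indicator (ball (fst p) r) (snd p) :: ennreal) = (\<lambda>p. indicator {p \<in> space (lebesgue \<Otimes>\<^sub>M (lebesgue :: 'a measure)). dist (fst p) (snd p) < r} p)"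
    by (auto simp: fun_eq_iff indicator_def space_pair_measure)
  also have "\<dots> \<in> borel_measurable (lebesgue \<Otimes>\<^sub>M (lebesgue :: 'a measure))"
    using d by (intro borel_measurable_indicator) simp
  finally show ?thesis .
qed

text \<open>A linearised Hoelder inequality: integrate first and choose \<open>s\<close> afterwards.
  It is Young's inequality for the factors \<open>(s v)^(1/p) * a\<close> and
  \<open>(s v)^(-1/p)\<close>, with the weights \<open>1/p\<close> and \<open>1/q\<close>
  dropped.\<close>

lemma young_weighted:
  fixes p a v s :: real
  assumes p: "1 < p" and a: "0 \<le> a" and v: "0 < v" and s: "0 < s"
  shows "a \<le> s * (a powr p * v) + s powr (- 1 / (p - 1)) * v powr (- 1 / (p - 1))"
proof -
  define q where "q = p / (p - 1)"
  have q: "1 < q" "1 / p + 1 / q = 1" using p by (auto simp: q_def field_simps)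
  define X where "X = (s * v) powr (1 / p) * a"
  define Y where "Y = (s * v) powr (- 1 / p)"
  have sv: "0 < s * v" using s v by simp
  have "(s * v) powr (1 / p) * (s * v) powr (- 1 / p) = 1" using s v by (simp flip: powr_add)
  moreover have "X * Y = ((s * v) powr (1 / p) * (s * v) powr (- 1 / p)) * a" by (simp only: X_def Y_def mult_ac)
  ultimately have "X * Y = a" by simp
  moreover have "X * Y \<le> X powr p / p + Y powr q / q"
    by (rule Youngs_inequality[OF p q]) (use a in \<open>auto simp: X_def Y_def\<close>)
  moreover have "X powr p = s * (a powr p * v)"
    using sv p s v by (simp add: X_def powr_mult powr_powr)
  moreover have "Y powr q = s powr (- 1 / (p - 1)) * v powr (- 1 / (p - 1))"
  proof -
    have "- 1 / p * q = - 1 / (p - 1)" using p by (simp add: q_def field_simps)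
    then have "Y powr q = (s * v) powr (- 1 / (p - 1))" unfolding Y_def powr_powr by (simp only:)
    then show ?thesis by (simp only: powr_mult)
  qed
  moreover have "X powr p / p \<le> X powr p" "Y powr q / q \<le> Y powr q"
  proof -
    have "t / k \<le> t" if "0 \<le> t" "1 < k" for t k :: real using divide_left_mono[of 1 k t] that by simp
    then show "X powr p / p \<le> X powr p" "Y powr q / q \<le> Y powr q" using p q(1) by simp_all
  qed
  ultimately show ?thesis by linarith
qed

section \<open>Averages and the Muckenhoupt condition\<close>

locale muckenhoupt =
  fixes w :: "real^'n \<Rightarrow> real" and p :: real
  assumes p: "1 < p" and w: "w \<in> A_weight p"
begin

text \<open>The dual weight in the \<open>A_p\<close> condition.\<close>

definition \<sigma> :: "real^'n \<Rightarrow> real" where "\<sigma> x = w x powr (- 1 / (p - 1))"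

definition mass :: "(real^'n \<Rightarrow> real) \<Rightarrow> real^'n \<Rightarrow> real \<Rightarrow> real"
  where "mass f z r = (LINT y:ball z r|lebesgue. f y)"

lemma w_meas: "w \<in> borel_measurable lebesgue"
  and w_pos: "AE x in lebesgue. 0 < w x"
  and sigma_meas: "\<sigma> \<in> borel_measurable lebesgue"
  and sigma_pos: "AE x in lebesgue. 0 < \<sigma> x"
  and w_int: "set_integrable lebesgue (ball z r) w"
  and sigma_int: "0 < r \<Longrightarrow> set_integrable lebesgue (ball z r) \<sigma>"
proof -
  show m: "w \<in> borel_measurable lebesgue" and pos: "AE x in lebesgue. 0 < w x"
    using w by (auto simp: A_weight_def)
  show "\<sigma> \<in> borel_measurable lebesgue" unfolding \<sigma>_def using m by measurable
  show "AE x in lebesgue. 0 < \<sigma> x" using pos by eventually_elim (simp add: \<sigma>_def)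
  have "set_integrable lebesgue (cball z r) w" using w by (auto simp: A_weight_def)
  then show "set_integrable lebesgue (ball z r) w" by (rule set_integrable_subset) auto
  show "set_integrable lebesgue (ball z r) \<sigma>" if "0 < r" using w that by (auto simp: A_weight_def \<sigma>_def[abs_def])
qed

lemma mass_nn:
  assumes "f \<in> borel_measurable lebesgue" "set_integrable lebesgue (ball z r) f" "AE x in lebesgue. 0 < f x"
  shows "(\<integral>\<^sup>+y. ennreal (f y) * indicator (ball z r) y \<partial>lebesgue) = ennreal (mass f z r)"
    "0 < r \<Longrightarrow> 0 < mass f z r"
proof -
  have int: "integrable lebesgue (\<lambda>y. indicator (ball z r) y *\<^sub>R f y)"
    using assms(2) by (simp add: set_integrable_def)
  have nn: "AE y in lebesgue. 0 \<le> indicator (ball z r) y *\<^sub>R f y"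
    using assms(3) by eventually_elim (simp add: indicator_def)
  have "(\<integral>\<^sup>+y. ennreal (f y) * indicator (ball z r) y \<partial>lebesgue) = (\<integral>\<^sup>+y. ennreal (indicator (ball z r) y *\<^sub>R f y) \<partial>lebesgue)"
    by (intro nn_integral_cong) (simp add: indicator_def)
  also have "\<dots> = ennreal (mass f z r)"
    using nn_integral_eq_integral[OF int nn] by (simp add: mass_def set_lebesgue_integral_def)
  finally show "(\<integral>\<^sup>+y. ennreal (f y) * indicator (ball z r) y \<partial>lebesgue) = ennreal (mass f z r)" .
  show "0 < mass f z r" if r: "0 < r"
  proof (rule ccontr)
    assume "\<not> 0 < mass f z r"
    then have "integral\<^sup>L lebesgue (\<lambda>y. indicator (ball z r) y *\<^sub>R f y) = 0"
      using integral_nonneg_AE[OF nn] by (simp add: mass_def set_lebesgue_integral_def)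
    then have "AE y in lebesgue. indicator (ball z r) y *\<^sub>R f y = 0"
      using integral_nonneg_eq_0_iff_AE[OF int nn] by simp
    then have "AE y in lebesgue. y \<notin> ball z r" using assms(3) by eventually_elim (auto simp: indicator_def split: if_splits)
    then have "emeasure lebesgue (ball z r) = 0"
      by (subst (asm) AE_iff_measurable[where N="ball z r"]) auto
    then show False using r content_ball_pos[OF r, of z] by (simp add: measure_def)
  qed
qed

lemmas w_mass = mass_nn[OF w_meas w_int w_pos]

lemmas sigma_mass = mass_nn[OF sigma_meas sigma_int sigma_pos]

text \<open>The condition with the averages cleared: \<open>w\<close> contributes one power of the
  volume and the dual weight \<open>p - 1\<close>. Enlarging the constant to at least
  \<open>1\<close> makes it positive.\<close>

lemma A_p_bound:
  obtains A where "0 < A" "\<And>z r. 0 < r \<Longrightarrow> mass w z r * mass \<sigma> z r powr (p - 1) \<le> A * measure lebesgue (ball z r) powr p"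
proof -
  obtain A where A: "\<And>z r. 0 < r \<Longrightarrow> ball_avg w z r * ball_avg \<sigma> z r powr (p - 1) \<le> A"
    using w by (auto simp: A_weight_def \<sigma>_def[abs_def])
  have "mass w z r * mass \<sigma> z r powr (p - 1) \<le> max A 1 * measure lebesgue (ball z r) powr p" if r: "0 < r" for z r
  proof -
    define v where "v = measure lebesgue (ball z r)"
    have v: "0 < v" unfolding v_def using content_ball_pos[OF r, of z] by simp
    have s: "0 < mass \<sigma> z r" by (rule sigma_mass(2)[OF r r])
    have "mass w z r / v * (mass \<sigma> z r / v) powr (p - 1) \<le> max A 1"
      using A[OF r, of z] by (simp add: ball_avg_def mass_def v_def)
    moreover have "mass w z r / v * (mass \<sigma> z r / v) powr (p - 1) = mass w z r * mass \<sigma> z r powr (p - 1) / v powr p"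
    proof -
      have "v * v powr (p - 1) = v powr p" using v by (simp add: powr_diff)
      then show ?thesis by (simp add: powr_divide)
    qed
    ultimately have "mass w z r * mass \<sigma> z r powr (p - 1) / v powr p \<le> max A 1" by (simp only:)
    then have "mass w z r * mass \<sigma> z r powr (p - 1) \<le> max A 1 * v powr p"
      by (rule iffD1[OF pos_divide_le_eq, rotated]) (use v in simp)
    then show ?thesis by (simp only: v_def)
  qed
  then show ?thesis using that[of "max A 1"] by simp
qed

text \<open>Hoelder's inequality against the dual weight, followed by \<open>A_p_bound\<close>: the
  plain average of \<open>norm u\<close> is controlled by the average of its \<open>p\<close>-th
  power with respect to the measure \<open>w\<close>, for which \<open>E\<close> is an upper
  bound.\<close>

lemma average_bound:
  obtains C where "0 < C" "\<And>u z r E. u \<in> borel_measurable lebesgue \<Longrightarrow> 0 < r \<Longrightarrow> 0 \<le> E \<Longrightarrow>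
      (\<integral>\<^sup>+y. ennreal (norm (u y :: complex) powr p * w y) * indicator (ball z r) y \<partial>lebesgue) \<le> ennreal (E * mass w z r) \<Longrightarrow>
      (\<integral>\<^sup>+y. ennreal (norm (u y)) * indicator (ball z r) y \<partial>lebesgue) \<le> ennreal (C * measure lebesgue (ball z r) * E powr (1 / p))"
proof -
  obtain A where A: "0 < A" "\<And>z r. 0 < r \<Longrightarrow> mass w z r * mass \<sigma> z r powr (p - 1) \<le> A * measure lebesgue (ball z r) powr p"
    using A_p_bound by blast
  define C where "C = 2 * A powr (1 / p)"
  have C: "0 < C" using A(1) by (simp add: C_def)
  have main: "(\<integral>\<^sup>+y. ennreal (norm (u y)) * indicator (ball z r) y \<partial>lebesgue) \<le> ennreal (C * measure lebesgue (ball z r) * E powr (1 / p))"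
    if u: "u \<in> borel_measurable lebesgue" and r: "0 < r" and E: "0 < E" and
      le: "(\<integral>\<^sup>+y. ennreal (norm (u y :: complex) powr p * w y) * indicator (ball z r) y \<partial>lebesgue) \<le> ennreal (E * mass w z r)"
    for u z r E
  proof -
    define U where "U = E * mass w z r"
    define S where "S = mass \<sigma> z r"
    define v where "v = measure lebesgue (ball z r)"
    have pos: "0 < U" "0 < S" "0 < v"
      using E w_mass(2)[OF r] sigma_mass(2)[OF r r] content_ball_pos[OF r, of z] by (auto simp: U_def S_def v_def)
    \<comment> \<open>The choice that makes the two terms of \<open>young_weighted\<close> equal
      after integration; they add up to the factor \<open>2\<close> in \<open>C\<close>.\<close>
    define s where "s = (S / U) powr ((p - 1) / p)"
    have s: "0 < s" using pos by (simp add: s_def)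
    have e1: "s * U = U powr (1 / p) * S powr ((p - 1) / p)"
    proof -
      have "U / U powr ((p - 1) / p) = U powr (1 - (p - 1) / p)" using pos by (simp add: powr_diff)
      also have "1 - (p - 1) / p = 1 / p" using p by (simp add: field_simps)
      finally have "U / U powr ((p - 1) / p) = U powr (1 / p)" .
      moreover have "s * U = S powr ((p - 1) / p) * (U / U powr ((p - 1) / p))" by (simp add: s_def powr_divide)
      ultimately show ?thesis by (simp only: mult.commute)
    qed
    have e2: "s powr (- 1 / (p - 1)) * S = U powr (1 / p) * S powr ((p - 1) / p)"
    proof -
      have "s powr (- 1 / (p - 1)) = (S / U) powr ((p - 1) / p * (- 1 / (p - 1)))" unfolding s_def powr_powr ..
      also have "(p - 1) / p * (- 1 / (p - 1)) = - (1 / p)" using p by (simp add: field_simps)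
      also have "(S / U) powr - (1 / p) = U powr (1 / p) / S powr (1 / p)" using pos by (simp add: powr_minus powr_divide)
      finally have "s powr (- 1 / (p - 1)) * S = U powr (1 / p) * (S / S powr (1 / p))" by simp
      also have "S / S powr (1 / p) = S powr (1 - 1 / p)" using pos by (simp add: powr_diff)
      also have "1 - 1 / p = (p - 1) / p" using p by (simp add: field_simps)
      finally show ?thesis .
    qed
    note [measurable] = u w_meas sigma_meas
    have "(\<integral>\<^sup>+y. ennreal (norm (u y)) * indicator (ball z r) y \<partial>lebesgue)
      \<le> (\<integral>\<^sup>+y. ennreal s * (ennreal (norm (u y) powr p * w y) * indicator (ball z r) y)
         + ennreal (s powr (- 1 / (p - 1))) * (ennreal (\<sigma> y) * indicator (ball z r) y) \<partial>lebesgue)"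
    proof (rule nn_integral_mono_AE)
      show "AE y in lebesgue. ennreal (norm (u y)) * indicator (ball z r) y \<le>
         ennreal s * (ennreal (norm (u y) powr p * w y) * indicator (ball z r) y)
         + ennreal (s powr (- 1 / (p - 1))) * (ennreal (\<sigma> y) * indicator (ball z r) y)"
        using w_pos
      proof eventually_elim
        fix y assume wy: "0 < w y"
        have "ennreal (norm (u y)) \<le> ennreal (s * (norm (u y) powr p * w y) + s powr (- 1 / (p - 1)) * \<sigma> y)"
          unfolding \<sigma>_def by (intro ennreal_leI young_weighted[OF p _ wy s]) simp
        also have "\<dots> = ennreal s * ennreal (norm (u y) powr p * w y) + ennreal (s powr (- 1 / (p - 1))) * ennreal (\<sigma> y)"
          using s wy by (simp add: ennreal_plus ennreal_mult \<sigma>_def)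
        finally show "ennreal (norm (u y)) * indicator (ball z r) y \<le>
         ennreal s * (ennreal (norm (u y) powr p * w y) * indicator (ball z r) y)
         + ennreal (s powr (- 1 / (p - 1))) * (ennreal (\<sigma> y) * indicator (ball z r) y)"
          by (cases "y \<in> ball z r") auto
      qed
    qed
    also have "\<dots> = ennreal s * (\<integral>\<^sup>+y. ennreal (norm (u y) powr p * w y) * indicator (ball z r) y \<partial>lebesgue)
         + ennreal (s powr (- 1 / (p - 1))) * (\<integral>\<^sup>+y. ennreal (\<sigma> y) * indicator (ball z r) y \<partial>lebesgue)"
    proof -
      have m1: "(\<lambda>y. ennreal (norm (u y) powr p * w y) * indicator (ball z r) y) \<in> borel_measurable lebesgue"
        by (intro borel_measurable_times_ennreal borel_measurable_indicator) (measurable, simp)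
      have m2: "(\<lambda>y. ennreal (\<sigma> y) * indicator (ball z r) y) \<in> borel_measurable lebesgue"
        by (intro borel_measurable_times_ennreal borel_measurable_indicator) (measurable, simp)
      note c = borel_measurable_times_ennreal[OF borel_measurable_const]
      show ?thesis unfolding nn_integral_add[OF c[OF m1] c[OF m2]] nn_integral_cmult[OF m1] nn_integral_cmult[OF m2] ..
    qed
    also have "\<dots> \<le> ennreal s * ennreal U + ennreal (s powr (- 1 / (p - 1))) * ennreal S"
      unfolding sigma_mass(1)[OF r] S_def using le by (intro add_mono mult_left_mono) (auto simp: U_def)
    also have "\<dots> = ennreal (s * U + s powr (- 1 / (p - 1)) * S)"
      using s pos by (simp add: ennreal_plus ennreal_mult)
    also have "s * U + s powr (- 1 / (p - 1)) * S = 2 * (U * S powr (p - 1)) powr (1 / p)"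
      unfolding e1 e2 by (simp add: powr_mult powr_powr)
    also have "\<dots> \<le> C * v * E powr (1 / p)"
    proof -
      have "U * S powr (p - 1) = E * (mass w z r * mass \<sigma> z r powr (p - 1))" by (simp add: U_def S_def)
      also have "\<dots> \<le> E * (A * v powr p)" unfolding v_def using A(2)[OF r, of z] E by (intro mult_left_mono) auto
      finally have "(U * S powr (p - 1)) powr (1 / p) \<le> (E * (A * v powr p)) powr (1 / p)"
        using pos p by (intro powr_mono2) auto
      also have "\<dots> = E powr (1 / p) * (A powr (1 / p) * v)" using p pos by (simp add: powr_mult powr_powr)
      finally show ?thesis by (simp add: C_def mult_ac)
    qed
    finally show ?thesis by (simp add: v_def ennreal_leI)
  qed
  show ?thesis
  proof (rule that[OF C])
    fix u :: "real^'n \<Rightarrow> complex" and z r and E :: real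
    assume u: "u \<in> borel_measurable lebesgue" and r: "0 < r" and E: "0 \<le> E" and
      le: "(\<integral>\<^sup>+y. ennreal (norm (u y :: complex) powr p * w y) * indicator (ball z r) y \<partial>lebesgue) \<le> ennreal (E * mass w z r)"
    let ?I = "(\<integral>\<^sup>+y. ennreal (norm (u y)) * indicator (ball z r) y \<partial>lebesgue)"
    let ?v = "measure lebesgue (ball z r)"
    \<comment> \<open>The balancing choice of \<open>s\<close> divides by \<open>U\<close>, which
      vanishes for \<open>E = 0\<close>; so \<open>E\<close> is approached from above.\<close>
    have "?I \<le> ennreal (C * ?v * (E + 1 / real (Suc k)) powr (1 / p))" for k
    proof (rule main[OF u r])
      show "0 < E + 1 / real (Suc k)" using E by (simp add: add_nonneg_pos)
      have "E * mass w z r \<le> (E + 1 / real (Suc k)) * mass w z r"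
        using w_mass(2)[OF r, of z] by (intro mult_right_mono) auto
      then show "(\<integral>\<^sup>+y. ennreal (norm (u y :: complex) powr p * w y) * indicator (ball z r) y \<partial>lebesgue) \<le> ennreal ((E + 1 / real (Suc k)) * mass w z r)"
        using le ennreal_leI order_trans by blast
    qed
    moreover have "(\<lambda>k. ennreal (C * ?v * (E + 1 / real (Suc k)) powr (1 / p))) \<longlonglongrightarrow> ennreal (C * ?v * E powr (1 / p))"
    proof (intro tendsto_ennrealI tendsto_mult tendsto_const)
      have "(\<lambda>k. E + 1 / real (Suc k)) \<longlonglongrightarrow> E + 0"
        by (intro tendsto_add tendsto_const LIMSEQ_Suc[OF lim_1_over_n])
      then show "(\<lambda>k. (E + 1 / real (Suc k)) powr (1 / p)) \<longlonglongrightarrow> E powr (1 / p)"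
        using p E by (intro tendsto_powr') (auto simp: add_nonneg_nonneg)
    qed
    ultimately show "?I \<le> ennreal (C * ?v * E powr (1 / p))"
      by (intro LIMSEQ_le_const) auto
  qed
qed

text \<open>Cover \<open>B(y, r)\<close> by \<open>K\<close> balls of radius \<open>r/2\<close>. If \<open>x\<close> lies in one of them, then that ball is
  contained in \<open>B(x, r)\<close>; hence \<open>\<integral>\<^bsub>B(y,r)\<^esub> w(x) / w(B(x,r)) dx \<le> K\<close>.\<close>

lemma averaging_operator:
  obtains K :: nat where "\<And>g r. g \<in> borel_measurable lebesgue \<Longrightarrow> 0 < r \<Longrightarrow>
    (\<integral>\<^sup>+x. (\<integral>\<^sup>+y. g y * indicator (ball x r) y \<partial>lebesgue) * ennreal (inverse (mass w x r)) * ennreal (w x) \<partial>lebesgue)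
      \<le> of_nat K * (\<integral>\<^sup>+y. g y \<partial>lebesgue)"
    "\<And>r. (\<lambda>x. ennreal (inverse (mass w x r))) \<in> borel_measurable lebesgue"
proof -
  \<comment> \<open>Centres for the unit ball, chosen once; as \<open>y + r *\<^sub>R c\<close> they
    serve every ball. Hence \<open>K = card F\<close> is independent of \<open>y\<close> and
    \<open>r\<close>.\<close>
  have "compact (cball (0::real^'n) 1)" by simp
  then obtain F where F: "finite F" "cball (0::real^'n) 1 \<subseteq> (\<Union>c\<in>F. ball c (1/2))"
  proof (rule compactE_image[where C="UNIV" and f="\<lambda>c. ball c (1/2)"])
    show "cball (0::real^'n) 1 \<subseteq> (\<Union>c\<in>UNIV. ball c (1/2))"
    proof
      fix x :: "real^'n"
      have "x \<in> ball x (1/2)" by simp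
      then show "x \<in> (\<Union>c\<in>UNIV. ball c (1/2))" by blast
    qed
  qed auto
  have mw: "(\<lambda>x. ennreal (mass w x r)) \<in> borel_measurable lebesgue" for r
  proof -
    have "(\<lambda>q. ennreal (w (snd q)) * indicator (ball (fst q) r) (snd q)) \<in> borel_measurable (lebesgue \<Otimes>\<^sub>M lebesgue)"
      using measurable_compose[OF measurable_snd w_meas]
      by (intro borel_measurable_times_ennreal measurable_indicator_ball) measurable
    then have "(\<lambda>x. \<integral>\<^sup>+y. ennreal (w y) * indicator (ball x r) y \<partial>lebesgue) \<in> borel_measurable lebesgue"
      by (intro lebesgue.borel_measurable_nn_integral) (simp add: case_prod_unfold)
    then show ?thesis by (simp add: w_mass(1))
  qed
  \<comment> \<open>Includes radii \<open>r \<le> 0\<close>, for which the ball is empty, as the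
    measurability claim is made for every \<open>r\<close>.\<close>
  have mass0: "0 \<le> mass w x r" for x r
  proof (cases "0 < r")
    case True then show ?thesis using w_mass(2)[of r x] by simp
  next
    case False then show ?thesis by (simp add: mass_def ball_empty set_lebesgue_integral_def)
  qed
  have iw: "(\<lambda>x. ennreal (inverse (mass w x r))) \<in> borel_measurable lebesgue" for r
  proof -
    have "(\<lambda>x. enn2real (ennreal (mass w x r))) \<in> borel_measurable lebesgue" using mw by measurable
    then have "(\<lambda>x. mass w x r) \<in> borel_measurable lebesgue" by (simp add: mass0)
    then show ?thesis by measurable
  qed
  show ?thesis
  proof (rule that[of "card F", OF _ iw])
    fix g :: "real^'n \<Rightarrow> ennreal" and r :: real
    assume g: "g \<in> borel_measurable lebesgue" and r: "0 < r"
    note [measurable] = g w_meas iw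
    have inner: "(\<integral>\<^sup>+x. indicator (ball x r) y * (ennreal (inverse (mass w x r)) * ennreal (w x)) \<partial>lebesgue) \<le> of_nat (card F)" for y
    proof -
      have "(\<integral>\<^sup>+x. indicator (ball x r) y * (ennreal (inverse (mass w x r)) * ennreal (w x)) \<partial>lebesgue)
        \<le> (\<integral>\<^sup>+x. (\<Sum>c\<in>F. ennreal (inverse (mass w (y + r *\<^sub>R c) (r/2))) * (ennreal (w x) * indicator (ball (y + r *\<^sub>R c) (r/2)) x)) \<partial>lebesgue)"
      proof (rule nn_integral_mono)
        fix x
        show "indicator (ball x r) y * (ennreal (inverse (mass w x r)) * ennreal (w x))
          \<le> (\<Sum>c\<in>F. ennreal (inverse (mass w (y + r *\<^sub>R c) (r/2))) * (ennreal (w x) * indicator (ball (y + r *\<^sub>R c) (r/2)) x))"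
        proof (cases "y \<in> ball x r")
          case True
          have "(x - y) /\<^sub>R r \<in> cball 0 1" using True r by (simp add: dist_norm divide_simps)
          then obtain c where c: "c \<in> F" "(x - y) /\<^sub>R r \<in> ball c (1/2)" using F(2) by blast
          have xc: "x \<in> ball (y + r *\<^sub>R c) (r/2)"
          proof -
            have "norm (r *\<^sub>R (c - (x - y) /\<^sub>R r)) < r * (1/2)"
              using c(2) r by (simp add: dist_norm)
            moreover have "r *\<^sub>R (c - (x - y) /\<^sub>R r) = y + r *\<^sub>R c - x" using r by (simp add: scaleR_diff_right)
            ultimately show ?thesis by (simp add: dist_norm)
          qed
          have sub: "ball (y + r *\<^sub>R c) (r/2) \<subseteq> ball x r"
          proof
            fix t assume "t \<in> ball (y + r *\<^sub>R c) (r/2)"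
            then show "t \<in> ball x r" using xc dist_triangle[of x t "y + r *\<^sub>R c"] by (simp add: dist_commute)
          qed
          have "ennreal (mass w (y + r *\<^sub>R c) (r/2)) \<le> ennreal (mass w x r)"
            unfolding w_mass(1)[symmetric] using sub by (intro nn_integral_mono mult_left_mono) (auto simp: indicator_def)
          then have "mass w (y + r *\<^sub>R c) (r/2) \<le> mass w x r" by (simp add: ennreal_le_iff mass0)
          then have "inverse (mass w x r) \<le> inverse (mass w (y + r *\<^sub>R c) (r/2))"
            using w_mass(2)[of "r/2" "y + r *\<^sub>R c"] r by (intro le_imp_inverse_le) auto
          then have "indicator (ball x r) y * (ennreal (inverse (mass w x r)) * ennreal (w x))
             \<le> ennreal (inverse (mass w (y + r *\<^sub>R c) (r/2))) * (ennreal (w x) * indicator (ball (y + r *\<^sub>R c) (r/2)) x)"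
            using True xc by (simp add: ennreal_leI mult_right_mono)
          also have "\<dots> \<le> (\<Sum>c\<in>F. ennreal (inverse (mass w (y + r *\<^sub>R c) (r/2))) * (ennreal (w x) * indicator (ball (y + r *\<^sub>R c) (r/2)) x))"
            using c(1) F(1) by (intro member_le_sum) auto
          finally show ?thesis .
        qed simp
      qed
      also have "\<dots> = (\<Sum>c\<in>F. ennreal (inverse (mass w (y + r *\<^sub>R c) (r/2))) * ennreal (mass w (y + r *\<^sub>R c) (r/2)))"
      proof -
        have m: "(\<lambda>x. ennreal (w x) * indicator (ball z s) x) \<in> borel_measurable lebesgue" for z s
          by (intro borel_measurable_times_ennreal borel_measurable_indicator) (measurable, simp)
        note c = borel_measurable_times_ennreal[OF borel_measurable_const m]
        show ?thesis unfolding nn_integral_sum[OF c] nn_integral_cmult[OF m] w_mass(1) ..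
      qed
      also have "\<dots> = (\<Sum>c\<in>F. 1)"
      proof (rule sum.cong[OF refl])
        fix c
        have "0 < mass w (y + r *\<^sub>R c) (r/2)" using w_mass(2)[of "r/2"] r by simp
        then show "ennreal (inverse (mass w (y + r *\<^sub>R c) (r/2))) * ennreal (mass w (y + r *\<^sub>R c) (r/2)) = 1"
          by (simp flip: ennreal_mult)
      qed
      finally show ?thesis by simp
    qed
    have m2: "(\<lambda>(x, y). g y * (indicator (ball x r) y * (ennreal (inverse (mass w x r)) * ennreal (w x)))) \<in> borel_measurable (lebesgue \<Otimes>\<^sub>M lebesgue)"
    proof -
      note [measurable] = measurable_indicator_ball
      show ?thesis unfolding case_prod_unfold by (intro borel_measurable_times_ennreal) measurable
    qed
    have "(\<integral>\<^sup>+x. (\<integral>\<^sup>+y. g y * indicator (ball x r) y \<partial>lebesgue) * ennreal (inverse (mass w x r)) * ennreal (w x) \<partial>lebesgue)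
       = (\<integral>\<^sup>+x. (\<integral>\<^sup>+y. g y * (indicator (ball x r) y * (ennreal (inverse (mass w x r)) * ennreal (w x))) \<partial>lebesgue) \<partial>lebesgue)"
    proof (rule nn_integral_cong)
      fix x
      have "(\<integral>\<^sup>+y. (g y * indicator (ball x r) y) * (ennreal (inverse (mass w x r)) * ennreal (w x)) \<partial>lebesgue)
         = (\<integral>\<^sup>+y. g y * indicator (ball x r) y \<partial>lebesgue) * (ennreal (inverse (mass w x r)) * ennreal (w x))"
        by (rule nn_integral_multc) (intro borel_measurable_times_ennreal borel_measurable_indicator g, simp)
      then show "(\<integral>\<^sup>+y. g y * indicator (ball x r) y \<partial>lebesgue) * ennreal (inverse (mass w x r)) * ennreal (w x)
         = (\<integral>\<^sup>+y. g y * (indicator (ball x r) y * (ennreal (inverse (mass w x r)) * ennreal (w x))) \<partial>lebesgue)"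
        by (simp add: mult.assoc)
    qed
    \<comment> \<open>Tonelli: for fixed \<open>y\<close>, the weight is now integrated over the
      centres \<open>x\<close> of the balls that contain \<open>y\<close>.\<close>
    also have "\<dots> = (\<integral>\<^sup>+y. (\<integral>\<^sup>+x. g y * (indicator (ball x r) y * (ennreal (inverse (mass w x r)) * ennreal (w x))) \<partial>lebesgue) \<partial>lebesgue)"
      by (rule lebesgue_pair.Fubini'[OF m2, symmetric])
    also have "\<dots> \<le> (\<integral>\<^sup>+y. of_nat (card F) * g y \<partial>lebesgue)"
    proof (rule nn_integral_mono)
      fix y
      have "(\<lambda>x. indicator (ball x r) y * (ennreal (inverse (mass w x r)) * ennreal (w x))) \<in> borel_measurable lebesgue"
        using measurable_Pair1[OF measurable_indicator_ball, of y r] w_meas iw by (intro borel_measurable_times_ennreal) auto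
      then have "(\<integral>\<^sup>+x. g y * (indicator (ball x r) y * (ennreal (inverse (mass w x r)) * ennreal (w x))) \<partial>lebesgue)
        = g y * (\<integral>\<^sup>+x. indicator (ball x r) y * (ennreal (inverse (mass w x r)) * ennreal (w x)) \<partial>lebesgue)"
        by (rule nn_integral_cmult)
      also have "\<dots> \<le> g y * of_nat (card F)" by (intro mult_left_mono inner) simp
      finally show "(\<integral>\<^sup>+x. g y * (indicator (ball x r) y * (ennreal (inverse (mass w x r)) * ennreal (w x))) \<partial>lebesgue) \<le> of_nat (card F) * g y"
        by (simp add: mult.commute)
    qed
    also have "\<dots> = of_nat (card F) * (\<integral>\<^sup>+y. g y \<partial>lebesgue)" by (rule nn_integral_cmult) measurable
    finally show "(\<integral>\<^sup>+x. (\<integral>\<^sup>+y. g y * indicator (ball x r) y \<partial>lebesgue) * ennreal (inverse (mass w x r)) * ennreal (w x) \<partial>lebesgue)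
      \<le> of_nat (card F) * (\<integral>\<^sup>+y. g y \<partial>lebesgue)" .
  qed
qed

section \<open>Operators dominated by convolution with \<open>decay\<close>\<close>

lemma ennreal_w_meas: "(\<lambda>x. ennreal (w x)) \<in> borel_measurable lebesgue"
  by (rule measurable_compose[OF w_meas measurable_ennreal])

lemma Lpw_nn:
  assumes "u \<in> Lpw p w"
  shows "(\<integral>\<^sup>+y. ennreal (norm (u y) powr p * w y) \<partial>lebesgue) = ennreal (LINT y|lebesgue. norm (u y) powr p * w y)"
    "0 \<le> (LINT y|lebesgue. norm (u y) powr p * w y)"
proof -
  have nn: "AE y in lebesgue. 0 \<le> norm (u y) powr p * w y" using w_pos by eventually_elim simp
  show "(\<integral>\<^sup>+y. ennreal (norm (u y) powr p * w y) \<partial>lebesgue) = ennreal (LINT y|lebesgue. norm (u y) powr p * w y)"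
    by (rule nn_integral_eq_integral[OF _ nn]) (use assms in \<open>auto simp: Lpw_def\<close>)
  show "0 \<le> (LINT y|lebesgue. norm (u y) powr p * w y)" by (rule integral_nonneg_AE[OF nn])
qed

text \<open>Instead of adding norms by Minkowski's inequality, the averages of
  \<open>norm u powr p\<close> at all scales are collected with geometric weights in one function
  \<open>G\<close>, whose weighted integral is controlled by \<open>averaging_operator\<close>. Each
  scale is then bounded pointwise through \<open>G\<close> by \<open>average_bound\<close>.\<close>

lemma decay_operator_bound:
  obtains C where "0 \<le> C"
    "\<And>u. u \<in> Lpw p w \<Longrightarrow> \<exists>G\<in>borel_measurable lebesgue.
      (\<integral>\<^sup>+x. G x * ennreal (w x) \<partial>lebesgue) \<le> ennreal (C * (LINT y|lebesgue. norm (u y) powr p * w y)) \<and>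
      (AE x in lebesgue. G x < \<infinity> \<and>
        (\<integral>\<^sup>+y. ennreal (decay (x - y) * norm (u y)) \<partial>lebesgue) \<le> ennreal (C * enn2real (G x) powr (1 / p)))"
proof -
  let ?s = "real CARD('n) + 1/2"
  obtain C1 where C1: "0 < C1" "\<And>u z r E. u \<in> borel_measurable lebesgue \<Longrightarrow> 0 < r \<Longrightarrow> 0 \<le> E \<Longrightarrow>
      (\<integral>\<^sup>+y. ennreal (norm (u y :: complex) powr p * w y) * indicator (ball z r) y \<partial>lebesgue) \<le> ennreal (E * mass w z r) \<Longrightarrow>
      (\<integral>\<^sup>+y. ennreal (norm (u y)) * indicator (ball z r) y \<partial>lebesgue) \<le> ennreal (C1 * measure lebesgue (ball z r) * E powr (1 / p))"
    using average_bound by blast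
  obtain K :: nat where K: "\<And>g r. g \<in> borel_measurable lebesgue \<Longrightarrow> 0 < r \<Longrightarrow>
    (\<integral>\<^sup>+x. (\<integral>\<^sup>+y. g y * indicator (ball x r) y \<partial>lebesgue) * ennreal (inverse (mass w x r)) * ennreal (w x) \<partial>lebesgue)
      \<le> of_nat K * (\<integral>\<^sup>+y. g y \<partial>lebesgue)"
    and iw: "\<And>r. (\<lambda>x. ennreal (inverse (mass w x r))) \<in> borel_measurable lebesgue"
    using averaging_operator by blast
  define V where "V = measure lebesgue (ball (0::real^'n) 1)"
  have V: "0 < V" using content_ball_pos[of 1 "0::real^'n"] by (simp add: V_def)
  have ballV: "measure lebesgue (ball x (2 ^ k)) = 2 ^ (k * CARD('n)) * V" for x :: "real^'n" and k :: nat
    using content_ball_conv_unit_ball[of "2^k" x] by (simp add: V_def power_mult)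
  \<comment> \<open>Bounding the scale \<open>2 ^ k\<close> by \<open>G\<close> loses
    \<open>b^(-k/p) = \<tau>^(-k)\<close>, and the kernel gains
    \<open>2^(-k/2) = \<tau>^(2k)\<close>, so \<tau>^k remains. Any \<open>b\<close> strictly
    between \<open>2^(-p/2)\<close> and \<open>1\<close> would do.\<close>
  define b where "b = (2::real) powr - (p / 4)"
  have b: "0 < b" "b < 1" using p powr_less_mono[of "- (p/4)" 0 "2::real"] by (auto simp: b_def)
  define \<tau> where "\<tau> = (2::real) powr - (1/4)"
  have \<tau>: "0 < \<tau>" "\<tau> < 1" using powr_less_mono[of "- (1/4)" 0 "2::real"] by (auto simp: \<tau>_def)
  have b\<tau>: "inverse (b ^ k) powr (1 / p) = inverse (\<tau> ^ k)" for k
  proof -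
    have "b powr (1 / p) = \<tau>" using p by (simp add: b_def \<tau>_def powr_powr)
    moreover have "inverse (b ^ k) powr (1 / p) = inverse ((b powr (1 / p)) ^ k)"
      using b by (simp add: powr_power powr_powr powr_minus[symmetric] inverse_powr mult.commute flip: powr_realpow)
    ultimately show ?thesis by simp
  qed
  define c where "c k = 2 powr ?s * (2 ^ k) powr - ?s" for k :: nat
  have c0: "0 \<le> c k" for k by (simp add: c_def)
  define C2 where "C2 = 2 powr ?s * C1 * V / (1 - \<tau>)"
  have C2: "0 \<le> C2" using C1(1) V \<tau> by (simp add: C2_def)
  have cV: "c k * (C1 * (2 ^ (k * CARD('n)) * V) * (g * inverse (b ^ k)) powr (1 / p)) = 2 powr ?s * C1 * V * g powr (1 / p) * \<tau> ^ k" if "0 \<le> g" for k g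
  proof -
    have "(2 powr (-1/2::real)) ^ k = \<tau> ^ k * \<tau> ^ k"
    proof -
      have "2 powr (-1/2::real) = \<tau> * \<tau>" by (simp add: \<tau>_def flip: powr_add)
      then show ?thesis by (simp add: power_mult_distrib)
    qed
    then have d: "(2 ^ k) powr - ?s * 2 ^ (k * CARD('n)) = \<tau> ^ k * \<tau> ^ k" using dyadic_weight[of k "CARD('n)"] by simp
    have "c k * (C1 * (2 ^ (k * CARD('n)) * V) * (g * inverse (b ^ k)) powr (1 / p))
        = 2 powr ?s * C1 * V * g powr (1 / p) * (((2 ^ k) powr - ?s * 2 ^ (k * CARD('n))) * inverse (\<tau> ^ k))"
      unfolding c_def powr_mult b\<tau> by (simp only: mult_ac)
    also have "((2 ^ k) powr - ?s * 2 ^ (k * CARD('n))) * inverse (\<tau> ^ k) = \<tau> ^ k" unfolding d using \<tau> by simp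
    finally show ?thesis .
  qed
  define C where "C = max C2 (real K / (1 - b))"
  show ?thesis
  proof (rule that[of C])
    show "0 \<le> C" using C2 by (simp add: C_def)
    fix u assume u: "u \<in> Lpw p w"
    have um: "u \<in> borel_measurable lebesgue" using u by (simp add: Lpw_def)
    define I where "I = (LINT y|lebesgue. norm (u y) powr p * w y)"
    define g where "g y = ennreal (norm (u y) powr p * w y)" for y
    have gI: "(\<integral>\<^sup>+y. g y \<partial>lebesgue) = ennreal I" "0 \<le> I" using Lpw_nn[OF u] by (auto simp: g_def I_def)
    note [measurable] = um w_meas
    have gm: "g \<in> borel_measurable lebesgue" unfolding g_def by measurable
    define X where "X k x = (\<integral>\<^sup>+y. g y * indicator (ball x (2 ^ k)) y \<partial>lebesgue)" for k :: nat and x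
    define E where "E k x = X k x * ennreal (inverse (mass w x (2 ^ k)))" for k x
    have Xm: "X k \<in> borel_measurable lebesgue" for k
    proof -
      have "(\<lambda>q. g (snd q) * indicator (ball (fst q) (2 ^ k)) (snd q)) \<in> borel_measurable (lebesgue \<Otimes>\<^sub>M lebesgue)"
        using measurable_compose[OF measurable_snd gm] by (intro borel_measurable_times_ennreal measurable_indicator_ball)
      then show ?thesis unfolding X_def
        by (intro lebesgue.borel_measurable_nn_integral) (simp add: case_prod_unfold)
    qed
    have Em: "E k \<in> borel_measurable lebesgue" for k unfolding E_def using Xm iw by (intro borel_measurable_times_ennreal) auto
    define G where "G x = (\<Sum>k. ennreal (b ^ k) * E k x)" for x
    have Gm: "G \<in> borel_measurable lebesgue" unfolding G_def using Em by (intro borel_measurable_suminf_order borel_measurable_times_ennreal borel_measurable_const)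
    have Ew: "(\<integral>\<^sup>+x. E k x * ennreal (w x) \<partial>lebesgue) \<le> ennreal (real K * I)" for k
    proof -
      have "(\<integral>\<^sup>+x. E k x * ennreal (w x) \<partial>lebesgue) \<le> of_nat K * ennreal I"
        using K[OF gm, of "2^k"] unfolding E_def X_def gI(1) by simp
      then show ?thesis using gI(2) by (simp add: ennreal_mult flip: ennreal_of_nat_eq_real_of_nat)
    qed
    have Gw: "(\<integral>\<^sup>+x. G x * ennreal (w x) \<partial>lebesgue) \<le> ennreal (real K / (1 - b) * I)"
    proof -
      have m: "(\<lambda>x. E k x * ennreal (w x)) \<in> borel_measurable lebesgue" for k
        by (intro borel_measurable_times_ennreal Em ennreal_w_meas)
      have "(\<integral>\<^sup>+x. G x * ennreal (w x) \<partial>lebesgue) = (\<integral>\<^sup>+x. (\<Sum>k. ennreal (b ^ k) * (E k x * ennreal (w x))) \<partial>lebesgue)"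
        unfolding G_def by (intro nn_integral_cong) (simp add: ennreal_suminf_multc[symmetric] mult.assoc)
      also have "\<dots> = (\<Sum>k. ennreal (b ^ k) * (\<integral>\<^sup>+x. E k x * ennreal (w x) \<partial>lebesgue))"
        unfolding nn_integral_suminf[OF borel_measurable_times_ennreal[OF borel_measurable_const m]] nn_integral_cmult[OF m] ..
      also have "\<dots> \<le> (\<Sum>k. ennreal (b ^ k) * ennreal (real K * I))"
        by (intro suminf_le mult_left_mono Ew) auto
      also have "\<dots> = (\<Sum>k. ennreal (b ^ k * (real K * I)))"
        using b gI(2) by (intro suminf_cong ennreal_mult[symmetric]) auto
      also have "\<dots> = ennreal (\<Sum>k. b ^ k * (real K * I))"
        by (rule suminf_ennreal2) (use b gI(2) in \<open>auto intro!: summable_mult2 summable_geometric\<close>)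
      also have "(\<Sum>k. b ^ k * (real K * I)) = (\<Sum>k. b ^ k) * (real K * I)"
        by (rule suminf_mult2[symmetric]) (use b in \<open>auto intro!: summable_geometric\<close>)
      also have "\<dots> = real K / (1 - b) * I" using b by (simp add: suminf_geometric)
      finally show ?thesis .
    qed
    have fin: "AE x in lebesgue. G x < \<infinity>"
    proof -
      have "(\<integral>\<^sup>+x. G x * ennreal (w x) \<partial>lebesgue) \<noteq> \<infinity>" using Gw by (auto simp: top_unique)
      moreover have "(\<lambda>x. G x * ennreal (w x)) \<in> borel_measurable lebesgue" by (intro borel_measurable_times_ennreal Gm ennreal_w_meas)
      ultimately have "AE x in lebesgue. G x * ennreal (w x) \<noteq> \<infinity>" by (intro nn_integral_PInf_AE)
      then show ?thesis using w_pos
        by eventually_elim (auto simp: ennreal_mult_eq_top_iff less_top)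
    qed
    have main: "(\<integral>\<^sup>+y. ennreal (decay (x - y) * norm (u y)) \<partial>lebesgue) \<le> ennreal (C * enn2real (G x) powr (1 / p))" if x: "G x < \<infinity>" for x
    proof -
      define \<gamma> where "\<gamma> = enn2real (G x)"
      have \<gamma>: "G x = ennreal \<gamma>" "0 \<le> \<gamma>" using x by (auto simp: \<gamma>_def)
      have ball: "(\<integral>\<^sup>+y. ennreal (norm (u y)) * indicator (ball x (2 ^ k)) y \<partial>lebesgue)
          \<le> ennreal (C1 * (2 ^ (k * CARD('n)) * V) * (\<gamma> * inverse (b ^ k)) powr (1 / p))" for k
      proof -
        have mk: "0 < mass w x (2 ^ k)" using w_mass(2)[of "2^k" x] by simp
        \<comment> \<open>A single term of the series defining \<open>G\<close> is at most
          \<open>G x\<close>.\<close>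
        have "ennreal (b ^ k) * E k x = (\<Sum>l\<in>{k}. ennreal (b ^ l) * E l x)" by simp
        also have "\<dots> \<le> G x" unfolding G_def by (rule sum_le_suminf) auto
        finally have le: "ennreal (b ^ k) * E k x \<le> ennreal \<gamma>" unfolding \<gamma>(1) .
        have one: "inverse (b ^ k) * b ^ k * (inverse (mass w x (2 ^ k)) * mass w x (2 ^ k)) = 1"
          using b mk by simp
        have "X k x = X k x * ennreal (inverse (b ^ k) * b ^ k * (inverse (mass w x (2 ^ k)) * mass w x (2 ^ k)))"
          unfolding one by simp
        also have "\<dots> = ennreal (inverse (b ^ k)) * (ennreal (b ^ k) * E k x) * ennreal (mass w x (2 ^ k))"
        proof -
          have split: "ennreal (t1 * t2 * (t3 * t4)) = ennreal t1 * ennreal t2 * (ennreal t3 * ennreal t4)"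
            if "0 \<le> t1" "0 \<le> t2" "0 \<le> t3" "0 \<le> t4" for t1 t2 t3 t4
            using that by (simp add: ennreal_mult)
          have nn: "0 \<le> inverse (b ^ k)" "0 \<le> b ^ k" "0 \<le> inverse (mass w x (2 ^ k))" "0 \<le> mass w x (2 ^ k)"
            using b mk by simp_all
          show ?thesis unfolding E_def split[OF nn] by (simp only: mult_ac)
        qed
        also have "\<dots> \<le> ennreal (inverse (b ^ k)) * ennreal \<gamma> * ennreal (mass w x (2 ^ k))"
          by (intro mult_right_mono mult_left_mono le) auto
        also have "\<dots> = ennreal ((\<gamma> * inverse (b ^ k)) * mass w x (2 ^ k))"
          using b mk \<gamma> by (simp add: ennreal_mult mult_ac)
        finally have Xle: "X k x \<le> ennreal ((\<gamma> * inverse (b ^ k)) * mass w x (2 ^ k))" .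
        show ?thesis unfolding ballV[of x k, symmetric]
          by (rule C1(2)[OF um]) (use Xle b \<gamma> in \<open>auto simp: X_def g_def\<close>)
      qed
      have um': "(\<lambda>y. ennreal (norm (u y)) * indicator (ball x (2 ^ k)) y) \<in> borel_measurable lebesgue" for k :: nat
        by (intro borel_measurable_times_ennreal borel_measurable_indicator) (measurable, simp)
      have "(\<integral>\<^sup>+y. ennreal (decay (x - y) * norm (u y)) \<partial>lebesgue)
          \<le> (\<integral>\<^sup>+y. (\<Sum>k. ennreal (c k) * (ennreal (norm (u y)) * indicator (ball x (2 ^ k)) y)) \<partial>lebesgue)"
      proof (rule nn_integral_mono)
        fix y
        have "ennreal (decay (x - y)) \<le> (\<Sum>k. ennreal (c k) * indicator (ball (0::real^'n) (2 ^ k)) (x - y))"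
          unfolding c_def by (rule decay_le_suminf)
        also have "\<dots> = (\<Sum>k. ennreal (c k) * indicator (ball x (2 ^ k)) y)"
          by (intro suminf_cong) (simp add: indicator_def dist_norm norm_minus_commute)
        finally have "ennreal (decay (x - y)) * ennreal (norm (u y)) \<le> (\<Sum>k. ennreal (c k) * indicator (ball x (2 ^ k)) y) * ennreal (norm (u y))"
          by (rule mult_right_mono) simp
        then show "ennreal (decay (x - y) * norm (u y)) \<le> (\<Sum>k. ennreal (c k) * (ennreal (norm (u y)) * indicator (ball x (2 ^ k)) y))"
        proof -
          have "(\<Sum>k. ennreal (c k) * indicator (ball x (2 ^ k)) y) * ennreal (norm (u y))
              = (\<Sum>k. ennreal (c k) * indicator (ball x (2 ^ k)) y * ennreal (norm (u y)))"
            by (rule ennreal_suminf_multc[symmetric])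
          also have "\<dots> = (\<Sum>k. ennreal (c k) * (ennreal (norm (u y)) * indicator (ball x (2 ^ k)) y))"
            by (intro suminf_cong) (simp only: mult_ac)
          finally have eq: "(\<Sum>k. ennreal (c k) * indicator (ball x (2 ^ k)) y) * ennreal (norm (u y))
              = (\<Sum>k. ennreal (c k) * (ennreal (norm (u y)) * indicator (ball x (2 ^ k)) y))" .
          assume "ennreal (decay (x - y)) * ennreal (norm (u y)) \<le> (\<Sum>k. ennreal (c k) * indicator (ball x (2 ^ k)) y) * ennreal (norm (u y))"
          then show ?thesis unfolding eq ennreal_mult[OF decay_nonneg norm_ge_zero, symmetric] .
        qed
      qed
      also have "\<dots> = (\<Sum>k. ennreal (c k) * (\<integral>\<^sup>+y. ennreal (norm (u y)) * indicator (ball x (2 ^ k)) y \<partial>lebesgue))"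
        unfolding nn_integral_suminf[OF borel_measurable_times_ennreal[OF borel_measurable_const um']] nn_integral_cmult[OF um'] ..
      also have "\<dots> \<le> (\<Sum>k. ennreal (c k) * ennreal (C1 * (2 ^ (k * CARD('n)) * V) * (\<gamma> * inverse (b ^ k)) powr (1 / p)))"
        by (intro suminf_le mult_left_mono ball) auto
      also have "\<dots> = (\<Sum>k. ennreal (2 powr ?s * C1 * V * \<gamma> powr (1 / p) * \<tau> ^ k))"
        using c0 C1(1) V unfolding cV[OF \<gamma>(2), symmetric] by (intro suminf_cong ennreal_mult[symmetric]) auto
      also have "\<dots> = ennreal (\<Sum>k. 2 powr ?s * C1 * V * \<gamma> powr (1 / p) * \<tau> ^ k)"
        by (rule suminf_ennreal2) (use C1(1) V \<tau> in \<open>auto intro!: summable_mult summable_geometric\<close>)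
      also have "(\<Sum>k. 2 powr ?s * C1 * V * \<gamma> powr (1 / p) * \<tau> ^ k) = 2 powr ?s * C1 * V * \<gamma> powr (1 / p) * (\<Sum>k. \<tau> ^ k)"
        by (rule suminf_mult) (use \<tau> in \<open>auto intro!: summable_geometric\<close>)
      also have "\<dots> = C2 * \<gamma> powr (1 / p)" using \<tau> by (simp add: suminf_geometric C2_def)
      also have "ennreal (C2 * \<gamma> powr (1 / p)) \<le> ennreal (C * \<gamma> powr (1 / p))"
        by (intro ennreal_leI mult_right_mono) (auto simp: C_def)
      finally show ?thesis by (simp add: \<gamma>_def)
    qed
    show "\<exists>G\<in>borel_measurable lebesgue.
      (\<integral>\<^sup>+x. G x * ennreal (w x) \<partial>lebesgue) \<le> ennreal (C * (LINT y|lebesgue. norm (u y) powr p * w y)) \<and>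
      (AE x in lebesgue. G x < \<infinity> \<and>
        (\<integral>\<^sup>+y. ennreal (decay (x - y) * norm (u y)) \<partial>lebesgue) \<le> ennreal (C * enn2real (G x) powr (1 / p)))"
    proof (intro bexI[OF _ Gm] conjI)
      have "real K / (1 - b) * I \<le> C * I" using gI(2) by (intro mult_right_mono) (auto simp: C_def)
      then show "(\<integral>\<^sup>+x. G x * ennreal (w x) \<partial>lebesgue) \<le> ennreal (C * (LINT y|lebesgue. norm (u y) powr p * w y))"
        using Gw ennreal_leI order_trans unfolding I_def by blast
      show "AE x in lebesgue. G x < \<infinity> \<and>
        (\<integral>\<^sup>+y. ennreal (decay (x - y) * norm (u y)) \<partial>lebesgue) \<le> ennreal (C * enn2real (G x) powr (1 / p))"
        using fin by eventually_elim (use main in blast)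
    qed
  qed
qed

text \<open>Formulated for an arbitrary measurable \<open>T\<close> below the convolution, so that
  it yields the boundedness of an operator as well as the membership of a function. The finiteness
  almost everywhere is what makes the kernel integrals converge.\<close>

lemma dominated_operator:
  "\<exists>C\<ge>0. \<forall>u\<in>Lpw p w.
     (AE x in lebesgue. (\<integral>\<^sup>+y. ennreal (decay (x - y) * norm (u y)) \<partial>lebesgue) < \<infinity>) \<and>
     (\<forall>T D. T \<in> borel_measurable lebesgue \<longrightarrow> 0 \<le> D \<longrightarrow>
       (AE x in lebesgue. ennreal (norm (T x)) \<le> ennreal D * (\<integral>\<^sup>+y. ennreal (decay (x - y) * norm (u y)) \<partial>lebesgue)) \<longrightarrow>
       T \<in> Lpw p w \<and> Lpw_norm p w T \<le> D * C * Lpw_norm p w u)"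
proof -
  obtain C where C: "0 \<le> C" and op:
    "\<And>u. u \<in> Lpw p w \<Longrightarrow> \<exists>G\<in>borel_measurable lebesgue.
      (\<integral>\<^sup>+x. G x * ennreal (w x) \<partial>lebesgue) \<le> ennreal (C * (LINT y|lebesgue. norm (u y) powr p * w y)) \<and>
      (AE x in lebesgue. G x < \<infinity> \<and>
        (\<integral>\<^sup>+y. ennreal (decay (x - y) * norm (u y)) \<partial>lebesgue) \<le> ennreal (C * enn2real (G x) powr (1 / p)))"
    using decay_operator_bound by blast
  show ?thesis
  proof (intro exI[of _ "C * C powr (1 / p)"] conjI ballI allI impI)
    show "0 \<le> C * C powr (1 / p)" using C by simp
  next
    fix u assume u: "u \<in> Lpw p w"
    obtain G where G: "G \<in> borel_measurable lebesgue"
      "(\<integral>\<^sup>+x. G x * ennreal (w x) \<partial>lebesgue) \<le> ennreal (C * (LINT y|lebesgue. norm (u y) powr p * w y))"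
      "AE x in lebesgue. G x < \<infinity> \<and>
        (\<integral>\<^sup>+y. ennreal (decay (x - y) * norm (u y)) \<partial>lebesgue) \<le> ennreal (C * enn2real (G x) powr (1 / p))"
      using op[OF u] by blast
    show "AE x in lebesgue. (\<integral>\<^sup>+y. ennreal (decay (x - y) * norm (u y)) \<partial>lebesgue) < \<infinity>"
      using G(3) by eventually_elim (auto intro: le_less_trans)
  next
    fix u and T :: "real^'n \<Rightarrow> complex" and D :: real
    assume u: "u \<in> Lpw p w" and T: "T \<in> borel_measurable lebesgue" and D: "0 \<le> D" and
      dom: "AE x in lebesgue. ennreal (norm (T x)) \<le> ennreal D * (\<integral>\<^sup>+y. ennreal (decay (x - y) * norm (u y)) \<partial>lebesgue)"
    obtain G where G: "G \<in> borel_measurable lebesgue"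
      "(\<integral>\<^sup>+x. G x * ennreal (w x) \<partial>lebesgue) \<le> ennreal (C * (LINT y|lebesgue. norm (u y) powr p * w y))"
      "AE x in lebesgue. G x < \<infinity> \<and>
        (\<integral>\<^sup>+y. ennreal (decay (x - y) * norm (u y)) \<partial>lebesgue) \<le> ennreal (C * enn2real (G x) powr (1 / p))"
      using op[OF u] by blast
    define I where "I = (LINT y|lebesgue. norm (u y) powr p * w y)"
    have I: "0 \<le> I" using Lpw_nn(2)[OF u] by (simp add: I_def)
    note [measurable] = T w_meas
    have m: "(\<lambda>x. norm (T x) powr p * w x) \<in> borel_measurable lebesgue" by measurable
    have bound: "AE x in lebesgue. ennreal (norm (T x) powr p * w x) \<le> ennreal ((D * C) powr p) * (G x * ennreal (w x))"
      using dom G(3) w_pos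
    proof eventually_elim
      fix x assume d: "ennreal (norm (T x)) \<le> ennreal D * (\<integral>\<^sup>+y. ennreal (decay (x - y) * norm (u y)) \<partial>lebesgue)"
        and g: "G x < \<infinity> \<and> (\<integral>\<^sup>+y. ennreal (decay (x - y) * norm (u y)) \<partial>lebesgue) \<le> ennreal (C * enn2real (G x) powr (1 / p))"
        and wx: "0 < w x"
      define \<gamma> where "\<gamma> = enn2real (G x)"
      have \<gamma>: "G x = ennreal \<gamma>" "0 \<le> \<gamma>" using g by (auto simp: \<gamma>_def)
      have "ennreal (norm (T x)) \<le> ennreal D * ennreal (C * \<gamma> powr (1 / p))"
        using d g unfolding \<gamma>_def by (meson mult_left_mono order_trans zero_le)
      also have "\<dots> = ennreal (D * C * \<gamma> powr (1 / p))" using C D by (simp add: ennreal_mult mult.assoc)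
      finally have "norm (T x) \<le> D * C * \<gamma> powr (1 / p)" using C D by (simp add: ennreal_le_iff)
      then have "norm (T x) powr p \<le> (D * C * \<gamma> powr (1 / p)) powr p" using p by (intro powr_mono2) auto
      also have "\<dots> = (D * C) powr p * \<gamma>" using p \<gamma>(2) by (simp add: powr_mult powr_powr)
      finally have "norm (T x) powr p * w x \<le> (D * C) powr p * (\<gamma> * w x)"
        using wx by (simp add: mult.assoc[symmetric] mult_right_mono)
      then show "ennreal (norm (T x) powr p * w x) \<le> ennreal ((D * C) powr p) * (G x * ennreal (w x))"
        unfolding \<gamma>(1) using \<gamma>(2) wx by (simp add: ennreal_mult[symmetric] ennreal_leI)
    qed
    have nn: "AE x in lebesgue. 0 \<le> norm (T x) powr p * w x" using w_pos by eventually_elim simp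
    have "(\<integral>\<^sup>+x. ennreal (norm (T x) powr p * w x) \<partial>lebesgue) \<le> (\<integral>\<^sup>+x. ennreal ((D * C) powr p) * (G x * ennreal (w x)) \<partial>lebesgue)"
      by (rule nn_integral_mono_AE[OF bound])
    also have "\<dots> = ennreal ((D * C) powr p) * (\<integral>\<^sup>+x. G x * ennreal (w x) \<partial>lebesgue)"
      by (intro nn_integral_cmult borel_measurable_times_ennreal G(1) ennreal_w_meas)
    also have "\<dots> \<le> ennreal ((D * C) powr p) * ennreal (C * I)" unfolding I_def by (intro mult_left_mono G(2)) simp
    also have "\<dots> = ennreal ((D * C) powr p * (C * I))" using C I by (simp add: ennreal_mult)
    finally have le: "(\<integral>\<^sup>+x. ennreal (norm (T x) powr p * w x) \<partial>lebesgue) \<le> ennreal ((D * C) powr p * (C * I))" .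
    have int: "integrable lebesgue (\<lambda>x. norm (T x) powr p * w x)"
      by (rule integrableI_nonneg[OF m nn]) (use le in \<open>auto intro: le_less_trans\<close>)
    then have TL: "T \<in> Lpw p w" using T by (simp add: Lpw_def)
    have "(LINT x|lebesgue. norm (T x) powr p * w x) \<le> (D * C) powr p * (C * I)"
      using le C I unfolding Lpw_nn(1)[OF TL] by (simp add: ennreal_le_iff)
    then have "Lpw_norm p w T \<le> ((D * C) powr p * (C * I)) powr (1 / p)"
      unfolding Lpw_norm_def using p Lpw_nn(2)[OF TL] by (intro powr_mono2) auto
    also have "\<dots> = D * (C * C powr (1 / p)) * I powr (1 / p)" using p C D by (simp add: powr_mult powr_powr)
    finally show "Lpw_norm p w T \<le> D * (C * C powr (1 / p)) * Lpw_norm p w u"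
      by (simp add: Lpw_norm_def I_def)
    show "T \<in> Lpw p w" by (rule TL)
  qed
qed

text \<open>The indicator of the unit ball belongs to the space because \<open>w\<close> is locally
  integrable, and its convolution with \<open>decay\<close> is bounded below by a multiple of
  \<open>decay\<close>, hence dominates every Schwartz function. So
  \<open>dominated_operator\<close> replaces a separate growth estimate for the weight.\<close>

lemma schwartz_subset_Lpw: "schwartz \<subseteq> Lpw p w"
proof
  fix u :: "real^'n \<Rightarrow> complex" assume u: "u \<in> schwartz"
  obtain C where C: "0 \<le> C" "\<forall>u\<in>Lpw p w.
     (AE x in lebesgue. (\<integral>\<^sup>+y. ennreal (decay (x - y) * norm (u y)) \<partial>lebesgue) < \<infinity>) \<and>
     (\<forall>T D. T \<in> borel_measurable lebesgue \<longrightarrow> 0 \<le> D \<longrightarrow>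
       (AE x in lebesgue. ennreal (norm (T x)) \<le> ennreal D * (\<integral>\<^sup>+y. ennreal (decay (x - y) * norm (u y)) \<partial>lebesgue)) \<longrightarrow>
       T \<in> Lpw p w \<and> Lpw_norm p w T \<le> D * C * Lpw_norm p w u)"
    using dominated_operator by (elim exE conjE)
  let ?s = "real CARD('n) + 1/2"
  define e where "e = (\<lambda>y::real^'n. indicator (ball 0 1) y :: complex)"
  have e: "e \<in> Lpw p w"
  proof -
    have "integrable lebesgue (\<lambda>y. indicator (ball 0 1) y *\<^sub>R w y)" using w_int[of 0 1] by (simp add: set_integrable_def)
    moreover have "(\<lambda>y. norm (e y) powr p * w y) = (\<lambda>y. indicator (ball 0 1) y *\<^sub>R w y)"
      by (simp add: fun_eq_iff e_def indicator_def)
    moreover have "e \<in> borel_measurable lebesgue" unfolding e_def by (rule borel_measurable_indicator) simp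
    ultimately show ?thesis by (simp add: Lpw_def)
  qed
  obtain Cu where Cu: "0 \<le> Cu" "\<And>x. norm (partials [] u x) \<le> Cu * decay x" using schwartz_decay[OF u, where \<alpha>="[]"] by blast
  define V where "V = measure lebesgue (ball (0::real^'n) 1)"
  have V: "0 < V" using content_ball_pos[of 1 "0::real^'n"] by (simp add: V_def)
  have eV: "emeasure lebesgue (ball (0::real^'n) 1) = ennreal V"
    using emeasure_bounded_finite[OF bounded_ball, of "0::real^'n" 1] unfolding V_def
    by (intro emeasure_eq_ennreal_measure) auto
  have "u \<in> Lpw p w \<and> Lpw_norm p w u \<le> (Cu * 2 powr ?s / V) * C * Lpw_norm p w e"
  proof (rule C(2)[rule_format, OF e, THEN conjunct2, rule_format])
    have "u \<in> borel_measurable lborel" using schwartz_integrable(2)[OF u, of "[]"] by simp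
    then show "u \<in> borel_measurable lebesgue" by (rule measurable_completion)
    show "0 \<le> Cu * 2 powr ?s / V" using Cu V by simp
    show "AE x in lebesgue. ennreal (norm (u x)) \<le> ennreal (Cu * 2 powr ?s / V) * (\<integral>\<^sup>+y. ennreal (decay (x - y) * norm (e y)) \<partial>lebesgue)"
    proof (rule AE_I2)
      fix x :: "real^'n"
      have "ennreal (decay x / 2 powr ?s * V) = (\<integral>\<^sup>+y. ennreal (decay x / 2 powr ?s) * indicator (ball (0::real^'n) 1) y \<partial>lebesgue)"
      proof -
        have 1: "(\<integral>\<^sup>+y. ennreal (decay x / 2 powr ?s) * indicator (ball (0::real^'n) 1) y \<partial>lebesgue) = ennreal (decay x / 2 powr ?s) * ennreal V"
          unfolding eV[symmetric] by (rule nn_integral_cmult_indicator) simp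
        have 0: "0 \<le> decay x / 2 powr ?s" by (intro divide_nonneg_nonneg decay_nonneg) simp
        show ?thesis unfolding 1 by (rule ennreal_mult[OF 0]) (use V in simp)
      qed
      also have "\<dots> \<le> (\<integral>\<^sup>+y. ennreal (decay (x - y) * norm (e y)) \<partial>lebesgue)"
      proof (rule nn_integral_mono)
        fix y :: "real^'n"
        show "ennreal (decay x / 2 powr ?s) * indicator (ball 0 1) y \<le> ennreal (decay (x - y) * norm (e y))"
        proof (cases "y \<in> ball 0 1")
          case True
          have "1 + norm (x - y) \<le> 2 * (1 + norm x)" using True norm_triangle_ineq4[of x y] norm_ge_zero[of x] unfolding mem_ball_0 by argo
          then have "decay x \<le> 2 powr ?s * decay (x - y)" by (rule decay_le_scaled) simp
          then have "decay x / 2 powr ?s \<le> decay (x - y)" by (simp add: divide_le_eq mult.commute)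
          then show ?thesis using True by (simp add: e_def ennreal_leI)
        qed simp
      qed
      finally have le: "ennreal (decay x / 2 powr ?s * V) \<le> (\<integral>\<^sup>+y. ennreal (decay (x - y) * norm (e y)) \<partial>lebesgue)" .
      have "norm (u x) \<le> (Cu * 2 powr ?s / V) * (decay x / 2 powr ?s * V)" using Cu(2)[of x] V by simp
      then have "ennreal (norm (u x)) \<le> ennreal (Cu * 2 powr ?s / V) * ennreal (decay x / 2 powr ?s * V)"
        using Cu V decay_nonneg[of x] by (subst ennreal_mult[symmetric]) (auto intro: ennreal_leI)
      also have "\<dots> \<le> ennreal (Cu * 2 powr ?s / V) * (\<integral>\<^sup>+y. ennreal (decay (x - y) * norm (e y)) \<partial>lebesgue)"
        by (intro mult_left_mono le) simp
      finally show "ennreal (norm (u x)) \<le> ennreal (Cu * 2 powr ?s / V) * (\<integral>\<^sup>+y. ennreal (decay (x - y) * norm (e y)) \<partial>lebesgue)" .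
    qed
  qed
  then show "u \<in> Lpw p w" by simp
qed

end

subsection \<open>Conclusion\<close>

lemma dense_bound:
  fixes f :: "'a::topological_space \<Rightarrow> real"
  assumes D: "\<And>X. open X \<Longrightarrow> X \<noteq> {} \<Longrightarrow> \<exists>d\<in>D. d \<in> X" and S: "open S" and f: "continuous_on S f"
    and b: "\<And>d. d \<in> D \<Longrightarrow> d \<in> S \<Longrightarrow> f d \<le> C" and x: "x \<in> S"
  shows "f x \<le> C"
proof (rule ccontr)
  assume "\<not> f x \<le> C"
  then have "x \<in> f -` {C<..} \<inter> S" using x by simp
  moreover have "open (f -` {C<..} \<inter> S)" using iffD1[OF continuous_on_open_vimage[OF S] f] open_greaterThan by simp
  ultimately obtain d where "d \<in> D" "d \<in> f -` {C<..} \<inter> S" using D by blast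
  then show False using b[of d] by simp
qed

lemma AE_lebesgue_ex:
  assumes "AE x in (lebesgue :: 'a::euclidean_space measure). P x"
  shows "\<exists>x. P x"
proof (rule ccontr)
  assume nP: "\<nexists>x. P x"
  have "AE x in (lebesgue :: 'a measure). x \<notin> ball 0 1" by (rule eventually_mono[OF assms]) (use nP in blast)
  then have "emeasure lebesgue (ball (0::'a) 1) = 0"
    by (subst (asm) AE_iff_measurable[where N="ball 0 1"]) auto
  then show False using content_ball_pos[of 1 "0::'a"] by (simp add: measure_def)
qed

text \<open>Completeness of Lebesgue measure makes the exceptional set measurable, although
  \<open>P\<close> is an arbitrary predicate.\<close>

lemma borel_measurable_lebesgue_modify:
  assumes "f \<in> borel_measurable lebesgue" "AE x in lebesgue. P x"
  shows "(\<lambda>x. if P x then f x else c) \<in> borel_measurable (lebesgue :: 'a::euclidean_space measure)"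
proof -
  obtain N where N: "{x \<in> space lebesgue. \<not> P x} \<subseteq> N" "N \<in> null_sets (lebesgue :: 'a measure)"
    using assms(2) by (auto elim!: AE_E simp: null_sets_def)
  then have "{x. \<not> P x} \<in> null_sets (lebesgue :: 'a measure)"
    by (intro null_sets_completion_subset[of "{x. \<not> P x}" N]) auto
  then have "{x. \<not> P x} \<in> sets (lebesgue :: 'a measure)" by auto
  then have "- {x. \<not> P x} \<in> sets (lebesgue :: 'a measure)" by (simp add: Compl_in_sets_lebesgue)
  moreover have "- {x. \<not> P x} = {x \<in> space lebesgue. P x}" by auto
  ultimately have "{x \<in> space (lebesgue :: 'a measure). P x} \<in> sets lebesgue" by simp
  then show ?thesis using assms(1) by (intro measurable_If) auto
qed

lemma continuous_on_jbracket_powr: "continuous_on S (\<lambda>\<xi>. jbracket \<xi> powr s)"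
  unfolding jbracket_def by (intro continuous_intros) (auto, smt (verit) zero_le_power2)

text \<open>In the definition the null set may depend on \<xi> and on the multi-index. There are
  countably many multi-indices, a countable dense set of \<xi> suffices by continuity, and countably
  many null sets have a null union.\<close>

lemma Linf_symbol_uniform:
  fixes a :: "real^'n \<Rightarrow> real^'n \<Rightarrow> complex"
  assumes a: "a \<in> Linf_symbol m \<rho>"
  obtains C where "AE x in lebesgue. \<forall>\<alpha> \<xi>. jbracket \<xi> powr (- m + \<rho> * real (length \<alpha>)) * norm (partials \<alpha> (a x) \<xi>) \<le> C \<alpha>"
proof -
  have "\<forall>\<alpha>. \<exists>C. \<forall>\<xi>. AE x in lebesgue. jbracket \<xi> powr (- m + \<rho> * real (length \<alpha>)) * norm (partials \<alpha> (a x) \<xi>) \<le> C"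
    using a by (auto simp: Linf_symbol_def)
  then obtain C where C: "\<And>\<alpha> \<xi>. AE x in lebesgue. jbracket \<xi> powr (- m + \<rho> * real (length \<alpha>)) * norm (partials \<alpha> (a x) \<xi>) \<le> C \<alpha>"
    unfolding choice_iff by blast
  obtain D :: "(real^'n) set" where D: "countable D" "\<And>X. open X \<Longrightarrow> X \<noteq> {} \<Longrightarrow> \<exists>d\<in>D. d \<in> X"
    using countable_dense_exists[where 'a="real^'n"] by blast
  have "AE x in lebesgue. \<forall>\<alpha>. \<forall>\<xi>\<in>D. jbracket \<xi> powr (- m + \<rho> * real (length \<alpha>)) * norm (partials \<alpha> (a x) \<xi>) \<le> C \<alpha>"
    unfolding AE_all_countable AE_ball_countable[OF D(1)] using C by blast
  then have "AE x in lebesgue. \<forall>\<alpha> \<xi>. jbracket \<xi> powr (- m + \<rho> * real (length \<alpha>)) * norm (partials \<alpha> (a x) \<xi>) \<le> C \<alpha>"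
  proof eventually_elim
    case (elim x)
    show ?case
    proof (intro allI)
      fix \<alpha> \<xi>
      have "continuous_on UNIV (partials \<alpha> (a x))"
        using a by (intro continuous_on_differentiable_UNIV) (auto simp: Linf_symbol_def smooth_on_def)
      then have "continuous_on UNIV (\<lambda>\<xi>. jbracket \<xi> powr (- m + \<rho> * real (length \<alpha>)) * norm (partials \<alpha> (a x) \<xi>))"
        by (intro continuous_on_mult continuous_on_norm continuous_on_jbracket_powr)
      from dense_bound[OF D(2) open_UNIV this, of "C \<alpha>" \<xi>]
      show "jbracket \<xi> powr (- m + \<rho> * real (length \<alpha>)) * norm (partials \<alpha> (a x) \<xi>) \<le> C \<alpha>"
        using elim by auto
    qed
  qed
  then show ?thesis by (rule that)
qed

lemma Linf_Phi1_uniform: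
  fixes \<theta> :: "real^'n \<Rightarrow> real^'n \<Rightarrow> real"
  assumes th: "\<theta> \<in> Linf_Phi1"
  obtains C where "AE x in lebesgue. \<forall>\<alpha> \<xi>. length \<alpha> \<ge> 1 \<longrightarrow> \<xi> \<noteq> 0 \<longrightarrow>
    norm \<xi> powr (- 1 + real (length \<alpha>)) * \<bar>partials \<alpha> (\<theta> x) \<xi>\<bar> \<le> C \<alpha>"
proof -
  have "\<forall>\<alpha>. \<exists>C. length \<alpha> \<ge> 1 \<longrightarrow> (\<forall>\<xi>. \<xi> \<noteq> 0 \<longrightarrow> (AE x in lebesgue. norm \<xi> powr (- 1 + real (length \<alpha>)) * \<bar>partials \<alpha> (\<theta> x) \<xi>\<bar> \<le> C))"
    using th by (auto simp: Linf_Phi1_def)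
  then obtain C where "\<forall>\<alpha>. length \<alpha> \<ge> 1 \<longrightarrow> (\<forall>\<xi>. \<xi> \<noteq> 0 \<longrightarrow> (AE x in lebesgue. norm \<xi> powr (- 1 + real (length \<alpha>)) * \<bar>partials \<alpha> (\<theta> x) \<xi>\<bar> \<le> C \<alpha>))"
    unfolding choice_iff by blast
  then have C: "AE x in lebesgue. length \<alpha> \<ge> 1 \<longrightarrow> \<xi> \<noteq> 0 \<longrightarrow> norm \<xi> powr (- 1 + real (length \<alpha>)) * \<bar>partials \<alpha> (\<theta> x) \<xi>\<bar> \<le> C \<alpha>" for \<alpha> \<xi>
    by (cases "length \<alpha> \<ge> 1 \<and> \<xi> \<noteq> 0") auto
  obtain D :: "(real^'n) set" where D: "countable D" "\<And>X. open X \<Longrightarrow> X \<noteq> {} \<Longrightarrow> \<exists>d\<in>D. d \<in> X"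
    using countable_dense_exists[where 'a="real^'n"] by blast
  have "AE x in lebesgue. \<forall>\<alpha>. \<forall>\<xi>\<in>D. length \<alpha> \<ge> 1 \<longrightarrow> \<xi> \<noteq> 0 \<longrightarrow> norm \<xi> powr (- 1 + real (length \<alpha>)) * \<bar>partials \<alpha> (\<theta> x) \<xi>\<bar> \<le> C \<alpha>"
    unfolding AE_all_countable AE_ball_countable[OF D(1)] using C by blast
  then have "AE x in lebesgue. \<forall>\<alpha> \<xi>. length \<alpha> \<ge> 1 \<longrightarrow> \<xi> \<noteq> 0 \<longrightarrow>
    norm \<xi> powr (- 1 + real (length \<alpha>)) * \<bar>partials \<alpha> (\<theta> x) \<xi>\<bar> \<le> C \<alpha>"
  proof eventually_elim
    case (elim x)
    show ?case
    proof (intro allI impI)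
      fix \<alpha> :: "'n list" and \<xi> :: "real^'n" assume l: "length \<alpha> \<ge> 1" and \<xi>: "\<xi> \<noteq> 0"
      have "continuous_on (- {0}) (partials \<alpha> (\<theta> x))"
        using th by (intro continuous_at_imp_continuous_on ballI differentiable_imp_continuous_within)
          (auto simp: Linf_Phi1_def smooth_on_def)
      then have "continuous_on (- {0}) (\<lambda>\<xi>. norm \<xi> powr (- 1 + real (length \<alpha>)) * \<bar>partials \<alpha> (\<theta> x) \<xi>\<bar>)"
        by (intro continuous_intros) auto
      from dense_bound[OF D(2) _ this, of "C \<alpha>" \<xi>]
      show "norm \<xi> powr (- 1 + real (length \<alpha>)) * \<bar>partials \<alpha> (\<theta> x) \<xi>\<bar> \<le> C \<alpha>"
        using elim l \<xi> by auto
    qed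
  qed
  then show ?thesis by (rule that)
qed

text \<open>The linear term shifts first derivatives by a constant and disappears from the second.
  It carries the determinant condition from the phase over to the homogeneous part.\<close>

lemma hessian_phase:
  fixes \<phi> :: "real^'n \<Rightarrow> real"
  assumes s: "smooth_on (- {0}) (\<lambda>\<xi>. \<phi> \<xi> - v \<bullet> \<xi>)" and \<xi>: "\<xi> \<noteq> 0"
  shows "hessian \<phi> \<xi> = hessian (\<lambda>\<xi>. \<phi> \<xi> - v \<bullet> \<xi>) \<xi>"
proof -
  let ?\<theta> = "\<lambda>\<xi>. \<phi> \<xi> - v \<bullet> \<xi>"
  have d: "partials \<alpha> ?\<theta> differentiable at \<eta>" if "\<eta> \<noteq> 0" for \<alpha> \<eta> using s that by (auto simp: smooth_on_def)
  have dv: "((\<lambda>\<xi>. v \<bullet> \<xi>) has_derivative (\<lambda>h. v \<bullet> h)) (at \<eta>)" for \<eta> by (auto intro!: derivative_eq_intros)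
  have 1: "partial j \<phi> \<eta> = partial j ?\<theta> \<eta> + v $ j" if "\<eta> \<noteq> 0" for j \<eta>
    using partial_add[OF d[OF that, of "[]", simplified] differentiableI[OF dv], of j] partial_has_derivative[OF dv, of j \<eta>]
    by (simp add: inner_axis)
  have "partial i (partial j \<phi>) \<xi> = partial i (partial j ?\<theta>) \<xi>" for i j
  proof -
    have "partial i (partial j \<phi>) \<xi> = partial i (\<lambda>\<eta>. partial j ?\<theta> \<eta> + v $ j) \<xi>"
      by (rule partial_cong_open[of "- {0}"]) (use 1 \<xi> in auto)
    also have "\<dots> = partial i (partial j ?\<theta>) \<xi>"
      using d[OF \<xi>, of "[j]"] by (subst partial_add) (auto simp: partial_const)
    finally show ?thesis .
  qed
  then show ?thesis by (simp add: hessian_def)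
qed

text \<open>The extension \<open>S\<close> is integration against the kernel on all of the weighted
  space; the majorant makes the integral absolutely convergent at almost every \<open>x\<close>.
  This is why additivity holds only almost everywhere.\<close>

lemma kernel_operator_bounded:
  fixes \<kappa> :: "real^'n \<Rightarrow> real^'n \<Rightarrow> complex"
  assumes p: "1 < p" and w: "w \<in> A_weight p" and C: "0 \<le> C"
    and meas: "(\<lambda>q. \<kappa> (fst q) (snd q)) \<in> borel_measurable (lebesgue \<Otimes>\<^sub>M borel)"
    and bd: "\<And>x z. norm (\<kappa> x z) \<le> C * decay z"
    and T: "\<And>u. u \<in> schwartz \<Longrightarrow> AE x in lebesgue. b * (LBINT y. \<kappa> x (x - y) * u y) = T u x"
  shows "bounded_on_Lpw p w T"
proof -
  interpret muckenhoupt w p by unfold_locales (rule p w)+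
  obtain C' where C': "0 \<le> C'" "\<forall>u\<in>Lpw p w.
     (AE x in lebesgue. (\<integral>\<^sup>+y. ennreal (decay (x - y) * norm (u y)) \<partial>lebesgue) < \<infinity>) \<and>
     (\<forall>T D. T \<in> borel_measurable lebesgue \<longrightarrow> 0 \<le> D \<longrightarrow>
       (AE x in lebesgue. ennreal (norm (T x)) \<le> ennreal D * (\<integral>\<^sup>+y. ennreal (decay (x - y) * norm (u y)) \<partial>lebesgue)) \<longrightarrow>
       T \<in> Lpw p w \<and> Lpw_norm p w T \<le> D * C' * Lpw_norm p w u)"
    using dominated_operator by (elim exE conjE)
  define S where "S u x = b * (LINT y|lebesgue. \<kappa> x (x - y) * u y)" for u x
  have K2: "(\<lambda>q. \<kappa> (fst q) (fst q - snd q)) \<in> borel_measurable (lebesgue \<Otimes>\<^sub>M lebesgue)"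
  proof -
    have f: "fst \<in> measurable (lebesgue \<Otimes>\<^sub>M lebesgue) (borel :: (real^'n) measure)"
      and s: "snd \<in> measurable (lebesgue \<Otimes>\<^sub>M lebesgue) (borel :: (real^'n) measure)"
      using measurable_compose[OF measurable_fst measurable_lebesgue_ident] measurable_compose[OF measurable_snd measurable_lebesgue_ident]
      by auto
    have "(\<lambda>q. (fst q, fst q - snd q)) \<in> measurable (lebesgue \<Otimes>\<^sub>M lebesgue) (lebesgue \<Otimes>\<^sub>M (borel :: (real^'n) measure))"
      by (intro measurable_Pair measurable_fst borel_measurable_diff f s)
    from measurable_compose[OF this meas] show ?thesis by simp
  qed
  have K1: "(\<lambda>y. \<kappa> x (x - y)) \<in> borel_measurable lebesgue" for x
    using measurable_Pair2[OF K2, of x] by simp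
  have majorant: "(\<integral>\<^sup>+y. ennreal (norm (\<kappa> x (x - y) * u y)) \<partial>lebesgue)
      \<le> ennreal C * (\<integral>\<^sup>+y. ennreal (decay (x - y) * norm (u y)) \<partial>lebesgue)"
    if u: "u \<in> borel_measurable lebesgue" for u x
  proof -
    have dm: "(\<lambda>y. ennreal (decay (x - y) * norm (u y))) \<in> borel_measurable lebesgue"
    proof -
      have "(\<lambda>y. decay (x - y)) \<in> borel_measurable lebesgue"
        by (rule measurable_compose[OF measurable_lebesgue_ident]) measurable
      then show ?thesis using u by measurable
    qed
    have "(\<integral>\<^sup>+y. ennreal (norm (\<kappa> x (x - y) * u y)) \<partial>lebesgue) \<le> (\<integral>\<^sup>+y. ennreal C * ennreal (decay (x - y) * norm (u y)) \<partial>lebesgue)"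
    proof (rule nn_integral_mono)
      fix y
      have "norm (\<kappa> x (x - y) * u y) \<le> C * (decay (x - y) * norm (u y))"
        using mult_right_mono[OF bd[of x "x - y"] norm_ge_zero[of "u y"]] by (simp add: norm_mult mult.assoc)
      then show "ennreal (norm (\<kappa> x (x - y) * u y)) \<le> ennreal C * ennreal (decay (x - y) * norm (u y))"
        using C decay_nonneg[of "x - y"] by (subst ennreal_mult[symmetric]) (auto intro: ennreal_leI)
    qed
    also have "\<dots> = ennreal C * (\<integral>\<^sup>+y. ennreal (decay (x - y) * norm (u y)) \<partial>lebesgue)" by (rule nn_integral_cmult[OF dm])
    finally show ?thesis .
  qed
  have int: "integrable lebesgue (\<lambda>y. \<kappa> x (x - y) * u y)"
    if u: "u \<in> borel_measurable lebesgue" and fin: "(\<integral>\<^sup>+y. ennreal (decay (x - y) * norm (u y)) \<partial>lebesgue) < \<infinity>" for u x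
  proof (rule integrableI_bounded)
    show "(\<lambda>y. \<kappa> x (x - y) * u y) \<in> borel_measurable lebesgue" by (intro borel_measurable_times K1 u)
    have "(\<integral>\<^sup>+y. ennreal (norm (\<kappa> x (x - y) * u y)) \<partial>lebesgue) \<le> ennreal C * (\<integral>\<^sup>+y. ennreal (decay (x - y) * norm (u y)) \<partial>lebesgue)"
      by (rule majorant[OF u])
    also have "\<dots> < \<infinity>" using fin by (simp add: ennreal_mult_less_top)
    finally show "(\<integral>\<^sup>+y. ennreal (norm (\<kappa> x (x - y) * u y)) \<partial>lebesgue) < \<infinity>" .
  qed
  have Sbound: "ennreal (norm (S u x)) \<le> ennreal (norm b * C) * (\<integral>\<^sup>+y. ennreal (decay (x - y) * norm (u y)) \<partial>lebesgue)"
    if u: "u \<in> borel_measurable lebesgue" and fin: "(\<integral>\<^sup>+y. ennreal (decay (x - y) * norm (u y)) \<partial>lebesgue) < \<infinity>" for u x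
  proof -
    have "ennreal (norm (LINT y|lebesgue. \<kappa> x (x - y) * u y)) \<le> (\<integral>\<^sup>+y. ennreal (norm (\<kappa> x (x - y) * u y)) \<partial>lebesgue)"
      by (rule integral_norm_bound_ennreal[OF int[OF u fin]])
    also have "\<dots> \<le> ennreal C * (\<integral>\<^sup>+y. ennreal (decay (x - y) * norm (u y)) \<partial>lebesgue)" by (rule majorant[OF u])
    finally have "ennreal (norm b) * ennreal (norm (LINT y|lebesgue. \<kappa> x (x - y) * u y)) \<le> ennreal (norm b) * (ennreal C * (\<integral>\<^sup>+y. ennreal (decay (x - y) * norm (u y)) \<partial>lebesgue))"
      by (rule mult_left_mono) simp
    then show ?thesis unfolding S_def norm_mult ennreal_mult[OF norm_ge_zero norm_ge_zero] ennreal_mult[OF norm_ge_zero C] by (simp only: mult.assoc)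
  qed
  have Smeas: "S u \<in> borel_measurable lebesgue" if u: "u \<in> borel_measurable lebesgue" for u
  proof -
    have "(\<lambda>q. \<kappa> (fst q) (fst q - snd q) * u (snd q)) \<in> borel_measurable (lebesgue \<Otimes>\<^sub>M lebesgue)"
      by (intro borel_measurable_times K2 measurable_compose[OF measurable_snd u])
    then have "(\<lambda>x. LINT y|lebesgue. \<kappa> x (x - y) * u y) \<in> borel_measurable lebesgue"
      by (intro lebesgue.borel_measurable_lebesgue_integral) (simp add: case_prod_unfold)
    then show ?thesis unfolding S_def by (intro borel_measurable_times borel_measurable_const)
  qed
  have meas_u: "u \<in> borel_measurable lebesgue" if "u \<in> Lpw p w" for u using that by (simp add: Lpw_def)
  show ?thesis unfolding bounded_on_Lpw_def
  proof (intro conjI exI[of _ S] exI[of _ "norm b * C * C'"])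
    show "schwartz \<subseteq> Lpw p w" by (rule schwartz_subset_Lpw)
    show "\<forall>u\<in>Lpw p w. S u \<in> Lpw p w \<and> Lpw_norm p w (S u) \<le> norm b * C * C' * Lpw_norm p w u"
    proof
      fix u assume u: "u \<in> Lpw p w"
      have "AE x in lebesgue. (\<integral>\<^sup>+y. ennreal (decay (x - y) * norm (u y)) \<partial>lebesgue) < \<infinity>" using C'(2) u by blast
      then have "AE x in lebesgue. ennreal (norm (S u x)) \<le> ennreal (norm b * C) * (\<integral>\<^sup>+y. ennreal (decay (x - y) * norm (u y)) \<partial>lebesgue)"
        by eventually_elim (rule Sbound[OF meas_u[OF u]])
      then show "S u \<in> Lpw p w \<and> Lpw_norm p w (S u) \<le> norm b * C * C' * Lpw_norm p w u"
        using C'(2)[rule_format, OF u, THEN conjunct2, rule_format, OF Smeas[OF meas_u[OF u]], of "norm b * C"] C by simp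
    qed
    show "\<forall>u\<in>Lpw p w. \<forall>v\<in>Lpw p w. AE x in lebesgue. S (\<lambda>y. u y + v y) x = S u x + S v x"
    proof (intro ballI)
      fix u v assume u: "u \<in> Lpw p w" and v: "v \<in> Lpw p w"
      have "AE x in lebesgue. (\<integral>\<^sup>+y. ennreal (decay (x - y) * norm (u y)) \<partial>lebesgue) < \<infinity>"
        "AE x in lebesgue. (\<integral>\<^sup>+y. ennreal (decay (x - y) * norm (v y)) \<partial>lebesgue) < \<infinity>" using C'(2) u v by blast+
      then show "AE x in lebesgue. S (\<lambda>y. u y + v y) x = S u x + S v x"
      proof eventually_elim
        case (elim x)
        show ?case using Bochner_Integration.integral_add[OF int[OF meas_u[OF u] elim(1)] int[OF meas_u[OF v] elim(2)]]
          by (simp add: S_def distrib_left)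
      qed
    qed
    \<comment> \<open>Scalars pass through the integral at every \<open>x\<close>: where it
      diverges, both sides are \<open>0\<close>.\<close>
    show "\<forall>c. \<forall>u\<in>Lpw p w. AE x in lebesgue. S (\<lambda>y. c * u y) x = c * S u x"
    proof (intro allI ballI AE_I2)
      fix c :: complex and u x
      have "(\<lambda>y. \<kappa> x (x - y) * (c * u y)) = (\<lambda>y. c * (\<kappa> x (x - y) * u y))" by (simp add: fun_eq_iff mult_ac)
      then show "S (\<lambda>y. c * u y) x = c * S u x" unfolding S_def by (simp add: mult_ac)
    qed
    show "\<forall>u\<in>schwartz. AE x in lebesgue. S u x = T u x"
    proof
      fix u :: "real^'n \<Rightarrow> complex" assume u: "u \<in> schwartz"
      \<comment> \<open>The two integrals agree because the integrand is Borel measurable for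
        Schwartz \<open>u\<close>.\<close>
      have eq: "S u x = b * (LBINT y. \<kappa> x (x - y) * u y)" for x
      proof -
        have "(\<lambda>z. \<kappa> x z) \<in> borel_measurable borel" using measurable_Pair2[OF meas, of x] by simp
        moreover have "(\<lambda>y. x - y) \<in> measurable borel (borel :: (real^'n) measure)" by measurable
        ultimately have "(\<lambda>y. \<kappa> x (x - y)) \<in> borel_measurable borel" by (rule measurable_compose[rotated])
        moreover have "u \<in> borel_measurable borel" using schwartz_integrable(2)[OF u, of "[]"] by simp
        ultimately have "(\<lambda>y. \<kappa> x (x - y) * u y) \<in> borel_measurable lborel" by simp
        then show ?thesis unfolding S_def by (simp only: integral_completion)
      qed
      show "AE x in lebesgue. S u x = T u x" using T[OF u] unfolding eq .
    qed
  qed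
qed

theorem theorem3p4p2:
  fixes a :: "real ^ 'n \<Rightarrow> real ^ 'n \<Rightarrow> complex"
    and \<phi> :: "real ^ 'n \<Rightarrow> real ^ 'n \<Rightarrow> real"
    and w :: "real ^ 'n \<Rightarrow> real"
    and m \<rho> c p :: real
  assumes "0 \<le> \<rho>" "\<rho> \<le> 1"
    and "m < - ((real CARD('n) + 1) / 2) * \<rho> + real CARD('n) * (\<rho> - 1)"
    and "a \<in> Linf_symbol m \<rho>"
    and "0 < c"
    and "\<And>x \<xi>. norm \<xi> = 1 \<Longrightarrow> c \<le> \<bar>det_corank1 (hessian (\<phi> x) \<xi>)\<bar>"
    and "(\<lambda>x \<xi>. \<phi> x \<xi> - x \<bullet> \<xi>) \<in> Linf_Phi1"
    and "1 < p"
    and "w \<in> A_weight p"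
  shows "bounded_on_Lpw p w (FIO a \<phi>)"
proof -
  define \<theta> where "\<theta> = (\<lambda>x \<xi>. \<phi> x \<xi> - x \<bullet> \<xi>)"
  have th: "\<theta> \<in> Linf_Phi1" using assms(7) by (simp add: \<theta>_def)
  obtain Ca where Ca: "AE x in lebesgue. \<forall>\<alpha> \<xi>. jbracket \<xi> powr (- m + \<rho> * real (length \<alpha>)) * norm (partials \<alpha> (a x) \<xi>) \<le> Ca \<alpha>"
    using Linf_symbol_uniform[OF assms(4)] by blast
  obtain Ct where Ct: "AE x in lebesgue. \<forall>\<alpha> \<xi>. length \<alpha> \<ge> 1 \<longrightarrow> \<xi> \<noteq> 0 \<longrightarrow>
    norm \<xi> powr (- 1 + real (length \<alpha>)) * \<bar>partials \<alpha> (\<theta> x) \<xi>\<bar> \<le> Ct \<alpha>"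
    using Linf_Phi1_uniform[OF th] by blast
  define good where "good x \<longleftrightarrow> (\<forall>\<alpha> \<xi>. jbracket \<xi> powr (- m + \<rho> * real (length \<alpha>)) * norm (partials \<alpha> (a x) \<xi>) \<le> Ca \<alpha>) \<and>
    (\<forall>\<alpha> \<xi>. length \<alpha> \<ge> 1 \<longrightarrow> \<xi> \<noteq> 0 \<longrightarrow> norm \<xi> powr (- 1 + real (length \<alpha>)) * \<bar>partials \<alpha> (\<theta> x) \<xi>\<bar> \<le> Ct \<alpha>)" for x
  have good: "AE x in lebesgue. good x" using Ca Ct by eventually_elim (simp add: good_def)
  then obtain x0 where x0: "good x0" using AE_lebesgue_ex by blast
  \<comment> \<open>Only the first argument is redirected. Smoothness, homogeneity and the
    determinant condition hold at every point and are therefore inherited.\<close>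
  define g where "g x = (if good x then x else x0)" for x
  have gg: "good (g x)" for x using x0 by (simp add: g_def)
  define a' where "a' x = a (g x)" for x
  define th' where "th' x = \<theta> (g x)" for x
  \<comment> \<open>The redirected point \<open>g x\<close> also occurs in the subtracted linear
    term, which the Hessian does not see.\<close>
  have det: "c \<le> \<bar>det_corank1 (hessian (th' x) \<xi>)\<bar>" if "norm \<xi> = 1" for x \<xi>
  proof -
    have "\<xi> \<noteq> 0" using that by auto
    moreover have "smooth_on (- {0}) (\<lambda>\<xi>. \<phi> (g x) \<xi> - g x \<bullet> \<xi>)" using th by (auto simp: Linf_Phi1_def \<theta>_def)
    ultimately show ?thesis using hessian_phase[of "\<phi> (g x)" "g x" \<xi>] assms(6)[OF that, of "g x"]
      by (simp add: th'_def \<theta>_def)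
  qed
  interpret fio_data a' th' m \<rho>
  proof
    \<comment> \<open>The upper bound on \<open>m\<close> equals
      \<open>(n - 1) * \<rho> / 2 - n\<close>, which is negative because
      \<open>\<rho> \<le> 1\<close>.\<close>
    have "real CARD('n) \<ge> 1" by (simp add: Suc_leI)
    then have "(real CARD('n) - 1) * \<rho> \<le> (real CARD('n) - 1) * 1" using assms(2) by (intro mult_left_mono) auto
    moreover have "- ((real CARD('n) + 1) / 2) * \<rho> + real CARD('n) * (\<rho> - 1) = (real CARD('n) - 1) * \<rho> / 2 - real CARD('n)"
      by (simp add: field_simps)
    ultimately show "m < 0" using assms(3) \<open>real CARD('n) \<ge> 1\<close> by argo
    show "0 \<le> \<rho>" "\<rho> \<le> 1" by (rule assms)+
    show "smooth_on UNIV (a' x)" for x using assms(4) by (auto simp: Linf_symbol_def a'_def)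
    show "\<exists>C. \<forall>x \<xi>. jbracket \<xi> powr (- m + \<rho> * real (length \<alpha>)) * norm (partials \<alpha> (a' x) \<xi>) \<le> C" for \<alpha>
      using gg unfolding good_def a'_def by blast
    show "smooth_on (- {0}) (th' x)" for x using th by (auto simp: Linf_Phi1_def th'_def)
    show "th' x (t *\<^sub>R \<xi>) = t * th' x \<xi>" if "\<xi> \<noteq> 0" "t > 0" for x \<xi> t
      using th that by (auto simp: Linf_Phi1_def th'_def)
    show "\<exists>C. \<forall>x \<xi>. \<xi> \<noteq> 0 \<longrightarrow> norm \<xi> powr (- 1 + real (length \<alpha>)) * \<bar>partials \<alpha> (th' x) \<xi>\<bar> \<le> C"
      if "length \<alpha> \<ge> 1" for \<alpha>
      using gg that unfolding good_def th'_def by blast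
  qed
  have ma: "(\<lambda>x. a' x \<xi>) \<in> borel_measurable lebesgue" for \<xi>
  proof -
    have "(\<lambda>x. a x \<xi>) \<in> borel_measurable lebesgue" using assms(4) by (simp add: Linf_symbol_def)
    from borel_measurable_lebesgue_modify[OF this good, of "a x0 \<xi>"] show ?thesis
      by (simp add: a'_def g_def if_distrib[of "\<lambda>x. a x \<xi>"])
  qed
  have mt: "(\<lambda>x. th' x \<xi>) \<in> borel_measurable lebesgue" if "\<xi> \<noteq> 0" for \<xi>
  proof -
    have "(\<lambda>x. \<theta> x \<xi>) \<in> borel_measurable lebesgue" using th that by (simp add: Linf_Phi1_def)
    from borel_measurable_lebesgue_modify[OF this good, of "\<theta> x0 \<xi>"] show ?thesis
      by (simp add: th'_def g_def if_distrib[of "\<lambda>x. \<theta> x \<xi>"])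
  qed
  have "\<exists>\<kappa> C. 0 \<le> C \<and> (\<lambda>p. \<kappa> (fst p) (snd p)) \<in> borel_measurable (lebesgue \<Otimes>\<^sub>M borel) \<and>
    (\<forall>x z. norm (\<kappa> x z) \<le> C * decay z) \<and>
    (\<forall>u\<in>schwartz. \<forall>x. (LINT \<xi>|lebesgue. exp (\<i> * of_real (th' x \<xi> + x \<bullet> \<xi>)) * a' x \<xi> * fourier u \<xi>)
      = (LBINT y. \<kappa> x (x - y) * u y))"
    by (rule kernel_representation[OF assms(5) _ assms(3)]) (rule det ma mt; assumption)+
  then obtain \<kappa> C where "0 \<le> C" "(\<lambda>p. \<kappa> (fst p) (snd p)) \<in> borel_measurable (lebesgue \<Otimes>\<^sub>M borel)"
    "\<forall>x z. norm (\<kappa> x z) \<le> C * decay z"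
    "\<forall>u\<in>schwartz. \<forall>x. (LINT \<xi>|lebesgue. exp (\<i> * of_real (th' x \<xi> + x \<bullet> \<xi>)) * a' x \<xi> * fourier u \<xi>)
      = (LBINT y. \<kappa> x (x - y) * u y)"
    by (elim exE conjE)
  note \<kappa> = this(1,2) this(3)[rule_format] this(4)[rule_format]
  show ?thesis
  proof (rule kernel_operator_bounded[OF assms(8,9) \<kappa>(1-3)])
    fix u :: "real^'n \<Rightarrow> complex" assume u: "u \<in> schwartz"
    \<comment> \<open>At good points \<open>g x = x\<close>, so the modified data give the original
      operator almost everywhere, which is all that \<open>bounded_on_Lpw\<close> asks.\<close>
    show "AE x in lebesgue. inverse (of_real ((2 * pi) ^ CARD('n))) * (LBINT y. \<kappa> x (x - y) * u y) = FIO a \<phi> u x"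
      using good
    proof eventually_elim
      case (elim x)
      then have "a' x = a x" "th' x = \<theta> x" by (auto simp: a'_def th'_def g_def)
      then show ?case using \<kappa>(4)[OF u, of x] by (simp add: FIO_def \<theta>_def)
    qed
  qed
qed

end
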